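(* Let $\sigma_{\mathrm t},\sigma_{\mathrm a}\in L^\infty(X)$ and $f\in L^2(X\times\mathbb S)$, and suppose there are constants $\sigma_{\mathrm s}^{\min}>0$ and $\sigma_{\mathrm a}^{\min}>0$ such that $\sigma_{\mathrm t}-\varepsilon^2\sigma_{\mathrm a}\ge \sigma_{\mathrm s}^{\min}$ in $X$ for all $\varepsilon\in(0,1)$, and $\sigma_{\mathrm a}\ge\sigma_{\mathrm a}^{\min}$ in $X$. Fix $N\ge 1$, the mesh $\mathcal T^h$ and the nonnegative integer degrees $k_0,\dots,k_N$. For $\varepsilon\in(0,1)$ let $u^{\varepsilon,h}\in \mathbf V^h$ be the (unique) solution of the spherical harmonic DG scheme $$\mathfrak a^h(u^{\varepsilon,h},v^h)=\mathfrak f(v^h)\qquad\forall\, v^h\in\mathbf V^h ,$$ and set, with $u^{\varepsilon}_{\mathrm{PN}}(x,\omega)=u^{\varepsilon,h}(x)^{\mathsf T}m(\omega)$, $$\phi^{\varepsilon,h}=\int_{\mathbb S}u^{\varepsilon}_{\mathrm{PN}}\,d\omega,\qquad J^{\varepsilon,h}=\frac1\varepsilon\int_{\mathbb S}\omega\,u^{\varepsilon}_{\mathrm{PN}}\,d\omega .$$ Then, as $\varepsilon\to0$, $$\phi^{\varepsilon,h}\to\phi^{0,h}\in C_0\cap \mathbf V_0^{h,k_0},\qquad J^{\varepsilon,h}\to J^{0,h}\in\mathbf V_1^{h,k_1},$$ where $\phi^{0,h}$ and $J^{0,h}$ solve the following system: for all $v_0\in C_0\cap\mathbf V_0^{h,k_0}$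 and all $v_1\in\mathbf V_1^{h,k_1}$, $$\sum_{K\in\mathcal T^h}\Big\{-(J^{0,h},\nabla v_0)_K+(\sigma_{\mathrm a}\phi^{0,h},v_0)_K\Big\}=4\pi\sum_{K\in\mathcal T^h}(\langle f\rangle,v_0)_K,$$ $$\sum_{K\in\mathcal T^h}\Big\{\tfrac13(\nabla\phi^{0,h},v_1)_K+(\sigma_{\mathrm t}J^{0,h},v_1)_K\Big\}=0 .$$
   Context: Domain: $X=[0,1)^3$ is the unit torus (all functions on $X$ are periodic), $\mathbb S\subset\mathbb R^3$ is the unit sphere, $\omega=(\omega_1,\omega_2,\omega_3)\in\mathbb S$, and $\langle g\rangle=\frac1{4\pi}\int_{\mathbb S}g\,d\omega$. The functions $\sigma_{\mathrm t}=\sigma_{\mathrm t}(x)$, $\sigma_{\mathrm a}=\sigma_{\mathrm a}(x)$, $f=f(x,\omega)$ do not depend on $\varepsilon$. Spherical harmonics: for $0\le\ell\le N$ let $m_\ell=(m_\ell^{-\ell},\dots,m_\ell^{\ell})^{\mathsf T}$ be the vector of the standard real spherical harmonics of degree $\ell$, orthonormal in $L^2(\mathbb S)$; in particular $m_0=1/\sqrt{4\pi}$ and $m_1=\sqrt{3/(4\pi)}\,(\omega_2,\omega_3,\omega_1)^{\mathsf T}$. Put $m=(m_0^{\mathsf T},\dots,m_N^{\mathsf T})^{\mathsf T}$, which has $L=(N+1)^2$ components. For $i=1,2,3$ let $A^{(i)}=\int_{\mathbb S}\omega_i\,m\,m^{\mathsf T}d\omega$ (a symmetric $L\times L$ matrix),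 and let $D^{(i)}=|A^{(i)}|=U_i|\Lambda^{(i)}|U_i^{\mathsf T}$, where $A^{(i)}=U_i\Lambda^{(i)}U_i^{\mathsf T}$ is an orthogonal diagonalization and $|\Lambda^{(i)}|$ is the entrywise absolute value of the diagonal matrix $\Lambda^{(i)}$. Let $\mathbf f(x)=\int_{\mathbb S}m\,f\,d\omega\in\mathbb R^L$ and $$Q=\operatorname{diag}\big(\varepsilon\sigma_{\mathrm a},\tfrac{\sigma_{\mathrm t}}{\varepsilon},\dots,\tfrac{\sigma_{\mathrm t}}{\varepsilon}\big)\in\mathbb R^{L\times L}.$$ Mesh and spaces: $\mathcal T^h$ is a (regular) partition of $X$ into elements $K$ which are either all simplices ("triangular") or all axis-parallel boxes ("rectangular"), with periodic mesh on the boundary (the surface meshes on opposite faces coincide). $n^K=(n^K_1,n^K_2,n^K_3)^{\mathsf T}$ is the unit outward normal on $\partial K$. For a nonnegative integer $k$, $V^{h,k}$ is the space of $v\in L^2(X)$ whose restriction to each $K$ is in $\mathbb P_k(K)$ (polynomials of total degree $\le k$) if the mesh is triangular, or in $\mathbb Q_k(K)$ (polynomials of degree $\le k$ in each variable) if it is rectangular. $\mathbf V_\ell^{h,k_\ell}=[V^{h,k_\ell}]^{2\ell+1}$ and $\mathbf V^h=\mathbf V_0^{h,k_0}\times\dots\times\mathbf V_N^{h,k_N}$, the $\ell$-th block of $v\in\mathbf V^h$ corresponding to $m_\ell$. $C_0$ denotes the space of continuous functions on the torus $X$. Convergence is in the finite-dimensional spaces $\mathbf V_0^{h,k_0}$,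 $\mathbf V_1^{h,k_1}$ (any norm). Traces and jumps: on $\partial K$, $g^\pm(x)=\lim_{\epsilon\to0^+}g(x\pm\epsilon n^K(x))$ (periodically extended), $\{\!\{g\}\!\}=\frac12(g^++g^-)$, $[\![g]\!]=g^+-g^-$. For a set $D$ (an element $K$, its boundary, or $X$) $(u,v)_D=\int_D u^{\mathsf T}v$. Scheme: for $u^h,v^h\in\mathbf V^h$, $$\mathfrak a^h(u^h,v^h)=\sum_{K\in\mathcal T^h}\Big\{\Big(\sum_{i=1}^3\big(n^K_iA^{(i)}\{\!\{u^h\}\!\}-\tfrac12|n^K_i|D^{(i)}[\![u^h]\!]\big),\,v^{h-}\Big)_{\partial K}-\sum_{i=1}^3(A^{(i)}u^h,\partial_iv^h)_K+(Qu^h,v^h)_K\Big\},$$ $$\mathfrak f(v^h)=\varepsilon\sum_{K\in\mathcal T^h}(\mathbf f,v^h)_K .$$ *)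

theory Defs
  imports "HOL-Analysis.Analysis"
begin

section \<open>The torus and the unit sphere\<close>

definition torus_cell :: "(real^3) set" where
  "torus_cell = {x. \<forall>i. 0 \<le> x $ i \<and> x $ i < 1}"

text \<open>Functions on the torus are represented by periodic functions on the whole space.\<close>

definition torus_periodic :: "(real^3 \<Rightarrow> 'b) \<Rightarrow> bool" where
  "torus_periodic g \<longleftrightarrow> (\<forall>x i. g (x + axis i 1) = g x)"

definition torus_C0 :: "(real^3 \<Rightarrow> real) set" where
  "torus_C0 = {g. torus_periodic g \<and> continuous_on UNIV g}"

definition sph_coord :: "real \<times> real \<Rightarrow> real^3" where
  "sph_coord = (\<lambda>(\<theta>, \<phi>). vector [sin \<theta> * cos \<phi>, sin \<theta> * sin \<phi>, cos \<theta>])"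

text \<open>Surface measure on the unit sphere: \<open>sin \<theta> d\<theta> d\<phi>\<close> in spherical coordinates.\<close>

definition sphere_measure :: "(real^3) measure" where
  "sphere_measure =
     distr (density (restrict_space lborel ({0..pi} \<times> {0..2 * pi}))
                    (\<lambda>(\<theta>, \<phi>). ennreal (sin \<theta>)))
           (restrict_space borel (sphere 0 1)) sph_coord"

definition sphere_avg :: "(real^3 \<Rightarrow> real) \<Rightarrow> real" where
  "sphere_avg g = 1 / (4 * pi) * (LINT \<omega>|sphere_measure. g \<omega>)"

definition Linf_fun :: "'a measure \<Rightarrow> ('a \<Rightarrow> real) \<Rightarrow> bool" where
  "Linf_fun M g \<longleftrightarrow> g \<in> borel_measurable M \<and> (\<exists>C. AE x in M. \<bar>g x\<bar> \<le> C)"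

definition L2_fun :: "'a measure \<Rightarrow> ('a \<Rightarrow> real) \<Rightarrow> bool" where
  "L2_fun M g \<longleftrightarrow> g \<in> borel_measurable M \<and> integrable M (\<lambda>x. (g x)\<^sup>2)"

definition torus_L2_norm :: "(real^3 \<Rightarrow> 'b::real_normed_vector) \<Rightarrow> real" where
  "torus_L2_norm g = sqrt (LINT x|lebesgue_on torus_cell. (norm (g x))\<^sup>2)"

section \<open>Real spherical harmonics\<close>

text \<open>Rodrigues' formula.\<close>

definition legendre_poly :: "nat \<Rightarrow> real poly" where
  "legendre_poly l = smult (1 / (2 ^ l * fact l)) ((pderiv ^^ l) ([:-1, 0, 1:] ^ l))"

text \<open>
  \<open>sph_harm (l, m)\<close> is the real spherical harmonic of degree \<open>l\<close> and order \<open>m\<close>, without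
  Condon-Shortley phase. In spherical coordinates it is a constant times
  \<open>P\<^sub>l\<^sup>|m| (cos \<theta>)\<close> times \<open>cos (m \<phi>)\<close> or \<open>sin (|m| \<phi>)\<close>, where
  \<open>P\<^sub>l\<^sup>j (z) = (1 - z^2)^(j/2) (d/dz)^j P\<^sub>l(z)\<close>; the factor \<open>(sin \<theta>)^j\<close> is absorbed by
  \<open>(sin \<theta>)^j exp (\<i> j \<phi>) = (\<omega>\<^sub>1 + \<i> \<omega>\<^sub>2)^j\<close>.
\<close>

definition sph_harm :: "nat \<times> int \<Rightarrow> real^3 \<Rightarrow> real" where
  "sph_harm = (\<lambda>(l, m) \<omega>. let j = nat \<bar>m\<bar> in
     sqrt ((2 * real l + 1) / (4 * pi) * (fact (l - j) / fact (l + j)))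
     * poly ((pderiv ^^ j) (legendre_poly l)) (\<omega> $ 3)
     * (if m = 0 then 1
        else if m > 0 then sqrt 2 * Re (Complex (\<omega> $ 1) (\<omega> $ 2) ^ j)
        else sqrt 2 * Im (Complex (\<omega> $ 1) (\<omega> $ 2) ^ j)))"

lemma legendre_poly_0: "legendre_poly 0 = 1"
  by (simp add: legendre_poly_def)

lemma legendre_poly_1: "legendre_poly 1 = [:0, 1:]"
  by (simp add: legendre_poly_def pderiv_pCons)

lemma sph_harm_degree_0: "sph_harm (0, 0) \<omega> = 1 / sqrt (4 * pi)"
  by (simp add: sph_harm_def legendre_poly_0 real_sqrt_divide)

lemma sph_harm_degree_1:
  "sph_harm (1, -1) \<omega> = sqrt (3 / (4 * pi)) * \<omega> $ 2"
  "sph_harm (1, 0) \<omega> = sqrt (3 / (4 * pi)) * \<omega> $ 3"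
  "sph_harm (1, 1) \<omega> = sqrt (3 / (4 * pi)) * \<omega> $ 1"
proof -
  have *: "sqrt (3 / (4 * pi) * (1 / 2)) * z * (sqrt 2 * y) = sqrt (3 / (4 * pi)) * (z * y)" for y z
  proof -
    have "sqrt (3 / (4 * pi) * (1 / 2)) * z * (sqrt 2 * y)
        = (sqrt (3 / (4 * pi) * (1 / 2)) * sqrt 2) * (z * y)"
      by (simp only: mult.assoc mult.left_commute)
    also have "sqrt (3 / (4 * pi) * (1 / 2)) * sqrt 2 = sqrt (3 / (4 * pi) * (1 / 2) * 2)"
      by (simp only: real_sqrt_mult)
    finally show ?thesis by simp
  qed
  show "sph_harm (1, -1) \<omega> = sqrt (3 / (4 * pi)) * \<omega> $ 2"
    using *[of 1 "\<omega> $ 2"] by (simp add: sph_harm_def legendre_poly_1[simplified] pderiv_pCons)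
  show "sph_harm (1, 0) \<omega> = sqrt (3 / (4 * pi)) * \<omega> $ 3"
    by (simp add: sph_harm_def legendre_poly_1[simplified] pderiv_pCons)
  show "sph_harm (1, 1) \<omega> = sqrt (3 / (4 * pi)) * \<omega> $ 1"
    using *[of 1 "\<omega> $ 1"] by (simp add: sph_harm_def legendre_poly_1[simplified] pderiv_pCons)
qed

section \<open>Moment vectors and matrices\<close>

text \<open>
  Vectors of length \<open>L = (N+1)^2\<close> and \<open>L \<times> L\<close> matrices are functions of the pairs \<open>(l, m)\<close> of
  degree and order; only their values on \<open>sh_index N\<close> are relevant.
\<close>

type_synonym mvec = "nat \<times> int \<Rightarrow> real"
type_synonym mmat = "nat \<times> int \<Rightarrow> nat \<times> int \<Rightarrow> real"

definition sh_index :: "nat \<Rightarrow> (nat \<times> int) set" where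
  "sh_index N = {(l, m). l \<le> N \<and> \<bar>m\<bar> \<le> int l}"

definition mdot :: "nat \<Rightarrow> mvec \<Rightarrow> mvec \<Rightarrow> real" where
  "mdot N v w = (\<Sum>a\<in>sh_index N. v a * w a)"

definition mapply :: "nat \<Rightarrow> mmat \<Rightarrow> mvec \<Rightarrow> mvec" where
  "mapply N B v = (\<lambda>a. \<Sum>b\<in>sh_index N. B a b * v b)"

definition mdiag :: "mvec \<Rightarrow> mmat" where
  "mdiag d = (\<lambda>a b. if a = b then d a else 0)"

definition mmult :: "nat \<Rightarrow> mmat \<Rightarrow> mmat \<Rightarrow> mmat" where
  "mmult N B C = (\<lambda>a b. \<Sum>c\<in>sh_index N. B a c * C c b)"

definition mtranspose :: "mmat \<Rightarrow> mmat" where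
  "mtranspose B = (\<lambda>a b. B b a)"

definition meq :: "nat \<Rightarrow> mmat \<Rightarrow> mmat \<Rightarrow> bool" where
  "meq N B C \<longleftrightarrow> (\<forall>a\<in>sh_index N. \<forall>b\<in>sh_index N. B a b = C a b)"

definition morthogonal :: "nat \<Rightarrow> mmat \<Rightarrow> bool" where
  "morthogonal N U \<longleftrightarrow> meq N (mmult N (mtranspose U) U) (mdiag (\<lambda>_. 1)) \<and>
                     meq N (mmult N U (mtranspose U)) (mdiag (\<lambda>_. 1))"

text \<open>\<open>B = U diag(d) U\<^sup>T\<close> with \<open>U\<close> orthogonal.\<close>

definition orth_diagonalization :: "nat \<Rightarrow> mmat \<Rightarrow> mmat \<Rightarrow> mvec \<Rightarrow> bool" where
  "orth_diagonalization N B U d \<longleftrightarrow>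
     morthogonal N U \<and> meq N B (mmult N (mmult N U (mdiag d)) (mtranspose U))"

text \<open>The absolute value of the matrix with orthogonal diagonalization \<open>U diag(d) U\<^sup>T\<close>.\<close>

definition mabs_of :: "nat \<Rightarrow> mmat \<Rightarrow> mvec \<Rightarrow> mmat" where
  "mabs_of N U d = mmult N (mmult N U (mdiag (\<lambda>a. \<bar>d a\<bar>))) (mtranspose U)"

definition flux_matrix :: "3 \<Rightarrow> mmat" where
  "flux_matrix i = (\<lambda>a b. LINT \<omega>|sphere_measure. \<omega> $ i * (sph_harm a \<omega> * sph_harm b \<omega>))"

definition Q_matrix :: "real \<Rightarrow> (real^3 \<Rightarrow> real) \<Rightarrow> (real^3 \<Rightarrow> real) \<Rightarrow> real^3 \<Rightarrow> mmat" where
  "Q_matrix \<epsilon> \<sigma>t \<sigma>a x = mdiag (\<lambda>(l, m). if l = 0 then \<epsilon> * \<sigma>a x else \<sigma>t x / \<epsilon>)"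

definition source_moments :: "(real^3 \<Rightarrow> real^3 \<Rightarrow> real) \<Rightarrow> real^3 \<Rightarrow> mvec" where
  "source_moments f x = (\<lambda>a. LINT \<omega>|sphere_measure. sph_harm a \<omega> * f x \<omega>)"

section \<open>Meshes and discrete spaces\<close>

datatype mesh_kind = Triangular | Rectangular

fun mesh_element :: "mesh_kind \<Rightarrow> (real^3) set \<Rightarrow> bool" where
  "mesh_element Triangular K \<longleftrightarrow> 3 simplex K"
| "mesh_element Rectangular K \<longleftrightarrow> (\<exists>a b. (\<forall>i. a $ i < b $ i) \<and> K = cbox a b)"

definition surface_mesh :: "(real^3) set set \<Rightarrow> 3 \<Rightarrow> real \<Rightarrow> (real^3) set set" where
  "surface_mesh T i c = {F. (\<exists>K\<in>T. F facet_of K) \<and> F \<subseteq> {x. x $ i = c}}"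

text \<open>
  Elements are closed, so they partition the closed unit cube up to their boundaries. Faces of
  neighbouring elements need not match in the interior of the cube (hanging nodes are allowed).
\<close>

definition torus_mesh :: "mesh_kind \<Rightarrow> (real^3) set set \<Rightarrow> bool" where
  "torus_mesh kind T \<longleftrightarrow>
     finite T \<and> (\<forall>K\<in>T. mesh_element kind K) \<and> \<Union>T = cbox 0 1 \<and>
     pairwise (\<lambda>K K'. interior K \<inter> interior K' = {}) T \<and>
     (\<forall>i. surface_mesh T i 1 = (\<lambda>F. (\<lambda>x. x + axis i 1) ` F) ` surface_mesh T i 0)"

fun poly_exponents :: "mesh_kind \<Rightarrow> nat \<Rightarrow> (3 \<Rightarrow> nat) set" where
  "poly_exponents Triangular k = {\<alpha>. (\<Sum>i\<in>UNIV. \<alpha> i) \<le> k}"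
| "poly_exponents Rectangular k = {\<alpha>. \<forall>i. \<alpha> i \<le> k}"

text \<open>The polynomial functions in \<open>P\<^sub>k\<close> (triangular) or \<open>Q\<^sub>k\<close> (rectangular).\<close>

definition poly_space :: "mesh_kind \<Rightarrow> nat \<Rightarrow> (real^3 \<Rightarrow> real) set" where
  "poly_space kind k =
     {p. \<exists>c. \<forall>x. p x = (\<Sum>\<alpha>\<in>poly_exponents kind k. c \<alpha> * (\<Prod>i\<in>UNIV. x $ i ^ \<alpha> i))}"

text \<open>
  Elements of the discrete spaces are classes modulo null sets. They are represented by functions
  that are polynomial in the interior of each element and have arbitrary values on the element
  boundaries, which are null sets and do not enter integrals or traces; such functions are
  automatically square integrable over the cell.
\<close>

definition DG_space :: "mesh_kind \<Rightarrow> (real^3) set set \<Rightarrow> nat \<Rightarrow> (real^3 \<Rightarrow> real) set" where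
  "DG_space kind T k =
     {v. torus_periodic v \<and> (\<forall>K\<in>T. \<exists>p\<in>poly_space kind k. \<forall>x\<in>interior K. v x = p x)}"

text \<open>The space for the first moments, with values in \<open>\<real>\<^sup>3\<close>.\<close>

definition DG_vec_space :: "mesh_kind \<Rightarrow> (real^3) set set \<Rightarrow> nat \<Rightarrow> (real^3 \<Rightarrow> real^3) set" where
  "DG_vec_space kind T k = {v. \<forall>i. (\<lambda>x. v x $ i) \<in> DG_space kind T k}"

definition DG_moment_space ::
  "mesh_kind \<Rightarrow> (real^3) set set \<Rightarrow> nat \<Rightarrow> (nat \<Rightarrow> nat) \<Rightarrow> (real^3 \<Rightarrow> mvec) set" where
  "DG_moment_space kind T N k =
     {v. \<forall>(l, m)\<in>sh_index N. (\<lambda>x. v x (l, m)) \<in> DG_space kind T (k l)}"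

section \<open>Integration over element boundaries, traces, derivatives\<close>

definition facet_normal :: "(real^3) set \<Rightarrow> (real^3) set \<Rightarrow> real^3" where
  "facet_normal K F = (THE n. norm n = 1 \<and> (\<forall>x\<in>F. \<forall>y\<in>K. n \<bullet> (y - x) \<le> 0))"

text \<open>
  Integral over a flat closed convex set \<open>F\<close> with unit normal \<open>n\<close> against surface area. The area
  of a subset of \<open>F\<close> is the volume of the right prism of height 1 over it, and a point of the
  prism over \<open>F\<close> lies above its closest point in \<open>F\<close>.
\<close>

definition facet_integral :: "(real^3) set \<Rightarrow> real^3 \<Rightarrow> (real^3 \<Rightarrow> real) \<Rightarrow> real" where
  "facet_integral F n g =
     (LINT y|lebesgue_on {x + t *\<^sub>R n |x t. x \<in> F \<and> 0 \<le> t \<and> t \<le> 1}. g (closest_point F y))"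

text \<open>
  Integral over the boundary of \<open>K\<close>. The integrand takes the outward unit normal, which is
  constant on each facet, as an additional argument.
\<close>

definition boundary_integral :: "(real^3) set \<Rightarrow> (real^3 \<Rightarrow> real^3 \<Rightarrow> real) \<Rightarrow> real" where
  "boundary_integral K g =
     (\<Sum>F | F facet_of K. let n = facet_normal K F in facet_integral F n (g n))"

definition outer_trace :: "real^3 \<Rightarrow> (real^3 \<Rightarrow> mvec) \<Rightarrow> real^3 \<Rightarrow> mvec" where
  "outer_trace n g x = (\<lambda>a. Lim (at_right 0) (\<lambda>s. g (x + s *\<^sub>R n) a))"

definition inner_trace :: "real^3 \<Rightarrow> (real^3 \<Rightarrow> mvec) \<Rightarrow> real^3 \<Rightarrow> mvec" where
  "inner_trace n g x = (\<lambda>a. Lim (at_right 0) (\<lambda>s. g (x - s *\<^sub>R n) a))"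

definition trace_avg :: "real^3 \<Rightarrow> (real^3 \<Rightarrow> mvec) \<Rightarrow> real^3 \<Rightarrow> mvec" where
  "trace_avg n g x = (\<lambda>a. 1/2 * (outer_trace n g x a + inner_trace n g x a))"

definition trace_jump :: "real^3 \<Rightarrow> (real^3 \<Rightarrow> mvec) \<Rightarrow> real^3 \<Rightarrow> mvec" where
  "trace_jump n g x = (\<lambda>a. outer_trace n g x a - inner_trace n g x a)"

definition partial_deriv :: "3 \<Rightarrow> (real^3 \<Rightarrow> real) \<Rightarrow> real^3 \<Rightarrow> real" where
  "partial_deriv i g x = deriv (\<lambda>t. g (x + t *\<^sub>R axis i 1)) 0"

definition grad :: "(real^3 \<Rightarrow> real) \<Rightarrow> real^3 \<Rightarrow> real^3" where
  "grad g x = (\<chi> i. partial_deriv i g x)"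

section \<open>The scheme\<close>

text \<open>\<open>D i\<close> is the matrix \<open>|A\<^sup>(\<^sup>i\<^sup>)|\<close>.\<close>

definition numerical_flux ::
  "nat \<Rightarrow> (3 \<Rightarrow> mmat) \<Rightarrow> real^3 \<Rightarrow> (real^3 \<Rightarrow> mvec) \<Rightarrow> real^3 \<Rightarrow> mvec" where
  "numerical_flux N D n u x = (\<lambda>a. \<Sum>i\<in>UNIV.
     n $ i * mapply N (flux_matrix i) (trace_avg n u x) a
     - 1/2 * \<bar>n $ i\<bar> * mapply N (D i) (trace_jump n u x) a)"

definition dg_form ::
  "(real^3) set set \<Rightarrow> nat \<Rightarrow> (3 \<Rightarrow> mmat) \<Rightarrow> (real^3 \<Rightarrow> real) \<Rightarrow> (real^3 \<Rightarrow> real) \<Rightarrow> real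
     \<Rightarrow> (real^3 \<Rightarrow> mvec) \<Rightarrow> (real^3 \<Rightarrow> mvec) \<Rightarrow> real" where
  "dg_form T N D \<sigma>t \<sigma>a \<epsilon> u v = (\<Sum>K\<in>T.
     boundary_integral K (\<lambda>n x. mdot N (numerical_flux N D n u x) (inner_trace n v x))
     - (\<Sum>i\<in>UNIV. LINT x|lebesgue_on K.
          mdot N (mapply N (flux_matrix i) (u x)) (\<lambda>a. partial_deriv i (\<lambda>y. v y a) x))
     + (LINT x|lebesgue_on K. mdot N (mapply N (Q_matrix \<epsilon> \<sigma>t \<sigma>a x) (u x)) (v x)))"

definition dg_rhs ::
  "(real^3) set set \<Rightarrow> nat \<Rightarrow> (real^3 \<Rightarrow> real^3 \<Rightarrow> real) \<Rightarrow> real \<Rightarrow> (real^3 \<Rightarrow> mvec) \<Rightarrow> real" where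
  "dg_rhs T N f \<epsilon> v =
     \<epsilon> * (\<Sum>K\<in>T. LINT x|lebesgue_on K. mdot N (source_moments f x) (v x))"

definition dg_solution ::
  "mesh_kind \<Rightarrow> (real^3) set set \<Rightarrow> nat \<Rightarrow> (nat \<Rightarrow> nat) \<Rightarrow> (3 \<Rightarrow> mmat)
     \<Rightarrow> (real^3 \<Rightarrow> real) \<Rightarrow> (real^3 \<Rightarrow> real) \<Rightarrow> (real^3 \<Rightarrow> real^3 \<Rightarrow> real) \<Rightarrow> real
     \<Rightarrow> (real^3 \<Rightarrow> mvec) \<Rightarrow> bool" where
  "dg_solution kind T N k D \<sigma>t \<sigma>a f \<epsilon> u \<longleftrightarrow>
     u \<in> DG_moment_space kind T N k \<and>
     (\<forall>v\<in>DG_moment_space kind T N k. dg_form T N D \<sigma>t \<sigma>a \<epsilon> u v = dg_rhs T N f \<epsilon> v)"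

definition u_PN :: "nat \<Rightarrow> (real^3 \<Rightarrow> mvec) \<Rightarrow> real^3 \<Rightarrow> real^3 \<Rightarrow> real" where
  "u_PN N u x \<omega> = mdot N (u x) (\<lambda>a. sph_harm a \<omega>)"

definition scalar_flux :: "nat \<Rightarrow> (real^3 \<Rightarrow> mvec) \<Rightarrow> real^3 \<Rightarrow> real" where
  "scalar_flux N u x = (LINT \<omega>|sphere_measure. u_PN N u x \<omega>)"

definition scaled_current :: "nat \<Rightarrow> real \<Rightarrow> (real^3 \<Rightarrow> mvec) \<Rightarrow> real^3 \<Rightarrow> real^3" where
  "scaled_current N \<epsilon> u x = (1 / \<epsilon>) *\<^sub>R (LINT \<omega>|sphere_measure. u_PN N u x \<omega> *\<^sub>R \<omega>)"

end

theory Submission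
  imports Defs
begin

text \<open>
  The coefficient of \<open>u\<close> at the index \<open>a = (l, m)\<close> is expected to be of order 1 for \<open>l = 0\<close> and of
  order \<open>\<epsilon>\<close> for \<open>l \<ge> 1\<close>. Let \<open>W\<close> denote the solution with the moments of degree \<open>\<ge> 1\<close> divided by
  \<open>\<epsilon>\<close>. Tested with itself, the scheme gives an energy identity: the transport part is
  skew-symmetric (\<open>transport_skew\<close>), because integration by parts over all elements leaves products
  of averages and jumps only (\<open>integration_by_parts\<close>), and those cancel against
  the central part of the numerical flux. What is left is half the sum of the jump terms weighted with \<open>|A\<^sup>(\<^sup>i\<^sup>)|\<close>,
  which is nonnegative, and \<open>\<epsilon>\<close> times a positive definite quadratic form in \<open>W\<close>; the right-hand
  side is \<open>\<epsilon>\<close> times a linear form in \<open>W\<close> that is bounded uniformly in \<open>\<epsilon>\<close>. So \<open>W\<close> is bounded and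
  the jump terms are of order \<open>\<epsilon>\<close> (\<open>a_priori\<close>).

  The discrete spaces are finite-dimensional, hence every sequence \<open>\<epsilon>\<^sub>n \<rightarrow> 0\<close> has a subsequence
  along which all components of \<open>W\<close> converge (\<open>limit_point\<close>). In the limit the jump terms vanish.
  They involve only the zeroth moment, with the weights \<open>|A\<^sup>(\<^sup>i\<^sup>)|\<^sub>0\<^sub>0\<close>, and these are positive because
  the first row of \<open>A\<^sup>(\<^sup>i\<^sup>)\<close> does not vanish (\<open>D00_pos\<close>). Hence the limit of the zeroth moment has no
  jumps, and a piecewise polynomial without jumps is continuous (\<open>zero_jumps_continuous\<close>). The
  numerical flux of a continuous function is its exact flux, so the limits of the equations for the
  zeroth and the first moments are the two equations of the limit system; the only entries of the
  first row of \<open>A\<^sup>(\<^sup>i\<^sup>)\<close> that enter are the \<open>1 / sqrt 3\<close> at the first moments (\<open>flux_matrix_row0\<close>). The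
  limit system has at most one solution (\<open>limit_system_unique\<close>), so the limit does not depend on the
  subsequence, and the whole family converges (\<open>convergence\<close>).

  Most of the work is geometric. Elements are only known to be convex polytopes that tile the cube,
  with hanging nodes. All face integrals are therefore rewritten as integrals over lines parallel to
  a coordinate axis (\<open>facet_area_formula\<close>). Almost every such line meets facets only at points where
  locally a single plane separates two elements (\<open>negligible_badline\<close>); it is cut by the mesh into
  finitely many segments, one for each element that it meets (\<open>line_partition\<close>). Integration by parts
  and the continuity of functions without jumps then reduce to one-dimensional facts.
\<close>

section \<open>Moments of the spherical harmonics\<close>

text \<open>Each derivative costs at most one power of a factor, so the zeros of \<open>(z\<^sup>2 - 1)\<^sup>l\<close> at
  \<open>\<plusminus>1\<close> survive in all derivatives of order below \<open>l\<close>. These are the boundary terms that have to vanish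
  for the orthogonality of the Legendre polynomials to polynomials of lower degree.\<close>

lemma dvd_pderiv_power:
  fixes q p :: "real poly"
  assumes "q ^ Suc n dvd p" shows "q ^ n dvd pderiv p"
proof -
  obtain r where "p = q ^ Suc n * r" using assms by (auto elim: dvdE)
  then have "pderiv p = q ^ Suc n * pderiv r + r * (smult (of_nat (Suc n)) (q ^ n) * pderiv q)"
    by (simp only: pderiv_mult pderiv_power_Suc)
  also have "\<dots> = q ^ n * (q * pderiv r + r * smult (of_nat (Suc n)) (pderiv q))"
    by (simp only: power_Suc distrib_left mult_smult_left mult_smult_right ac_simps)
  finally show ?thesis by simp
qed

lemma rodrigues_dvd:
  "j \<le> l \<Longrightarrow> ([:-1, 0, 1:] :: real poly) ^ (l - j) dvd (pderiv ^^ j) ([:-1, 0, 1:] ^ l)"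
proof (induction j)
  case (Suc j)
  then have "([:-1, 0, 1:] :: real poly) ^ Suc (l - Suc j) dvd (pderiv ^^ j) ([:-1, 0, 1:] ^ l)"
    by (simp add: Suc_diff_Suc Suc_le_lessD del: power_Suc)
  from dvd_pderiv_power[OF this] show ?case by simp
qed simp

lemma rodrigues_endpoints:
  assumes "j < l" "z = 1 \<or> z = -1"
  shows "poly ((pderiv ^^ j) ([:-1, 0, 1:] ^ l)) (z::real) = 0"
proof -
  have "([:-1, 0, 1:] :: real poly) dvd [:-1, 0, 1:] ^ (l - j)"
    using assms by (intro dvd_power) auto
  then have "([:-1, 0, 1:] :: real poly) dvd (pderiv ^^ j) ([:-1, 0, 1:] ^ l)"
    using rodrigues_dvd[of j l] assms dvd_trans by fastforce
  then show ?thesis using assms by (auto elim!: dvdE)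
qed

lemma integral_sin_poly_cos:
  assumes "pderiv R = q"
  shows "((\<lambda>\<theta>. sin \<theta> * poly q (cos \<theta>)) has_integral (poly R 1 - poly R (-1))) {0..pi}"
proof -
  have "((\<lambda>\<theta>. sin \<theta> * poly q (cos \<theta>)) has_integral (- poly R (cos pi) - (- poly R (cos 0)))) {0..pi}"
    by (intro fundamental_theorem_of_calculus)
       (auto simp flip: has_real_derivative_iff_has_vector_derivative assms intro!: derivative_eq_intros)
  then show ?thesis by simp
qed

text \<open>By Rodrigues' formula the Legendre polynomial is an \<open>l\<close>-th derivative; the derivatives
  of order \<open>l - 1\<close> and \<open>l - 2\<close> serve as iterated antiderivatives that vanish at \<open>\<plusminus>1\<close>.\<close>

lemma legendre_antiderivative:
  assumes "l \<ge> 1"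
  obtains R where "pderiv R = legendre_poly l" "poly R 1 = 0" "poly R (-1) = 0"
    "l \<ge> 2 \<Longrightarrow> \<exists>S. pderiv S = R \<and> poly S 1 = 0 \<and> poly S (-1) = 0"
proof
  let ?c = "1 / (2 ^ l * fact l) :: real"
  let ?W = "\<lambda>j. (pderiv ^^ j) ([:-1, 0, 1:] ^ l) :: real poly"
  have 1: "pderiv (?W j) = ?W (Suc j)" for j by simp
  show "pderiv (smult ?c (?W (l - 1))) = legendre_poly l"
    using assms 1[of "l-1"] by (simp add: legendre_poly_def pderiv_smult)
  show "poly (smult ?c (?W (l - 1))) 1 = 0" "poly (smult ?c (?W (l - 1))) (-1) = 0"
    using rodrigues_endpoints[of "l-1" l] assms by simp_all
  assume "l \<ge> 2"
  then show "\<exists>S. pderiv S = smult ?c (?W (l - 1)) \<and> poly S 1 = 0 \<and> poly S (-1) = 0"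
    using rodrigues_endpoints[of "l-2" l] 1[of "l-2"]
    by (intro exI[of _ "smult ?c (?W (l - 2))"])
       (auto simp: pderiv_smult numeral_2_eq_2 Suc_diff_Suc simp del: funpow.simps)
qed

lemma integral_legendre:
  assumes "l \<ge> 1"
  shows "((\<lambda>\<theta>. sin \<theta> * poly (legendre_poly l) (cos \<theta>)) has_integral 0) {0..pi}"
  using legendre_antiderivative[OF assms] integral_sin_poly_cos by (metis diff_self)

text \<open>Orthogonality to the Legendre polynomial of degree 1. For \<open>l \<ge> 2\<close> integrate by parts twice; for
  \<open>l = 0\<close> the integrand is odd.\<close>

lemma integral_id_legendre:
  assumes "l \<noteq> 1"
  shows "((\<lambda>\<theta>. sin \<theta> * (cos \<theta> * poly (legendre_poly l) (cos \<theta>))) has_integral 0) {0..pi}"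
proof -
  obtain R where R: "pderiv R = [:0,1:] * legendre_poly l" "poly R 1 = poly R (-1)"
  proof (cases "l = 0")
    case True
    show ?thesis by (rule that[of "[:0,0,1/2:]"]) (auto simp: True legendre_poly_0 pderiv_pCons)
  next
    case False
    then have "l \<ge> 1" "l \<ge> 2" using assms by auto
    from legendre_antiderivative[OF this(1)] this(2) obtain R S where
      "pderiv R = legendre_poly l" "poly R 1 = 0" "poly R (-1) = 0"
      "pderiv S = R" "poly S 1 = 0" "poly S (-1) = 0" by metis
    then show ?thesis
      by (intro that[of "[:0,1:] * R - S"]) (auto simp: pderiv_diff pderiv_mult pderiv_pCons)
  qed
  show ?thesis using integral_sin_poly_cos[OF R(1)] R(2) by simp
qed

text \<open>The polar factor in the product of \<open>\<omega>\<^sub>1\<close> or \<open>\<omega>\<^sub>2\<close> with a harmonic of order \<open>\<plusminus>1\<close>: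
  the two factors \<open>sin \<theta>\<close> combine to \<open>1 - z\<^sup>2\<close>, whose derivative is again of degree 1.\<close>

lemma integral_legendre_deriv:
  assumes "l \<noteq> 1"
  shows "((\<lambda>\<theta>. sin \<theta> * (sin \<theta> * sin \<theta> * poly (pderiv (legendre_poly l)) (cos \<theta>))) has_integral 0) {0..pi}"
proof -
  obtain R where R: "pderiv R = [:1,0,-1:] * pderiv (legendre_poly l)" "poly R 1 = poly R (-1)"
  proof (cases "l = 0")
    case True
    show ?thesis by (rule that[of 0]) (auto simp: True legendre_poly_0)
  next
    case False
    then have "l \<ge> 1" "l \<ge> 2" using assms by auto
    from legendre_antiderivative[OF this(1)] this(2) obtain R S where
      *: "pderiv R = legendre_poly l" "poly R 1 = 0" "poly R (-1) = 0"
      "pderiv S = R" "poly S 1 = 0" "poly S (-1) = 0" by metis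
    have "pderiv [:1,0,-1::real:] = [:0,-2:]" by (simp add: pderiv_pCons)
    then show ?thesis using *
      by (intro that[of "[:1,0,-1:] * legendre_poly l + [:0,2:] * R - smult 2 S"])
        (auto simp: pderiv_diff pderiv_mult pderiv_pCons pderiv_add pderiv_smult pderiv_minus numeral_poly)
  qed
  have *: "sin \<theta> * sin \<theta> = poly [:1,0,-1:] (cos \<theta>)" for \<theta> :: real
    using sin_squared_eq[of \<theta>] by (simp add: power2_eq_square)
  show ?thesis unfolding * using integral_sin_poly_cos[OF R(1)] R(2) by (simp only: poly_mult) simp
qed

lemma integral_cos_multiple:
  assumes "k \<noteq> 0"
  shows "((\<lambda>\<phi>. cos (real_of_int k * \<phi>)) has_integral 0) {0..2*pi}"
proof -
  have "((\<lambda>\<phi>. cos (real_of_int k * \<phi>)) has_integral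
      (sin (real_of_int k * (2*pi)) / real_of_int k - sin (real_of_int k * 0) / real_of_int k)) {0..2*pi}"
    using assms
    by (intro fundamental_theorem_of_calculus)
       (auto simp flip: has_real_derivative_iff_has_vector_derivative intro!: derivative_eq_intros)
  moreover have "sin (real_of_int k * (2*pi)) = 0"
    using sin_int_2pin[of k] by (simp add: mult.commute mult.left_commute)
  ultimately show ?thesis by simp
qed

lemma integral_sin_multiple:
  "((\<lambda>\<phi>. sin (real_of_int k * \<phi>)) has_integral 0) {0..2*pi}"
proof (cases "k = 0")
  case False
  have "((\<lambda>\<phi>. sin (real_of_int k * \<phi>)) has_integral
      ((- cos (real_of_int k * (2*pi)) / real_of_int k) - (- cos (real_of_int k * 0) / real_of_int k))) {0..2*pi}"
    using False
    by (intro fundamental_theorem_of_calculus)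
       (auto simp flip: has_real_derivative_iff_has_vector_derivative intro!: derivative_eq_intros)
  moreover have "cos (real_of_int k * (2*pi)) = 1"
    using cos_int_2pin[of k] by (simp add: mult.commute mult.left_commute)
  ultimately show ?thesis by simp
qed simp

text \<open>The dependence of the harmonic of order \<open>m\<close> on the longitude, as it appears in
  \<open>sph_harm_sph_coord\<close>.\<close>

definition azimuthal :: "int \<Rightarrow> real \<Rightarrow> real" where
  "azimuthal m \<phi> = (if m = 0 then 1 else if m > 0 then sqrt 2 * cos (of_int m * \<phi>)
                    else sqrt 2 * sin (of_int (- m) * \<phi>))"

lemma integral_azimuthal:
  "m \<noteq> 0 \<Longrightarrow> (azimuthal m has_integral 0) {0..2*pi}"
  using has_integral_mult_right[OF integral_cos_multiple[of m], of "sqrt 2"]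
    has_integral_mult_right[OF integral_sin_multiple[of "-m"], of "sqrt 2"]
  by (cases "m > 0") (auto simp: azimuthal_def[abs_def] simp del: of_int_minus)

lemma integral_cos_azimuthal:
  assumes "m \<noteq> 1"
  shows "((\<lambda>\<phi>. cos \<phi> * azimuthal m \<phi>) has_integral 0) {0..2*pi}"
proof -
  consider "m = 0" | "m > 1" | "m < 0" using assms by linarith
  then show ?thesis
  proof cases
    case 1 then show ?thesis using integral_cos_multiple[of 1] by (simp add: azimuthal_def)
  next
    case 2
    have "((\<lambda>\<phi>. sqrt 2 / 2 * (cos (of_int (m - 1) * \<phi>) + cos (of_int (m + 1) * \<phi>))) has_integral
        sqrt 2 / 2 * (0 + 0)) {0..2*pi}"
      using 2 by (intro has_integral_mult_right has_integral_add integral_cos_multiple) auto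
    then show ?thesis
      by (rule has_integral_eq_rhs[OF has_integral_eq, rotated])
        (use 2 in \<open>auto simp: azimuthal_def algebra_simps cos_diff cos_add\<close>)
  next
    case 3
    have "((\<lambda>\<phi>. sqrt 2 / 2 * (sin (of_int (1 - m) * \<phi>) + sin (of_int (- m - 1) * \<phi>))) has_integral
        sqrt 2 / 2 * (0 + 0)) {0..2*pi}"
      by (intro has_integral_mult_right has_integral_add integral_sin_multiple)
    then show ?thesis
      by (rule has_integral_eq_rhs[OF has_integral_eq, rotated])
        (use 3 in \<open>auto simp: azimuthal_def algebra_simps sin_diff sin_add cos_diff cos_add\<close>)
  qed
qed

lemma integral_sin_azimuthal:
  assumes "m \<noteq> -1"
  shows "((\<lambda>\<phi>. sin \<phi> * azimuthal m \<phi>) has_integral 0) {0..2*pi}"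
proof -
  consider "m = 0" | "m > 0" | "m < -1" using assms by linarith
  then show ?thesis
  proof cases
    case 1 then show ?thesis using integral_sin_multiple[of 1] by (simp add: azimuthal_def)
  next
    case 2
    have "((\<lambda>\<phi>. sqrt 2 / 2 * (sin (of_int (m + 1) * \<phi>) - sin (of_int (m - 1) * \<phi>))) has_integral
        sqrt 2 / 2 * (0 - 0)) {0..2*pi}"
      by (intro has_integral_mult_right has_integral_diff integral_sin_multiple)
    then show ?thesis
      by (rule has_integral_eq_rhs[OF has_integral_eq, rotated])
        (use 2 in \<open>auto simp: azimuthal_def algebra_simps sin_diff sin_add\<close>)
  next
    case 3
    have "((\<lambda>\<phi>. sqrt 2 / 2 * (cos (of_int (- m - 1) * \<phi>) - cos (of_int (1 - m) * \<phi>))) has_integral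
        sqrt 2 / 2 * (0 - 0)) {0..2*pi}"
      using 3 by (intro has_integral_mult_right has_integral_diff integral_cos_multiple) auto
    then show ?thesis
      by (rule has_integral_eq_rhs[OF has_integral_eq, rotated])
        (use 3 in \<open>auto simp: azimuthal_def algebra_simps sin_diff sin_add cos_diff cos_add\<close>)
  qed
qed

lemma sph_coord_eq: "sph_coord (\<theta>, \<phi>) = (\<chi> i. if i = 3 then cos \<theta> else sin \<theta> * (if i = 1 then cos \<phi> else sin \<phi>))"
  by (simp add: sph_coord_def vec_eq_iff forall_3)

lemma norm_sph_coord: "norm (sph_coord x) = 1"
proof (cases x)
  case (Pair \<theta> \<phi>)
  have "(norm (sph_coord x))\<^sup>2 = (sin \<theta> * sin \<phi>)\<^sup>2 + (sin \<theta> * cos \<phi>)\<^sup>2 + (cos \<theta>)\<^sup>2"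
    unfolding Pair sph_coord_def power2_norm_eq_inner inner_vec_def sum_3
    by (simp add: power2_eq_square)
  also have "\<dots> = (sin \<theta>)\<^sup>2 * ((sin \<phi>)\<^sup>2 + (cos \<phi>)\<^sup>2) + (cos \<theta>)\<^sup>2"
    by (simp only: power_mult_distrib distrib_left)
  finally have "(norm (sph_coord x))\<^sup>2 = 1" by (simp only: sin_cos_squared_add mult_1_right)
  then show ?thesis using norm_ge_zero[of "sph_coord x"] by (auto simp: power2_eq_1_iff simp del: norm_ge_zero)
qed

lemma continuous_sph_coord: "continuous_on A sph_coord"
proof -
  have *: "sph_coord = (\<lambda>x. \<chi> i. if i = 3 then cos (fst x) else sin (fst x) * (if i = 1 then cos (snd x) else sin (snd x)))"
    by (rule ext, subst prod.collapse[symmetric], simp only: sph_coord_eq)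
  show ?thesis unfolding *
    by (intro continuous_on_vec_lambda, case_tac "i = 3"; case_tac "i = 1")
      (simp_all add: continuous_on_mult continuous_on_sin continuous_on_cos continuous_on_fst continuous_on_snd continuous_on_id)
qed

lemma sphere_integral:
  fixes g :: "real^3 \<Rightarrow> real"
  assumes "continuous_on UNIV g"
  shows "integrable sphere_measure g"
    and "(LINT \<omega>|sphere_measure. g \<omega>) =
      integral (cbox (0, 0) (pi, 2*pi)) (\<lambda>x. sin (fst x) * g (sph_coord x))"
proof -
  let ?B = "{0..pi} \<times> {0..2*pi} :: (real\<times>real) set"
  have B: "?B = cbox (0, 0) (pi, 2*pi)" by (simp add: cbox_Pair_eq)
  have Bm: "?B \<in> sets lborel" unfolding B by simp
  let ?M = "restrict_space lborel ?B"
  have m1: "(\<lambda>(\<theta>, \<phi>). ennreal (sin \<theta>)) = (\<lambda>x. ennreal (sin (fst x)))" by auto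
  have sc: "sph_coord \<in> borel_measurable borel"
    using continuous_sph_coord[of UNIV] by (rule borel_measurable_continuous_onI)
  have sp: "sph_coord \<in> measurable (density ?M (\<lambda>(\<theta>, \<phi>). ennreal (sin \<theta>))) (restrict_space borel (sphere 0 1))"
    using norm_sph_coord sc
    by (intro measurable_restrict_space2) (auto intro: measurable_restrict_space1 simp: borel_prod)
  have g: "g \<in> borel_measurable borel" using assms by (rule borel_measurable_continuous_onI)
  then have g1: "g \<in> borel_measurable (restrict_space borel (sphere 0 1))"
    by (rule measurable_restrict_space1)
  have gs: "(\<lambda>x. g (sph_coord x)) \<in> borel_measurable ?M"
    using measurable_compose[OF sc g] by (auto intro: measurable_restrict_space1 simp: borel_prod)
  have sn: "(\<lambda>x. sin (fst x)) \<in> borel_measurable ?M"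
    by (rule measurable_restrict_space1) (simp, intro borel_measurable_continuous_onI continuous_intros)
  have nn: "AE x in ?M. 0 \<le> sin (fst x)"
    by (rule AE_I2) (auto simp: space_restrict_space intro: sin_ge_zero)
  have c: "continuous_on ?B (\<lambda>x. sin (fst x) * g (sph_coord x))"
    by (intro continuous_intros continuous_on_compose2[OF assms continuous_sph_coord]) auto
  then have si: "set_integrable lborel ?B (\<lambda>x. sin (fst x) * g (sph_coord x))"
    unfolding B by (rule borel_integrable_compact[OF compact_cbox, folded set_integrable_def])
  then have i: "integrable ?M (\<lambda>x. sin (fst x) *\<^sub>R g (sph_coord x))"
    using Bm by (simp add: integrable_restrict_space set_integrable_def)
  then have i2: "integrable (density ?M (\<lambda>x. ennreal (sin (fst x)))) (\<lambda>x. g (sph_coord x))"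
    using integrable_density[OF gs sn nn] by simp
  then show "integrable sphere_measure g"
    unfolding sphere_measure_def using integrable_distr_eq[OF sp g1] by (simp add: m1)
  have "(LINT \<omega>|sphere_measure. g \<omega>) = (LINT x|density ?M (\<lambda>x. ennreal (sin (fst x))). g (sph_coord x))"
    unfolding sphere_measure_def using integral_distr[OF sp g1] by (simp add: m1)
  also have "\<dots> = (LINT x|?M. sin (fst x) *\<^sub>R g (sph_coord x))"
    by (rule integral_density[OF gs sn nn])
  also have "\<dots> = (LINT x:?B|lborel. sin (fst x) * g (sph_coord x))"
    using Bm by (simp add: integral_restrict_space set_lebesgue_integral_def)
  also have "\<dots> = integral ?B (\<lambda>x. sin (fst x) * g (sph_coord x))"
    by (rule set_borel_integral_eq_integral[OF si])
  finally show "(LINT \<omega>|sphere_measure. g \<omega>) =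
      integral (cbox (0, 0) (pi, 2*pi)) (\<lambda>x. sin (fst x) * g (sph_coord x))" unfolding B .
qed

text \<open>Every integrand below is a product of a function of the latitude and a function of the
  longitude in spherical coordinates, so one vanishing factor is enough for the integral to vanish.\<close>

lemma sphere_integral_separated:
  fixes g :: "real^3 \<Rightarrow> real"
  assumes "continuous_on UNIV g"
    and sep: "\<And>\<theta> \<phi>. sin \<theta> * g (sph_coord (\<theta>, \<phi>)) = a \<theta> * b \<phi>"
    and a: "(a has_integral I) {0..pi}" and b: "(b has_integral J) {0..2*pi}"
  shows "(LINT \<omega>|sphere_measure. g \<omega>) = I * J"
proof -
  have c: "continuous_on (cbox (0, 0) (pi, 2*pi)) (\<lambda>x. sin (fst x) * g (sph_coord x))"
    by (intro continuous_intros continuous_on_compose2[OF assms(1) continuous_sph_coord]) auto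
  show ?thesis
    unfolding sphere_integral(2)[OF assms(1)] integral_prod_continuous[OF c]
    using a b by (simp add: sep integral_unique)
qed

lemma continuous_sph_harm: "continuous_on A (sph_harm a)"
  (is "continuous_on A ?h")
proof (cases a)
  case (Pair l m)
  consider "m = 0" | "m > 0" | "m < 0" by linarith
  then show ?thesis
    by cases (auto simp: Pair sph_harm_def Let_def Complex_eq intro!: continuous_intros)
qed

lemma sph_harm_sph_coord:
  "sph_harm (l, m) (sph_coord (\<theta>, \<phi>)) =
     sqrt ((2 * real l + 1) / (4 * pi) * (fact (l - nat \<bar>m\<bar>) / fact (l + nat \<bar>m\<bar>))) *
     (sin \<theta> ^ nat \<bar>m\<bar> * poly ((pderiv ^^ nat \<bar>m\<bar>) (legendre_poly l)) (cos \<theta>)) * azimuthal m \<phi>"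
proof -
  have "Complex (sin \<theta> * cos \<phi>) (sin \<theta> * sin \<phi>) = complex_of_real (sin \<theta>) * cis \<phi>"
    by (simp add: complex_eq_iff)
  then have *: "Complex (sin \<theta> * cos \<phi>) (sin \<theta> * sin \<phi>) ^ j = complex_of_real (sin \<theta> ^ j) * cis (real j * \<phi>)" for j
    by (simp only: power_mult_distrib Complex.DeMoivre of_real_power)
  show ?thesis
    unfolding sph_harm_def sph_coord_def azimuthal_def
    by (auto simp: Let_def * )
qed

text \<open>The index of the harmonic of degree 1 that is proportional to \<open>\<omega>\<^sub>i\<close>.\<close>

definition sph_idx :: "3 \<Rightarrow> nat \<times> int" where
  "sph_idx i = (1, if i = 1 then 1 else if i = 2 then -1 else 0)"

lemma integral_sph_harm:
  assumes "\<bar>m\<bar> \<le> int l"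
  shows "(LINT \<omega>|sphere_measure. sph_harm (l, m) \<omega>) = (if (l, m) = (0, 0) then sqrt (4 * pi) else 0)"
proof -
  let ?c = "sqrt ((2 * real l + 1) / (4 * pi) * (fact (l - nat \<bar>m\<bar>) / fact (l + nat \<bar>m\<bar>)))"
  let ?a = "\<lambda>\<theta>. ?c * (sin \<theta> * (sin \<theta> ^ nat \<bar>m\<bar> * poly ((pderiv ^^ nat \<bar>m\<bar>) (legendre_poly l)) (cos \<theta>)))"
  have sep: "sin \<theta> * sph_harm (l, m) (sph_coord (\<theta>, \<phi>)) = ?a \<theta> * azimuthal m \<phi>" for \<theta> \<phi>
    by (simp add: sph_harm_sph_coord)
  note S = sphere_integral_separated[OF continuous_sph_harm sep]
  have a: "(?a has_integral integral {0..pi} ?a) {0..pi}"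
    by (intro integrable_integral integrable_continuous_interval continuous_intros)
  consider "m \<noteq> 0" | "m = 0" "l \<ge> 1" | "m = 0" "l = 0" by linarith
  then show ?thesis
  proof cases
    case 1
    then show ?thesis using S[OF a integral_azimuthal[OF 1]] by simp
  next
    case 2
    have "(?a has_integral ?c * 0) {0..pi}"
      using integral_legendre[OF 2(2)] 2(1) by (intro has_integral_mult_right) simp
    from S[OF this] show ?thesis using 2 has_integral_const_real[of "1::real" 0 "2*pi"]
      by (simp add: azimuthal_def[abs_def])
  next
    case 3
    have "pderiv [:0, 1:] = (1::real poly)" by (simp add: pderiv_pCons)
    from integral_sin_poly_cos[OF this]
    have "((\<lambda>\<theta>. sin \<theta> * (1 / sqrt (4*pi))) has_integral 2 * (1 / sqrt (4*pi))) {0..pi}"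
      by (intro has_integral_mult_left) simp
    moreover have "((\<lambda>\<theta>. 1::real) has_integral 2 * pi) {0..2*pi}"
      using has_integral_const_real[of "1::real" 0 "2*pi"] by simp
    ultimately have "(LINT \<omega>|sphere_measure. sph_harm (l, m) \<omega>) = 2 * (1 / sqrt (4*pi)) * (2*pi)"
      by (rule sphere_integral_separated[OF continuous_sph_harm, rotated 1])
        (simp only: 3 sph_harm_degree_0 mult_1_right)
    also have "\<dots> = (4 * pi) / sqrt (4*pi)" by simp
    also have "\<dots> = sqrt (4*pi)" by (rule real_div_sqrt) simp
    finally show ?thesis using 3 by simp
  qed
qed

lemma integral_coord_squared: "(LINT \<omega>|sphere_measure. \<omega> $ i * \<omega> $ i) = 4 * pi / 3"
proof -
  have c: "continuous_on UNIV (\<lambda>\<omega>::real^3. \<omega> $ i * \<omega> $ i)" by (intro continuous_intros)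
  have *: "sin \<theta> * sin \<theta> = poly [:1,0,-1:] (cos \<theta>)" for \<theta> :: real
    using sin_squared_eq[of \<theta>] by (simp add: power2_eq_square)
  have p: "pderiv [:0,1,0,-1/3:] = ([:1,0,-1:] :: real poly)" "pderiv [:0,0,0,1/3:] = ([:0,0,1:] :: real poly)"
    by (simp_all add: pderiv_pCons)
  have s3: "((\<lambda>\<theta>. sin \<theta> * (sin \<theta> * sin \<theta>)) has_integral 4/3) {0..pi}"
    using integral_sin_poly_cos[OF p(1)] unfolding * by simp
  have s1: "((\<lambda>\<theta>. sin \<theta> * (cos \<theta> * cos \<theta>)) has_integral 2/3) {0..pi}"
    using integral_sin_poly_cos[OF p(2)] by simp
  have one: "((\<lambda>\<theta>. 1::real) has_integral 2 * pi) {0..2*pi}"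
    using has_integral_const_real[of "1::real" 0 "2*pi"] by simp
  have cc: "((\<lambda>\<phi>. 1/2 * (1 + cos (of_int 2 * \<phi>))) has_integral 1/2 * (2*pi + 0)) {0..2*pi}"
    by (intro has_integral_mult_right has_integral_add one integral_cos_multiple) simp
  have ss: "((\<lambda>\<phi>. 1/2 * (1 - cos (of_int 2 * \<phi>))) has_integral 1/2 * (2*pi - 0)) {0..2*pi}"
    by (intro has_integral_mult_right has_integral_diff one integral_cos_multiple) simp
  have d: "1/2 * (1 + cos (of_int 2 * \<phi>)) = cos \<phi> * cos \<phi>" "1/2 * (1 - cos (of_int 2 * \<phi>)) = sin \<phi> * sin \<phi>" for \<phi> :: real
    using sin_squared_eq[of \<phi>] by (auto simp: cos_double power2_eq_square)
  consider "i = 1" | "i = 2" | "i = 3" using exhaust_3 by blast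
  then show ?thesis
  proof cases
    case 1
    show ?thesis
      by (rule trans[OF sphere_integral_separated[OF c _ s3 cc[unfolded d]]]) (auto simp: 1 sph_coord_def)
  next
    case 2
    show ?thesis
      by (rule trans[OF sphere_integral_separated[OF c _ s3 ss[unfolded d]]]) (auto simp: 2 sph_coord_def)
  next
    case 3
    show ?thesis
      by (rule trans[OF sphere_integral_separated[OF c _ s1 one]]) (auto simp: 3 sph_coord_def)
  qed
qed

text \<open>If the order \<open>m\<close> does not match the coordinate, the longitudinal integral vanishes; if
  it does but the degree is not 1, the latitudinal integral does.\<close>

lemma integral_coord_sph_harm:
  assumes "\<bar>m\<bar> \<le> int l"
  shows "(LINT \<omega>|sphere_measure. \<omega> $ i * sph_harm (l, m) \<omega>) = (if (l, m) = sph_idx i then sqrt (4 * pi / 3) else 0)"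
proof (cases "(l, m) = sph_idx i")
  case True
  then have *: "sph_harm (l, m) \<omega> = sqrt (3 / (4 * pi)) * \<omega> $ i" for \<omega>
    using sph_harm_degree_1[of \<omega>] exhaust_3[of i] by (auto simp: sph_idx_def)
  have "(LINT \<omega>|sphere_measure. \<omega> $ i * sph_harm (l, m) \<omega>) = (LINT \<omega>|sphere_measure. sqrt (3 / (4 * pi)) * (\<omega> $ i * \<omega> $ i))"
    by (simp add: * mult_ac)
  also have "\<dots> = sqrt (3 / (4 * pi)) * (4 * pi / 3)"
    by (simp only: integral_mult_right_zero integral_coord_squared)
  also have "\<dots> = sqrt (4 * pi / 3)"
    using real_div_sqrt[of "4 * pi / 3"] by (simp add: real_sqrt_divide field_simps)
  finally show ?thesis using True by simp
next
  case False
  let ?c = "sqrt ((2 * real l + 1) / (4 * pi) * (fact (l - nat \<bar>m\<bar>) / fact (l + nat \<bar>m\<bar>)))"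
  let ?p = "\<lambda>\<theta>. sin \<theta> ^ nat \<bar>m\<bar> * poly ((pderiv ^^ nat \<bar>m\<bar>) (legendre_poly l)) (cos \<theta>)"
  let ?t = "\<lambda>\<theta>. if i = 3 then cos \<theta> else sin \<theta>"
  let ?k = "\<lambda>\<phi>. if i = 1 then cos \<phi> else if i = 2 then sin \<phi> else 1"
  let ?a = "\<lambda>\<theta>. ?c * (sin \<theta> * (?t \<theta> * ?p \<theta>))"
  let ?b = "\<lambda>\<phi>. ?k \<phi> * azimuthal m \<phi>"
  have c: "continuous_on UNIV (\<lambda>\<omega>. \<omega> $ i * sph_harm (l, m) \<omega>)"
    by (intro continuous_intros continuous_sph_harm)
  have sep: "sin \<theta> * (sph_coord (\<theta>, \<phi>) $ i * sph_harm (l, m) (sph_coord (\<theta>, \<phi>))) = ?a \<theta> * ?b \<phi>" for \<theta> \<phi>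
    using exhaust_3[of i] by (auto simp: sph_harm_sph_coord) (simp_all add: sph_coord_eq)
  note S = sphere_integral_separated[OF c sep]
  have a: "(?a has_integral integral {0..pi} ?a) {0..pi}"
    by (intro integrable_integral integrable_continuous_interval) (cases "i = 3"; simp; intro continuous_intros)
  have b: "(?b has_integral integral {0..2*pi} ?b) {0..2*pi}"
    unfolding azimuthal_def
    by (intro integrable_integral integrable_continuous_interval)
      (cases "i = 1"; cases "i = 2"; cases "m = 0"; cases "m > 0"; simp; intro continuous_intros)
  have "(?b has_integral 0) {0..2*pi} \<or> (?a has_integral ?c * 0) {0..pi}"
  proof -
    consider "i = 1" "m \<noteq> 1" | "i = 2" "m \<noteq> -1" | "i = 3" "m \<noteq> 0" | "i = 1" "m = 1" "l \<noteq> 1"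
      | "i = 2" "m = -1" "l \<noteq> 1" | "i = 3" "m = 0" "l \<noteq> 1"
      using exhaust_3[of i] False by (auto simp: sph_idx_def)
    then show ?thesis
    proof cases
      case 1 then show ?thesis using integral_cos_azimuthal by simp
    next
      case 2 then show ?thesis using integral_sin_azimuthal by simp
    next
      case 3 then show ?thesis using integral_azimuthal by (auto simp: eta_contract_eq)
    next
      case 4 then show ?thesis using integral_legendre_deriv[of l]
        by (intro disjI2 has_integral_mult_right) (simp add: mult.assoc)
    next
      case 5 then show ?thesis using integral_legendre_deriv[of l]
        by (intro disjI2 has_integral_mult_right) (simp add: mult.assoc)
    next
      case 6 then show ?thesis using integral_id_legendre[of l]
        by (intro disjI2 has_integral_mult_right) simp
    qed
  qed
  then show ?thesis using S[OF a, of 0] S[OF _ b, of 0] False by auto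
qed

lemma flux_matrix_sym: "flux_matrix i a b = flux_matrix i b a"
  by (simp add: flux_matrix_def mult.commute)

text \<open>The zeroth harmonic is constant, so the first row of the flux matrix contains the moments
  of \<open>\<omega>\<^sub>i\<close>, which is itself a harmonic of degree 1. This is where the factor 1/3 of the diffusion
  limit comes from.\<close>

lemma flux_matrix_row0:
  assumes "(l, m) \<in> sh_index N"
  shows "flux_matrix i (0, 0) (l, m) = (if (l, m) = sph_idx i then 1 / sqrt 3 else 0)"
proof -
  have "flux_matrix i (0, 0) (l, m) = (LINT \<omega>|sphere_measure. 1 / sqrt (4*pi) * (\<omega> $ i * sph_harm (l, m) \<omega>))"
    unfolding flux_matrix_def sph_harm_degree_0 by (simp only: mult_ac)
  also have "\<dots> = 1 / sqrt (4*pi) * (if (l, m) = sph_idx i then sqrt (4 * pi / 3) else 0)"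
    using assms by (simp only: integral_mult_right_zero) (subst integral_coord_sph_harm, auto simp: sh_index_def)
  finally show ?thesis by (simp add: real_sqrt_divide)
qed

lemma finite_sh_index [simp]: "finite (sh_index N)"
proof (rule finite_subset)
  show "sh_index N \<subseteq> {..N} \<times> {- int N..int N}" by (auto simp: sh_index_def)
qed simp

lemma zero_in_sh_index [simp]: "(0, 0) \<in> sh_index N"
  by (simp add: sh_index_def)

lemma sph_idx_in_sh_index: "N \<ge> 1 \<Longrightarrow> sph_idx i \<in> sh_index N"
  by (simp add: sh_index_def sph_idx_def)

lemma inj_sph_idx: "sph_idx i = sph_idx j \<longleftrightarrow> i = j"
  using exhaust_3[of i] exhaust_3[of j] by (auto simp: sph_idx_def)

lemma scalar_flux_eq: "scalar_flux N u x = sqrt (4 * pi) * u x (0, 0)"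
proof -
  have "scalar_flux N u x = (\<Sum>a\<in>sh_index N. u x a * (LINT \<omega>|sphere_measure. sph_harm a \<omega>))"
    unfolding scalar_flux_def u_PN_def mdot_def
    by (subst Bochner_Integration.integral_sum) (auto intro!: integrable_mult_right sphere_integral(1) continuous_sph_harm)
  also have "\<dots> = (\<Sum>a\<in>sh_index N. if a = (0, 0) then sqrt (4 * pi) * u x (0, 0) else 0)"
    by (intro sum.cong refl) (auto simp: sh_index_def integral_sph_harm split: if_splits)
  finally show ?thesis by simp
qed

lemma scaled_current_eq:
  assumes "N \<ge> 1"
  shows "scaled_current N \<epsilon> u x $ i = sqrt (4 * pi / 3) * (u x (sph_idx i) / \<epsilon>)"
proof -
  let ?g = "\<lambda>j \<omega>. \<Sum>a\<in>sh_index N. u x a * (\<omega> $ j * sph_harm a \<omega>)"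
  have int: "integrable sphere_measure (?g j)" for j
    by (auto intro!: integrable_mult_right sphere_integral(1) continuous_intros continuous_sph_harm Bochner_Integration.integrable_sum)
  have "u_PN N u x \<omega> *\<^sub>R \<omega> = (\<Sum>j\<in>UNIV. ?g j \<omega> *\<^sub>R axis j 1)" for \<omega>
    by (simp add: vec_eq_iff u_PN_def mdot_def axis_def sum_distrib_left sum_distrib_right mult_ac if_distrib cong: if_cong)
  then have "scaled_current N \<epsilon> u x $ i = 1 / \<epsilon> * (LINT \<omega>|sphere_measure. ?g i \<omega>)"
    unfolding scaled_current_def using int
    by (simp add: axis_def if_distrib cong: if_cong)
  also have "(LINT \<omega>|sphere_measure. ?g i \<omega>) = (\<Sum>a\<in>sh_index N. u x a * (LINT \<omega>|sphere_measure. \<omega> $ i * sph_harm a \<omega>))"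
    by (subst Bochner_Integration.integral_sum) (auto intro!: integrable_mult_right sphere_integral(1) continuous_intros continuous_sph_harm)
  also have "\<dots> = (\<Sum>a\<in>sh_index N. if a = sph_idx i then sqrt (4 * pi / 3) * u x (sph_idx i) else 0)"
  proof (intro sum.cong refl)
    fix a assume "a \<in> sh_index N"
    then obtain l m where a: "a = (l, m)" "\<bar>m\<bar> \<le> int l" by (auto simp: sh_index_def)
    show "u x a * (LINT \<omega>|sphere_measure. \<omega> $ i * sph_harm a \<omega>)
        = (if a = sph_idx i then sqrt (4 * pi / 3) * u x (sph_idx i) else 0)"
      unfolding a(1) integral_coord_sph_harm[OF a(2)] by simp
  qed
  also have "\<dots> = sqrt (4 * pi / 3) * u x (sph_idx i)"
    using sph_idx_in_sh_index[OF assms] by simp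
  finally show ?thesis by simp
qed

section \<open>Facet integrals as integrals over parallel lines\<close>

lemma lebesgue_on_integral_spike:
  fixes f g :: "'a::euclidean_space \<Rightarrow> real"
  assumes S: "S \<in> sets lebesgue" and N: "negligible N" and eq: "\<And>x. x \<in> S - N \<Longrightarrow> f x = g x"
  shows "integrable (lebesgue_on S) f \<longleftrightarrow> integrable (lebesgue_on S) g"
    and "integral\<^sup>L (lebesgue_on S) f = integral\<^sup>L (lebesgue_on S) g"
proof -
  let ?f = "\<lambda>x. indicator S x *\<^sub>R f x" and ?g = "\<lambda>x. indicator S x *\<^sub>R g x"
  have ae: "AE x in lebesgue. ?f x = ?g x"
    using N eq by (intro AE_I'[of N]) (auto simp: negligible_iff_null_sets indicator_def)
  then have ae': "AE x in lebesgue. ?g x = ?f x" by auto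
  have m: "?f \<in> borel_measurable lebesgue \<longleftrightarrow> ?g \<in> borel_measurable lebesgue"
    using borel_measurable_AE[OF _ ae] borel_measurable_AE[OF _ ae'] by blast
  have i: "integrable lebesgue ?f \<longleftrightarrow> integrable lebesgue ?g"
    using m integrable_cong_AE[OF _ _ ae] borel_measurable_integrable by blast
  then show "integrable (lebesgue_on S) f \<longleftrightarrow> integrable (lebesgue_on S) g"
    using S by (simp add: integrable_restrict_space)
  have "integral\<^sup>L lebesgue ?f = integral\<^sup>L lebesgue ?g"
  proof (cases "integrable lebesgue ?f")
    case True
    then show ?thesis using i by (intro integral_cong_AE[OF _ _ ae]) auto
  next
    case False
    then show ?thesis using i by (simp add: not_integrable_integral_eq)
  qed
  then show "integral\<^sup>L (lebesgue_on S) f = integral\<^sup>L (lebesgue_on S) g"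
    using S by (simp add: integral_restrict_space)
qed

lemma nn_integral_translate:
  fixes f :: "'a::euclidean_space \<Rightarrow> ennreal"
  assumes "f \<in> borel_measurable borel"
  shows "(\<integral>\<^sup>+x. f (c + x) \<partial>lborel) = (\<integral>\<^sup>+x. f x \<partial>lborel)"
proof -
  have "(\<integral>\<^sup>+x. f x \<partial>distr lborel borel ((+) c)) = (\<integral>\<^sup>+x. f (c + x) \<partial>lborel)"
    using assms by (intro nn_integral_distr) auto
  then show ?thesis by (simp add: lborel_distr_plus)
qed

text \<open>Moving the point along a line and integrating over the shift is a self-adjoint operation.
  With a function \<open>k\<close> whose integral over every line is 1, this trades an integral over the space for
  an integral over any set that meets the lines in unit segments.\<close>

lemma nn_integral_line_adjoint:
  fixes h k :: "'a::euclidean_space \<Rightarrow> ennreal"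
  assumes h[measurable]: "h \<in> borel_measurable borel" and k[measurable]: "k \<in> borel_measurable borel"
  shows "(\<integral>\<^sup>+z. h z * (\<integral>\<^sup>+s. k (z + s *\<^sub>R e) \<partial>lborel) \<partial>lborel) =
         (\<integral>\<^sup>+z. k z * (\<integral>\<^sup>+s. h (z + s *\<^sub>R e) \<partial>lborel) \<partial>lborel)"
proof -
  have "(\<integral>\<^sup>+z. h z * (\<integral>\<^sup>+s. k (z + s *\<^sub>R e) \<partial>lborel) \<partial>lborel)
      = (\<integral>\<^sup>+z. (\<integral>\<^sup>+s. h z * k (z + s *\<^sub>R e) \<partial>lborel) \<partial>lborel)"
    by (subst nn_integral_cmult) auto
  also have "\<dots> = (\<integral>\<^sup>+s. (\<integral>\<^sup>+z. h z * k (z + s *\<^sub>R e) \<partial>lborel) \<partial>lborel)"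
    by (rule lborel_pair.Fubini'[symmetric]) (simp add: borel_prod case_prod_beta, measurable)
  also have "\<dots> = (\<integral>\<^sup>+s. (\<integral>\<^sup>+z. h (- (s *\<^sub>R e) + z) * k z \<partial>lborel) \<partial>lborel)"
  proof (rule nn_integral_cong)
    fix s :: real
    show "(\<integral>\<^sup>+z. h z * k (z + s *\<^sub>R e) \<partial>lborel) = (\<integral>\<^sup>+z. h (- (s *\<^sub>R e) + z) * k z \<partial>lborel)"
      by (subst nn_integral_translate[symmetric, where c = "s *\<^sub>R e", of "\<lambda>z. h (- (s *\<^sub>R e) + z) * k z"])
        (auto simp: add.commute)
  qed
  also have "\<dots> = (\<integral>\<^sup>+s. (\<integral>\<^sup>+z. h (z - s *\<^sub>R e) * k z \<partial>lborel) \<partial>lborel)" by simp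
  also have "\<dots> = (\<integral>\<^sup>+z. (\<integral>\<^sup>+s. h (z - s *\<^sub>R e) * k z \<partial>lborel) \<partial>lborel)"
    by (rule lborel_pair.Fubini') (simp add: borel_prod case_prod_beta, measurable)
  also have "\<dots> = (\<integral>\<^sup>+z. (\<integral>\<^sup>+s. h (z - s *\<^sub>R e) \<partial>lborel) * k z \<partial>lborel)"
    by (subst nn_integral_multc) auto
  also have "\<dots> = (\<integral>\<^sup>+z. (\<integral>\<^sup>+s. h (z + s *\<^sub>R e) \<partial>lborel) * k z \<partial>lborel)"
  proof -
    have "(\<integral>\<^sup>+s. h (z - s *\<^sub>R e) \<partial>distr lborel borel uminus) = (\<integral>\<^sup>+s. h (z + s *\<^sub>R e) \<partial>lborel)" for z
      by (subst nn_integral_distr) auto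
    then show ?thesis by (simp add: lborel_distr_uminus)
  qed
  finally show ?thesis by (simp add: mult.commute)
qed

text \<open>The point at which the line through \<open>x\<close> in direction \<open>d\<close> meets the plane \<open>n \<bullet> y = c\<close>. For
  \<open>d = n\<close> this is the orthogonal projection, for a coordinate direction the point where an axis-parallel
  line hits a facet.\<close>

definition line_proj :: "real^3 \<Rightarrow> real^3 \<Rightarrow> real \<Rightarrow> real^3 \<Rightarrow> real^3" where
  "line_proj d n c x = x + ((c - n \<bullet> x) / (n \<bullet> d)) *\<^sub>R d"

lemma line_proj_line:
  assumes "n \<bullet> d \<noteq> 0" shows "line_proj d n c (x + s *\<^sub>R d) = line_proj d n c x"
proof -
  have "(c - n \<bullet> (x + s *\<^sub>R d)) / (n \<bullet> d) = (c - n \<bullet> x) / (n \<bullet> d) - s"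
    using assms by (simp add: inner_add_right field_simps)
  then show ?thesis unfolding line_proj_def by (simp only:) (simp add: algebra_simps)
qed

lemma line_proj_fix: "n \<bullet> x = c \<Longrightarrow> line_proj d n c x = x"
  by (simp add: line_proj_def)

lemma continuous_line_proj [continuous_intros]: "continuous_on A (line_proj d n c)"
  unfolding line_proj_def divide_inverse by (intro continuous_intros)

lemma measurable_line_proj [measurable]: "line_proj d n c \<in> borel_measurable borel"
  by (rule borel_measurable_continuous_onI) (rule continuous_line_proj)

lemma det_shear: "det (matrix (\<lambda>x::real^3. x + (n \<bullet> x) *\<^sub>R a)) = 1 + n \<bullet> a"
proof -
  have "matrix (\<lambda>x::real^3. x + (n \<bullet> x) *\<^sub>R a) $ i $ j = (if i = j then 1 else 0) + n $ j * a $ i" for i j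
    by (simp add: matrix_def inner_axis) (simp add: axis_def)
  then show ?thesis
    by (simp add: det_3 inner_vec_def sum_3 algebra_simps)
qed

lemma emeasure_lborel_unit_interval: "(\<integral>\<^sup>+s. indicator {s. 0 \<le> a + s \<and> a + s \<le> (1::real)} s \<partial>lborel) = 1"
proof -
  have "{s. 0 \<le> a + s \<and> a + s \<le> 1} = {-a..1-a}" by auto
  then show ?thesis by simp
qed

lemma cube_line:
  assumes "z + t *\<^sub>R axis i 1 \<in> cbox 0 (1::real^3)"
  shows "z + s *\<^sub>R axis i 1 \<in> cbox 0 1 \<longleftrightarrow> 0 \<le> z $ i + s \<and> z $ i + s \<le> 1"
  using assms by (auto simp: mem_box_cart axis_def split: if_splits)

text \<open>Both sides measure the set \<open>B\<close> in a plane: the left-hand side by the orthogonal prism of height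
  1 over it and the direction cosine, the right-hand side by its shadow along the \<open>i\<close>-th axis in the
  unit cube. A shear maps the orthogonal prism to the prism along the axis with the same base; the
  latter has the same volume as the part of the cube over the shadow, because both meet every line
  parallel to the axis through \<open>B\<close> in a segment of length 1.\<close>

lemma area_sets:
  fixes n :: "real^3"
  assumes B: "B \<in> sets borel" "B \<subseteq> cbox 0 1" "B \<subseteq> {x. n \<bullet> x = c}" and n: "norm n = 1" "n $ i \<noteq> 0"
  shows "ennreal \<bar>n $ i\<bar> * emeasure lborel {x. line_proj n n c x \<in> B \<and> 0 \<le> n \<bullet> x - c \<and> n \<bullet> x - c \<le> 1}
       = emeasure lborel {x \<in> cbox 0 1. line_proj (axis i 1) n c x \<in> B}"
proof -
  let ?e = "axis i 1 :: real^3"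
  have nn: "n \<bullet> n = 1" using n(1) by (simp add: norm_eq_1)
  have ne: "n \<bullet> ?e = n $ i" by (simp add: inner_axis)
  \<comment> \<open>The shear that keeps the plane \<open>n \<bullet> x = 0\<close> and takes the normal \<open>n\<close> to the axis \<open>?e\<close>.\<close>
  define L where "L = (\<lambda>x::real^3. x + (n \<bullet> x) *\<^sub>R (?e - n))"
  have linL: "linear L"
    by (simp add: L_def linear_iff inner_add_right algebra_simps)
  have detL: "det (matrix L) = n $ i"
    unfolding L_def det_shear by (simp add: inner_diff_right nn ne)
  define S1 where "S1 = {x. line_proj n n c x \<in> B \<and> 0 \<le> n \<bullet> x - c \<and> n \<bullet> x - c \<le> 1}"
  define S2 where "S2 = {x. line_proj ?e n c x \<in> B \<and> 0 \<le> (n \<bullet> x - c) / n $ i \<and> (n \<bullet> x - c) / n $ i \<le> 1}"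
  have B'[measurable]: "B \<in> sets borel" by fact
  have S1b: "S1 \<in> sets borel" unfolding S1_def by measurable
  have S2b: "S2 \<in> sets borel" unfolding S2_def by measurable
  have bdd: "S1 \<subseteq> cball 0 (norm (1::real^3) + 1)"
  proof
    fix x assume x: "x \<in> S1"
    have "x = line_proj n n c x + (n \<bullet> x - c) *\<^sub>R n" by (simp add: line_proj_def nn flip: scaleR_add_left)
    then have "norm x \<le> norm (line_proj n n c x) + \<bar>n \<bullet> x - c\<bar>"
      using norm_triangle_ineq[of "line_proj n n c x" "(n \<bullet> x - c) *\<^sub>R n"] n(1) by simp
    moreover have "norm (line_proj n n c x) \<le> norm (1::real^3)"
      using x B(2) by (intro norm_le_componentwise_cart) (force simp: S1_def mem_box_cart)
    ultimately show "x \<in> cball 0 (norm (1::real^3) + 1)" using x by (auto simp: S1_def)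
  qed
  have S1m: "S1 \<in> lmeasurable"
    using S1b bdd bounded_cball bounded_subset by (intro bounded_set_imp_lmeasurable) auto
  have im: "(+) (- c *\<^sub>R (?e - n)) ` L ` S1 = S2"
  proof -
    have 1: "line_proj ?e n c (- c *\<^sub>R (?e - n) + L x) = line_proj n n c x"
         "(n \<bullet> (- c *\<^sub>R (?e - n) + L x) - c) / n $ i = n \<bullet> x - c" for x
    proof -
      have a: "n \<bullet> (- c *\<^sub>R (?e - n) + L x) = c + (n \<bullet> x - c) * n $ i"
        by (simp add: L_def inner_add_right inner_diff_right nn ne algebra_simps)
      show "(n \<bullet> (- c *\<^sub>R (?e - n) + L x) - c) / n $ i = n \<bullet> x - c" unfolding a using n by simp
      have d: "(c - (c + (n \<bullet> x - c) * n $ i)) / n $ i = c - n \<bullet> x" using n(2) by (simp add: field_simps)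
      show "line_proj ?e n c (- c *\<^sub>R (?e - n) + L x) = line_proj n n c x"
        unfolding line_proj_def[of ?e] a ne d by (simp add: line_proj_def L_def nn algebra_simps)
    qed
    have "S2 \<subseteq> (+) (- c *\<^sub>R (?e - n)) ` L ` S1"
    proof
      fix y assume y: "y \<in> S2"
      define x where "x = y + ((n \<bullet> y - c) / n $ i) *\<^sub>R (n - ?e)"
      have nx: "n \<bullet> x = c + (n \<bullet> y - c) / n $ i"
        using n(2) by (simp add: x_def inner_add_right inner_diff_right nn ne field_simps)
      have y': "y = - c *\<^sub>R (?e - n) + L x"
        unfolding L_def nx by (simp add: x_def algebra_simps)
      moreover have "x \<in> S1" using y 1[of x] unfolding S1_def S2_def y'[symmetric] by simp
      ultimately show "y \<in> (+) (- c *\<^sub>R (?e - n)) ` L ` S1" by blast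
    qed
    moreover have "(+) (- c *\<^sub>R (?e - n)) ` L ` S1 \<subseteq> S2"
      by (auto simp: S1_def S2_def 1 simp del: scaleR_minus_left)
    ultimately show ?thesis by blast
  qed
  have S2m: "S2 \<in> lmeasurable"
    unfolding im[symmetric] by (intro measurable_translation measurable_linear_image linL S1m)
  have "measure lebesgue S2 = \<bar>n $ i\<bar> * measure lebesgue S1"
    unfolding im[symmetric] measure_translation measure_linear_image[OF linL S1m] detL ..
  then have "emeasure lebesgue S2 = ennreal \<bar>n $ i\<bar> * emeasure lebesgue S1"
    using S1m S2m by (simp add: emeasure_eq_measure2 ennreal_mult')
  then have 2: "emeasure lborel S2 = ennreal \<bar>n $ i\<bar> * emeasure lborel S1"
    using S1b S2b by simp
  define G :: "real^3 \<Rightarrow> ennreal" where "G z = indicator B (line_proj ?e n c z)" for z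
  define sl :: "real^3 \<Rightarrow> ennreal" where "sl z = indicator {x. 0 \<le> (n \<bullet> x - c) / n $ i \<and> (n \<bullet> x - c) / n $ i \<le> 1} z" for z
  have Gm[measurable]: "G \<in> borel_measurable borel" unfolding G_def by measurable
  have slm[measurable]: "sl \<in> borel_measurable borel" unfolding sl_def by measurable
  have Ginv: "G (z + s *\<^sub>R ?e) = G z" for z s unfolding G_def using n by (subst line_proj_line) (auto simp: ne)
  have slab: "(\<integral>\<^sup>+s. sl (z + s *\<^sub>R ?e) \<partial>lborel) = 1" for z
  proof -
    have "sl (z + s *\<^sub>R ?e) = indicator {s. 0 \<le> (n \<bullet> z - c) / n $ i + s \<and> (n \<bullet> z - c) / n $ i + s \<le> 1} s" for s
    proof -
      have "(n \<bullet> (z + s *\<^sub>R ?e) - c) / n $ i = (n \<bullet> z - c) / n $ i + s"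
        using n(2) by (simp add: inner_add_right ne field_simps)
      then show ?thesis by (simp add: sl_def indicator_def)
    qed
    then show ?thesis by (simp only: emeasure_lborel_unit_interval)
  qed
  have cube: "G z * (\<integral>\<^sup>+s. indicator (cbox 0 1) (z + s *\<^sub>R ?e) \<partial>lborel) = G z" for z
  proof (cases "line_proj ?e n c z \<in> B")
    case True
    then have *: "z + s *\<^sub>R ?e \<in> cbox 0 1 \<longleftrightarrow> 0 \<le> z $ i + s \<and> z $ i + s \<le> 1" for s
      using B(2) cube_line[of z "(c - n \<bullet> z) / (n \<bullet> ?e)" i s] unfolding line_proj_def by blast
    have "(\<integral>\<^sup>+s. indicator (cbox 0 1) (z + s *\<^sub>R ?e) \<partial>lborel) = (1::ennreal)"
      unfolding emeasure_lborel_unit_interval[of "z $ i", symmetric]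
      by (intro nn_integral_cong) (simp only: indicator_def * mem_Collect_eq)
    then show ?thesis by simp
  qed (simp add: G_def)
  have "emeasure lborel S2 = (\<integral>\<^sup>+z. indicator S2 z \<partial>lborel)" using S2b by simp
  also have "\<dots> = (\<integral>\<^sup>+z. (G z * sl z) * (\<integral>\<^sup>+s. indicator (cbox 0 1) (z + s *\<^sub>R ?e) \<partial>lborel) \<partial>lborel)"
    by (rule nn_integral_cong, subst mult.assoc[of "G _"], subst mult.commute[of "sl _"], subst mult.assoc[symmetric], subst cube)
       (auto simp: S2_def G_def sl_def indicator_def)
  also have "\<dots> = (\<integral>\<^sup>+z. indicator (cbox 0 1) z * (\<integral>\<^sup>+s. G (z + s *\<^sub>R ?e) * sl (z + s *\<^sub>R ?e) \<partial>lborel) \<partial>lborel)"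
    by (rule nn_integral_line_adjoint) measurable
  also have "\<dots> = (\<integral>\<^sup>+z. indicator (cbox 0 1) z * G z \<partial>lborel)"
    unfolding Ginv by (subst nn_integral_cmult) (auto simp: slab)
  also have "\<dots> = (\<integral>\<^sup>+z. indicator {x \<in> cbox 0 1. line_proj ?e n c x \<in> B} z \<partial>lborel)"
    by (intro nn_integral_cong) (auto simp: G_def indicator_def)
  also have "\<dots> = emeasure lborel {x \<in> cbox 0 1. line_proj ?e n c x \<in> B}"
    by (rule nn_integral_indicator) measurable
  finally show ?thesis using 2 by (simp add: S1_def)
qed

text \<open>The prism in the definition of the facet integral, described by its projection and its height so
  that it is visibly a Borel set.\<close>

lemma prism_eq:
  assumes "F \<subseteq> {x. n \<bullet> x = c}" "norm n = 1"
  shows "{x + t *\<^sub>R n |x t. x \<in> F \<and> 0 \<le> t \<and> t \<le> 1}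
       = {x. line_proj n n c x \<in> F \<and> 0 \<le> n \<bullet> x - c \<and> n \<bullet> x - c \<le> 1}" (is "?P = ?Q")
proof -
  have nn: "n \<bullet> n = 1" using assms(2) by (simp add: norm_eq_1)
  show ?thesis
  proof (intro set_eqI iffI)
    fix y assume "y \<in> ?P"
    then obtain x t where *: "y = x + t *\<^sub>R n" "x \<in> F" "0 \<le> t" "t \<le> 1" by auto
    have "n \<bullet> y - c = t" using * assms nn by (auto simp: inner_add_right)
    moreover have "line_proj n n c y = x" using * assms(1) unfolding *(1)
      by (subst line_proj_line) (auto simp: nn line_proj_fix)
    ultimately show "y \<in> ?Q" using * by auto
  next
    fix y assume y: "y \<in> ?Q"
    have "y = line_proj n n c y + (n \<bullet> y - c) *\<^sub>R n" by (simp add: line_proj_def nn flip: scaleR_add_left)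
    then show "y \<in> ?P" using y by blast
  qed
qed

lemma closest_point_prism:
  assumes "F \<subseteq> {x. n \<bullet> x = c}" "norm n = 1" "closed F" "convex F" "line_proj n n c y \<in> F"
  shows "closest_point F y = line_proj n n c y"
proof -
  let ?x = "line_proj n n c y"
  have nn: "n \<bullet> n = 1" using assms(2) by (simp add: norm_eq_1)
  have "dist y ?x \<le> dist y z" if "z \<in> F" for z
  proof -
    have "\<bar>n \<bullet> (y - z)\<bar> \<le> norm n * norm (y - z)" by (rule Cauchy_Schwarz_ineq2)
    moreover have "n \<bullet> (y - z) = n \<bullet> y - c" using that assms(1) by (auto simp: inner_diff_right)
    moreover have "dist y ?x = \<bar>n \<bullet> y - c\<bar>" using assms(2) by (simp add: line_proj_def dist_norm nn)
    ultimately show ?thesis using assms(2) by (simp add: dist_norm)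
  qed
  then show ?thesis using closest_point_unique[of F ?x y] assms by auto
qed

text \<open>The set version \<open>area_sets\<close> says that two measures on the facet agree; integrating \<open>g\<close>
  against them gives the formula. The integral on the right runs over a fixed cube, whatever the
  facet, so that integrals over all facets can be added under one integral sign.\<close>

lemma facet_area_formula:
  fixes n :: "real^3" and g :: "real^3 \<Rightarrow> real"
  assumes F: "compact F" "convex F" "F \<subseteq> cbox 0 1" "F \<subseteq> {x. n \<bullet> x = c}"
    and n: "norm n = 1" "n $ i \<noteq> 0" and g: "g \<in> borel_measurable borel"
  shows "integrable (lebesgue_on {x + t *\<^sub>R n |x t. x \<in> F \<and> 0 \<le> t \<and> t \<le> 1}) (\<lambda>y. g (closest_point F y))
      \<longleftrightarrow> integrable lborel (\<lambda>x. indicator {x \<in> cbox 0 1. line_proj (axis i 1) n c x \<in> F} x * g (line_proj (axis i 1) n c x))" (is ?A)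
    and "\<bar>n $ i\<bar> * facet_integral F n g
      = (LINT x|lborel. indicator {x \<in> cbox 0 1. line_proj (axis i 1) n c x \<in> F} x * g (line_proj (axis i 1) n c x))" (is ?B)
proof -
  let ?P = "{x + t *\<^sub>R n |x t. x \<in> F \<and> 0 \<le> t \<and> t \<le> 1}"
  let ?C = "{x \<in> cbox 0 1. line_proj (axis i 1) n c x \<in> F}"
  have Fb[measurable]: "F \<in> sets borel" using F(1) by (simp add: borel_compact)
  note [measurable] = g
  have P: "?P = {x. line_proj n n c x \<in> F \<and> 0 \<le> n \<bullet> x - c \<and> n \<bullet> x - c \<le> 1}"
    by (rule prism_eq[OF F(4) n(1)])
  have Pm: "?P \<in> sets borel" unfolding P by measurable
  have Cm: "?C \<in> sets borel" by measurable
  define \<mu>1 where "\<mu>1 = distr (restrict_space lborel ?P) borel (line_proj n n c)"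
  define \<mu>2 where "\<mu>2 = distr (restrict_space lborel ?C) borel (line_proj (axis i 1) n c)"
  have m1: "line_proj d n c \<in> measurable (restrict_space lborel S) borel" for d S
    by (rule measurable_restrict_space1) simp
  have eq: "density \<mu>1 (\<lambda>_. ennreal \<bar>n $ i\<bar>) = \<mu>2"
  proof (rule measure_eqI)
    fix A assume "A \<in> sets (density \<mu>1 (\<lambda>_. ennreal \<bar>n $ i\<bar>))"
    then have A[measurable]: "A \<in> sets borel" by (simp add: \<mu>1_def)
    have "emeasure (density \<mu>1 (\<lambda>_. ennreal \<bar>n $ i\<bar>)) A = ennreal \<bar>n $ i\<bar> * emeasure \<mu>1 A"
      by (subst emeasure_density_const) (auto simp: \<mu>1_def)
    also have "emeasure \<mu>1 A = emeasure lborel {x. line_proj n n c x \<in> F \<inter> A \<and> 0 \<le> n \<bullet> x - c \<and> n \<bullet> x - c \<le> 1}"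
      unfolding \<mu>1_def using A Pm
      by (subst emeasure_distr[OF m1 A], subst emeasure_restrict_space)
        (auto simp: P space_restrict_space intro!: arg_cong[of _ _ "emeasure lborel"])
    also have "ennreal \<bar>n $ i\<bar> * \<dots> = emeasure lborel {x \<in> cbox 0 1. line_proj (axis i 1) n c x \<in> F \<inter> A}"
      using F n by (intro area_sets) auto
    also have "\<dots> = emeasure \<mu>2 A"
      unfolding \<mu>2_def using A Cm
      by (subst emeasure_distr[OF m1 A], subst emeasure_restrict_space)
        (auto simp: space_restrict_space intro!: arg_cong[of _ _ "emeasure lborel"])
    finally show "emeasure (density \<mu>1 (\<lambda>_. ennreal \<bar>n $ i\<bar>)) A = emeasure \<mu>2 A" .
  qed (simp add: \<mu>1_def \<mu>2_def)
  have g1: "g \<in> borel_measurable \<mu>1" unfolding \<mu>1_def by simp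
  have cp: "g (closest_point F y) = g (line_proj n n c y)" if "y \<in> ?P" for y
    using that closest_point_prism[OF F(4) n(1) compact_imp_closed[OF F(1)] F(2), of y] unfolding P by simp
  have Pl: "?P \<in> sets lebesgue" using Pm by simp
  have i1: "integrable (lebesgue_on ?P) (\<lambda>y. g (closest_point F y)) \<longleftrightarrow> integrable \<mu>1 g"
  proof -
    have "integrable (lebesgue_on ?P) (\<lambda>y. g (closest_point F y)) \<longleftrightarrow> integrable (lebesgue_on ?P) (\<lambda>y. g (line_proj n n c y))"
      using cp by (intro Bochner_Integration.integrable_cong) auto
    also have "\<dots> \<longleftrightarrow> integrable lborel (\<lambda>y. indicator ?P y *\<^sub>R g (line_proj n n c y))"
      using Pm Pl by (subst integrable_restrict_space) (auto intro!: integrable_completion)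
    also have "\<dots> \<longleftrightarrow> integrable \<mu>1 g"
      unfolding \<mu>1_def using Pm by (subst integrable_distr_eq[OF m1 g]) (simp add: integrable_restrict_space)
    finally show ?thesis .
  qed
  have I1: "facet_integral F n g = (LINT x|\<mu>1. g x)"
  proof -
    have "facet_integral F n g = (LINT y|lebesgue_on ?P. g (line_proj n n c y))"
      unfolding facet_integral_def using cp by (intro Bochner_Integration.integral_cong) auto
    also have "\<dots> = (LINT y|lborel. indicator ?P y *\<^sub>R g (line_proj n n c y))"
      using Pm Pl by (subst integral_restrict_space) (auto intro!: integral_completion)
    also have "\<dots> = (LINT x|\<mu>1. g x)"
      unfolding \<mu>1_def using Pm by (subst integral_distr[OF m1 g]) (simp add: integral_restrict_space)
    finally show ?thesis .
  qed
  have i2: "integrable \<mu>2 g \<longleftrightarrow> integrable lborel (\<lambda>x. indicator ?C x * g (line_proj (axis i 1) n c x))"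
    unfolding \<mu>2_def using Cm by (subst integrable_distr_eq[OF m1 g]) (simp add: integrable_restrict_space)
  have I2: "(LINT x|\<mu>2. g x) = (LINT x|lborel. indicator ?C x * g (line_proj (axis i 1) n c x))"
    unfolding \<mu>2_def using Cm by (subst integral_distr[OF m1 g]) (simp add: integral_restrict_space)
  have "integrable \<mu>2 g \<longleftrightarrow> integrable \<mu>1 (\<lambda>x. \<bar>n $ i\<bar> *\<^sub>R g x)"
    unfolding eq[symmetric] using g1 by (intro integrable_density) auto
  also have "\<dots> \<longleftrightarrow> integrable \<mu>1 g" using n by simp
  finally show ?A using i1 i2 by simp
  have "(LINT x|\<mu>2. g x) = (LINT x|\<mu>1. \<bar>n $ i\<bar> *\<^sub>R g x)"
    unfolding eq[symmetric] using g1 by (intro integral_density) auto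
  then show ?B using I1 I2 by simp
qed

text \<open>Two different planes meet in at most a line, and the lines through it in a fixed
  direction fill at most a plane.\<close>

lemma negligible_lines_crossing:
  fixes n a d :: "real^3"
  assumes F: "F \<subseteq> {w. n \<bullet> w = c}" "n \<bullet> d \<noteq> 0" and G: "G \<subseteq> {w. a \<bullet> w = b}" "a \<noteq> 0"
    and not: "\<not> G \<subseteq> {w. n \<bullet> w = c}"
  shows "negligible {x. \<exists>s. x + s *\<^sub>R d \<in> F \<inter> G}"
proof (cases "a = (a \<bullet> d / (n \<bullet> d)) *\<^sub>R n")
  case True
  define k where "k = a \<bullet> d / (n \<bullet> d)"
  have k: "a = k *\<^sub>R n" "k \<noteq> 0" using True G(2) by (auto simp: k_def)
  have "F \<inter> G = {}"
  proof (rule ccontr)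
    assume "F \<inter> G \<noteq> {}"
    then have "k * c = b" using F(1) G(1) k by auto
    then show False using not G(1) k by auto
  qed
  then show ?thesis by simp
next
  case False
  let ?m = "a - (a \<bullet> d / (n \<bullet> d)) *\<^sub>R n"
  have "{x. \<exists>s. x + s *\<^sub>R d \<in> F \<inter> G} \<subseteq> {x. ?m \<bullet> x = b - (a \<bullet> d / (n \<bullet> d)) * c}"
  proof safe
    fix x s assume "x + s *\<^sub>R d \<in> F" "x + s *\<^sub>R d \<in> G"
    then have c: "c = n \<bullet> x + s * (n \<bullet> d)" "b = a \<bullet> x + s * (a \<bullet> d)"
      using F G by (auto simp: inner_add_right)
    show "?m \<bullet> x = b - (a \<bullet> d / (n \<bullet> d)) * c"
      unfolding c using F(2) by (simp add: inner_diff_left field_simps)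
  qed
  moreover have "?m \<noteq> 0" using False by simp
  ultimately show ?thesis using negligible_hyperplane negligible_subset by blast
qed

lemma negligible_lines_in_plane:
  fixes n d :: "real^3"
  assumes "F \<subseteq> {w. n \<bullet> w = c}" "n \<noteq> 0" "n \<bullet> d = 0"
  shows "negligible {x. \<exists>s. x + s *\<^sub>R d \<in> F}"
proof (rule negligible_subset)
  show "negligible {x. n \<bullet> x = c}" using assms by (intro negligible_hyperplane) auto
  show "{x. \<exists>s. x + s *\<^sub>R d \<in> F} \<subseteq> {x. n \<bullet> x = c}" using assms by (auto simp: inner_add_right)
qed

section \<open>Facets, regular points and generic lines\<close>

text \<open>What the geometric part uses of a mesh: convex polytopes with nonempty interior that tile the closed
  unit cube. Periodicity is built in by looking at integer translates of the elements.\<close>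

locale unit_cube_mesh =
  fixes T :: "(real^3) set set"
  assumes finT: "finite T"
    and polyT: "K \<in> T \<Longrightarrow> polytope K"
    and intT: "K \<in> T \<Longrightarrow> interior K \<noteq> {}"
    and covT: "\<Union>T = cbox 0 1"
    and disT: "K \<in> T \<Longrightarrow> K' \<in> T \<Longrightarrow> K \<noteq> K' \<Longrightarrow> interior K \<inter> interior K' = {}"

lemma mesh_element_polytope:
  assumes "mesh_element kind K" shows "polytope K \<and> interior K \<noteq> {}"
proof (cases kind)
  case Triangular
  then have s: "3 simplex K" using assms by simp
  then have p: "polytope K" by (rule simplex_imp_polytope)
  have a: "aff_dim K = 3" using s by (rule aff_dim_simplex)
  have "rel_interior K = interior K"
    using a by (intro rel_interior_interior) (simp flip: aff_dim_eq_full)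
  moreover have "rel_interior K \<noteq> {}"
    using a polytope_imp_convex[OF p] by (subst rel_interior_eq_empty) auto
  ultimately show ?thesis using p by simp
next
  case Rectangular
  then obtain a b where "\<forall>i. a $ i < b $ i" "K = cbox a b" using assms by auto
  moreover from this have "box a b \<noteq> {}" by (simp add: interval_ne_empty_cart)
  ultimately show ?thesis by (simp add: interior_cbox polytope_interval)
qed

lemma torus_mesh_unit_cube_mesh:
  assumes "torus_mesh kind T" shows "unit_cube_mesh T"
  using assms mesh_element_polytope unfolding torus_mesh_def pairwise_def
  by unfold_locales auto

definition facet_offset :: "(real^3) set \<Rightarrow> (real^3) set \<Rightarrow> real" where
  "facet_offset K F = facet_normal K F \<bullet> (SOME x. x \<in> F)"

text \<open>A facet of a full-dimensional element spans its plane, so the normal is determined up to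
  sign, and the sign is fixed by an interior point.\<close>

lemma facet_normal_unique:
  fixes K :: "(real^3) set"
  assumes K: "convex K" "interior K \<noteq> {}" and F: "F facet_of K"
    and n: "norm n = 1" "\<forall>x\<in>F. \<forall>y\<in>K. n \<bullet> (y - x) \<le> 0"
    and m: "norm m = 1" "\<forall>x\<in>F. \<forall>y\<in>K. m \<bullet> (y - x) \<le> 0"
  shows "m = n"
proof -
  have FK: "F \<subseteq> K" "F \<noteq> {}" using F by (auto simp: facet_of_def face_of_imp_subset)
  obtain x where x: "x \<in> F" using FK by auto
  obtain z where z: "z \<in> interior K" using K by auto
  have nn: "n \<bullet> n = 1" "m \<bullet> m = 1" "n \<noteq> 0" "m \<noteq> 0" using n m by (auto simp: norm_eq_1)
  have strict: "a \<bullet> (z - x) < 0" if "a \<noteq> 0" "\<forall>y\<in>K. a \<bullet> (y - x) \<le> 0" for a :: "real^3"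
  proof -
    obtain e where e: "e > 0" "ball z e \<subseteq> K" using z mem_interior by blast
    define w where "w = z + (e / 2 / norm a) *\<^sub>R a"
    have "w \<in> K" using e that(1) by (intro subsetD[OF e(2)]) (simp add: w_def dist_norm)
    then have "a \<bullet> (w - x) \<le> 0" using that(2) by auto
    moreover have "a \<bullet> (w - x) = a \<bullet> (z - x) + e / 2 / norm a * (a \<bullet> a)"
      by (simp add: w_def inner_diff_right inner_add_right)
    moreover have "e / 2 / norm a * (a \<bullet> a) > 0" using that(1) e by simp
    ultimately show ?thesis by linarith
  qed
  have pl: "F \<subseteq> {w. a \<bullet> w = a \<bullet> x}" if "\<forall>x\<in>F. \<forall>y\<in>K. a \<bullet> (y - x) \<le> 0" for a
  proof
    fix w assume "w \<in> F"
    then have "a \<bullet> (w - x) \<le> 0" "a \<bullet> (x - w) \<le> 0" using that x FK by blast+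
    then show "w \<in> {w. a \<bullet> w = a \<bullet> x}" by (simp add: inner_diff_right)
  qed
  let ?S = "{w. n \<bullet> w = n \<bullet> x}"
  have "aff_dim K = 3"
    using aff_dim_nonempty_interior[OF K(2)] by simp
  then have aF: "aff_dim F = 2" using F by (simp add: facet_of_def)
  have aS: "aff_dim ?S = 2" using nn by simp
  have "affine ?S" by (rule affine_hyperplane)
  then have "?S \<subseteq> {w. m \<bullet> w = m \<bullet> x}"
    using aff_dim_subset[of F "?S \<inter> {w. m \<bullet> w = m \<bullet> x}"] pl[OF n(2)] pl[OF m(2)] aF aS x
    by (auto simp: aff_dim_affine_Int_hyperplane split: if_splits)
  moreover define v where "v = m - (m \<bullet> n) *\<^sub>R n"
  have "x + v \<in> ?S" by (simp add: v_def inner_add_right inner_diff_right nn inner_commute)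
  ultimately have "m \<bullet> (x + v) = m \<bullet> x" by blast
  then have "m \<bullet> v = 0" by (simp add: inner_add_right)
  moreover have "n \<bullet> v = 0" by (simp add: v_def inner_diff_right nn inner_commute)
  ultimately have "v \<bullet> v = 0" by (simp add: v_def inner_diff_left)
  then have mn: "m = (m \<bullet> n) *\<^sub>R n" by (simp add: v_def)
  then have "\<bar>m \<bullet> n\<bar> = 1" using n(1) m(1) by (metis mult.right_neutral norm_scaleR)
  moreover have "m \<bullet> n > 0"
  proof -
    have "m \<bullet> (z - x) < 0" "n \<bullet> (z - x) < 0" using strict n m nn x by auto
    moreover have "m \<bullet> (z - x) = (m \<bullet> n) * (n \<bullet> (z - x))" by (subst mn) simp
    ultimately show ?thesis by (metis mult_less_0_iff not_less_iff_gr_or_eq)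
  qed
  ultimately show ?thesis using mn by simp
qed

lemma interior_halfspace_strict:
  fixes n :: "real^3"
  assumes "K \<subseteq> {x. n \<bullet> x \<le> c}" "n \<noteq> 0" "x \<in> interior K"
  shows "n \<bullet> x < c"
  using interior_mono[OF assms(1)] assms by auto

context unit_cube_mesh
begin

lemma subset_cube: "K \<in> T \<Longrightarrow> K \<subseteq> cbox 0 1"
  using covT by auto

lemma convex_elt: "K \<in> T \<Longrightarrow> convex K" and compact_elt: "K \<in> T \<Longrightarrow> compact K" and closed_elt: "K \<in> T \<Longrightarrow> closed K"
  and finite_facets: "K \<in> T \<Longrightarrow> finite {F. F facet_of K}"
  using polyT by (auto simp: polytope_imp_convex polytope_imp_compact polytope_imp_closed
    intro!: finite_polyhedron_facets polytope_imp_polyhedron)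

lemma facet_props:
  assumes K: "K \<in> T" and F: "F facet_of K"
  defines "n \<equiv> facet_normal K F" and "c \<equiv> facet_offset K F"
  shows "norm n = 1" "F = K \<inter> {x. n \<bullet> x = c}" "K \<subseteq> {x. n \<bullet> x \<le> c}" "interior K \<subseteq> {x. n \<bullet> x < c}"
    "compact F" "convex F" "F \<noteq> {}" "F \<subseteq> cbox 0 1"
proof -
  have ff: "F face_of K" "F \<noteq> {}" using F by (auto simp: facet_of_def)
  have "F exposed_face_of K"
    using ff polyT[OF K] exposed_face_of_polyhedron polytope_imp_polyhedron by blast
  then obtain a b where ab: "K \<subseteq> {x. a \<bullet> x \<le> b}" "F = K \<inter> {x. a \<bullet> x = b}"
    by (auto simp: exposed_face_of_def)
  have "F \<noteq> K" using F by (auto simp: facet_of_def)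
  then have a0: "a \<noteq> 0" using ab ff(2) by auto
  let ?n = "a /\<^sub>R norm a"
  have ex: "norm ?n = 1 \<and> (\<forall>x\<in>F. \<forall>y\<in>K. ?n \<bullet> (y - x) \<le> 0)"
    using a0 ab by (auto simp: inner_diff_right field_simps)
  have nn: "n = ?n"
    unfolding n_def facet_normal_def
    using ex facet_normal_unique[OF convex_elt[OF K] intT[OF K] F] by (intro the_equality) blast+
  then show "norm n = 1" using ex by simp
  have "(SOME x. x \<in> F) \<in> F" using ff by (auto intro: someI_ex)
  then have c: "c = b / norm a" unfolding c_def facet_offset_def n_def[symmetric] nn using ab
    by (auto simp: divide_inverse)
  show "F = K \<inter> {x. n \<bullet> x = c}" using ab(2) a0 unfolding nn c by (auto simp: field_simps)
  show le: "K \<subseteq> {x. n \<bullet> x \<le> c}" using ab(1) a0 unfolding nn c by (auto simp: field_simps)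
  show "interior K \<subseteq> {x. n \<bullet> x < c}"
    using interior_halfspace_strict[OF le] \<open>norm n = 1\<close> by fastforce
  show "compact F" using compact_elt[OF K] unfolding ab(2) by (intro compact_Int_closed closed_hyperplane)
  show "convex F" using ff face_of_imp_convex by blast
  show "F \<noteq> {}" by fact
  show "F \<subseteq> cbox 0 1" using ab(2) subset_cube[OF K] by auto
qed

lemma frontier_facets:
  assumes "K \<in> T" "x \<in> K" "x \<notin> interior K" shows "\<exists>F. F facet_of K \<and> x \<in> F"
proof -
  have "rel_interior K = interior K"
    using intT[OF assms(1)] by (rule rel_interior_nonempty_interior)
  then show ?thesis
    using rel_boundary_of_polyhedron[OF polytope_imp_polyhedron[OF polyT[OF assms(1)]]] assms by auto
qed

text \<open>The translations that bring a neighbourhood of a point of the closed unit cube back into the cube.\<close>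

definition shifts :: "(real^3) set" where
  "shifts = {z. \<forall>j. z $ j \<in> {-1, 0, 1}}"

lemma finite_shifts: "finite shifts"
proof -
  have "z \<in> (\<lambda>(a, b, c). vector [a, b, c]) ` ({-1, 0, 1} \<times> {-1, 0, 1} \<times> {-1, 0, 1})" if "z \<in> shifts" for z
  proof (rule image_eqI[of _ _ "(z $ 1, z $ 2, z $ 3)"])
    show "(z $ 1, z $ 2, z $ 3) \<in> {-1, 0, 1} \<times> {-1, 0, 1} \<times> {-1, 0, 1}"
      using that by (intro SigmaI) (simp_all add: shifts_def)
  qed (simp add: vec_eq_iff forall_3)
  then have "shifts \<subseteq> (\<lambda>(a, b, c). vector [a, b, c]) ` ({-1, 0, 1} \<times> {-1, 0, 1} \<times> {-1, 0, 1})" by blast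
  then show ?thesis by (rule finite_subset) simp
qed

text \<open>At a regular point of a facet with normal \<open>n\<close> only facets in the same plane meet, also across the
  periodic boundary. Hanging nodes are harmless: the irregular points of a facet lie on edges.\<close>

definition regpt :: "real^3 \<Rightarrow> real^3 \<Rightarrow> bool" where
  "regpt n y \<longleftrightarrow> (\<forall>K\<in>T. \<forall>F. F facet_of K \<longrightarrow> (\<forall>z\<in>shifts. y - z \<in> F \<longrightarrow> (\<forall>w\<in>F. n \<bullet> w = n \<bullet> (y - z))))"

lemma regpt_minus: "regpt (- n) y \<longleftrightarrow> regpt n y"
  by (simp add: regpt_def)

text \<open>Only finitely many translated facets are not contained in the plane of \<open>F\<close>; each of them
  crosses \<open>F\<close> in a set over which the lines in direction \<open>d\<close> form a null set.\<close>

lemma negligible_irregular: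
  assumes K: "K \<in> T" "F facet_of K" and d: "facet_normal K F \<bullet> d \<noteq> 0"
  shows "negligible {x. \<exists>s. x + s *\<^sub>R d \<in> F \<and> \<not> regpt (facet_normal K F) (x + s *\<^sub>R d)}"
proof -
  let ?n = "facet_normal K F" and ?c = "facet_offset K F"
  note fp = facet_props[OF K]
  define I where "I = {(K', F', z). K' \<in> T \<and> F' facet_of K' \<and> z \<in> shifts \<and> \<not> (\<lambda>w. w + z) ` F' \<subseteq> {w. ?n \<bullet> w = ?c}}"
  have "finite I"
  proof (rule finite_subset)
    show "I \<subseteq> (SIGMA K':T. {F'. F' facet_of K'} \<times> shifts)" by (auto simp: I_def)
    show "finite (SIGMA K':T. {F'. F' facet_of K'} \<times> shifts)"
      using finT finite_facets finite_shifts by auto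
  qed
  moreover have "negligible {x. \<exists>s. x + s *\<^sub>R d \<in> F \<inter> (\<lambda>w. w + z) ` F'}" if "(K', F', z) \<in> I" for K' F' z
  proof -
    have K': "K' \<in> T" "F' facet_of K'" using that by (auto simp: I_def)
    note fp' = facet_props[OF K']
    show ?thesis
    proof (rule negligible_lines_crossing)
      show "F \<subseteq> {w. ?n \<bullet> w = ?c}" using fp by auto
      show "(\<lambda>w. w + z) ` F' \<subseteq> {w. facet_normal K' F' \<bullet> w = facet_offset K' F' + facet_normal K' F' \<bullet> z}"
        using fp'(2) by (auto simp: inner_add_right)
      show "facet_normal K' F' \<noteq> 0" using fp'(1) by auto
    qed (use d that in \<open>auto simp: I_def\<close>)
  qed
  ultimately have "negligible (\<Union>(K', F', z)\<in>I. {x. \<exists>s. x + s *\<^sub>R d \<in> F \<inter> (\<lambda>w. w + z) ` F'})"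
    by (intro negligible_Union) auto
  moreover have "{x. \<exists>s. x + s *\<^sub>R d \<in> F \<and> \<not> regpt ?n (x + s *\<^sub>R d)}
      \<subseteq> (\<Union>(K', F', z)\<in>I. {x. \<exists>s. x + s *\<^sub>R d \<in> F \<inter> (\<lambda>w. w + z) ` F'})"
  proof
    fix x assume "x \<in> {x. \<exists>s. x + s *\<^sub>R d \<in> F \<and> \<not> regpt ?n (x + s *\<^sub>R d)}"
    then obtain s K' F' z w where *: "x + s *\<^sub>R d \<in> F" "K' \<in> T" "F' facet_of K'" "z \<in> shifts"
      "x + s *\<^sub>R d - z \<in> F'" "w \<in> F'" "?n \<bullet> w \<noteq> ?n \<bullet> (x + s *\<^sub>R d - z)"
      by (auto simp: regpt_def)
    have "?n \<bullet> (x + s *\<^sub>R d) = ?c" using *(1) fp(2) by auto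
    then have "(K', F', z) \<in> I" using * by (force simp: I_def inner_add_right inner_diff_right)
    moreover have "x + s *\<^sub>R d \<in> (\<lambda>w. w + z) ` F'" using *(5) by (metis diff_add_cancel imageI)
    ultimately show "x \<in> (\<Union>(K', F', z)\<in>I. {x. \<exists>s. x + s *\<^sub>R d \<in> F \<inter> (\<lambda>w. w + z) ` F'})"
      using *(1) by blast
  qed
  ultimately show ?thesis by (rule negligible_subset)
qed

text \<open>Close to \<open>y\<close> there are only the facets through \<open>y\<close>, and these lie in the plane that bounds the half
  ball. The half ball is connected and meets no facet, so it lies in one translated open element.\<close>

lemma half_ball:
  assumes y: "y \<in> cbox 0 1" and n: "n \<noteq> 0" and reg: "regpt n y"
  shows "\<exists>r>0. \<exists>K\<in>T. \<exists>z\<in>shifts. \<forall>w. dist y w < r \<and> n \<bullet> (w - y) > 0 \<longrightarrow> w - z \<in> interior K"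
proof -
  define I where "I = {(K, F, z). K \<in> T \<and> F facet_of K \<and> z \<in> shifts \<and> y - z \<notin> F}"
  have finI: "finite I"
  proof (rule finite_subset)
    show "I \<subseteq> (SIGMA K':T. {F'. F' facet_of K'} \<times> shifts)" by (auto simp: I_def)
    show "finite (SIGMA K':T. {F'. F' facet_of K'} \<times> shifts)"
      using finT finite_facets finite_shifts by auto
  qed
  have "closed ((\<lambda>w. w + z) ` F)" if "(K, F, z) \<in> I" for K F z
    using that facet_props(5)[of K F] closed_translation[of F z] by (simp add: I_def add.commute[of _ z] compact_imp_closed)
  then have "closed (\<Union>(K, F, z)\<in>I. (\<lambda>w. w + z) ` F)"
    using finI by (intro closed_UN) auto
  moreover have "y \<notin> (\<Union>(K, F, z)\<in>I. (\<lambda>w. w + z) ` F)" by (auto simp: I_def)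
  ultimately obtain r1 where r1: "r1 > 0" "ball y r1 \<inter> (\<Union>(K, F, z)\<in>I. (\<lambda>w. w + z) ` F) = {}"
    by (metis (no_types, lifting) Compl_iff disjoint_eq_subset_Compl open_Compl open_contains_ball)
  define r where "r = min r1 1"
  have r: "r > 0" "r \<le> 1" "r \<le> r1" using r1 by (auto simp: r_def)
  define H where "H = ball y r \<inter> {w. n \<bullet> w > n \<bullet> y}"
  have cH: "connected H"
    unfolding H_def by (intro convex_connected convex_Int convex_ball convex_halfspace_gt)
  define w0 where "w0 = y + (r / 2 / norm n) *\<^sub>R n"
  have w0: "w0 \<in> H" using r n by (simp add: H_def w0_def dist_norm inner_add_right)
  have wd: "\<bar>w0 $ j - y $ j\<bar> < 1" for j
  proof -
    have "\<bar>(y - w0) $ j\<bar> \<le> norm (y - w0)" by (rule component_le_norm_cart)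
    then show ?thesis using w0 r by (auto simp: H_def dist_norm abs_minus_commute)
  qed
  define z :: "real^3" where "z = (\<chi> j. if w0 $ j < 0 then -1 else if w0 $ j > 1 then 1 else 0)"
  have z: "z \<in> shifts" by (auto simp: shifts_def z_def)
  have "w0 - z \<in> cbox 0 1"
    unfolding mem_box_cart
  proof
    fix j
    show "0 $ j \<le> (w0 - z) $ j \<and> (w0 - z) $ j \<le> 1 $ j"
      using y[unfolded mem_box_cart, rule_format, of j] wd[of j] by (auto simp: z_def)
  qed
  then obtain K where K: "K \<in> T" "w0 - z \<in> K" using covT by blast
  have cH': "connected ((\<lambda>w. w - z) ` H)"
    using cH by (intro connected_continuous_image continuous_intros)
  have nof: "w - z \<notin> frontier K" if w: "w \<in> H" for w
  proof
    assume "w - z \<in> frontier K"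
    then have "w - z \<in> K" "w - z \<notin> interior K"
      using closed_elt[OF K(1)] by (auto simp: frontier_def)
    from frontier_facets[OF K(1) this] obtain F where F: "F facet_of K" "w - z \<in> F" by auto
    show False
    proof (cases "y - z \<in> F")
      case True
      then have "n \<bullet> (w - z) = n \<bullet> (y - z)" using reg K(1) F z unfolding regpt_def by blast
      then show False using w by (simp add: H_def inner_diff_right)
    next
      case False
      then have "(K, F, z) \<in> I" using K F z by (simp add: I_def)
      moreover have "w \<in> (\<lambda>w. w + z) ` F" using F(2) by (metis diff_add_cancel imageI)
      moreover have "w \<in> ball y r1" using w r by (auto simp: H_def)
      ultimately show False using r1(2) by blast
    qed
  qed
  have "(\<lambda>w. w - z) ` H \<subseteq> K"
    using connected_Int_frontier[OF cH', of K] nof w0 K(2) by blast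
  then have "w - z \<in> interior K" if "w \<in> H" for w
    using nof[OF that] that closed_elt[OF K(1)] by (auto simp: frontier_def)
  then show ?thesis
    using r(1) K(1) z by (intro exI[of _ r] conjI bexI[of _ K] bexI[of _ z] allI impI) (auto simp: H_def inner_diff_right)
qed

lemma interior_shift_eq:
  assumes "K \<in> T" "K' \<in> T" "z \<in> shifts" "w \<in> interior K" "w - z \<in> interior K'"
  shows "z = 0 \<and> K' = K"
proof -
  have "interior K \<subseteq> box 0 1" if "K \<in> T" for K
    using interior_mono[OF subset_cube[OF that]] by (simp add: interior_cbox)
  then have "w \<in> box 0 1" "w - z \<in> box 0 1" using assms by blast+
  then have "\<bar>z $ j\<bar> < 1" for j by (auto simp: mem_box_cart abs_less_iff dest!: spec[of _ j])
  moreover have "z $ j \<in> {-1, 0, 1}" for j using assms(3) by (auto simp: shifts_def)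
  ultimately have "z $ j = 0" for j by (metis abs_1 abs_minus_cancel empty_iff insert_iff order_less_irrefl)
  then have "z = 0" by (simp add: vec_eq_iff)
  then show ?thesis using assms disT[of K K'] by auto
qed

text \<open>On the inner side the element of \<open>half_ball\<close> can only be \<open>K\<close> itself, since \<open>y\<close> is a limit of
  interior points of \<open>K\<close> and different interiors are disjoint.\<close>

lemma half_ball_inside:
  assumes K: "K \<in> T" "F facet_of K" and y: "y \<in> F" and reg: "regpt (facet_normal K F) y"
  shows "\<exists>r>0. \<forall>w. dist y w < r \<and> facet_normal K F \<bullet> (w - y) < 0 \<longrightarrow> w \<in> interior K"
proof -
  let ?n = "facet_normal K F"
  note fp = facet_props[OF K]
  have "- ?n \<noteq> 0" using fp(1) by auto
  moreover have "y \<in> cbox 0 1" using y fp(8) by blast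
  ultimately obtain r K' z where r: "r > 0" "K' \<in> T" "z \<in> shifts"
    "\<And>w. dist y w < r \<Longrightarrow> ?n \<bullet> (w - y) < 0 \<Longrightarrow> w - z \<in> interior K'"
    using half_ball[of y "- ?n"] reg by (auto simp: regpt_minus)
  have "y \<in> closure (interior K)"
    using convex_closure_interior[OF convex_elt intT] K y fp(2) closure_subset by blast
  then obtain w where w: "w \<in> interior K" "dist y w < r"
    using r(1) closure_approachable by (metis dist_commute)
  have "?n \<bullet> y = facet_offset K F" using y fp(2) by auto
  then have "?n \<bullet> (w - y) < 0" using w(1) fp(4) by (auto simp: inner_diff_right)
  then have "z = 0 \<and> K' = K" using interior_shift_eq[OF K(1) r(2,3) w(1)] r(4) w(2) by blast
  then show ?thesis using r by auto
qed

text \<open>This rules out lines that lie in the plane of a facet or pass through an edge of an element; they form a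
  null set.\<close>

definition goodline :: "3 \<Rightarrow> real^3 \<Rightarrow> bool" where
  "goodline i x \<longleftrightarrow> (\<forall>K\<in>T. \<forall>F s. F facet_of K \<longrightarrow> x + s *\<^sub>R axis i 1 \<in> F \<longrightarrow>
      facet_normal K F $ i \<noteq> 0 \<and> regpt (facet_normal K F) (x + s *\<^sub>R axis i 1))"

lemma negligible_badline: "negligible {x. \<not> goodline i x}"
proof -
  let ?B = "\<lambda>K F. {x. \<exists>s. x + s *\<^sub>R axis i 1 \<in> F \<and> \<not> (facet_normal K F $ i \<noteq> 0 \<and> regpt (facet_normal K F) (x + s *\<^sub>R axis i 1))}"
  have B: "negligible (?B K F)" if K: "K \<in> T" "F facet_of K" for K F
  proof (cases "facet_normal K F $ i = 0")
    case True
    have "negligible {x. \<exists>s. x + s *\<^sub>R axis i 1 \<in> F}"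
      using facet_props(1,2)[OF K] True
      by (intro negligible_lines_in_plane[of F "facet_normal K F" "facet_offset K F"]) (auto simp: inner_axis)
    then show ?thesis by (rule negligible_subset) auto
  next
    case False
    then show ?thesis
      using negligible_irregular[OF K, of "axis i 1"] by (simp add: inner_axis)
  qed
  have "{x. \<not> goodline i x} = (\<Union>(K, F)\<in>(SIGMA K:T. {F. F facet_of K}). ?B K F)"
    by (auto simp: goodline_def)
  moreover have "negligible (\<Union>(K, F)\<in>(SIGMA K:T. {F. F facet_of K}). ?B K F)"
    using finT finite_facets B by (intro negligible_Union) auto
  ultimately show ?thesis by simp
qed

definition facet_hit :: "3 \<Rightarrow> (real^3) set \<Rightarrow> (real^3) set \<Rightarrow> real^3 \<Rightarrow> real^3" where
  "facet_hit i K F = line_proj (axis i 1) (facet_normal K F) (facet_offset K F)"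

lemma facet_hit_line:
  assumes K: "K \<in> T" "F facet_of K" and n: "facet_normal K F $ i \<noteq> 0" and "x + s *\<^sub>R axis i 1 \<in> F"
  shows "facet_hit i K F x = x + s *\<^sub>R axis i 1"
proof -
  have "facet_hit i K F x = facet_hit i K F (x + s *\<^sub>R axis i 1)"
    unfolding facet_hit_def using n by (subst line_proj_line) (auto simp: inner_axis)
  also have "\<dots> = x + s *\<^sub>R axis i 1"
    unfolding facet_hit_def using facet_props(2)[OF K] assms(4) by (intro line_proj_fix) auto
  finally show ?thesis .
qed

lemma facet_hit_on_line: "\<exists>s. facet_hit i K F x = x + s *\<^sub>R axis i 1"
  by (auto simp: facet_hit_def line_proj_def)

text \<open>The element lies on the inner side of the plane of the facet, which the line crosses only once, and
  by \<open>half_ball_inside\<close> the line is in the open element just before.\<close>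

lemma line_boundary_point:
  assumes good: "goodline i x" and K: "K \<in> T" "F facet_of K" and t: "x + t *\<^sub>R axis i 1 \<in> F"
  defines "\<sigma> \<equiv> sgn (facet_normal K F $ i)"
  shows "\<sigma> = 1 \<or> \<sigma> = -1"
    "\<And>s. s > 0 \<Longrightarrow> x + (t + \<sigma> * s) *\<^sub>R axis i 1 \<notin> K"
    "\<exists>r>0. \<forall>s. 0 < s \<and> s < r \<longrightarrow> x + (t - \<sigma> * s) *\<^sub>R axis i 1 \<in> interior K"
proof -
  let ?n = "facet_normal K F" and ?y = "x + t *\<^sub>R axis i 1"
  note fp = facet_props[OF K]
  have n0: "?n $ i \<noteq> 0" and reg: "regpt ?n ?y" using good K t unfolding goodline_def by blast+
  show s1: "\<sigma> = 1 \<or> \<sigma> = -1" using n0 by (auto simp: \<sigma>_def sgn_if)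
  have nt: "?n \<bullet> (x + (t + u) *\<^sub>R axis i 1 - ?y) = u * ?n $ i" for u
    by (simp add: inner_axis inner_diff_right inner_add_right algebra_simps)
  have c: "?n \<bullet> ?y = facet_offset K F" using t fp(2) by auto
  show "x + (t + \<sigma> * s) *\<^sub>R axis i 1 \<notin> K" if "s > 0" for s
  proof
    assume "x + (t + \<sigma> * s) *\<^sub>R axis i 1 \<in> K"
    then have "?n \<bullet> (x + (t + \<sigma> * s) *\<^sub>R axis i 1) \<le> ?n \<bullet> ?y" using c fp(3) by auto
    then have "\<sigma> * s * ?n $ i \<le> 0" unfolding nt[symmetric] by (simp only: inner_diff_right)
    moreover have "\<sigma> * s * ?n $ i > 0" using that n0 by (auto simp: \<sigma>_def sgn_if zero_less_mult_iff mult_less_0_iff)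
    ultimately show False by linarith
  qed
  obtain r where r: "r > 0" "\<And>w. dist ?y w < r \<Longrightarrow> ?n \<bullet> (w - ?y) < 0 \<Longrightarrow> w \<in> interior K"
    using half_ball_inside[OF K t reg] by auto
  show "\<exists>r>0. \<forall>s. 0 < s \<and> s < r \<longrightarrow> x + (t - \<sigma> * s) *\<^sub>R axis i 1 \<in> interior K"
  proof (intro exI[of _ r] conjI allI impI r(1) r(2))
    fix s assume s: "0 < s \<and> s < r"
    have "?y - (x + (t - \<sigma> * s) *\<^sub>R axis i 1) = (\<sigma> * s) *\<^sub>R axis i 1" by (simp add: algebra_simps)
    then show "dist ?y (x + (t - \<sigma> * s) *\<^sub>R axis i 1) < r"
      unfolding dist_norm using s s1 by auto
    show "?n \<bullet> (x + (t - \<sigma> * s) *\<^sub>R axis i 1 - ?y) < 0"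
      using nt[of "- (\<sigma> * s)"] s n0 by (auto simp: \<sigma>_def sgn_if zero_less_mult_iff mult_less_0_iff)
  qed
qed

text \<open>A convex compact set meets a line in a segment. For a generic line its endpoints are regular
  points, each on exactly one facet, and the sign of the normal tells the exit from the entry.\<close>

lemma line_segment:
  assumes good: "goodline i x" and K: "K \<in> T" and hit: "\<exists>t. x + t *\<^sub>R axis i 1 \<in> K"
  obtains lo hi Fh Fl where "lo < hi" "\<And>t. x + t *\<^sub>R axis i 1 \<in> K \<longleftrightarrow> lo \<le> t \<and> t \<le> hi"
    "\<And>t. x + t *\<^sub>R axis i 1 \<in> interior K \<longleftrightarrow> lo < t \<and> t < hi"
    "{F. F facet_of K \<and> facet_normal K F $ i > 0 \<and> facet_hit i K F x \<in> F} = {Fh}"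
    "facet_hit i K Fh x = x + hi *\<^sub>R axis i 1"
    "{F. F facet_of K \<and> facet_normal K F $ i < 0 \<and> facet_hit i K F x \<in> F} = {Fl}"
    "facet_hit i K Fl x = x + lo *\<^sub>R axis i 1"
proof -
  define L where "L t = x + t *\<^sub>R axis i (1::real)" for t
  define I where "I = {t. L t \<in> K}"
  have I0: "I \<noteq> {}" using hit by (auto simp: I_def L_def)
  have cL: "continuous_on UNIV L" unfolding L_def by (intro continuous_intros)
  have clI: "closed I"
    unfolding I_def using continuous_closed_vimage[OF closed_elt[OF K], of L] cL
    by (simp add: vimage_def continuous_on_eq_continuous_at)
  have Li: "L t $ i = x $ i + t" for t by (simp add: L_def)
  have "I \<subseteq> {- x $ i..1 - x $ i}"
  proof
    fix t assume "t \<in> I"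
    then have "0 \<le> L t $ i \<and> L t $ i \<le> 1" using subset_cube[OF K] by (auto simp: I_def mem_box_cart)
    then show "t \<in> {- x $ i..1 - x $ i}" unfolding Li by auto
  qed
  then have "{- x $ i..1 - x $ i} \<inter> I = I" by blast
  then have "compact I" using compact_Int_closed[OF compact_Icc[of "- x $ i" "1 - x $ i"] clI] by simp
  moreover have "convex I"
  proof (rule convexI)
    fix a b u v :: real assume *: "a \<in> I" "b \<in> I" "0 \<le> u" "0 \<le> v" "u + v = 1"
    have "L (u *\<^sub>R a + v *\<^sub>R b) = u *\<^sub>R L a + v *\<^sub>R L b"
      using *(5) unfolding L_def by (simp add: algebra_simps flip: scaleR_add_left)
    then show "u *\<^sub>R a + v *\<^sub>R b \<in> I" using * convexD[OF convex_elt[OF K]] by (simp add: I_def)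
  qed
  ultimately have "connected I \<and> compact I" using convex_connected by blast
  then obtain lo hi where "I = {lo..hi}" unfolding connected_compact_interval_1 box_real by blast
  moreover have "L t \<in> K \<longleftrightarrow> t \<in> I" for t by (simp add: I_def)
  ultimately have I: "L t \<in> K \<longleftrightarrow> lo \<le> t \<and> t \<le> hi" for t by simp
  obtain t0 where "L t0 \<in> K" using hit unfolding L_def by blast
  then have lohi: "lo \<le> hi" using I by force
  have up: "t = hi \<and> lo < hi" if F: "F facet_of K" "facet_normal K F $ i > 0" "L t \<in> F" for F t
  proof -
    note b = line_boundary_point[OF good K F(1) F(3)[unfolded L_def]]
    have s: "sgn (facet_normal K F $ i) = 1" using F by simp
    have "L t \<in> K" using F facet_props(2)[OF K F(1)] by auto
    then have t: "lo \<le> t" "t \<le> hi" using I by auto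
    have "\<not> t < hi" using b(2)[of "hi - t"] I[of hi] lohi s by (auto simp: L_def)
    moreover obtain r where r: "r > 0" "\<And>u. 0 < u \<Longrightarrow> u < r \<Longrightarrow> L (t - u) \<in> interior K"
      using b(3) s by (auto simp: L_def)
    have "L (t - r/2) \<in> K" using r interior_subset by fastforce
    then have "lo < t" using I[of "t - r/2"] r(1) by simp
    ultimately show ?thesis using t by auto
  qed
  have down: "t = lo \<and> lo < hi" if F: "F facet_of K" "facet_normal K F $ i < 0" "L t \<in> F" for F t
  proof -
    note b = line_boundary_point[OF good K F(1) F(3)[unfolded L_def]]
    have s: "sgn (facet_normal K F $ i) = -1" using F by simp
    have "L t \<in> K" using F facet_props(2)[OF K F(1)] by auto
    then have t: "lo \<le> t" "t \<le> hi" using I by auto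
    have "\<not> lo < t" using b(2)[of "t - lo"] I[of lo] lohi s by (auto simp: L_def)
    moreover obtain r where r: "r > 0" "\<And>u. 0 < u \<Longrightarrow> u < r \<Longrightarrow> L (t + u) \<in> interior K"
      using b(3) s by (auto simp: L_def)
    have "L (t + r/2) \<in> K" using r interior_subset by fastforce
    then have "t < hi" using I[of "t + r/2"] r(1) by simp
    ultimately show ?thesis using t by auto
  qed
  have bd: "(\<exists>F. F facet_of K \<and> facet_normal K F $ i > 0 \<and> L t \<in> F) \<or> (\<exists>F. F facet_of K \<and> facet_normal K F $ i < 0 \<and> L t \<in> F)"
    if t: "L t \<in> K" "L t \<notin> interior K" for t
  proof -
    obtain F where F: "F facet_of K" "L t \<in> F" using frontier_facets[OF K t] by auto
    then have "facet_normal K F $ i \<noteq> 0" using good K unfolding goodline_def L_def by blast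
    then show ?thesis using F by (meson linorder_neqE_linordered_idom)
  qed
  have nint: "L t \<notin> interior K" if "t = lo \<or> t = hi" for t
  proof
    assume "L t \<in> interior K"
    then have "t \<in> interior {t. L t \<in> K}"
      using cL open_vimage[OF open_interior[of K], of L] interior_subset[of K]
      by (intro interiorI[of "L -` interior K"]) (auto simp: continuous_on_eq_continuous_at)
    moreover have "{t. L t \<in> K} = {lo..hi}" by (simp only: set_eq_iff mem_Collect_eq I atLeastAtMost_iff) simp
    ultimately have "t \<in> {lo<..<hi}" by simp
    then show False using that by auto
  qed
  have hiK: "L hi \<in> K" "L lo \<in> K" by (simp_all only: I lohi order_refl)
  have "lo < hi" using bd[OF hiK(1) nint] up down by blast
  obtain Fh where Fh: "Fh facet_of K" "facet_normal K Fh $ i > 0" "L hi \<in> Fh"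
    using bd[OF hiK(1) nint] down \<open>lo < hi\<close> by force
  obtain Fl where Fl: "Fl facet_of K" "facet_normal K Fl $ i < 0" "L lo \<in> Fl"
    using bd[OF hiK(2) nint] up \<open>lo < hi\<close> by force
  have hitt: "facet_hit i K F x = L t" if "F facet_of K" "facet_normal K F $ i \<noteq> 0" "L t \<in> F" for F t
    using facet_hit_line[OF K that(1,2)] that(3) by (simp add: L_def)
  have z0: "0 \<in> shifts" by (simp add: shifts_def)
  have sub: "F \<subseteq> F'" if F: "F facet_of K" "F' facet_of K" "L t \<in> F" "L t \<in> F'" for F F' t
  proof -
    have "regpt (facet_normal K F') (L t)" using good K F unfolding goodline_def L_def by blast
    then have "\<forall>w\<in>F. facet_normal K F' \<bullet> w = facet_normal K F' \<bullet> L t"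
      unfolding regpt_def using K F(1,3) z0 by (metis diff_zero)
    moreover have "facet_normal K F' \<bullet> L t = facet_offset K F'" "F \<subseteq> K"
      using facet_props(2)[OF K F(1)] facet_props(2)[OF K F(2)] F(4) by blast+
    ultimately show ?thesis by (subst facet_props(2)[OF K F(2)]) auto
  qed
  have hitL: "\<exists>t. facet_hit i K F x = L t" for F using facet_hit_on_line unfolding L_def by blast
  show thesis
  proof (rule that[of lo hi Fh Fl])
    show "lo < hi" by fact
    show "x + t *\<^sub>R axis i 1 \<in> K \<longleftrightarrow> lo \<le> t \<and> t \<le> hi" for t by (rule I[unfolded L_def])
    show "x + t *\<^sub>R axis i 1 \<in> interior K \<longleftrightarrow> lo < t \<and> t < hi" for t
    proof
      assume *: "x + t *\<^sub>R axis i 1 \<in> interior K"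
      then have "L t \<in> K" using interior_subset by (auto simp: L_def)
      then have "lo \<le> t" "t \<le> hi" using I[of t] by blast+
      moreover have "t \<noteq> lo" "t \<noteq> hi" using nint[of t] * unfolding L_def by blast+
      ultimately show "lo < t \<and> t < hi" by simp
    next
      assume *: "lo < t \<and> t < hi"
      then have tK: "L t \<in> K" using I[of t] by simp
      show "x + t *\<^sub>R axis i 1 \<in> interior K"
      proof (rule ccontr)
        assume "\<not> ?thesis"
        then have "L t \<notin> interior K" by (simp add: L_def)
        from bd[OF tK this] show False using up[of _ t] down[of _ t] * by blast
      qed
    qed
    show "facet_hit i K Fh x = x + hi *\<^sub>R axis i 1" using hitt[OF Fh(1) _ Fh(3)] Fh(2) by (simp add: L_def)
    show "facet_hit i K Fl x = x + lo *\<^sub>R axis i 1" using hitt[OF Fl(1) _ Fl(3)] Fl(2) by (simp add: L_def)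
    show "{F. F facet_of K \<and> facet_normal K F $ i > 0 \<and> facet_hit i K F x \<in> F} = {Fh}"
    proof (intro set_eqI iffI)
      fix F assume F: "F \<in> {F. F facet_of K \<and> facet_normal K F $ i > 0 \<and> facet_hit i K F x \<in> F}"
      then obtain t where "facet_hit i K F x = L t" using hitL by blast
      then have "L hi \<in> F" using up[of F t] F by auto
      then show "F \<in> {Fh}" using sub[of F Fh hi] sub[of Fh F hi] F Fh by auto
    qed (use Fh hitt[OF Fh(1) _ Fh(3)] in auto)
    show "{F. F facet_of K \<and> facet_normal K F $ i < 0 \<and> facet_hit i K F x \<in> F} = {Fl}"
    proof (intro set_eqI iffI)
      fix F assume F: "F \<in> {F. F facet_of K \<and> facet_normal K F $ i < 0 \<and> facet_hit i K F x \<in> F}"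
      then obtain t where "facet_hit i K F x = L t" using hitL by blast
      then have "L lo \<in> F" using down[of F t] F by auto
      then show "F \<in> {Fl}" using sub[of F Fl lo] sub[of Fl F lo] F Fl by auto
    qed (use Fl hitt[OF Fl(1) _ Fl(3)] in auto)
  qed
qed

end

section \<open>Piecewise polynomials on the torus and their traces\<close>

lemma torus_periodic_integer:
  assumes g: "torus_periodic g" and z: "\<forall>j. z $ j \<in> \<int>"
  shows "g (x + z) = g x"
proof -
  have up: "g (x + of_nat k *\<^sub>R axis i 1) = g x" for x i k
  proof (induction k)
    case (Suc k)
    have "g (x + of_nat (Suc k) *\<^sub>R axis i 1) = g ((x + of_nat k *\<^sub>R axis i 1) + axis i 1)"
      by (simp add: algebra_simps)
    also have "\<dots> = g (x + of_nat k *\<^sub>R axis i 1)" using g by (simp only: torus_periodic_def)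
    finally show ?case using Suc by simp
  qed simp
  have int: "g (x + of_int k *\<^sub>R axis i 1) = g x" for x i k
  proof (cases "k \<ge> 0")
    case True
    then show ?thesis using up[of x "nat k" i] by simp
  next
    case False
    then show ?thesis using up[of "x + of_int k *\<^sub>R axis i 1" "nat (- k)" i] by (simp add: algebra_simps)
  qed
  have "\<forall>j. \<exists>k. z $ j = of_int k" using z by (auto elim!: Ints_cases)
  then obtain k where k: "\<And>j. z $ j = of_int (k j)" by metis
  have "g (x + (\<Sum>i\<in>S. of_int (k i) *\<^sub>R axis i 1)) = g x" if "finite S" for S
    using that
  proof (induction S)
    case (insert i S)
    have "x + (\<Sum>i\<in>insert i S. of_int (k i) *\<^sub>R axis i 1) = (x + (\<Sum>i\<in>S. of_int (k i) *\<^sub>R axis i 1)) + of_int (k i) *\<^sub>R axis i 1"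
      using insert by (simp add: add_ac)
    then show ?case using insert int[of "x + (\<Sum>i\<in>S. of_int (k i) *\<^sub>R axis i 1)"] by (simp only:)
  qed simp
  moreover have "z = (\<Sum>i\<in>UNIV. of_int (k i) *\<^sub>R axis i 1)"
    by (simp add: vec_eq_iff k axis_def if_distrib cong: if_cong)
  ultimately show ?thesis by simp
qed

definition frac3 :: "real^3 \<Rightarrow> real^3" where
  "frac3 x = (\<chi> j. frac (x $ j))"

lemma frac3_periodic: "torus_periodic g \<Longrightarrow> g (frac3 x) = g x"
  using torus_periodic_integer[of g "x - frac3 x" "frac3 x"] by (simp add: frac3_def frac_def)

lemma frac3_shift: "frac3 (x + axis i 1) = frac3 x"
  by (simp add: vec_eq_iff frac3_def axis_def frac_1_eq)

lemma frac3_eqI: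
  assumes "\<forall>j. z $ j \<in> \<int>" "w - z \<in> box 0 (1::real^3)" shows "frac3 w = w - z"
proof -
  have "frac (w $ j) = w $ j - z $ j" for j
    using assms by (subst frac_unique_iff) (auto simp: mem_box_cart less_imp_le)
  then show ?thesis by (simp add: vec_eq_iff frac3_def)
qed

lemma measurable_frac3 [measurable]: "frac3 \<in> borel_measurable borel"
proof -
  have "(\<lambda>x. frac3 x \<bullet> b) \<in> borel_measurable borel" if b: "b \<in> Basis" for b :: "real^3"
  proof -
    obtain j where "b = axis j 1" using b by (auto simp: Basis_vec_def)
    then have "(\<lambda>x. frac3 x \<bullet> b) = (\<lambda>x. x $ j - of_int \<lfloor>x $ j\<rfloor>)" by (auto simp: frac3_def inner_axis frac_def)
    then show ?thesis by simp
  qed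
  then show ?thesis by (subst borel_measurable_euclidean_space) auto
qed

lemma real_polynomial_function_continuous: "real_polynomial_function p \<Longrightarrow> continuous_on A p"
  by (simp add: continuous_on_polymonial_function real_polynomial_function_eq)

text \<open>Induction over the construction of polynomials; the derivative is kept
  as a polynomial so that it can be differentiated and integrated further.\<close>

lemma real_polynomial_function_partial_derivative:
  fixes p :: "real^3 \<Rightarrow> real"
  assumes "real_polynomial_function p"
  shows "\<exists>q. real_polynomial_function q \<and> (\<forall>x. ((\<lambda>t. p (x + t *\<^sub>R axis i 1)) has_real_derivative q x) (at 0))"
  using assms
proof induction
  case (linear f)
  then interpret bounded_linear f .
  have "(\<lambda>t. f (x + t *\<^sub>R axis i 1)) = (\<lambda>t. f x + t * f (axis i 1))" for x by (simp add: add scaleR)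
  then show ?case
    by (intro exI[of _ "\<lambda>_. f (axis i 1)"] conjI allI) (auto intro!: real_polynomial_function.intros(2) derivative_eq_intros)
next
  case (const c)
  then show ?case by (intro exI[of _ "\<lambda>_. 0"]) (auto intro!: real_polynomial_function.intros(2))
next
  case (add f g)
  then obtain f' g' where *: "real_polynomial_function f'" "real_polynomial_function g'"
    "\<And>x. ((\<lambda>t. f (x + t *\<^sub>R axis i 1)) has_real_derivative f' x) (at 0)"
    "\<And>x. ((\<lambda>t. g (x + t *\<^sub>R axis i 1)) has_real_derivative g' x) (at 0)" by blast
  then show ?case
    by (intro exI[of _ "\<lambda>x. f' x + g' x"]) (auto intro!: real_polynomial_function.intros(3) DERIV_add)
next
  case (mult f g)
  then obtain f' g' where *: "real_polynomial_function f'" "real_polynomial_function g'"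
    "\<And>x. ((\<lambda>t. f (x + t *\<^sub>R axis i 1)) has_real_derivative f' x) (at 0)"
    "\<And>x. ((\<lambda>t. g (x + t *\<^sub>R axis i 1)) has_real_derivative g' x) (at 0)" by blast
  show ?case
  proof (intro exI[of _ "\<lambda>x. f' x * g x + g' x * f x"] conjI allI)
    show "real_polynomial_function (\<lambda>x. f' x * g x + g' x * f x)"
      using * mult by (intro real_polynomial_function.intros(3) real_polynomial_function.intros(4))
    show "((\<lambda>t. f (x + t *\<^sub>R axis i 1) * g (x + t *\<^sub>R axis i 1)) has_real_derivative f' x * g x + g' x * f x) (at 0)" for x
      using DERIV_mult[OF *(3)[of x] *(4)[of x]] by simp
  qed
qed



lemma partial_deriv_polynomial:
  assumes "real_polynomial_function p"
  shows "real_polynomial_function (partial_deriv i p)"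
    and "((\<lambda>t. p (x + t *\<^sub>R axis i 1)) has_real_derivative partial_deriv i p (x + s *\<^sub>R axis i 1)) (at s)"
proof -
  obtain q where q: "real_polynomial_function q"
    "\<And>x. ((\<lambda>t. p (x + t *\<^sub>R axis i 1)) has_real_derivative q x) (at 0)"
    using real_polynomial_function_partial_derivative[OF assms, of i] by blast
  then have "partial_deriv i p = q" by (auto simp: partial_deriv_def fun_eq_iff DERIV_imp_deriv)
  then show "real_polynomial_function (partial_deriv i p)" using q by simp
  have "((\<lambda>t. p (x + s *\<^sub>R axis i 1 + t *\<^sub>R axis i 1)) has_real_derivative partial_deriv i p (x + s *\<^sub>R axis i 1)) (at 0)"
    using q(2) \<open>partial_deriv i p = q\<close> by blast
  then show "((\<lambda>t. p (x + t *\<^sub>R axis i 1)) has_real_derivative partial_deriv i p (x + s *\<^sub>R axis i 1)) (at s)"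
    using DERIV_shift[of "\<lambda>t. p (x + t *\<^sub>R axis i 1)" "partial_deriv i p (x + s *\<^sub>R axis i 1)" 0 s]
    by (simp add: algebra_simps)
qed

text \<open>The derivative is a two-sided limit at an interior point, so it only sees values nearby.\<close>

lemma partial_deriv_local:
  assumes "open U" "x \<in> U" "\<And>y. y \<in> U \<Longrightarrow> v y = p y"
  shows "partial_deriv i v x = partial_deriv i p x"
proof -
  have "isCont (\<lambda>t. x + t *\<^sub>R axis i (1::real)) 0" by (intro continuous_intros)
  then have "((\<lambda>t. x + t *\<^sub>R axis i (1::real)) \<longlongrightarrow> x) (nhds 0)"
    using tendsto_at_iff_tendsto_nhds[of "\<lambda>t. x + t *\<^sub>R axis i (1::real)" 0] by (simp add: isCont_def)
  then have "\<forall>\<^sub>F t in nhds 0. x + t *\<^sub>R axis i (1::real) \<in> U"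
    using assms by (intro topological_tendstoD)
  then have "\<forall>\<^sub>F t in nhds 0. v (x + t *\<^sub>R axis i 1) = p (x + t *\<^sub>R axis i 1)"
    by (rule eventually_mono) (rule assms(3))
  then show ?thesis unfolding partial_deriv_def by (rule deriv_cong_ev) simp
qed

context unit_cube_mesh
begin

text \<open>All discrete spaces, for both kinds of meshes and all degrees, are contained in this one space, which
  moreover is closed under products. Values on element boundaries are arbitrary, and need not even be
  measurable.\<close>

definition PW :: "(real^3 \<Rightarrow> real) set" where
  "PW = {v. torus_periodic v \<and> (\<forall>K\<in>T. \<exists>p. real_polynomial_function p \<and> (\<forall>x\<in>interior K. v x = p x))}"

definition pol :: "(real^3 \<Rightarrow> real) \<Rightarrow> (real^3) set \<Rightarrow> real^3 \<Rightarrow> real" where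
  "pol v K = (SOME p. real_polynomial_function p \<and> (\<forall>x\<in>interior K. v x = p x))"

lemma pol_props:
  assumes "v \<in> PW" "K \<in> T"
  shows "real_polynomial_function (pol v K)" "x \<in> interior K \<Longrightarrow> pol v K x = v x"
proof -
  have "real_polynomial_function (pol v K) \<and> (\<forall>x\<in>interior K. v x = pol v K x)"
  proof -
    have "\<exists>p. real_polynomial_function p \<and> (\<forall>x\<in>interior K. v x = p x)" using assms by (auto simp: PW_def)
    then show ?thesis unfolding pol_def by (rule someI_ex)
  qed
  then show "real_polynomial_function (pol v K)" "x \<in> interior K \<Longrightarrow> pol v K x = v x" by auto
qed

lemma pol_continuous: "v \<in> PW \<Longrightarrow> K \<in> T \<Longrightarrow> continuous_on A (pol v K)"
  using pol_props(1) real_polynomial_function_continuous by blast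

lemma PW_periodic: "v \<in> PW \<Longrightarrow> torus_periodic v"
  by (simp add: PW_def)

lemma PW_const [intro]: "(\<lambda>x. c) \<in> PW"
  by (auto simp: PW_def torus_periodic_def intro!: exI[of _ "\<lambda>_. c"] real_polynomial_function.intros(2))

lemma PW_add [intro]:
  assumes "v \<in> PW" "w \<in> PW" shows "(\<lambda>x. v x + w x) \<in> PW"
proof -
  have "\<exists>p. real_polynomial_function p \<and> (\<forall>x\<in>interior K. v x + w x = p x)" if "K \<in> T" for K
    using pol_props[OF assms(1) that] pol_props[OF assms(2) that]
    by (intro exI[of _ "\<lambda>x. pol v K x + pol w K x"]) (auto intro: real_polynomial_function.intros(3))
  then show ?thesis using assms by (auto simp: PW_def torus_periodic_def)
qed

lemma PW_mult [intro]:
  assumes "v \<in> PW" "w \<in> PW" shows "(\<lambda>x. v x * w x) \<in> PW"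
proof -
  have "\<exists>p. real_polynomial_function p \<and> (\<forall>x\<in>interior K. v x * w x = p x)" if "K \<in> T" for K
    using pol_props[OF assms(1) that] pol_props[OF assms(2) that]
    by (intro exI[of _ "\<lambda>x. pol v K x * pol w K x"]) (auto intro: real_polynomial_function.intros(4))
  then show ?thesis using assms by (auto simp: PW_def torus_periodic_def)
qed

lemma PW_cmult [intro]: "v \<in> PW \<Longrightarrow> (\<lambda>x. c * v x) \<in> PW"
  by (rule PW_mult[OF PW_const])

lemma PW_diff [intro]: "v \<in> PW \<Longrightarrow> w \<in> PW \<Longrightarrow> (\<lambda>x. v x - w x) \<in> PW"
  using PW_add[of v "\<lambda>x. (-1) * w x"] PW_cmult[of w "-1"] by simp

lemma PW_sum [intro]: "(\<And>j. j \<in> S \<Longrightarrow> f j \<in> PW) \<Longrightarrow> (\<lambda>x. \<Sum>j\<in>S. f j x) \<in> PW"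
  by (induction S rule: infinite_finite_induct) (auto intro: PW_const)

lemma PW_bound:
  assumes "v \<in> PW" shows "\<exists>B\<ge>0. \<forall>K\<in>T. \<forall>x\<in>K. \<bar>pol v K x\<bar> \<le> B"
proof -
  have "\<exists>B. \<forall>x\<in>K. \<bar>pol v K x\<bar> \<le> B" if "K \<in> T" for K
    using compact_imp_bounded[OF compact_continuous_image[OF pol_continuous[OF assms that] compact_elt[OF that]]]
    by (auto simp: bounded_iff)
  then obtain B where B: "\<And>K x. K \<in> T \<Longrightarrow> x \<in> K \<Longrightarrow> \<bar>pol v K x\<bar> \<le> B K" by metis
  have "\<bar>pol v K x\<bar> \<le> (\<Sum>K\<in>T. \<bar>B K\<bar>)" if "K \<in> T" "x \<in> K" for K x
    using B[OF that] member_le_sum[of K T "\<lambda>K. \<bar>B K\<bar>"] finT that by fastforce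
  then show ?thesis by (intro exI[of _ "\<Sum>K\<in>T. \<bar>B K\<bar>"]) (auto intro: sum_nonneg)
qed

text \<open>The points at which a function in \<open>PW\<close> has a meaningful value.\<close>

definition \<Omega> :: "(real^3) set" where
  "\<Omega> = {x. \<exists>K\<in>T. frac3 x \<in> interior K}"

text \<open>Resets the arbitrary, possibly nonmeasurable values on element boundaries.\<close>

definition core :: "(real^3 \<Rightarrow> real) \<Rightarrow> real^3 \<Rightarrow> real" where
  "core v x = (if x \<in> \<Omega> then v x else 0)"

lemma interior_box: "K \<in> T \<Longrightarrow> interior K \<subseteq> box 0 1"
  using interior_mono[OF subset_cube] by (simp add: interior_cbox)

lemma shifted_interior:
  assumes "K \<in> T" "w - z \<in> interior K" "\<forall>j. z $ j \<in> \<int>" "v \<in> PW"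
  shows "w \<in> \<Omega>" "v w = pol v K (w - z)" "core v w = pol v K (w - z)"
proof -
  have "frac3 w = w - z" using assms interior_box by (intro frac3_eqI) auto
  then show "w \<in> \<Omega>" using assms by (auto simp: \<Omega>_def)
  have "v w = v (w - z)"
    using torus_periodic_integer[OF PW_periodic[OF assms(4)] assms(3), of "w - z"] by simp
  then show "v w = pol v K (w - z)" using pol_props(2) assms by simp
  then show "core v w = pol v K (w - z)" using \<open>w \<in> \<Omega>\<close> by (simp add: core_def)
qed

lemma interior_in_\<Omega>: "K \<in> T \<Longrightarrow> x \<in> interior K \<Longrightarrow> x \<in> \<Omega>"
  using shifted_interior(1)[of K x 0 "\<lambda>_. 0"] by (auto intro: PW_const)

lemma shifts_Ints: "z \<in> shifts \<Longrightarrow> \<forall>j. z $ j \<in> \<int>"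
proof
  fix j assume "z \<in> shifts"
  then have "z $ j \<in> {-1, 0, 1}" by (simp add: shifts_def)
  then show "z $ j \<in> \<int>" by auto
qed

lemma \<Omega>_periodic: "x + axis i 1 \<in> \<Omega> \<longleftrightarrow> x \<in> \<Omega>"
  by (simp add: \<Omega>_def frac3_shift)

lemma core_periodic: "v \<in> PW \<Longrightarrow> torus_periodic (core v)"
  using PW_periodic[of v] by (auto simp: torus_periodic_def core_def \<Omega>_periodic)

lemma core_eq:
  assumes "v \<in> PW" shows "core v x = (\<Sum>K\<in>T. indicator (interior K) (frac3 x) * pol v K (frac3 x))"
proof (cases "x \<in> \<Omega>")
  case True
  then obtain K where K: "K \<in> T" "frac3 x \<in> interior K" by (auto simp: \<Omega>_def)
  have "(\<Sum>K\<in>T. indicator (interior K) (frac3 x) * pol v K (frac3 x)) = (\<Sum>L\<in>T. if L = K then pol v K (frac3 x) else 0)"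
    using disT[of K] K by (intro sum.cong) (auto simp: indicator_def)
  then show ?thesis using True K pol_props(2)[OF assms K] frac3_periodic[OF PW_periodic[OF assms], of x] finT
    by (simp add: core_def)
next
  case False
  then show ?thesis by (auto simp: core_def \<Omega>_def intro!: sum.neutral[symmetric])
qed

lemma core_measurable [measurable]:
  assumes "v \<in> PW" shows "core v \<in> borel_measurable borel"
proof -
  have [measurable]: "pol v K \<in> borel_measurable borel" if "K \<in> T" for K
    using pol_continuous[OF assms that] by (rule borel_measurable_continuous_onI)
  have "(\<lambda>x. indicator (interior K) x * pol v K x) \<in> borel_measurable borel" if "K \<in> T" for K
    using that by (intro borel_measurable_times borel_measurable_indicator) auto
  from measurable_compose[OF measurable_frac3 this]
  have "(\<lambda>x. \<Sum>K\<in>T. indicator (interior K) (frac3 x) * pol v K (frac3 x)) \<in> borel_measurable borel"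
    by (intro borel_measurable_sum)
  then show ?thesis using core_eq[OF assms] by (simp cong: measurable_cong)
qed

text \<open>The trace at \<open>y\<close> from the direction \<open>d\<close>. Taking the limit of \<open>core v\<close> along a sequence makes it a Borel
  function of \<open>y\<close>; at regular points it agrees with the limit in the definition of the scheme.\<close>

definition tr :: "real^3 \<Rightarrow> (real^3 \<Rightarrow> real) \<Rightarrow> real^3 \<Rightarrow> real" where
  "tr d v y = lim (\<lambda>m. core v (y + (1 / real (Suc m)) *\<^sub>R d))"

lemma tr_measurable [measurable]: "v \<in> PW \<Longrightarrow> tr d v \<in> borel_measurable borel"
  unfolding tr_def by (intro borel_measurable_lim_metric) measurable

lemma tr_periodic:
  assumes "v \<in> PW" shows "tr d v (y + axis i 1) = tr d v y"
proof -
  have "core v (y + axis i 1 + s) = core v (y + s)" for s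
    using core_periodic[OF assms] unfolding torus_periodic_def by (metis add.assoc add.commute)
  then show ?thesis by (simp add: tr_def)
qed

lemma tendsto_along_ray:
  fixes y d :: "real^3"
  assumes r: "r > 0" and d: "n \<bullet> d > 0"
    and eq: "\<And>w. dist y w < r \<Longrightarrow> n \<bullet> (w - y) > 0 \<Longrightarrow> g w = p (w - z)"
    and p: "continuous_on UNIV p"
  shows "((\<lambda>s. g (y + s *\<^sub>R d)) \<longlongrightarrow> p (y - z)) (at_right 0)"
proof -
  have "d \<noteq> 0" using d by auto
  have ev: "\<forall>\<^sub>F s in at_right 0. g (y + s *\<^sub>R d) = p (y + s *\<^sub>R d - z)"
    unfolding eventually_at_right_field
  proof (intro exI[of _ "r / norm d"] conjI allI impI)
    show "r / norm d > 0" using r \<open>d \<noteq> 0\<close> by simp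
    fix s assume s: "0 < s" "s < r / norm d"
    show "g (y + s *\<^sub>R d) = p (y + s *\<^sub>R d - z)"
      using s d \<open>d \<noteq> 0\<close> by (intro eq) (auto simp: dist_norm field_simps)
  qed
  have "((\<lambda>s. y + s *\<^sub>R d - z) \<longlongrightarrow> y + 0 *\<^sub>R d - z) (at_right 0)" by (intro tendsto_intros)
  then have "((\<lambda>s. p (y + s *\<^sub>R d - z)) \<longlongrightarrow> p (y - z)) (at_right 0)"
    using continuous_on_tendsto_compose[OF p] by fastforce
  then show ?thesis using ev by (simp add: tendsto_cong)
qed

lemma tr_eqI:
  assumes r: "r > 0" and d: "n \<bullet> d > 0" and K: "K \<in> T" and z: "\<forall>j. z $ j \<in> \<int>" and v: "v \<in> PW"
    and eq: "\<And>w. dist y w < r \<Longrightarrow> n \<bullet> (w - y) > 0 \<Longrightarrow> w - z \<in> interior K"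
  shows "tr d v y = pol v K (y - z)" "((\<lambda>s. v (y + s *\<^sub>R d)) \<longlongrightarrow> pol v K (y - z)) (at_right 0)" "y - z \<in> K"
proof -
  note si = shifted_interior[OF K eq z v]
  show "((\<lambda>s. v (y + s *\<^sub>R d)) \<longlongrightarrow> pol v K (y - z)) (at_right 0)"
    using si by (intro tendsto_along_ray[OF r d] pol_continuous[OF v K])
  have "((\<lambda>s. core v (y + s *\<^sub>R d)) \<longlongrightarrow> pol v K (y - z)) (at_right 0)"
    using si by (intro tendsto_along_ray[OF r d] pol_continuous[OF v K])
  moreover have "filterlim (\<lambda>m. 1 / real (Suc m)) (at_right 0) sequentially"
    using LIMSEQ_inverse_real_of_nat[unfolded inverse_eq_divide] by (simp add: filterlim_at)
  ultimately have "(\<lambda>m. core v (y + (1 / real (Suc m)) *\<^sub>R d)) \<longlonglongrightarrow> pol v K (y - z)"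
    by (rule filterlim_compose)
  then show "tr d v y = pol v K (y - z)" unfolding tr_def by (rule limI)
  have "((\<lambda>s. y + s *\<^sub>R d - z) \<longlongrightarrow> y + 0 *\<^sub>R d - z) (at_right 0)" by (intro tendsto_intros)
  moreover have "\<forall>\<^sub>F s in at_right 0. y + s *\<^sub>R d - z \<in> K"
    unfolding eventually_at_right_field
  proof (intro exI[of _ "r / norm d"] conjI allI impI)
    have "d \<noteq> 0" using d by auto
    then show "r / norm d > 0" using r by simp
    fix s assume s: "0 < s" "s < r / norm d"
    have "y + s *\<^sub>R d - z \<in> interior K"
      using s d \<open>d \<noteq> 0\<close> by (intro eq) (auto simp: dist_norm field_simps)
    then show "y + s *\<^sub>R d - z \<in> K" using interior_subset by blast
  qed
  ultimately have "y + 0 *\<^sub>R d - z \<in> K"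
    by (intro Lim_in_closed_set[OF closed_elt[OF K], of "\<lambda>s. y + s *\<^sub>R d - z" "at_right 0"]) auto
  then show "y - z \<in> K" by simp
qed

text \<open>By \<open>half_ball\<close> the function is one polynomial on a half ball, so all transversal directions to
  the same side see the same trace, namely the value of that polynomial at the point.\<close>

lemma regular_trace:
  assumes y: "y \<in> cbox 0 1" and n: "n \<noteq> 0" and reg: "regpt n y"
  shows "\<exists>K\<in>T. \<exists>z. y - z \<in> K \<and> (\<forall>v\<in>PW. \<forall>d. n \<bullet> d > 0 \<longrightarrow>
      tr d v y = pol v K (y - z) \<and> ((\<lambda>s. v (y + s *\<^sub>R d)) \<longlongrightarrow> pol v K (y - z)) (at_right 0))"
proof -
  obtain r K z where *: "r > 0" "K \<in> T" "z \<in> shifts" "\<And>w. dist y w < r \<Longrightarrow> n \<bullet> (w - y) > 0 \<Longrightarrow> w - z \<in> interior K"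
    using half_ball[OF y n reg] by blast
  note te = tr_eqI[OF *(1) _ *(2) shifts_Ints[OF *(3)] _ *(4)]
  have "y - z \<in> K" by (rule te(3)[of n n "\<lambda>_. 0"]) (use n PW_const in auto)
  moreover have "tr d v y = pol v K (y - z) \<and> ((\<lambda>s. v (y + s *\<^sub>R d)) \<longlongrightarrow> pol v K (y - z)) (at_right 0)"
    if "v \<in> PW" "n \<bullet> d > 0" for v d using te(1,2)[OF that(2,1)] by blast
  ultimately show ?thesis using *(2) by blast
qed

lemma facet_inner_trace:
  assumes K: "K \<in> T" "F facet_of K" and y: "y \<in> F" and reg: "regpt (facet_normal K F) y"
    and v: "v \<in> PW" and d: "facet_normal K F \<bullet> d < 0"
  shows "tr d v y = pol v K y"
proof -
  obtain r where r: "r > 0" "\<And>w. dist y w < r \<Longrightarrow> - facet_normal K F \<bullet> (w - y) > 0 \<Longrightarrow> w - 0 \<in> interior K"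
    using half_ball_inside[OF K y reg] by auto
  have "- facet_normal K F \<bullet> d > 0" using d by simp
  from tr_eqI(1)[OF r(1) this K(1) _ v r(2)] show ?thesis by simp
qed

lemma regular_trace_tendsto:
  assumes y: "y \<in> cbox 0 1" and reg: "regpt n y" and v: "v \<in> PW" and d: "n \<bullet> d \<noteq> 0"
  shows "((\<lambda>s. v (y + s *\<^sub>R d)) \<longlongrightarrow> tr d v y) (at_right 0)"
proof (cases "n \<bullet> d > 0")
  case True
  then have "n \<noteq> 0" by auto
  from regular_trace[OF y this reg] v True show ?thesis by metis
next
  case False
  then have "- n \<bullet> d > 0" "- n \<noteq> 0" "regpt (- n) y" using d reg by (auto simp: regpt_minus)
  from regular_trace[OF y this(2,3)] v this(1) show ?thesis by metis
qed

text \<open>Allows replacing the normal of a facet by a coordinate direction in all traces.\<close>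

lemma regular_trace_same_side:
  assumes y: "y \<in> cbox 0 1" and reg: "regpt n y" and v: "v \<in> PW" and d: "n \<bullet> d > 0" "n \<bullet> d' > 0"
  shows "tr d v y = tr d' v y"
proof -
  have "n \<noteq> 0" using d by auto
  from regular_trace[OF y this reg] v d show ?thesis by metis
qed

text \<open>A bound for all local polynomials of \<open>v\<close>, hence for its traces.\<close>

definition vbound :: "(real^3 \<Rightarrow> real) \<Rightarrow> real" where
  "vbound v = (SOME B. B \<ge> 0 \<and> (\<forall>K\<in>T. \<forall>x\<in>K. \<bar>pol v K x\<bar> \<le> B))"

lemma vbound: "v \<in> PW \<Longrightarrow> vbound v \<ge> 0" "v \<in> PW \<Longrightarrow> K \<in> T \<Longrightarrow> x \<in> K \<Longrightarrow> \<bar>pol v K x\<bar> \<le> vbound v"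
proof -
  have "vbound v \<ge> 0 \<and> (\<forall>K\<in>T. \<forall>x\<in>K. \<bar>pol v K x\<bar> \<le> vbound v)" if "v \<in> PW"
    unfolding vbound_def by (rule someI_ex) (use PW_bound[OF that] in blast)
  then show "v \<in> PW \<Longrightarrow> vbound v \<ge> 0" "v \<in> PW \<Longrightarrow> K \<in> T \<Longrightarrow> x \<in> K \<Longrightarrow> \<bar>pol v K x\<bar> \<le> vbound v" by auto
qed

lemma regular_trace_bound:
  assumes y: "y \<in> cbox 0 1" and reg: "regpt n y" and v: "v \<in> PW" and d: "n \<bullet> d \<noteq> 0"
  shows "\<bar>tr d v y\<bar> \<le> vbound v"
proof (cases "n \<bullet> d > 0")
  case True
  then have "n \<noteq> 0" by auto
  from regular_trace[OF y this reg] v True vbound show ?thesis by metis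
next
  case False
  then have "- n \<bullet> d > 0" "- n \<noteq> 0" "regpt (- n) y" using d reg by (auto simp: regpt_minus)
  from regular_trace[OF y this(2,3)] v this(1) vbound show ?thesis by metis
qed

lemma regular_trace_lincomb:
  assumes y: "y \<in> cbox 0 1" and reg: "regpt n y" and v: "v \<in> PW" "w \<in> PW" and d: "n \<bullet> d \<noteq> 0"
  shows "tr d (\<lambda>x. a * v x + b * w x) y = a * tr d v y + b * tr d w y"
proof -
  have "((\<lambda>s. a * v (y + s *\<^sub>R d) + b * w (y + s *\<^sub>R d)) \<longlongrightarrow> a * tr d v y + b * tr d w y) (at_right 0)"
    by (intro tendsto_intros regular_trace_tendsto[OF y reg _ d] v)
  moreover have "((\<lambda>s. a * v (y + s *\<^sub>R d) + b * w (y + s *\<^sub>R d)) \<longlongrightarrow> tr d (\<lambda>x. a * v x + b * w x) y) (at_right 0)"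
    using v by (intro regular_trace_tendsto[OF y reg _ d, of "\<lambda>x. a * v x + b * w x"]) auto
  ultimately show ?thesis using tendsto_unique trivial_limit_at_right_real by blast
qed

lemma outer_inner_trace:
  assumes y: "y \<in> cbox 0 1" and reg: "regpt n y" and n: "n \<noteq> 0" and v: "(\<lambda>x. u x a) \<in> PW"
  shows "outer_trace n u y a = tr n (\<lambda>x. u x a) y" "inner_trace n u y a = tr (- n) (\<lambda>x. u x a) y"
  using regular_trace_tendsto[OF y reg v, of n] regular_trace_tendsto[OF y reg v, of "- n"] n
  by (auto simp: outer_trace_def inner_trace_def intro!: tendsto_Lim)

end

section \<open>Partitions of generic lines\<close>

text \<open>The segments form a tagged division of \<open>[a, b]\<close>, and increments are additive over
  divisions.\<close>

lemma telescope_cover: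
  fixes lo hi :: "'k \<Rightarrow> real" and f :: "real \<Rightarrow> real"
  assumes H: "finite H" and ab: "a \<le> b" and lh: "\<And>k. k \<in> H \<Longrightarrow> lo k < hi k"
    and cov: "(\<Union>k\<in>H. {lo k..hi k}) = {a..b}"
    and dis: "\<And>k k'. k \<in> H \<Longrightarrow> k' \<in> H \<Longrightarrow> k \<noteq> k' \<Longrightarrow> {lo k<..<hi k} \<inter> {lo k'<..<hi k'} = {}"
  shows "(\<Sum>k\<in>H. f (hi k) - f (lo k)) = f b - f a"
proof -
  let ?p = "(\<lambda>k. (lo k, {lo k..hi k})) ` H"
  have inj: "inj_on (\<lambda>k. (lo k, {lo k..hi k})) H"
  proof (rule inj_onI)
    fix k k' assume k: "k \<in> H" "k' \<in> H" "(lo k, {lo k..hi k}) = (lo k', {lo k'..hi k'})"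
    then have "lo k = lo k'" "hi k = hi k'" using lh[of k] lh[of k'] by (auto simp: Icc_eq_Icc)
    then have "(lo k + hi k) / 2 \<in> {lo k<..<hi k} \<inter> {lo k'<..<hi k'}" using lh[OF k(1)] by auto
    then show "k = k'" using dis[OF k(1,2)] by blast
  qed
  have "?p tagged_division_of {a..b}"
  proof (rule tagged_division_ofI)
    show "finite ?p" using H by simp
    show "x \<in> K" if "(x, K) \<in> ?p" for x K using that lh by (auto simp: less_imp_le)
    show "K \<subseteq> {a..b}" if "(x, K) \<in> ?p" for x K using that cov by blast
    show "\<exists>a b. K = cbox a b" if "(x, K) \<in> ?p" for x K using that by (auto simp flip: box_real)
    show "interior K1 \<inter> interior K2 = {}" if "(x1, K1) \<in> ?p" "(x2, K2) \<in> ?p" "(x1, K1) \<noteq> (x2, K2)" for x1 K1 x2 K2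
    proof -
      obtain k1 k2 where "k1 \<in> H" "k2 \<in> H" "K1 = {lo k1..hi k1}" "K2 = {lo k2..hi k2}" "k1 \<noteq> k2"
        using \<open>(x1, K1) \<in> ?p\<close> \<open>(x2, K2) \<in> ?p\<close> \<open>(x1, K1) \<noteq> (x2, K2)\<close> by blast
      then show ?thesis using dis by simp
    qed
    show "\<Union>{K. \<exists>x. (x, K) \<in> ?p} = {a..b}" unfolding cov[symmetric] by blast
  qed
  from additive_tagged_division_1[OF ab this, of f]
  have "f b - f a = (\<Sum>k\<in>H. f (Sup {lo k..hi k}) - f (Inf {lo k..hi k}))"
    using inj by (simp add: sum.reindex)
  then show ?thesis using lh by (simp add: less_imp_le)
qed

text \<open>Clamping the parameter to \<open>[c, d]\<close> lets \<open>telescope_cover\<close> split both increments over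
  the same segments, on each of which they can be compared.\<close>

lemma lipschitz_cover:
  fixes lo hi :: "'k \<Rightarrow> real" and f :: "real \<Rightarrow> real"
  assumes H: "finite H" and ab: "a \<le> b" and lh: "\<And>k. k \<in> H \<Longrightarrow> lo k < hi k"
    and cov: "(\<Union>k\<in>H. {lo k..hi k}) = {a..b}"
    and dis: "\<And>k k'. k \<in> H \<Longrightarrow> k' \<in> H \<Longrightarrow> k \<noteq> k' \<Longrightarrow> {lo k<..<hi k} \<inter> {lo k'<..<hi k'} = {}"
    and lip: "\<And>k s t. k \<in> H \<Longrightarrow> lo k \<le> s \<Longrightarrow> s \<le> t \<Longrightarrow> t \<le> hi k \<Longrightarrow> \<bar>f t - f s\<bar> \<le> L * (t - s)"
    and cd: "a \<le> c" "c \<le> d" "d \<le> b"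
  shows "\<bar>f d - f c\<bar> \<le> L * (d - c)"
proof -
  define cl where "cl t = max c (min d t)" for t :: real
  have 1: "f d - f c = (\<Sum>k\<in>H. f (cl (hi k)) - f (cl (lo k)))"
    using telescope_cover[OF H ab lh cov dis, of "\<lambda>t. f (cl t)"] cd by (simp add: cl_def)
  have 2: "d - c = (\<Sum>k\<in>H. cl (hi k) - cl (lo k))"
    using telescope_cover[OF H ab lh cov dis, of cl] cd by (simp add: cl_def)
  have "\<bar>f (cl (hi k)) - f (cl (lo k))\<bar> \<le> L * (cl (hi k) - cl (lo k))" if "k \<in> H" for k
  proof (cases "cl (hi k) = cl (lo k)")
    case False
    then have "lo k \<le> cl (lo k)" "cl (lo k) \<le> cl (hi k)" "cl (hi k) \<le> hi k"
      using lh[OF that] cd by (auto simp: cl_def)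
    then show ?thesis using lip[OF that] by blast
  qed simp
  then have "\<bar>\<Sum>k\<in>H. f (cl (hi k)) - f (cl (lo k))\<bar> \<le> (\<Sum>k\<in>H. L * (cl (hi k) - cl (lo k)))"
    by (intro order_trans[OF sum_abs] sum_mono)
  then show ?thesis unfolding 1 2 by (simp add: sum_distrib_left)
qed

context unit_cube_mesh
begin

definition exit_facets :: "3 \<Rightarrow> (real^3) set \<Rightarrow> (real^3) set set" where
  "exit_facets i K = {F. F facet_of K \<and> facet_normal K F $ i > 0}"

definition entry_facets :: "3 \<Rightarrow> (real^3) set \<Rightarrow> (real^3) set set" where
  "entry_facets i K = {F. F facet_of K \<and> facet_normal K F $ i < 0}"

lemma finite_exit_facets: "K \<in> T \<Longrightarrow> finite (exit_facets i K)" "K \<in> T \<Longrightarrow> finite (entry_facets i K)"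
  by (auto simp: exit_facets_def entry_facets_def intro: finite_subset[OF _ finite_facets])

text \<open>The segments of \<open>line_segment\<close> for all elements that a generic line meets. They cover the part of
  the line in the closed cube because the elements do, and they do not overlap because the interiors
  are disjoint.\<close>

lemma line_partition:
  assumes good: "goodline i x" and x: "x \<in> cbox 0 1"
  obtains H lo hi where "H = {K \<in> T. \<exists>t. x + t *\<^sub>R axis i 1 \<in> K}"
    "\<And>K. K \<in> H \<Longrightarrow> lo K < hi K"
    "\<And>K t. K \<in> H \<Longrightarrow> x + t *\<^sub>R axis i 1 \<in> K \<longleftrightarrow> lo K \<le> t \<and> t \<le> hi K"
    "\<And>K t. K \<in> H \<Longrightarrow> x + t *\<^sub>R axis i 1 \<in> interior K \<longleftrightarrow> lo K < t \<and> t < hi K"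
    "\<And>K. K \<in> H \<Longrightarrow> \<exists>F. {F\<in>exit_facets i K. facet_hit i K F x \<in> F} = {F} \<and> facet_hit i K F x = x + hi K *\<^sub>R axis i 1"
    "\<And>K. K \<in> H \<Longrightarrow> \<exists>F. {F\<in>entry_facets i K. facet_hit i K F x \<in> F} = {F} \<and> facet_hit i K F x = x + lo K *\<^sub>R axis i 1"
    "\<And>K F. K \<in> T - H \<Longrightarrow> F \<in> exit_facets i K \<union> entry_facets i K \<Longrightarrow> facet_hit i K F x \<notin> F"
    "(\<Union>K\<in>H. {lo K..hi K}) = {- x $ i..1 - x $ i}"
    "\<And>K K'. K \<in> H \<Longrightarrow> K' \<in> H \<Longrightarrow> K \<noteq> K' \<Longrightarrow> {lo K<..<hi K} \<inter> {lo K'<..<hi K'} = {}"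
proof -
  define H where "H = {K \<in> T. \<exists>t. x + t *\<^sub>R axis i 1 \<in> K}"
  have "\<forall>K\<in>H. \<exists>lo hi. lo < hi \<and> (\<forall>t. x + t *\<^sub>R axis i 1 \<in> K \<longleftrightarrow> lo \<le> t \<and> t \<le> hi) \<and>
    (\<forall>t. x + t *\<^sub>R axis i 1 \<in> interior K \<longleftrightarrow> lo < t \<and> t < hi) \<and>
    (\<exists>F. {F\<in>exit_facets i K. facet_hit i K F x \<in> F} = {F} \<and> facet_hit i K F x = x + hi *\<^sub>R axis i 1) \<and>
    (\<exists>F. {F\<in>entry_facets i K. facet_hit i K F x \<in> F} = {F} \<and> facet_hit i K F x = x + lo *\<^sub>R axis i 1)" (is "\<forall>K\<in>H. \<exists>lo hi. ?P K lo hi")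
  proof
    fix K assume "K \<in> H"
    then have K: "K \<in> T" "\<exists>t. x + t *\<^sub>R axis i 1 \<in> K" by (auto simp: H_def)
    obtain lo hi Fh Fl where "lo < hi" "\<And>t. x + t *\<^sub>R axis i 1 \<in> K \<longleftrightarrow> lo \<le> t \<and> t \<le> hi"
      "\<And>t. x + t *\<^sub>R axis i 1 \<in> interior K \<longleftrightarrow> lo < t \<and> t < hi"
      "{F. F facet_of K \<and> facet_normal K F $ i > 0 \<and> facet_hit i K F x \<in> F} = {Fh}"
      "facet_hit i K Fh x = x + hi *\<^sub>R axis i 1"
      "{F. F facet_of K \<and> facet_normal K F $ i < 0 \<and> facet_hit i K F x \<in> F} = {Fl}"
      "facet_hit i K Fl x = x + lo *\<^sub>R axis i 1"
      using line_segment[OF good K] by blast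
    then have "?P K lo hi" unfolding exit_facets_def entry_facets_def by (simp add: conj_assoc)
    then show "\<exists>lo hi. ?P K lo hi" by (rule_tac exI[of _ lo], rule_tac exI[of _ hi])
  qed
  from bchoice[OF this] obtain lo where "\<forall>K\<in>H. \<exists>hi. ?P K (lo K) hi" ..
  from bchoice[OF this] obtain hi where P': "\<forall>K\<in>H. ?P K (lo K) (hi K)" ..
  note P = bspec[OF P']
  show thesis
  proof (rule that[of H lo hi])
    show "H = {K \<in> T. \<exists>t. x + t *\<^sub>R axis i 1 \<in> K}" by (rule H_def)
    show "facet_hit i K F x \<notin> F" if "K \<in> T - H" "F \<in> exit_facets i K \<union> entry_facets i K" for K F
    proof
      assume *: "facet_hit i K F x \<in> F"
      have "F facet_of K" "K \<in> T" using that by (auto simp: exit_facets_def entry_facets_def)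
      then have "F \<subseteq> K" using facet_props(2) by blast
      then show False using * facet_hit_on_line[of i K F x] that(1) by (auto simp: H_def)
    qed
    show "(\<Union>K\<in>H. {lo K..hi K}) = {- x $ i..1 - x $ i}"
    proof (intro set_eqI iffI)
      fix t assume "t \<in> (\<Union>K\<in>H. {lo K..hi K})"
      then obtain K where "K \<in> H" "x + t *\<^sub>R axis i 1 \<in> K" using P by auto
      then have "x + t *\<^sub>R axis i 1 \<in> cbox 0 1" using subset_cube by (auto simp: H_def)
      then have "0 \<le> (x + t *\<^sub>R axis i 1) $ i \<and> (x + t *\<^sub>R axis i 1) $ i \<le> 1"
        unfolding mem_box_cart by (metis one_index zero_index)
      then show "t \<in> {- x $ i..1 - x $ i}" by simp
    next
      fix t assume "t \<in> {- x $ i..1 - x $ i}"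
      then have "x + t *\<^sub>R axis i 1 \<in> cbox 0 1" using cube_line[of x 0 i t] x by auto
      then obtain K where "K \<in> T" "x + t *\<^sub>R axis i 1 \<in> K" using covT by blast
      then have "K \<in> H" by (auto simp: H_def)
      then show "t \<in> (\<Union>K\<in>H. {lo K..hi K})" using P \<open>x + t *\<^sub>R axis i 1 \<in> K\<close> by auto
    qed
    show "{lo K<..<hi K} \<inter> {lo K'<..<hi K'} = {}" if "K \<in> H" "K' \<in> H" "K \<noteq> K'" for K K'
    proof -
      have "K \<in> T" "K' \<in> T" using that by (auto simp: H_def)
      then show ?thesis using disT[of K K'] P[OF that(1)] P[OF that(2)] that(3)
        by (metis (no_types, lifting) disjoint_iff greaterThanLessThan_iff)
    qed
  qed (use P in blast)+
qed

definition hitset :: "3 \<Rightarrow> (real^3) set \<Rightarrow> (real^3) set \<Rightarrow> (real^3) set" where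
  "hitset i K F = {x \<in> cbox 0 1. facet_hit i K F x \<in> F}"

text \<open>The integral over \<open>F\<close> with respect to the area element times \<open>|n\<^sub>i|\<close>, written as an integral over
  the axis-parallel lines that hit \<open>F\<close>; see \<open>facet_integral_hit_integral\<close>.\<close>

definition hit_integral :: "3 \<Rightarrow> (real^3) set \<Rightarrow> (real^3) set \<Rightarrow> (real^3 \<Rightarrow> real) \<Rightarrow> real" where
  "hit_integral i K F \<psi> = (LINT x|lborel. indicator (hitset i K F) x * \<psi> (facet_hit i K F x))"

text \<open>The sum over the facets through which lines in the positive \<open>i\<close>-th direction leave an element.
  Since every interior or periodic interface is left by one element and entered by another, this is an
  integral over each interface once; interfaces with hanging nodes need no special treatment.\<close>

definition exit_integral :: "3 \<Rightarrow> (real^3 \<Rightarrow> real) \<Rightarrow> real" where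
  "exit_integral i \<psi> = (\<Sum>K\<in>T. \<Sum>F\<in>exit_facets i K. hit_integral i K F \<psi>)"

definition entry_integral :: "3 \<Rightarrow> (real^3 \<Rightarrow> real) \<Rightarrow> real" where
  "entry_integral i \<psi> = (\<Sum>K\<in>T. \<Sum>F\<in>entry_facets i K. hit_integral i K F \<psi>)"

lemma AE_goodline: "AE x in lborel. goodline i x"
  using negligible_badline[of i] unfolding negligible_iff_null_sets
  by (subst AE_completion_iff[symmetric]) (auto intro: AE_I')

lemma facet_hit_measurable [measurable]: "facet_hit i K F \<in> borel_measurable borel"
  unfolding facet_hit_def by simp

lemma hitset_measurable:
  assumes "K \<in> T" "F facet_of K" shows "hitset i K F \<in> sets borel"
proof -
  have [measurable]: "F \<in> sets borel" using facet_props(5)[OF assms] by (simp add: borel_compact)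
  show ?thesis unfolding hitset_def by measurable
qed

lemma good_hit:
  assumes "goodline i x" "K \<in> T" "F facet_of K" "x \<in> hitset i K F"
  shows "facet_hit i K F x \<in> F" "facet_normal K F $ i \<noteq> 0" "regpt (facet_normal K F) (facet_hit i K F x)"
    "facet_hit i K F x \<in> cbox 0 1"
proof -
  show F: "facet_hit i K F x \<in> F" using assms by (simp add: hitset_def)
  obtain s where "facet_hit i K F x = x + s *\<^sub>R axis i 1" using facet_hit_on_line by blast
  then show "facet_normal K F $ i \<noteq> 0" "regpt (facet_normal K F) (facet_hit i K F x)"
    using assms(1-3) F unfolding goodline_def by metis+
  show "facet_hit i K F x \<in> cbox 0 1" using F facet_props(8)[OF assms(2,3)] by blast
qed

lemma hit_integral_integrable:
  fixes \<psi> :: "real^3 \<Rightarrow> real"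
  assumes K: "K \<in> T" "F facet_of K" and m: "\<psi> \<in> borel_measurable borel"
    and B: "\<And>y. y \<in> F \<Longrightarrow> facet_normal K F $ i \<noteq> 0 \<Longrightarrow> regpt (facet_normal K F) y \<Longrightarrow> \<bar>\<psi> y\<bar> \<le> B"
  shows "integrable lborel (\<lambda>x. indicator (hitset i K F) x * \<psi> (facet_hit i K F x))"
proof -
  have i: "integrable lborel (\<lambda>x::real^3. indicator (cbox 0 1) x * \<bar>B\<bar> :: real)"
    by (intro integrable_real_indicator integrable_mult_left) (auto simp: emeasure_lborel_cbox_eq)
  note [measurable] = hitset_measurable[OF K] m
  have m': "(\<lambda>x. indicator (hitset i K F) x * \<psi> (facet_hit i K F x)) \<in> borel_measurable lborel" by measurable
  have "AE x in lborel. norm (indicator (hitset i K F) x * \<psi> (facet_hit i K F x)) \<le> norm (indicator (cbox 0 1) x * \<bar>B\<bar> :: real)"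
    using AE_goodline[of i]
  proof eventually_elim
    case (elim x)
    show ?case
    proof (cases "x \<in> hitset i K F")
      case True
      from B[OF good_hit(1-3)[OF elim K this]] True show ?thesis by (auto simp: hitset_def)
    qed simp
  qed
  then show ?thesis by (rule Bochner_Integration.integrable_bound[OF i m'])
qed

lemma hit_integral_cong:
  assumes K: "K \<in> T" "F facet_of K" and m: "\<psi> \<in> borel_measurable borel" "\<psi>' \<in> borel_measurable borel"
    and eq: "\<And>y. y \<in> F \<Longrightarrow> facet_normal K F $ i \<noteq> 0 \<Longrightarrow> regpt (facet_normal K F) y \<Longrightarrow> \<psi> y = \<psi>' y"
  shows "hit_integral i K F \<psi> = hit_integral i K F \<psi>'"
  unfolding hit_integral_def
proof (rule integral_cong_AE)
  note [measurable] = hitset_measurable[OF K] m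
  show "(\<lambda>x. indicator (hitset i K F) x * \<psi> (facet_hit i K F x)) \<in> borel_measurable lborel"
    "(\<lambda>x. indicator (hitset i K F) x * \<psi>' (facet_hit i K F x)) \<in> borel_measurable lborel" by measurable
  show "AE x in lborel. indicator (hitset i K F) x * \<psi> (facet_hit i K F x) = indicator (hitset i K F) x * \<psi>' (facet_hit i K F x)"
    using AE_goodline[of i]
  proof eventually_elim
    case (elim x)
    show ?case
      using eq[OF good_hit(1-3)[OF elim K]] by (cases "x \<in> hitset i K F") auto
  qed
qed

text \<open>The functions for which exit and entry integrals make sense: Borel functions, periodic along the
  axis and bounded at the regular points of transversal facets, like traces and their products.\<close>

definition trace_fun :: "3 \<Rightarrow> (real^3 \<Rightarrow> real) set" where
  "trace_fun i = {\<psi>. \<psi> \<in> borel_measurable borel \<and> (\<forall>y. \<psi> (y + axis i 1) = \<psi> y) \<and>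
     (\<exists>B. \<forall>n y. y \<in> cbox 0 1 \<longrightarrow> regpt n y \<longrightarrow> n $ i \<noteq> 0 \<longrightarrow> \<bar>\<psi> y\<bar> \<le> B)}"

lemma trace_fun_const: "(\<lambda>_. c) \<in> trace_fun i" by (auto simp: trace_fun_def)

lemma trace_fun_tr: assumes "v \<in> PW" "d = axis i 1 \<or> d = - axis i 1" shows "tr d v \<in> trace_fun i"
proof -
  have "\<forall>n y. y \<in> cbox 0 1 \<longrightarrow> regpt n y \<longrightarrow> n $ i \<noteq> 0 \<longrightarrow> \<bar>tr d v y\<bar> \<le> vbound v"
    using regular_trace_bound[OF _ _ assms(1), of _ _ d] assms(2) by (auto simp: inner_axis)
  then show ?thesis using tr_measurable[OF assms(1)] tr_periodic[OF assms(1)] by (auto simp: trace_fun_def)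
qed

lemma trace_fun_add: assumes "\<psi> \<in> trace_fun i" "\<psi>' \<in> trace_fun i" shows "(\<lambda>y. \<psi> y + \<psi>' y) \<in> trace_fun i"
proof -
  obtain B B' where "\<forall>n y. y \<in> cbox 0 1 \<longrightarrow> regpt n y \<longrightarrow> n $ i \<noteq> 0 \<longrightarrow> \<bar>\<psi> y\<bar> \<le> B"
    "\<forall>n y. y \<in> cbox 0 1 \<longrightarrow> regpt n y \<longrightarrow> n $ i \<noteq> 0 \<longrightarrow> \<bar>\<psi>' y\<bar> \<le> B'"
    using assms by (auto simp: trace_fun_def)
  then have "\<forall>n y. y \<in> cbox 0 1 \<longrightarrow> regpt n y \<longrightarrow> n $ i \<noteq> 0 \<longrightarrow> \<bar>\<psi> y + \<psi>' y\<bar> \<le> B + B'"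
    by (meson abs_triangle_ineq add_mono order_trans)
  then show ?thesis using assms by (auto simp: trace_fun_def)
qed

lemma trace_fun_mult: assumes "\<psi> \<in> trace_fun i" "\<psi>' \<in> trace_fun i" shows "(\<lambda>y. \<psi> y * \<psi>' y) \<in> trace_fun i"
proof -
  obtain B B' where "\<forall>n y. y \<in> cbox 0 1 \<longrightarrow> regpt n y \<longrightarrow> n $ i \<noteq> 0 \<longrightarrow> \<bar>\<psi> y\<bar> \<le> B"
    "\<forall>n y. y \<in> cbox 0 1 \<longrightarrow> regpt n y \<longrightarrow> n $ i \<noteq> 0 \<longrightarrow> \<bar>\<psi>' y\<bar> \<le> B'"
    using assms by (auto simp: trace_fun_def)
  then have "\<forall>n y. y \<in> cbox 0 1 \<longrightarrow> regpt n y \<longrightarrow> n $ i \<noteq> 0 \<longrightarrow> \<bar>\<psi> y * \<psi>' y\<bar> \<le> B * B'"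
    unfolding abs_mult by (meson abs_ge_zero mult_mono order_trans)
  then show ?thesis using assms by (auto simp: trace_fun_def)
qed

lemma trace_fun_cmult: "\<psi> \<in> trace_fun i \<Longrightarrow> (\<lambda>y. c * \<psi> y) \<in> trace_fun i"
  by (rule trace_fun_mult[OF trace_fun_const])

lemma trace_fun_diff: "\<psi> \<in> trace_fun i \<Longrightarrow> \<psi>' \<in> trace_fun i \<Longrightarrow> (\<lambda>y. \<psi> y - \<psi>' y) \<in> trace_fun i"
  using trace_fun_add[of \<psi> i "\<lambda>y. (-1) * \<psi>' y"] trace_fun_cmult[of \<psi>' i "-1"] by simp

lemma trace_fun_measurable: "\<psi> \<in> trace_fun i \<Longrightarrow> \<psi> \<in> borel_measurable borel" by (simp add: trace_fun_def)

lemma trace_fun_hit_integral_integrable: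
  assumes K: "K \<in> T" "F facet_of K" and t: "\<psi> \<in> trace_fun i"
  shows "integrable lborel (\<lambda>x. indicator (hitset i K F) x * \<psi> (facet_hit i K F x))"
proof -
  obtain B where B: "\<And>n y. y \<in> cbox 0 1 \<Longrightarrow> regpt n y \<Longrightarrow> n $ i \<noteq> 0 \<Longrightarrow> \<bar>\<psi> y\<bar> \<le> B"
    using t by (auto simp: trace_fun_def)
  show ?thesis
    by (rule hit_integral_integrable[OF K trace_fun_measurable[OF t]]) (rule B, use facet_props(8)[OF K] in auto)
qed

lemma hit_integral_add:
  assumes K: "K \<in> T" "F facet_of K" and t: "\<psi> \<in> trace_fun i" "\<psi>' \<in> trace_fun i"
  shows "hit_integral i K F (\<lambda>y. \<psi> y + \<psi>' y) = hit_integral i K F \<psi> + hit_integral i K F \<psi>'"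
  unfolding hit_integral_def distrib_left
  by (rule Bochner_Integration.integral_add[OF trace_fun_hit_integral_integrable[OF K t(1)] trace_fun_hit_integral_integrable[OF K t(2)]])

lemma hit_integral_cmult: "hit_integral i K F (\<lambda>y. c * \<psi> y) = c * hit_integral i K F \<psi>"
  unfolding hit_integral_def by (subst mult.left_commute) (rule integral_mult_right_zero)

lemma exit_integral_add: "\<psi> \<in> trace_fun i \<Longrightarrow> \<psi>' \<in> trace_fun i \<Longrightarrow> exit_integral i (\<lambda>y. \<psi> y + \<psi>' y) = exit_integral i \<psi> + exit_integral i \<psi>'"
  unfolding exit_integral_def sum.distrib[symmetric] by (intro sum.cong refl hit_integral_add) (auto simp: exit_facets_def)

lemma exit_integral_cmult: "exit_integral i (\<lambda>y. c * \<psi> y) = c * exit_integral i \<psi>"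
  unfolding exit_integral_def by (simp only: hit_integral_cmult sum_distrib_left)

lemma exit_integral_diff: "\<psi> \<in> trace_fun i \<Longrightarrow> \<psi>' \<in> trace_fun i \<Longrightarrow> exit_integral i (\<lambda>y. \<psi> y - \<psi>' y) = exit_integral i \<psi> - exit_integral i \<psi>'"
  using exit_integral_add[of \<psi> i "\<lambda>y. (-1) * \<psi>' y"] trace_fun_cmult[of \<psi>' i "-1"] exit_integral_cmult[of i "-1" \<psi>'] by simp

lemma exit_integral_cong:
  assumes "\<psi> \<in> trace_fun i" "\<psi>' \<in> trace_fun i"
    and "\<And>n y. y \<in> cbox 0 1 \<Longrightarrow> regpt n y \<Longrightarrow> n $ i \<noteq> 0 \<Longrightarrow> \<psi> y = \<psi>' y"
  shows "exit_integral i \<psi> = exit_integral i \<psi>'"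
  unfolding exit_integral_def
proof (intro sum.cong refl)
  fix K F assume "K \<in> T" "F \<in> exit_facets i K"
  then have K: "K \<in> T" "F facet_of K" by (auto simp: exit_facets_def)
  show "hit_integral i K F \<psi> = hit_integral i K F \<psi>'"
    by (rule hit_integral_cong[OF K]) (use assms trace_fun_measurable facet_props(8)[OF K] in auto)
qed

lemma exit_integral_nonneg: "(\<And>y. \<psi> y \<ge> 0) \<Longrightarrow> exit_integral i \<psi> \<ge> 0"
  unfolding exit_integral_def hit_integral_def by (intro sum_nonneg integral_nonneg_AE) auto

text \<open>Leaving one element is entering the next. On each generic line the points of exit
  and the points of entry are the same, except for the two ends of the segment in the cube, at which
  a periodic function takes the same value.\<close>

lemma exit_integral_eq_entry_integral:
  assumes t: "\<psi> \<in> trace_fun i"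
  shows "exit_integral i \<psi> = entry_integral i \<psi>"
proof -
  let ?g = "\<lambda>K F x. indicator (hitset i K F) x * \<psi> (facet_hit i K F x) :: real"
  have int: "integrable lborel (?g K F)" if "K \<in> T" "F \<in> exit_facets i K \<union> entry_facets i K" for K F
    using that by (intro trace_fun_hit_integral_integrable t) (auto simp: exit_facets_def entry_facets_def)
  have "exit_integral i \<psi> = (LINT x|lborel. (\<Sum>K\<in>T. \<Sum>F\<in>exit_facets i K. ?g K F x))"
    unfolding exit_integral_def hit_integral_def using int
    by (subst Bochner_Integration.integral_sum) (auto intro!: sum.cong Bochner_Integration.integrable_sum)
  also have "\<dots> = (LINT x|lborel. (\<Sum>K\<in>T. \<Sum>F\<in>entry_facets i K. ?g K F x))"
  proof (rule integral_cong_AE)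
    show "(\<lambda>x. \<Sum>K\<in>T. \<Sum>F\<in>exit_facets i K. ?g K F x) \<in> borel_measurable lborel"
      "(\<lambda>x. \<Sum>K\<in>T. \<Sum>F\<in>entry_facets i K. ?g K F x) \<in> borel_measurable lborel"
      using int by (auto intro!: borel_measurable_sum borel_measurable_integrable)
    show "AE x in lborel. (\<Sum>K\<in>T. \<Sum>F\<in>exit_facets i K. ?g K F x) = (\<Sum>K\<in>T. \<Sum>F\<in>entry_facets i K. ?g K F x)"
      using AE_goodline[of i]
    proof eventually_elim
      case good: (elim x)
      show ?case
      proof (cases "x \<in> cbox 0 1")
        case True
        obtain H lo hi where *:
          "H = {K \<in> T. \<exists>t. x + t *\<^sub>R axis i 1 \<in> K}"
          "\<And>K. K \<in> H \<Longrightarrow> lo K < hi K"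
          and "\<And>K t. K \<in> H \<Longrightarrow> x + t *\<^sub>R axis i 1 \<in> K \<longleftrightarrow> lo K \<le> t \<and> t \<le> hi K"
          and "\<And>K t. K \<in> H \<Longrightarrow> x + t *\<^sub>R axis i 1 \<in> interior K \<longleftrightarrow> lo K < t \<and> t < hi K"
          and hits:
          "\<And>K. K \<in> H \<Longrightarrow> \<exists>F. {F\<in>exit_facets i K. facet_hit i K F x \<in> F} = {F} \<and> facet_hit i K F x = x + hi K *\<^sub>R axis i 1"
          "\<And>K. K \<in> H \<Longrightarrow> \<exists>F. {F\<in>entry_facets i K. facet_hit i K F x \<in> F} = {F} \<and> facet_hit i K F x = x + lo K *\<^sub>R axis i 1"
          "\<And>K F. K \<in> T - H \<Longrightarrow> F \<in> exit_facets i K \<union> entry_facets i K \<Longrightarrow> facet_hit i K F x \<notin> F"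
          "(\<Union>K\<in>H. {lo K..hi K}) = {- x $ i..1 - x $ i}"
          "\<And>K K'. K \<in> H \<Longrightarrow> K' \<in> H \<Longrightarrow> K \<noteq> K' \<Longrightarrow> {lo K<..<hi K} \<inter> {lo K'<..<hi K'} = {}"
        proof (rule line_partition[OF good True], goal_cases)
          case (1 H lo hi)
          show ?case by (rule 1(1)[OF 1(2-)])
        qed
        note * = * hits
        have HT: "H \<subseteq> T" "finite H" using *(1) finT by auto
        have sumS: "(\<Sum>F\<in>S. ?g K F x) = (\<Sum>F\<in>{F\<in>S. facet_hit i K F x \<in> F}. \<psi> (facet_hit i K F x))"
          if "finite S" for K S
          by (subst sum.inter_filter[OF that]) (intro sum.cong refl, simp add: hitset_def True)
        have ex: "(\<Sum>F\<in>exit_facets i K. ?g K F x) = (if K \<in> H then \<psi> (x + hi K *\<^sub>R axis i 1) else 0)" if K: "K \<in> T" for K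
        proof (cases "K \<in> H")
          case True
          from *(3)[OF True] obtain F where F: "{F\<in>exit_facets i K. facet_hit i K F x \<in> F} = {F}"
            "facet_hit i K F x = x + hi K *\<^sub>R axis i 1" by blast
          show ?thesis unfolding sumS[OF finite_exit_facets(1)[OF K]] F(1) using True F(2) by simp
        next
          case False
          then have "{F\<in>exit_facets i K. facet_hit i K F x \<in> F} = {}" using *(5)[of K] K by auto
          then show ?thesis unfolding sumS[OF finite_exit_facets(1)[OF K]] using False by (simp only: sum.empty if_False)
        qed
        have en: "(\<Sum>F\<in>entry_facets i K. ?g K F x) = (if K \<in> H then \<psi> (x + lo K *\<^sub>R axis i 1) else 0)" if K: "K \<in> T" for K
        proof (cases "K \<in> H")
          case True
          from *(4)[OF True] obtain F where F: "{F\<in>entry_facets i K. facet_hit i K F x \<in> F} = {F}"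
            "facet_hit i K F x = x + lo K *\<^sub>R axis i 1" by blast
          show ?thesis unfolding sumS[OF finite_exit_facets(2)[OF K]] F(1) using True F(2) by simp
        next
          case False
          then have "{F\<in>entry_facets i K. facet_hit i K F x \<in> F} = {}" using *(5)[of K] K by auto
          then show ?thesis unfolding sumS[OF finite_exit_facets(2)[OF K]] using False by (simp only: sum.empty if_False)
        qed
        have "(\<Sum>K\<in>H. \<psi> (x + hi K *\<^sub>R axis i 1) - \<psi> (x + lo K *\<^sub>R axis i 1))
            = \<psi> (x + (1 - x $ i) *\<^sub>R axis i 1) - \<psi> (x + (- x $ i) *\<^sub>R axis i 1)"
          using telescope_cover[OF HT(2) _ *(2) *(6) *(7), of "\<lambda>t. \<psi> (x + t *\<^sub>R axis i 1)"] by simp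
        also have "x + (1 - x $ i) *\<^sub>R axis i 1 = x + (- x $ i) *\<^sub>R axis i 1 + axis i 1"
          by (simp add: algebra_simps)
        also have "\<psi> \<dots> = \<psi> (x + (- x $ i) *\<^sub>R axis i 1)" using t unfolding trace_fun_def by blast
        finally have "(\<Sum>K\<in>H. \<psi> (x + hi K *\<^sub>R axis i 1)) = (\<Sum>K\<in>H. \<psi> (x + lo K *\<^sub>R axis i 1))"
          by (simp add: sum_subtractf)
        moreover have "T \<inter> {K. K \<in> H} = H" using HT by auto
        ultimately show ?thesis using finT by (simp add: ex en sum.If_cases)
      qed (simp add: hitset_def)
    qed
  qed
  also have "\<dots> = entry_integral i \<psi>"
    unfolding entry_integral_def hit_integral_def using int
    by (subst Bochner_Integration.integral_sum) (auto intro!: sum.cong Bochner_Integration.integrable_sum)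
  finally show ?thesis .
qed

definition facet_integrable :: "(real^3) set \<Rightarrow> real^3 \<Rightarrow> (real^3 \<Rightarrow> real) \<Rightarrow> bool" where
  "facet_integrable F n g \<longleftrightarrow> integrable (lebesgue_on {x + t *\<^sub>R n |x t. x \<in> F \<and> 0 \<le> t \<and> t \<le> 1}) (\<lambda>y. g (closest_point F y))"

text \<open>The irregular points of a facet do not contribute: the part of the prism above them is a null
  set. So the traces in the scheme may be replaced by any function that agrees at regular points.\<close>

lemma facet_integral_cong:
  assumes K: "K \<in> T" "F facet_of K" and eq: "\<And>y. y \<in> F \<Longrightarrow> regpt (facet_normal K F) y \<Longrightarrow> g y = g' y"
  shows "facet_integrable F (facet_normal K F) g \<longleftrightarrow> facet_integrable F (facet_normal K F) g'"
    "facet_integral F (facet_normal K F) g = facet_integral F (facet_normal K F) g'"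
proof -
  let ?n = "facet_normal K F" and ?c = "facet_offset K F"
  note fp = facet_props[OF K]
  have Fs: "F \<subseteq> {x. ?n \<bullet> x = ?c}" using fp(2) by blast
  have nn: "?n \<bullet> ?n = 1" using fp(1) by (simp add: norm_eq_1)
  let ?P = "{x + t *\<^sub>R ?n |x t. x \<in> F \<and> 0 \<le> t \<and> t \<le> 1}"
  let ?N = "{x. \<exists>s. x + s *\<^sub>R ?n \<in> F \<and> \<not> regpt ?n (x + s *\<^sub>R ?n)}"
  have P: "?P = {x. line_proj ?n ?n ?c x \<in> F \<and> 0 \<le> ?n \<bullet> x - ?c \<and> ?n \<bullet> x - ?c \<le> 1}"
    by (rule prism_eq[OF Fs fp(1)])
  have [measurable]: "F \<in> sets borel" using fp(5) by (simp add: borel_compact)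
  have "?P \<in> sets borel" unfolding P by measurable
  then have Pm: "?P \<in> sets lebesgue" by simp
  have N: "negligible ?N" by (rule negligible_irregular[OF K]) (simp add: nn)
  have "g (closest_point F y) = g' (closest_point F y)" if y: "y \<in> ?P - ?N" for y
  proof -
    have F: "line_proj ?n ?n ?c y \<in> F" using y unfolding P by simp
    have cp: "closest_point F y = line_proj ?n ?n ?c y"
      by (rule closest_point_prism[OF Fs fp(1) compact_imp_closed[OF fp(5)] fp(6) F])
    have "regpt ?n (line_proj ?n ?n ?c y)" using y F unfolding line_proj_def by blast
    then show ?thesis unfolding cp using eq F by blast
  qed
  from lebesgue_on_integral_spike[OF Pm N this]
  show "facet_integrable F ?n g \<longleftrightarrow> facet_integrable F ?n g'" "facet_integral F ?n g = facet_integral F ?n g'"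
    unfolding facet_integrable_def facet_integral_def by auto
qed

lemma facet_integral_hit_integral:
  assumes K: "K \<in> T" "F facet_of K" and n: "facet_normal K F $ i \<noteq> 0" and t: "\<psi> \<in> trace_fun i"
  shows "facet_integrable F (facet_normal K F) \<psi>" "\<bar>facet_normal K F $ i\<bar> * facet_integral F (facet_normal K F) \<psi> = hit_integral i K F \<psi>"
proof -
  note fp = facet_props[OF K]
  have Fs: "F \<subseteq> {x. facet_normal K F \<bullet> x = facet_offset K F}" using fp(2) by blast
  note fa = facet_area_formula[OF fp(5,6,8) Fs fp(1) n trace_fun_measurable[OF t]]
  show "facet_integrable F (facet_normal K F) \<psi>"
    using fa(1) trace_fun_hit_integral_integrable[OF K t] unfolding facet_integrable_def hitset_def facet_hit_def by blast
  show "\<bar>facet_normal K F $ i\<bar> * facet_integral F (facet_normal K F) \<psi> = hit_integral i K F \<psi>"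
    using fa(2) unfolding hit_integral_def hitset_def facet_hit_def .
qed

end

section \<open>Integration by parts over the mesh\<close>

context unit_cube_mesh
begin

lemma hit_integral_integrable_cont:
  fixes p :: "real^3 \<Rightarrow> real"
  assumes K: "K \<in> T" "F facet_of K" and p: "continuous_on UNIV p"
  shows "integrable lborel (\<lambda>x. indicator (hitset i K F) x * p (facet_hit i K F x))"
proof -
  have "compact (p ` cbox 0 1)" by (intro compact_continuous_image continuous_on_subset[OF p]) auto
  then obtain B where "\<And>y. y \<in> cbox 0 1 \<Longrightarrow> \<bar>p y\<bar> \<le> B" using compact_imp_bounded bounded_iff by (metis imageI real_norm_def)
  then show ?thesis
    using facet_props(8)[OF K] by (intro hit_integral_integrable[OF K borel_measurable_continuous_onI[OF p]]) auto
qed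

lemma lebesgue_on_elt:
  fixes g :: "real^3 \<Rightarrow> real"
  assumes K: "K \<in> T" and g: "continuous_on UNIV g"
  shows "integrable (lebesgue_on K) g" "integral\<^sup>L (lebesgue_on K) g = (LINT x|lborel. indicator K x * g x)"
    "integrable lborel (\<lambda>x. indicator K x * g x)"
proof -
  have Kb: "K \<in> sets borel" using compact_elt[OF K] by (simp add: borel_compact)
  show i: "integrable lborel (\<lambda>x. indicator K x * g x)"
    using borel_integrable_compact[OF compact_elt[OF K] continuous_on_subset[OF g]] by (simp add: set_integrable_def)
  have m: "(\<lambda>x. indicator K x * g x) \<in> borel_measurable lborel" using i by (rule borel_measurable_integrable)
  show "integrable (lebesgue_on K) g"
    using Kb i integrable_completion[OF m] by (simp add: integrable_restrict_space)
  show "integral\<^sup>L (lebesgue_on K) g = (LINT x|lborel. indicator K x * g x)"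
    using Kb integral_completion[OF m] by (simp add: integral_restrict_space)
qed

text \<open>The integral of \<open>p n\<^sub>i\<close> over the boundary of \<open>K\<close>.\<close>

definition boundary_flux :: "3 \<Rightarrow> (real^3) set \<Rightarrow> (real^3 \<Rightarrow> real) \<Rightarrow> real" where
  "boundary_flux i K p = (\<Sum>F\<in>exit_facets i K. hit_integral i K F p) - (\<Sum>F\<in>entry_facets i K. hit_integral i K F p)"

lemma boundary_flux_eq_integral:
  fixes p :: "real^3 \<Rightarrow> real"
  assumes K: "K \<in> T" and p: "continuous_on UNIV p"
  shows "boundary_flux i K p = (LINT x|lborel. (\<Sum>F\<in>exit_facets i K. indicator (hitset i K F) x * p (facet_hit i K F x))
      - (\<Sum>F\<in>entry_facets i K. indicator (hitset i K F) x * p (facet_hit i K F x)))" (is "_ = integral\<^sup>L lborel ?R")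
    and "integrable lborel (\<lambda>x. (\<Sum>F\<in>exit_facets i K. indicator (hitset i K F) x * p (facet_hit i K F x))
      - (\<Sum>F\<in>entry_facets i K. indicator (hitset i K F) x * p (facet_hit i K F x)))"
proof -
  have i: "integrable lborel (\<lambda>x. indicator (hitset i K F) x * p (facet_hit i K F x))" if "F \<in> exit_facets i K \<union> entry_facets i K" for F
    using that by (intro hit_integral_integrable_cont[OF K _ p]) (auto simp: exit_facets_def entry_facets_def)
  have i1: "integrable lborel (\<lambda>x. \<Sum>F\<in>exit_facets i K. indicator (hitset i K F) x * p (facet_hit i K F x))"
    "integrable lborel (\<lambda>x. \<Sum>F\<in>entry_facets i K. indicator (hitset i K F) x * p (facet_hit i K F x))"
    using i by (auto intro!: Bochner_Integration.integrable_sum)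
  then show "integrable lborel ?R" by (rule Bochner_Integration.integrable_diff)
  show "boundary_flux i K p = integral\<^sup>L lborel ?R"
    unfolding boundary_flux_def hit_integral_def Bochner_Integration.integral_diff[OF i1] using i
    by (subst (1 2) Bochner_Integration.integral_sum) auto
qed

text \<open>By \<open>line_segment\<close> only one exit and one entry facet are hit, at the two ends of the segment.\<close>

lemma boundary_flux_line:
  fixes p :: "real^3 \<Rightarrow> real"
  assumes good: "goodline i x" and x: "x \<in> cbox 0 1" and K: "K \<in> T"
  obtains "{t. x + t *\<^sub>R axis i 1 \<in> K} = {}"
    "(\<Sum>F\<in>exit_facets i K. indicator (hitset i K F) x * p (facet_hit i K F x))
      - (\<Sum>F\<in>entry_facets i K. indicator (hitset i K F) x * p (facet_hit i K F x)) = 0"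
  | lo hi where "lo < hi" "{t. x + t *\<^sub>R axis i 1 \<in> K} = {lo..hi}"
    "(\<Sum>F\<in>exit_facets i K. indicator (hitset i K F) x * p (facet_hit i K F x))
      - (\<Sum>F\<in>entry_facets i K. indicator (hitset i K F) x * p (facet_hit i K F x)) = p (x + hi *\<^sub>R axis i 1) - p (x + lo *\<^sub>R axis i 1)"
proof (cases "\<exists>t. x + t *\<^sub>R axis i 1 \<in> K")
  case False
  have "indicator (hitset i K F) x = (0::real)" if "F facet_of K" for F
    using that False facet_props(2)[OF K that] facet_hit_on_line[of i K F x] by (auto simp: hitset_def indicator_def)
  then have z: "(\<Sum>F\<in>exit_facets i K. indicator (hitset i K F) x * p (facet_hit i K F x))
      - (\<Sum>F\<in>entry_facets i K. indicator (hitset i K F) x * p (facet_hit i K F x)) = 0"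
    by (simp add: exit_facets_def entry_facets_def)
  have "{t. x + t *\<^sub>R axis i 1 \<in> K} = {}" using False by blast
  from that(1)[OF this z] show ?thesis .
next
  case True
  obtain lo hi Fh Fl where *: "lo < hi"
    "\<And>t. x + t *\<^sub>R axis i 1 \<in> K \<longleftrightarrow> lo \<le> t \<and> t \<le> hi"
    and "\<And>t. x + t *\<^sub>R axis i 1 \<in> interior K \<longleftrightarrow> lo < t \<and> t < hi"
    and hits: "{F. F facet_of K \<and> facet_normal K F $ i > 0 \<and> facet_hit i K F x \<in> F} = {Fh}"
    "facet_hit i K Fh x = x + hi *\<^sub>R axis i 1"
    "{F. F facet_of K \<and> facet_normal K F $ i < 0 \<and> facet_hit i K F x \<in> F} = {Fl}"
    "facet_hit i K Fl x = x + lo *\<^sub>R axis i 1"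
  proof (rule line_segment[OF good K True], goal_cases)
    case (1 lo hi Fh Fl)
    show ?case by (rule 1(1)[OF 1(2-)])
  qed
  note * = * hits
  have sumS: "(\<Sum>F\<in>S. indicator (hitset i K F) x * p (facet_hit i K F x)) = (\<Sum>F\<in>{F\<in>S. facet_hit i K F x \<in> F}. p (facet_hit i K F x))"
    if "finite S" for S
    by (subst sum.inter_filter[OF that]) (intro sum.cong refl, simp add: hitset_def x)
  have e: "{F\<in>exit_facets i K. facet_hit i K F x \<in> F} = {Fh}" "{F\<in>entry_facets i K. facet_hit i K F x \<in> F} = {Fl}"
    unfolding *(3)[symmetric] *(5)[symmetric] by (auto simp: exit_facets_def entry_facets_def)
  have "(\<Sum>F\<in>exit_facets i K. indicator (hitset i K F) x * p (facet_hit i K F x))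
      - (\<Sum>F\<in>entry_facets i K. indicator (hitset i K F) x * p (facet_hit i K F x)) = p (x + hi *\<^sub>R axis i 1) - p (x + lo *\<^sub>R axis i 1)"
    unfolding sumS[OF finite_exit_facets(1)[OF K]] sumS[OF finite_exit_facets(2)[OF K]] e using *(4,6) by simp
  moreover have "{t. x + t *\<^sub>R axis i 1 \<in> K} = {lo..hi}" by (simp only: *(2) set_eq_iff mem_Collect_eq atLeastAtMost_iff) simp
  ultimately show ?thesis using that(2)[OF *(1)] by (simp only:)
qed

text \<open>On almost every line the boundary flux is the increment of \<open>p\<close> along the segment in \<open>K\<close>, so
  the integral over the lines is the integral of the derivative. Fubini's theorem enters through
  \<open>nn_integral_line_adjoint\<close>; the sign condition allows working with nonnegative integrals.\<close>

lemma divergence_theorem_nonneg: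
  fixes p :: "real^3 \<Rightarrow> real"
  assumes K: "K \<in> T" and p: "real_polynomial_function p"
    and nn: "\<And>x. x \<in> K \<Longrightarrow> partial_deriv i p x \<ge> 0"
  shows "integral\<^sup>L (lebesgue_on K) (partial_deriv i p) = boundary_flux i K p"
proof -
  let ?q = "partial_deriv i p" and ?e = "axis i 1 :: real^3"
  let ?R = "\<lambda>x. (\<Sum>F\<in>exit_facets i K. indicator (hitset i K F) x * p (facet_hit i K F x))
      - (\<Sum>F\<in>entry_facets i K. indicator (hitset i K F) x * p (facet_hit i K F x))"
  have cp: "continuous_on UNIV p" and cq: "continuous_on UNIV ?q"
    using p partial_deriv_polynomial(1)[OF p] by (auto intro: real_polynomial_function_continuous)
  note [measurable] = borel_measurable_continuous_onI[OF cq]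
  have [measurable]: "K \<in> sets borel" using compact_elt[OF K] by (simp add: borel_compact)
  define h where "h z = indicator K z * ennreal (?q z)" for z
  have hm: "h \<in> borel_measurable borel" unfolding h_def by measurable
  have line: "h z * (\<integral>\<^sup>+s. indicator (cbox 0 1) (z + s *\<^sub>R ?e) \<partial>lborel) = h z" for z
  proof (cases "z \<in> K")
    case True
    then have *: "z + s *\<^sub>R ?e \<in> cbox 0 1 \<longleftrightarrow> 0 \<le> z $ i + s \<and> z $ i + s \<le> 1" for s
      using subset_cube[OF K] cube_line[of z 0 i s] by auto
    have "(\<integral>\<^sup>+s. indicator (cbox 0 1) (z + s *\<^sub>R ?e) \<partial>lborel) = (1::ennreal)"
      unfolding emeasure_lborel_unit_interval[of "z $ i", symmetric]
      by (intro nn_integral_cong) (simp only: indicator_def * mem_Collect_eq)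
    then show ?thesis by simp
  qed (simp add: h_def)
  have "(\<integral>\<^sup>+z. h z \<partial>lborel) = (\<integral>\<^sup>+z. h z * (\<integral>\<^sup>+s. indicator (cbox 0 1) (z + s *\<^sub>R ?e) \<partial>lborel) \<partial>lborel)"
    unfolding line ..
  also have "\<dots> = (\<integral>\<^sup>+z. indicator (cbox 0 1) z * (\<integral>\<^sup>+s. h (z + s *\<^sub>R ?e) \<partial>lborel) \<partial>lborel)"
    by (rule nn_integral_line_adjoint[OF hm]) simp
  also have "\<dots> = (\<integral>\<^sup>+z. ennreal (?R z) \<partial>lborel)"
  proof (rule nn_integral_cong_AE)
    show "AE z in lborel. indicator (cbox 0 1) z * (\<integral>\<^sup>+s. h (z + s *\<^sub>R ?e) \<partial>lborel) = ennreal (?R z)"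
      using AE_goodline[of i]
    proof eventually_elim
      case good: (elim z)
      show ?case
      proof (cases "z \<in> cbox 0 1")
        case True
        show ?thesis
        proof (rule boundary_flux_line[OF good True K, of p])
          assume *: "{t. z + t *\<^sub>R ?e \<in> K} = {}" "?R z = 0"
          then have "h (z + s *\<^sub>R ?e) = 0" for s by (auto simp: h_def)
          then show ?thesis using * by simp
        next
          fix lo hi assume *: "lo < hi" "{t. z + t *\<^sub>R ?e \<in> K} = {lo..hi}" "?R z = p (z + hi *\<^sub>R ?e) - p (z + lo *\<^sub>R ?e)"
          have mem: "z + s *\<^sub>R ?e \<in> K \<longleftrightarrow> s \<in> {lo..hi}" for s using *(2) by blast
          have "((\<lambda>s. ?q (z + s *\<^sub>R ?e)) has_integral (p (z + hi *\<^sub>R ?e) - p (z + lo *\<^sub>R ?e))) {lo..hi}"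
            using *(1) partial_deriv_polynomial(2)[OF p, of z i]
            by (intro fundamental_theorem_of_calculus)
              (auto simp flip: has_real_derivative_iff_has_vector_derivative intro: DERIV_subset)
          from nn_integral_has_integral_lebesgue'[OF _ this]
          have "(\<integral>\<^sup>+s. ennreal (?q (z + s *\<^sub>R ?e)) * indicator {lo..hi} s \<partial>lborel) = ennreal (p (z + hi *\<^sub>R ?e) - p (z + lo *\<^sub>R ?e))"
            using nn mem by blast
          moreover have "h (z + s *\<^sub>R ?e) = ennreal (?q (z + s *\<^sub>R ?e)) * indicator {lo..hi} s" for s
            using mem[of s] by (simp add: h_def indicator_def)
          ultimately show ?thesis using True *(3) by simp
        qed
      next
        case False
        then show ?thesis by (simp add: hitset_def)
      qed
    qed
  qed
  finally have eq: "(\<integral>\<^sup>+z. h z \<partial>lborel) = (\<integral>\<^sup>+z. ennreal (?R z) \<partial>lborel)" .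
  have Rnn: "AE z in lborel. 0 \<le> ?R z"
    using AE_goodline[of i]
  proof eventually_elim
    case good: (elim z)
    show ?case
    proof (cases "z \<in> cbox 0 1")
      case True
      show ?thesis
      proof (rule boundary_flux_line[OF good True K, of p])
        fix lo hi assume *: "lo < hi" "{t. z + t *\<^sub>R ?e \<in> K} = {lo..hi}" "?R z = p (z + hi *\<^sub>R ?e) - p (z + lo *\<^sub>R ?e)"
        have "p (z + lo *\<^sub>R ?e) \<le> p (z + hi *\<^sub>R ?e)"
        proof (rule DERIV_nonneg_imp_nondecreasing[of lo hi "\<lambda>s. p (z + s *\<^sub>R ?e)"])
          fix s assume "lo \<le> s" "s \<le> hi"
          then have "z + s *\<^sub>R ?e \<in> K" using *(2) by auto
          then show "\<exists>y. ((\<lambda>s. p (z + s *\<^sub>R ?e)) has_real_derivative y) (at s) \<and> 0 \<le> y"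
            using partial_deriv_polynomial(2)[OF p, of z i s] nn by blast
        qed (use * in simp)
        then show ?thesis using *(3) by simp
      qed simp
    qed (simp add: hitset_def)
  qed
  have "integral\<^sup>L (lebesgue_on K) ?q = (LINT x|lborel. indicator K x * ?q x)"
    by (rule lebesgue_on_elt(2)[OF K cq])
  also have "\<dots> = enn2real (\<integral>\<^sup>+x. ennreal (indicator K x * ?q x) \<partial>lborel)"
    by (rule integral_eq_nn_integral) (auto simp: indicator_def nn)
  also have "(\<integral>\<^sup>+x. ennreal (indicator K x * ?q x) \<partial>lborel) = (\<integral>\<^sup>+z. h z \<partial>lborel)"
    by (intro nn_integral_cong) (simp add: h_def indicator_def)
  also have "enn2real \<dots> = (LINT x|lborel. ?R x)"
    unfolding eq using boundary_flux_eq_integral(2)[OF K cp] by (intro integral_eq_nn_integral[symmetric] Rnn) auto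
  also have "\<dots> = boundary_flux i K p" by (rule boundary_flux_eq_integral(1)[OF K cp, symmetric])
  finally show ?thesis .
qed

lemma partial_deriv_add_mult:
  assumes "real_polynomial_function p" "real_polynomial_function q"
  shows "partial_deriv i (\<lambda>x. p x + q x) x = partial_deriv i p x + partial_deriv i q x"
    "partial_deriv i (\<lambda>x. p x * q x) x = partial_deriv i p x * q x + p x * partial_deriv i q x"
proof -
  note d = partial_deriv_polynomial(2)[OF assms(1), of x i 0, simplified] partial_deriv_polynomial(2)[OF assms(2), of x i 0, simplified]
  show "partial_deriv i (\<lambda>x. p x + q x) x = partial_deriv i p x + partial_deriv i q x"
    using DERIV_add[OF d] unfolding partial_deriv_def[of i "\<lambda>x. p x + q x"] by (rule DERIV_imp_deriv)
  have "((\<lambda>t. p (x + t *\<^sub>R axis i 1) * q (x + t *\<^sub>R axis i 1)) has_real_derivative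
      partial_deriv i p x * q x + p x * partial_deriv i q x) (at 0)"
    using DERIV_mult[OF d] by (simp add: mult.commute)
  then show "partial_deriv i (\<lambda>x. p x * q x) x = partial_deriv i p x * q x + p x * partial_deriv i q x"
    unfolding partial_deriv_def[of i "\<lambda>x. p x * q x"] by (rule DERIV_imp_deriv)
qed

text \<open>Adding a multiple of \<open>x\<^sub>i\<close> makes the derivative nonnegative on \<open>K\<close>, and both sides are additive.\<close>

lemma divergence_theorem:
  fixes p :: "real^3 \<Rightarrow> real"
  assumes K: "K \<in> T" and p: "real_polynomial_function p"
  shows "integral\<^sup>L (lebesgue_on K) (partial_deriv i p) = boundary_flux i K p"
proof -
  let ?q = "partial_deriv i p"
  have cq: "continuous_on UNIV ?q" and cp: "continuous_on UNIV p"
    using p partial_deriv_polynomial(1)[OF p] by (auto intro: real_polynomial_function_continuous)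
  have "compact (?q ` K)" by (intro compact_continuous_image continuous_on_subset[OF cq] compact_elt K) auto
  then obtain B where B: "\<And>y. y \<in> K \<Longrightarrow> \<bar>?q y\<bar> \<le> B" using compact_imp_bounded bounded_iff by (metis imageI real_norm_def)
  \<comment> \<open>\<open>B\<close> bounds the derivative of \<open>p\<close> on \<open>K\<close>.\<close>
  let ?b = "\<lambda>x::real^3. \<bar>B\<bar> * x $ i"
  have b: "real_polynomial_function ?b"
    by (intro real_polynomial_function.intros(4) real_polynomial_function.intros(2) real_polynomial_function.intros(1) bounded_linear_vec_nth)
  have db: "partial_deriv i ?b x = \<bar>B\<bar>" for x
    unfolding partial_deriv_def by (rule DERIV_imp_deriv) (auto intro!: derivative_eq_intros)
  have pb: "real_polynomial_function (\<lambda>x. p x + ?b x)" using p b by (rule real_polynomial_function.intros(3))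
  have cb: "continuous_on UNIV ?b" by (intro continuous_intros)
  have "integral\<^sup>L (lebesgue_on K) (partial_deriv i (\<lambda>x. p x + ?b x)) = boundary_flux i K (\<lambda>x. p x + ?b x)"
  proof (rule divergence_theorem_nonneg[OF K pb])
    fix x assume "x \<in> K"
    then show "0 \<le> partial_deriv i (\<lambda>x. p x + ?b x) x"
      unfolding partial_deriv_add_mult(1)[OF p b] db using B[of x] by linarith
  qed
  moreover have "integral\<^sup>L (lebesgue_on K) (partial_deriv i ?b) = boundary_flux i K ?b"
    by (rule divergence_theorem_nonneg[OF K b]) (simp add: db)
  moreover have "partial_deriv i (\<lambda>x. p x + ?b x) = (\<lambda>x. ?q x + partial_deriv i ?b x)"
    by (rule ext) (rule partial_deriv_add_mult(1)[OF p b])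
  moreover have "integral\<^sup>L (lebesgue_on K) (\<lambda>x. ?q x + partial_deriv i ?b x)
      = integral\<^sup>L (lebesgue_on K) ?q + integral\<^sup>L (lebesgue_on K) (partial_deriv i ?b)"
    using lebesgue_on_elt(1)[OF K cq] lebesgue_on_elt(1)[OF K, of "partial_deriv i ?b"] unfolding db
    by (intro Bochner_Integration.integral_add) auto
  moreover have "boundary_flux i K (\<lambda>x. p x + ?b x) = boundary_flux i K p + boundary_flux i K ?b"
  proof -
    have "hit_integral i K F (\<lambda>x. p x + ?b x) = hit_integral i K F p + hit_integral i K F ?b" if "F facet_of K" for F
      unfolding hit_integral_def distrib_left
      by (rule Bochner_Integration.integral_add[OF hit_integral_integrable_cont[OF K that cp] hit_integral_integrable_cont[OF K that cb]])
    then have "(\<Sum>F\<in>exit_facets i K. hit_integral i K F (\<lambda>x. p x + ?b x)) = (\<Sum>F\<in>exit_facets i K. hit_integral i K F p) + (\<Sum>F\<in>exit_facets i K. hit_integral i K F ?b)"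
      "(\<Sum>F\<in>entry_facets i K. hit_integral i K F (\<lambda>x. p x + ?b x)) = (\<Sum>F\<in>entry_facets i K. hit_integral i K F p) + (\<Sum>F\<in>entry_facets i K. hit_integral i K F ?b)"
      unfolding sum.distrib[symmetric] by (auto simp: exit_facets_def entry_facets_def intro!: sum.cong)
    then show ?thesis by (simp add: boundary_flux_def)
  qed
  ultimately show ?thesis by simp
qed

definition avg :: "3 \<Rightarrow> (real^3 \<Rightarrow> real) \<Rightarrow> real^3 \<Rightarrow> real" where
  "avg i v y = (tr (axis i 1) v y + tr (- axis i 1) v y) / 2"

definition jmp :: "3 \<Rightarrow> (real^3 \<Rightarrow> real) \<Rightarrow> real^3 \<Rightarrow> real" where
  "jmp i v y = tr (axis i 1) v y - tr (- axis i 1) v y"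

text \<open>The average and jump forms use the traces along the \<open>i\<close>-th axis, from the right minus from the left,
  in place of those along the normal. On a facet with \<open>n\<^sub>i < 0\<close> the sign of the jump changes along with
  the sign of \<open>n\<^sub>i\<close>, so both forms count every interface once, with a weight \<open>|n\<^sub>i|\<close>.\<close>

definition avg_form :: "3 \<Rightarrow> (real^3 \<Rightarrow> real) \<Rightarrow> (real^3 \<Rightarrow> real) \<Rightarrow> real" where
  "avg_form i v w = exit_integral i (\<lambda>y. avg i v y * jmp i w y)"

definition jump_form :: "3 \<Rightarrow> (real^3 \<Rightarrow> real) \<Rightarrow> (real^3 \<Rightarrow> real) \<Rightarrow> real" where
  "jump_form i v w = exit_integral i (\<lambda>y. jmp i v y * jmp i w y)"

definition vol_form :: "3 \<Rightarrow> (real^3 \<Rightarrow> real) \<Rightarrow> (real^3 \<Rightarrow> real) \<Rightarrow> real" where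
  "vol_form i v w = (\<Sum>K\<in>T. integral\<^sup>L (lebesgue_on K) (\<lambda>x. v x * partial_deriv i w x))"

lemma trace_fun_avg_jmp: assumes "v \<in> PW" shows "avg i v \<in> trace_fun i" "jmp i v \<in> trace_fun i"
proof -
  have "(\<lambda>y. 1/2 * (tr (axis i 1) v y + tr (- axis i 1) v y)) \<in> trace_fun i"
    by (intro trace_fun_cmult trace_fun_add trace_fun_tr[OF assms]) auto
  then show "avg i v \<in> trace_fun i" by (simp add: avg_def[abs_def])
  show "jmp i v \<in> trace_fun i" unfolding jmp_def using trace_fun_tr[OF assms] by (auto intro!: trace_fun_diff)
qed

lemma elt_spike:
  fixes f g :: "real^3 \<Rightarrow> real"
  assumes K: "K \<in> T" and eq: "\<And>x. x \<in> interior K \<Longrightarrow> f x = g x"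
  shows "integral\<^sup>L (lebesgue_on K) f = integral\<^sup>L (lebesgue_on K) g"
    "integrable (lebesgue_on K) f \<longleftrightarrow> integrable (lebesgue_on K) g"
proof -
  have N: "negligible (frontier K)" by (rule negligible_convex_frontier[OF convex_elt[OF K]])
  have Ks: "K \<in> sets lebesgue" using closed_elt[OF K] by (simp add: borel_closed)
  have *: "f x = g x" if "x \<in> K - frontier K" for x
    using that closed_elt[OF K] by (intro eq) (auto simp: frontier_def)
  show "integral\<^sup>L (lebesgue_on K) f = integral\<^sup>L (lebesgue_on K) g"
    "integrable (lebesgue_on K) f \<longleftrightarrow> integrable (lebesgue_on K) g"
    using lebesgue_on_integral_spike[OF Ks N *] by auto
qed

lemma partial_deriv_pol:
  assumes "w \<in> PW" "K \<in> T" "x \<in> interior K"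
  shows "partial_deriv i w x = partial_deriv i (pol w K) x"
  using assms pol_props(2)[OF assms(1,2)] by (intro partial_deriv_local[of "interior K"]) auto

lemma vol_form_pol:
  assumes "v \<in> PW" "w \<in> PW"
  shows "vol_form i v w = (\<Sum>K\<in>T. integral\<^sup>L (lebesgue_on K) (\<lambda>x. pol v K x * partial_deriv i (pol w K) x))"
    "K \<in> T \<Longrightarrow> integrable (lebesgue_on K) (\<lambda>x. v x * partial_deriv i w x)"
proof -
  have eq: "v x * partial_deriv i w x = pol v K x * partial_deriv i (pol w K) x" if "K \<in> T" "x \<in> interior K" for K x
    using partial_deriv_pol[OF assms(2) that] pol_props(2)[OF assms(1) that] by simp
  show "vol_form i v w = (\<Sum>K\<in>T. integral\<^sup>L (lebesgue_on K) (\<lambda>x. pol v K x * partial_deriv i (pol w K) x))"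
    unfolding vol_form_def by (intro sum.cong refl elt_spike(1) eq)
  show "integrable (lebesgue_on K) (\<lambda>x. v x * partial_deriv i w x)" if K: "K \<in> T"
    by (rule iffD2[OF elt_spike(2)[OF K eq[OF K]]], assumption, intro lebesgue_on_elt(1)[OF K] continuous_on_mult pol_continuous[OF assms(1) K]
        real_polynomial_function_continuous[OF partial_deriv_polynomial(1)[OF pol_props(1)[OF assms(2) K]]])
qed

text \<open>The divergence theorem for the product on each element produces inner traces: left traces at
  exits, right traces at entries. Moving the entries to the exits by
  \<open>exit_integral_eq_entry_integral\<close> leaves the jump of the product, which is the sum of the products
  of averages and jumps.\<close>

lemma integration_by_parts:
  assumes v: "v \<in> PW" and w: "w \<in> PW"
  shows "vol_form i v w + vol_form i w v = - (avg_form i v w + avg_form i w v)"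
proof -
  let ?r = "axis i 1 :: real^3" and ?l = "- axis i 1 :: real^3"
  let ?A = "\<lambda>y. tr ?l v y * tr ?l w y" and ?B = "\<lambda>y. tr ?r v y * tr ?r w y"
  have tA: "?A \<in> trace_fun i" and tB: "?B \<in> trace_fun i" using trace_fun_tr[OF v] trace_fun_tr[OF w] by (auto intro!: trace_fun_mult)
  have "integral\<^sup>L (lebesgue_on K) (\<lambda>x. pol v K x * partial_deriv i (pol w K) x)
      + integral\<^sup>L (lebesgue_on K) (\<lambda>x. pol w K x * partial_deriv i (pol v K) x)
      = (\<Sum>F\<in>exit_facets i K. hit_integral i K F ?A) - (\<Sum>F\<in>entry_facets i K. hit_integral i K F ?B)" if K: "K \<in> T" for K
  proof -
    note pp = pol_props(1)[OF v K] pol_props(1)[OF w K]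
    have c: "continuous_on UNIV (\<lambda>x. pol v K x * partial_deriv i (pol w K) x)"
      "continuous_on UNIV (\<lambda>x. pol w K x * partial_deriv i (pol v K) x)"
      by (intro continuous_on_mult pol_continuous[OF v K] pol_continuous[OF w K]
          real_polynomial_function_continuous[OF partial_deriv_polynomial(1)] pp)+
    have "integral\<^sup>L (lebesgue_on K) (\<lambda>x. pol v K x * partial_deriv i (pol w K) x)
      + integral\<^sup>L (lebesgue_on K) (\<lambda>x. pol w K x * partial_deriv i (pol v K) x)
      = integral\<^sup>L (lebesgue_on K) (\<lambda>x. pol v K x * partial_deriv i (pol w K) x + pol w K x * partial_deriv i (pol v K) x)"
      by (rule Bochner_Integration.integral_add[symmetric]) (rule lebesgue_on_elt(1)[OF K], rule c)+
    also have "\<dots> = integral\<^sup>L (lebesgue_on K) (partial_deriv i (\<lambda>x. pol v K x * pol w K x))"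
      by (intro arg_cong[of _ _ "integral\<^sup>L _"] ext) (simp add: partial_deriv_add_mult(2)[OF pp] mult.commute)
    also have "\<dots> = boundary_flux i K (\<lambda>x. pol v K x * pol w K x)"
      by (intro divergence_theorem[OF K] real_polynomial_function.intros(4) pp)
    also have "\<dots> = (\<Sum>F\<in>exit_facets i K. hit_integral i K F ?A) - (\<Sum>F\<in>entry_facets i K. hit_integral i K F ?B)"
    proof -
      have m: "(\<lambda>x. pol v K x * pol w K x) \<in> borel_measurable borel"
        by (intro borel_measurable_continuous_onI continuous_on_mult pol_continuous v w K)
      have 1: "hit_integral i K F (\<lambda>x. pol v K x * pol w K x) = hit_integral i K F ?A" if "F \<in> exit_facets i K" for F
      proof -
        have F: "F facet_of K" "facet_normal K F \<bullet> ?l < 0" using that by (auto simp: exit_facets_def inner_axis)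
        show ?thesis
          using facet_inner_trace[OF K F(1) _ _ _ F(2)] v w
          by (intro hit_integral_cong[OF K F(1) m trace_fun_measurable[OF tA]]) simp
      qed
      have 2: "hit_integral i K F (\<lambda>x. pol v K x * pol w K x) = hit_integral i K F ?B" if "F \<in> entry_facets i K" for F
      proof -
        have F: "F facet_of K" "facet_normal K F \<bullet> ?r < 0" using that by (auto simp: entry_facets_def inner_axis)
        show ?thesis
          using facet_inner_trace[OF K F(1) _ _ _ F(2)] v w
          by (intro hit_integral_cong[OF K F(1) m trace_fun_measurable[OF tB]]) simp
      qed
      show ?thesis unfolding boundary_flux_def using 1 2 by simp
    qed
    finally show ?thesis .
  qed
  then have "vol_form i v w + vol_form i w v = exit_integral i ?A - entry_integral i ?B"
    unfolding vol_form_pol(1)[OF v w] vol_form_pol(1)[OF w v] exit_integral_def entry_integral_def by (simp add: sum.distrib[symmetric] sum_subtractf)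
  also have "\<dots> = exit_integral i (\<lambda>y. ?A y - ?B y)" by (simp add: exit_integral_eq_entry_integral[OF tB, symmetric] exit_integral_diff[OF tA tB])
  also have "(\<lambda>y. ?A y - ?B y) = (\<lambda>y. (-1) * (avg i v y * jmp i w y + avg i w y * jmp i v y))"
    by (auto simp: avg_def jmp_def field_simps)
  also have "exit_integral i \<dots> = - (avg_form i v w + avg_form i w v)"
    unfolding exit_integral_cmult avg_form_def using trace_fun_avg_jmp[OF v] trace_fun_avg_jmp[OF w] by (subst exit_integral_add) (auto intro!: trace_fun_mult)
  finally show ?thesis .
qed

text \<open>At regular points the traces along the normal are the traces along the coordinate axis to the
  same side. For \<open>n\<^sub>i < 0\<close> the outer side is the left one, which accounts for the signs.\<close>

lemma facet_trace_terms:
  assumes K: "K \<in> T" "F facet_of K" and U: "(\<lambda>x. U x a) \<in> PW" and W: "(\<lambda>x. W x b) \<in> PW"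
    and n: "n = facet_normal K F"
  shows "facet_integrable F n (\<lambda>y. trace_avg n U y a * inner_trace n W y b)"
    "facet_integrable F n (\<lambda>y. trace_jump n U y a * inner_trace n W y b)"
    "n $ i > 0 \<Longrightarrow> n $ i * facet_integral F n (\<lambda>y. trace_avg n U y a * inner_trace n W y b)
      = hit_integral i K F (\<lambda>y. avg i (\<lambda>x. U x a) y * tr (- axis i 1) (\<lambda>x. W x b) y)"
    "n $ i > 0 \<Longrightarrow> \<bar>n $ i\<bar> * facet_integral F n (\<lambda>y. trace_jump n U y a * inner_trace n W y b)
      = hit_integral i K F (\<lambda>y. jmp i (\<lambda>x. U x a) y * tr (- axis i 1) (\<lambda>x. W x b) y)"
    "n $ i < 0 \<Longrightarrow> n $ i * facet_integral F n (\<lambda>y. trace_avg n U y a * inner_trace n W y b)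
      = - hit_integral i K F (\<lambda>y. avg i (\<lambda>x. U x a) y * tr (axis i 1) (\<lambda>x. W x b) y)"
    "n $ i < 0 \<Longrightarrow> \<bar>n $ i\<bar> * facet_integral F n (\<lambda>y. trace_jump n U y a * inner_trace n W y b)
      = - hit_integral i K F (\<lambda>y. jmp i (\<lambda>x. U x a) y * tr (axis i 1) (\<lambda>x. W x b) y)"
proof -
  note fp = facet_props[OF K]
  let ?u = "\<lambda>x. U x a" and ?w = "\<lambda>x. W x b"
  have n0: "n \<noteq> 0" "n \<bullet> n = 1" using fp(1) by (auto simp: n norm_eq_1)
  have oi: "outer_trace n U y a = tr n ?u y" "inner_trace n U y a = tr (- n) ?u y" "inner_trace n W y b = tr (- n) ?w y"
    if "y \<in> F" "regpt n y" for y
    using outer_inner_trace[OF _ that(2) n0(1), of U a] outer_inner_trace[OF _ that(2) n0(1), of W b] U W that(1) fp(8) by auto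
  have side: "tr n v y = tr d v y" "tr (- n) v y = tr (- d) v y" if "y \<in> F" "regpt n y" "v \<in> PW" "n \<bullet> d > 0" for y v d
  proof -
    have y: "y \<in> cbox 0 1" using that fp(8) by auto
    show "tr n v y = tr d v y" by (rule regular_trace_same_side[OF y that(2,3)]) (use that n0 in auto)
    show "tr (- n) v y = tr (- d) v y" using that n0
      by (intro regular_trace_same_side[OF y _ that(3), of "- n"]) (auto simp: regpt_minus)
  qed
  have pos: "facet_integrable F n (\<lambda>y. trace_avg n U y a * inner_trace n W y b)"
    "facet_integrable F n (\<lambda>y. trace_jump n U y a * inner_trace n W y b)"
    "n $ i * facet_integral F n (\<lambda>y. trace_avg n U y a * inner_trace n W y b)
      = hit_integral i K F (\<lambda>y. avg i ?u y * tr (- axis i 1) ?w y)"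
    "\<bar>n $ i\<bar> * facet_integral F n (\<lambda>y. trace_jump n U y a * inner_trace n W y b)
      = hit_integral i K F (\<lambda>y. jmp i ?u y * tr (- axis i 1) ?w y)" if ni: "n $ i > 0" for i
  proof -
    have d: "n \<bullet> axis i 1 > 0" using ni by (simp add: inner_axis)
    have 1: "trace_avg n U y a * inner_trace n W y b = avg i ?u y * tr (- axis i 1) ?w y"
      "trace_jump n U y a * inner_trace n W y b = jmp i ?u y * tr (- axis i 1) ?w y"
      if "y \<in> F" "regpt (facet_normal K F) y" for y
      using oi[OF that[folded n]] side[OF that[folded n] U d] side[OF that[folded n] W d]
      by (simp_all add: trace_avg_def trace_jump_def avg_def jmp_def)
    have t: "(\<lambda>y. avg i ?u y * tr (- axis i 1) ?w y) \<in> trace_fun i" "(\<lambda>y. jmp i ?u y * tr (- axis i 1) ?w y) \<in> trace_fun i"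
      using trace_fun_avg_jmp[OF U] trace_fun_tr[OF W] by (auto intro!: trace_fun_mult)
    have ni': "facet_normal K F $ i \<noteq> 0" using ni n by simp
    show "facet_integrable F n (\<lambda>y. trace_avg n U y a * inner_trace n W y b)"
      unfolding n using facet_integral_cong(1)[OF K 1(1)] facet_integral_hit_integral(1)[OF K ni' t(1)] n by simp
    show "facet_integrable F n (\<lambda>y. trace_jump n U y a * inner_trace n W y b)"
      unfolding n using facet_integral_cong(1)[OF K 1(2)] facet_integral_hit_integral(1)[OF K ni' t(2)] n by simp
    show "n $ i * facet_integral F n (\<lambda>y. trace_avg n U y a * inner_trace n W y b)
      = hit_integral i K F (\<lambda>y. avg i ?u y * tr (- axis i 1) ?w y)"
      using facet_integral_cong(2)[OF K 1(1)] facet_integral_hit_integral(2)[OF K ni' t(1)] ni n by simp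
    show "\<bar>n $ i\<bar> * facet_integral F n (\<lambda>y. trace_jump n U y a * inner_trace n W y b)
      = hit_integral i K F (\<lambda>y. jmp i ?u y * tr (- axis i 1) ?w y)"
      using facet_integral_cong(2)[OF K 1(2)] facet_integral_hit_integral(2)[OF K ni' t(2)] n by simp
  qed
  have neg: "facet_integrable F n (\<lambda>y. trace_avg n U y a * inner_trace n W y b)"
    "facet_integrable F n (\<lambda>y. trace_jump n U y a * inner_trace n W y b)"
    "n $ i * facet_integral F n (\<lambda>y. trace_avg n U y a * inner_trace n W y b)
      = - hit_integral i K F (\<lambda>y. avg i ?u y * tr (axis i 1) ?w y)"
    "\<bar>n $ i\<bar> * facet_integral F n (\<lambda>y. trace_jump n U y a * inner_trace n W y b)
      = - hit_integral i K F (\<lambda>y. jmp i ?u y * tr (axis i 1) ?w y)" if ni: "n $ i < 0" for i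
  proof -
    have d: "n \<bullet> - axis i 1 > 0" using ni by (simp add: inner_axis)
    have 1: "trace_avg n U y a * inner_trace n W y b = avg i ?u y * tr (axis i 1) ?w y"
      "trace_jump n U y a * inner_trace n W y b = (-1) * (jmp i ?u y * tr (axis i 1) ?w y)"
      if "y \<in> F" "regpt (facet_normal K F) y" for y
    proof -
      have o: "outer_trace n U y a = tr (- axis i 1) ?u y" "inner_trace n U y a = tr (axis i 1) ?u y"
        "inner_trace n W y b = tr (axis i 1) ?w y"
        using oi[OF that[folded n]] side[OF that[folded n] U d] side(2)[OF that[folded n] W d] by simp_all
      show "trace_avg n U y a * inner_trace n W y b = avg i ?u y * tr (axis i 1) ?w y"
        unfolding trace_avg_def o avg_def by simp
      show "trace_jump n U y a * inner_trace n W y b = (-1) * (jmp i ?u y * tr (axis i 1) ?w y)"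
        unfolding trace_jump_def o jmp_def by (simp add: left_diff_distrib)
    qed
    have t: "(\<lambda>y. avg i ?u y * tr (axis i 1) ?w y) \<in> trace_fun i" "(\<lambda>y. (-1) * (jmp i ?u y * tr (axis i 1) ?w y)) \<in> trace_fun i"
      by (intro trace_fun_cmult trace_fun_mult trace_fun_avg_jmp[OF U] trace_fun_tr[OF W]; simp)+
    have ni': "facet_normal K F $ i \<noteq> 0" using ni n by simp
    show "facet_integrable F n (\<lambda>y. trace_avg n U y a * inner_trace n W y b)"
      unfolding n using facet_integral_cong(1)[OF K 1(1)] facet_integral_hit_integral(1)[OF K ni' t(1)] n by simp
    show "facet_integrable F n (\<lambda>y. trace_jump n U y a * inner_trace n W y b)"
      unfolding n using facet_integral_cong(1)[OF K 1(2)] facet_integral_hit_integral(1)[OF K ni' t(2)] n by simp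
    show "n $ i * facet_integral F n (\<lambda>y. trace_avg n U y a * inner_trace n W y b)
      = - hit_integral i K F (\<lambda>y. avg i ?u y * tr (axis i 1) ?w y)"
      using facet_integral_cong(2)[OF K 1(1)] facet_integral_hit_integral(2)[OF K ni' t(1)] ni n by simp
    show "\<bar>n $ i\<bar> * facet_integral F n (\<lambda>y. trace_jump n U y a * inner_trace n W y b)
      = - hit_integral i K F (\<lambda>y. jmp i ?u y * tr (axis i 1) ?w y)"
      using facet_integral_cong(2)[OF K 1(2)] facet_integral_hit_integral(2)[OF K ni' t(2)] n
        hit_integral_cmult[of i K F "-1" "\<lambda>y. jmp i ?u y * tr (axis i 1) ?w y"] by simp
  qed
  obtain j where j: "n $ j \<noteq> 0" using n0(1) by (auto simp: vec_eq_iff)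
  have "facet_integrable F n (\<lambda>y. trace_avg n U y a * inner_trace n W y b) \<and>
    facet_integrable F n (\<lambda>y. trace_jump n U y a * inner_trace n W y b)"
  proof (cases "n $ j > 0")
    case True
    show ?thesis by (intro conjI pos(1)[OF True] pos(2)[OF True])
  next
    case False
    then have ni: "n $ j < 0" using j by simp
    show ?thesis by (intro conjI neg(1)[OF ni] neg(2)[OF ni])
  qed
  then show "facet_integrable F n (\<lambda>y. trace_avg n U y a * inner_trace n W y b)"
    "facet_integrable F n (\<lambda>y. trace_jump n U y a * inner_trace n W y b)" by blast+
  show "n $ i > 0 \<Longrightarrow> n $ i * facet_integral F n (\<lambda>y. trace_avg n U y a * inner_trace n W y b)
      = hit_integral i K F (\<lambda>y. avg i (\<lambda>x. U x a) y * tr (- axis i 1) (\<lambda>x. W x b) y)" by (rule pos)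
  show "n $ i > 0 \<Longrightarrow> \<bar>n $ i\<bar> * facet_integral F n (\<lambda>y. trace_jump n U y a * inner_trace n W y b)
      = hit_integral i K F (\<lambda>y. jmp i (\<lambda>x. U x a) y * tr (- axis i 1) (\<lambda>x. W x b) y)" by (rule pos)
  show "n $ i < 0 \<Longrightarrow> n $ i * facet_integral F n (\<lambda>y. trace_avg n U y a * inner_trace n W y b)
      = - hit_integral i K F (\<lambda>y. avg i (\<lambda>x. U x a) y * tr (axis i 1) (\<lambda>x. W x b) y)" by (rule neg)
  show "n $ i < 0 \<Longrightarrow> \<bar>n $ i\<bar> * facet_integral F n (\<lambda>y. trace_jump n U y a * inner_trace n W y b)
      = - hit_integral i K F (\<lambda>y. jmp i (\<lambda>x. U x a) y * tr (axis i 1) (\<lambda>x. W x b) y)" by (rule neg)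
qed

text \<open>Summing over all elements, an interface contributes the left trace of the test function from the
  element that is left and, with the opposite sign, its right trace from the element that is entered.\<close>

lemma face_terms:
  assumes U: "(\<lambda>x. U x a) \<in> PW" and W: "(\<lambda>x. W x b) \<in> PW"
  shows "(\<Sum>K\<in>T. \<Sum>F | F facet_of K. facet_normal K F $ i *
      facet_integral F (facet_normal K F) (\<lambda>y. trace_avg (facet_normal K F) U y a * inner_trace (facet_normal K F) W y b))
      = - avg_form i (\<lambda>x. U x a) (\<lambda>x. W x b)" (is ?A)
    "(\<Sum>K\<in>T. \<Sum>F | F facet_of K. \<bar>facet_normal K F $ i\<bar> *
      facet_integral F (facet_normal K F) (\<lambda>y. trace_jump (facet_normal K F) U y a * inner_trace (facet_normal K F) W y b))
      = - jump_form i (\<lambda>x. U x a) (\<lambda>x. W x b)" (is ?B)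
proof -
  let ?u = "\<lambda>x. U x a" and ?w = "\<lambda>x. W x b"
  have split: "(\<Sum>F | F facet_of K. g F) = (\<Sum>F\<in>exit_facets i K. g F) + (\<Sum>F\<in>entry_facets i K. g F)"
    if "K \<in> T" "\<And>F. F facet_of K \<Longrightarrow> facet_normal K F $ i = 0 \<Longrightarrow> g F = 0" for K and g :: "_ \<Rightarrow> real"
  proof -
    have "(\<Sum>F | F facet_of K. g F) = sum g (exit_facets i K \<union> entry_facets i K)"
    proof (rule sum.mono_neutral_right[OF finite_facets[OF that(1)]])
      show "\<forall>F\<in>{F. F facet_of K} - (exit_facets i K \<union> entry_facets i K). g F = 0"
        using that(2) by (auto simp: exit_facets_def entry_facets_def not_less intro: order_antisym)
    qed (auto simp: exit_facets_def entry_facets_def)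
    also have "\<dots> = sum g (exit_facets i K) + sum g (entry_facets i K)"
      by (rule sum.union_disjoint) (use finite_exit_facets[OF that(1)] in \<open>auto simp: exit_facets_def entry_facets_def\<close>)
    finally show ?thesis .
  qed
  have t: "(\<lambda>y. q y * tr d ?w y) \<in> trace_fun i" if "q \<in> trace_fun i" "d = axis i 1 \<or> d = - axis i 1" for q d
    using that trace_fun_tr[OF W] by (auto intro!: trace_fun_mult)
  note ta = trace_fun_avg_jmp(1)[OF U, of i] and tj = trace_fun_avg_jmp(2)[OF U, of i]
  have "(\<Sum>K\<in>T. \<Sum>F | F facet_of K. facet_normal K F $ i *
      facet_integral F (facet_normal K F) (\<lambda>y. trace_avg (facet_normal K F) U y a * inner_trace (facet_normal K F) W y b))
    = (\<Sum>K\<in>T. (\<Sum>F\<in>exit_facets i K. hit_integral i K F (\<lambda>y. avg i ?u y * tr (- axis i 1) ?w y))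
        + (\<Sum>F\<in>entry_facets i K. - hit_integral i K F (\<lambda>y. avg i ?u y * tr (axis i 1) ?w y)))"
    by (intro sum.cong refl, subst split)
      (auto simp: exit_facets_def entry_facets_def facet_trace_terms(3,5)[where U = U and a = a and W = W and b = b, OF _ _ U W refl] intro!: arg_cong2[of _ _ _ _ "(+)"] sum.cong)
  also have "\<dots> = exit_integral i (\<lambda>y. avg i ?u y * tr (- axis i 1) ?w y) - entry_integral i (\<lambda>y. avg i ?u y * tr (axis i 1) ?w y)"
    by (simp add: exit_integral_def entry_integral_def sum_negf sum_subtractf)
  also have "\<dots> = exit_integral i (\<lambda>y. avg i ?u y * tr (- axis i 1) ?w y - avg i ?u y * tr (axis i 1) ?w y)"
    using t[OF ta] by (simp add: exit_integral_eq_entry_integral[symmetric] exit_integral_diff)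
  also have "\<dots> = exit_integral i (\<lambda>y. (-1) * (avg i ?u y * jmp i ?w y))"
    by (simp add: jmp_def algebra_simps)
  also have "\<dots> = - avg_form i ?u ?w" unfolding exit_integral_cmult avg_form_def by simp
  finally show ?A .
  have "(\<Sum>K\<in>T. \<Sum>F | F facet_of K. \<bar>facet_normal K F $ i\<bar> *
      facet_integral F (facet_normal K F) (\<lambda>y. trace_jump (facet_normal K F) U y a * inner_trace (facet_normal K F) W y b))
    = (\<Sum>K\<in>T. (\<Sum>F\<in>exit_facets i K. hit_integral i K F (\<lambda>y. jmp i ?u y * tr (- axis i 1) ?w y))
        + (\<Sum>F\<in>entry_facets i K. - hit_integral i K F (\<lambda>y. jmp i ?u y * tr (axis i 1) ?w y)))"
  proof (intro sum.cong refl)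
    fix K assume K: "K \<in> T"
    note ft = facet_trace_terms(4,6)[where U = U and a = a and W = W and b = b, OF K _ U W refl]
    show "(\<Sum>F | F facet_of K. \<bar>facet_normal K F $ i\<bar> *
        facet_integral F (facet_normal K F) (\<lambda>y. trace_jump (facet_normal K F) U y a * inner_trace (facet_normal K F) W y b))
      = (\<Sum>F\<in>exit_facets i K. hit_integral i K F (\<lambda>y. jmp i ?u y * tr (- axis i 1) ?w y))
        + (\<Sum>F\<in>entry_facets i K. - hit_integral i K F (\<lambda>y. jmp i ?u y * tr (axis i 1) ?w y))"
      by (subst split[OF K], simp, intro arg_cong2[of _ _ _ _ "(+)"] sum.cong refl)
        (rule ft; simp add: exit_facets_def entry_facets_def)+
  qed
  also have "\<dots> = exit_integral i (\<lambda>y. jmp i ?u y * tr (- axis i 1) ?w y) - entry_integral i (\<lambda>y. jmp i ?u y * tr (axis i 1) ?w y)"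
    by (simp add: exit_integral_def entry_integral_def sum_negf sum_subtractf)
  also have "\<dots> = exit_integral i (\<lambda>y. jmp i ?u y * tr (- axis i 1) ?w y - jmp i ?u y * tr (axis i 1) ?w y)"
    using t[OF tj] by (simp add: exit_integral_eq_entry_integral[symmetric] exit_integral_diff)
  also have "\<dots> = exit_integral i (\<lambda>y. (-1) * (jmp i ?u y * jmp i ?w y))"
    by (simp add: jmp_def[of i ?w] algebra_simps)
  also have "\<dots> = - jump_form i ?u ?w" unfolding exit_integral_cmult jump_form_def by simp
  finally show ?B .
qed

end

section \<open>Vanishing jumps mean continuity\<close>

lemma negligible_periodic:
  assumes N: "negligible (S \<inter> cbox 0 1)" and per: "\<And>x. x \<in> S \<Longrightarrow> frac3 x \<in> S"
  shows "negligible S"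
proof -
  let ?Z = "range (\<lambda>(a, b, c). vector [of_int a, of_int b, of_int c] :: real^3)"
  have "S \<subseteq> (\<Union>z\<in>?Z. (+) z ` (S \<inter> cbox 0 1))"
  proof
    fix x assume x: "x \<in> S"
    let ?z = "vector [of_int \<lfloor>x $ 1\<rfloor>, of_int \<lfloor>x $ 2\<rfloor>, of_int \<lfloor>x $ 3\<rfloor>] :: real^3"
    have "x = ?z + frac3 x" by (simp add: vec_eq_iff forall_3 frac3_def frac_def)
    moreover have "frac3 x \<in> cbox 0 1" by (simp add: mem_box_cart frac3_def less_imp_le frac_lt_1)
    moreover have "?z \<in> ?Z" by (rule image_eqI[of _ _ "(\<lfloor>x $ 1\<rfloor>, \<lfloor>x $ 2\<rfloor>, \<lfloor>x $ 3\<rfloor>)"]) auto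
    ultimately show "x \<in> (\<Union>z\<in>?Z. (+) z ` (S \<inter> cbox 0 1))" using per[OF x] by blast
  qed
  moreover have "negligible (\<Union>z\<in>?Z. (+) z ` (S \<inter> cbox 0 1))"
    using N by (intro negligible_countable_Union) (auto intro: negligible_translation)
  ultimately show ?thesis by (rule negligible_subset[rotated])
qed

lemma negligible_avoid:
  assumes "negligible (N :: (real^3) set)" "\<delta> > 0" obtains z where "dist x z < \<delta>" "z \<notin> N"
proof -
  have "\<not> ball x \<delta> \<subseteq> N"
    using assms open_not_negligible[of "ball x \<delta>"] negligible_subset by (metis centre_in_ball empty_iff open_ball)
  then obtain z where "z \<in> ball x \<delta>" "z \<notin> N" by blast
  then show ?thesis using that[of z] by simp
qed

context unit_cube_mesh
begin

lemma frac3_frac3: "frac3 (frac3 x) = frac3 x"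
  by (simp add: frac3_def vec_eq_iff frac_lt_1 frac_eq)

lemma \<Omega>_frac3: "frac3 x \<in> \<Omega> \<longleftrightarrow> x \<in> \<Omega>"
  by (simp add: \<Omega>_def frac3_frac3)

text \<open>Element boundaries are boundaries of convex sets.\<close>

lemma negligible_compl_\<Omega>: "negligible (- \<Omega>)"
proof (rule negligible_periodic)
  have "- \<Omega> \<inter> cbox 0 1 \<subseteq> (\<Union>K\<in>T. frontier K)"
  proof
    fix x assume x: "x \<in> - \<Omega> \<inter> cbox 0 1"
    then obtain K where K: "K \<in> T" "x \<in> K" using covT by blast
    then have "x \<notin> interior K" using x interior_in_\<Omega> by blast
    then show "x \<in> (\<Union>K\<in>T. frontier K)" using K closed_elt by (auto simp: frontier_def)
  qed
  moreover have "negligible (\<Union>K\<in>T. frontier K)"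
    using finT negligible_convex_frontier convex_elt by (intro negligible_Union) auto
  ultimately show "negligible (- \<Omega> \<inter> cbox 0 1)" by (rule negligible_subset[rotated])
qed (simp add: \<Omega>_frac3)

lemma \<Omega>_local:
  assumes "x \<in> \<Omega>"
  obtains K z r where "K \<in> T" "\<forall>j. z $ j \<in> \<int>" "r > 0" "\<And>w. dist x w < r \<Longrightarrow> w - z \<in> interior K"
proof -
  obtain K where K: "K \<in> T" "frac3 x \<in> interior K" using assms by (auto simp: \<Omega>_def)
  obtain r where r: "r > 0" "ball (frac3 x) r \<subseteq> interior K" using K(2) open_contains_ball by blast
  let ?z = "x - frac3 x"
  have "w - ?z \<in> interior K" if "dist x w < r" for w
    using that by (intro subsetD[OF r(2)]) (simp add: dist_norm norm_minus_commute)
  then show ?thesis using K r by (intro that[of K ?z r]) (auto simp: frac3_def frac_def)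
qed

lemma tr_\<Omega>:
  assumes x: "x \<in> \<Omega>" and v: "v \<in> PW" and d: "d \<noteq> 0"
  shows "tr d v x = v x"
proof -
  obtain K z r where *: "K \<in> T" "\<forall>j. z $ j \<in> \<int>" "r > 0" "\<And>w. dist x w < r \<Longrightarrow> w - z \<in> interior K"
    using \<Omega>_local[OF x] by metis
  have "d \<bullet> d > 0" using d by simp
  from tr_eqI(1)[OF *(3) this *(1,2) v *(4)] have "tr d v x = pol v K (x - z)" by simp
  then show ?thesis using shifted_interior(2)[OF *(1) *(4) *(2) v, of x] *(3) by simp
qed

lemma continuous_on_\<Omega>:
  assumes v: "v \<in> PW" and x: "x \<in> \<Omega>" shows "isCont v x"
proof -
  obtain K z r where *: "K \<in> T" "\<forall>j. z $ j \<in> \<int>" "r > 0" "\<And>w. dist x w < r \<Longrightarrow> w - z \<in> interior K"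
    using \<Omega>_local[OF x] by metis
  have "continuous_on UNIV (\<lambda>w. pol v K (w - z))"
    by (intro continuous_on_compose2[OF pol_continuous[OF v *(1), of UNIV]] continuous_intros) auto
  then have "isCont (\<lambda>w. pol v K (w - z)) x" by (simp add: continuous_on_eq_continuous_at)
  moreover have "\<forall>\<^sub>F w in nhds x. v w = pol v K (w - z)"
    unfolding eventually_nhds_metric
    using shifted_interior(2)[OF *(1) *(4) *(2) v] *(3) by (metis dist_commute)
  ultimately show ?thesis by (simp add: isCont_cong)
qed

lemma partial_deriv_bound:
  assumes v: "v \<in> PW"
  obtains L where "L \<ge> 0" "\<And>K x i. K \<in> T \<Longrightarrow> x \<in> K \<Longrightarrow> \<bar>partial_deriv i (pol v K) x\<bar> \<le> L"
proof -
  have "\<exists>B. \<forall>x\<in>K. \<bar>partial_deriv i (pol v K) x\<bar> \<le> B" if K: "K \<in> T" for K i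
  proof -
    have "continuous_on K (partial_deriv i (pol v K))"
      by (intro real_polynomial_function_continuous partial_deriv_polynomial(1) pol_props(1)[OF v K])
    from compact_imp_bounded[OF compact_continuous_image[OF this compact_elt[OF K]]]
    show ?thesis by (auto simp: bounded_iff)
  qed
  then obtain B where B: "\<And>K x i. K \<in> T \<Longrightarrow> x \<in> K \<Longrightarrow> \<bar>partial_deriv i (pol v K) x\<bar> \<le> B K i" by metis
  show ?thesis
  proof (rule that[of "\<Sum>K\<in>T. \<Sum>i\<in>UNIV. \<bar>B K i\<bar>"])
    fix K x i assume K: "K \<in> T" "x \<in> K"
    have "\<bar>partial_deriv i (pol v K) x\<bar> \<le> \<bar>B K i\<bar>" using B[OF K, of i] by linarith
    also have "\<dots> \<le> (\<Sum>i\<in>UNIV. \<bar>B K i\<bar>)" by (intro member_le_sum) auto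
    also have "\<dots> \<le> (\<Sum>K\<in>T. \<Sum>i\<in>UNIV. \<bar>B K i\<bar>)"
      using K finT by (intro member_le_sum[of K T "\<lambda>K. \<Sum>i\<in>UNIV. \<bar>B K i\<bar>"]) (auto intro: sum_nonneg)
    finally show "\<bar>partial_deriv i (pol v K) x\<bar> \<le> (\<Sum>K\<in>T. \<Sum>i\<in>UNIV. \<bar>B K i\<bar>)" .
  qed (auto intro!: sum_nonneg)
qed

text \<open>A sum of integrals of squares that vanishes has vanishing integrands almost everywhere.\<close>

lemma zero_jumps_AE:
  assumes v: "v \<in> PW" and J: "jump_form i v v = 0"
  shows "AE x in lborel. \<forall>K\<in>T. \<forall>F\<in>exit_facets i K. x \<in> hitset i K F \<longrightarrow> jmp i v (facet_hit i K F x) = 0"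
proof -
  have nn: "hit_integral i K F (\<lambda>y. jmp i v y * jmp i v y) \<ge> 0" for K F
    unfolding hit_integral_def by (intro integral_nonneg_AE) auto
  then have "\<forall>K\<in>T. (\<Sum>F\<in>exit_facets i K. hit_integral i K F (\<lambda>y. jmp i v y * jmp i v y)) = 0"
    using J unfolding jump_form_def exit_integral_def by (subst (asm) sum_nonneg_eq_0_iff[OF finT]) (auto intro: sum_nonneg)
  then have z: "hit_integral i K F (\<lambda>y. jmp i v y * jmp i v y) = 0" if "K \<in> T" "F \<in> exit_facets i K" for K F
    using that nn finite_exit_facets by (auto simp: sum_nonneg_eq_0_iff)
  have "AE x in lborel. x \<in> hitset i K F \<longrightarrow> jmp i v (facet_hit i K F x) = 0" if K: "K \<in> T" "F \<in> exit_facets i K" for K F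
  proof -
    have "F facet_of K" using K by (simp add: exit_facets_def)
    then have int: "integrable lborel (\<lambda>x. indicator (hitset i K F) x * (jmp i v (facet_hit i K F x) * jmp i v (facet_hit i K F x)))"
      using trace_fun_avg_jmp(2)[OF v] by (intro trace_fun_hit_integral_integrable K trace_fun_mult)
    have "AE x in lborel. indicator (hitset i K F) x * (jmp i v (facet_hit i K F x) * jmp i v (facet_hit i K F x)) = 0"
      using z[OF K] unfolding hit_integral_def by (subst (asm) integral_nonneg_eq_0_iff_AE[OF int]) auto
    then show ?thesis by eventually_elim auto
  qed
  then show ?thesis using finT finite_exit_facets by (simp add: AE_finite_all)
qed

text \<open>On each segment the trace from the right is a polynomial, also at the left end. At the
  right end it is the left trace that is given by this polynomial, and there the vanishing jump is
  used. So the function along the line is Lipschitz on closed segments that cover \<open>[-x\<^sub>i, 1 - x\<^sub>i]\<close>.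
  If \<open>x + s e\<^sub>i\<close> leaves the cube, the line is continued periodically.\<close>

lemma zero_jumps_lipschitz_on_line:
  assumes v: "v \<in> PW" and good: "goodline i x" and x: "x \<in> cbox 0 1"
    and j0: "\<forall>K\<in>T. \<forall>F\<in>exit_facets i K. x \<in> hitset i K F \<longrightarrow> jmp i v (facet_hit i K F x) = 0"
    and L: "\<And>K y. K \<in> T \<Longrightarrow> y \<in> K \<Longrightarrow> \<bar>partial_deriv i (pol v K) y\<bar> \<le> L"
    and s: "0 \<le> s" "s \<le> 1"
  shows "\<bar>tr (axis i 1) v (x + s *\<^sub>R axis i 1) - tr (axis i 1) v x\<bar> \<le> L * s"
proof -
  let ?e = "axis i 1 :: real^3"
  define f where "f t = tr ?e v (x + t *\<^sub>R ?e)" for t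
  obtain H lo hi where H: "H = {K \<in> T. \<exists>t. x + t *\<^sub>R axis i 1 \<in> K}"
    and lh: "\<And>K. K \<in> H \<Longrightarrow> lo K < hi K"
    and mem: "\<And>K t. K \<in> H \<Longrightarrow> x + t *\<^sub>R axis i 1 \<in> K \<longleftrightarrow> lo K \<le> t \<and> t \<le> hi K"
    and memi: "\<And>K t. K \<in> H \<Longrightarrow> x + t *\<^sub>R axis i 1 \<in> interior K \<longleftrightarrow> lo K < t \<and> t < hi K"
    and ex: "\<And>K. K \<in> H \<Longrightarrow> \<exists>F. {F\<in>exit_facets i K. facet_hit i K F x \<in> F} = {F} \<and> facet_hit i K F x = x + hi K *\<^sub>R axis i 1"
    and en: "\<And>K. K \<in> H \<Longrightarrow> \<exists>F. {F\<in>entry_facets i K. facet_hit i K F x \<in> F} = {F} \<and> facet_hit i K F x = x + lo K *\<^sub>R axis i 1"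
    and "\<And>K F. K \<in> T - H \<Longrightarrow> F \<in> exit_facets i K \<union> entry_facets i K \<Longrightarrow> facet_hit i K F x \<notin> F"
    and cov: "(\<Union>K\<in>H. {lo K..hi K}) = {- x $ i..1 - x $ i}"
    and dis: "\<And>K K'. K \<in> H \<Longrightarrow> K' \<in> H \<Longrightarrow> K \<noteq> K' \<Longrightarrow> {lo K<..<hi K} \<inter> {lo K'<..<hi K'} = {}"
  proof (rule line_partition[OF good x], goal_cases)
    case (1 H lo hi)
    show ?case by (rule 1(1)[OF 1(2-)])
  qed
  have fpol: "f t = pol v K (x + t *\<^sub>R ?e)" if K: "K \<in> H" and t: "lo K \<le> t" "t \<le> hi K" for K t
  proof -
    have KT: "K \<in> T" using K H by simp
    consider "lo K < t" "t < hi K" | "t = lo K" | "t = hi K" using t by linarith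
    then show ?thesis
    proof cases
      case 1
      then have *: "x + t *\<^sub>R ?e \<in> interior K" using memi[OF K] by simp
      then have "f t = v (x + t *\<^sub>R ?e)"
        unfolding f_def using interior_in_\<Omega>[OF KT] by (intro tr_\<Omega> v) auto
      then show ?thesis using pol_props(2)[OF v KT *] by simp
    next
      case 2
      obtain F where F: "{F\<in>entry_facets i K. facet_hit i K F x \<in> F} = {F}" "facet_hit i K F x = x + lo K *\<^sub>R ?e"
        using en[OF K] by blast
      have "F \<in> {F\<in>entry_facets i K. facet_hit i K F x \<in> F}" unfolding F(1) by simp
      then have F': "F facet_of K" "facet_normal K F \<bullet> ?e < 0" "facet_hit i K F x \<in> F"
        by (simp_all add: entry_facets_def inner_axis)
      then have "x \<in> hitset i K F" using x by (simp add: hitset_def)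
      from good_hit[OF good KT F'(1) this] show ?thesis
        unfolding f_def 2 F(2)[symmetric] by (intro facet_inner_trace[OF KT F'(1) _ _ v F'(2)])
    next
      case 3
      obtain F where F: "{F\<in>exit_facets i K. facet_hit i K F x \<in> F} = {F}" "facet_hit i K F x = x + hi K *\<^sub>R ?e"
        using ex[OF K] by blast
      have "F \<in> {F\<in>exit_facets i K. facet_hit i K F x \<in> F}" unfolding F(1) by simp
      then have Fe: "F \<in> exit_facets i K" and h: "x \<in> hitset i K F" using x by (simp_all add: hitset_def)
      then have F': "F facet_of K" "facet_normal K F \<bullet> - ?e < 0" by (simp_all add: exit_facets_def inner_axis)
      have "tr (- ?e) v (facet_hit i K F x) = pol v K (facet_hit i K F x)"
        using good_hit[OF good KT F'(1) h] by (intro facet_inner_trace[OF KT F'(1) _ _ v F'(2)])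
      moreover have "jmp i v (facet_hit i K F x) = 0" using j0 KT Fe h by blast
      ultimately show ?thesis unfolding f_def 3 F(2)[symmetric] jmp_def by simp
    qed
  qed
  have lip: "\<bar>f t - f s\<bar> \<le> L * (t - s)" if K: "K \<in> H" and st: "lo K \<le> s" "s \<le> t" "t \<le> hi K" for K s t
  proof (cases "s = t")
    case False
    have KT: "K \<in> T" using K H by simp
    have "s < t" using False st(2) by simp
    from MVT2[OF this, of "\<lambda>t. pol v K (x + t *\<^sub>R ?e)" "\<lambda>t. partial_deriv i (pol v K) (x + t *\<^sub>R ?e)",
        OF partial_deriv_polynomial(2)[OF pol_props(1)[OF v KT]]]
    obtain r where r: "s < r" "r < t" "pol v K (x + t *\<^sub>R ?e) - pol v K (x + s *\<^sub>R ?e) = (t - s) * partial_deriv i (pol v K) (x + r *\<^sub>R ?e)"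
      by blast
    have "x + r *\<^sub>R ?e \<in> K" using mem[OF K, of r] r(1,2) st by simp
    then have b: "\<bar>partial_deriv i (pol v K) (x + r *\<^sub>R ?e)\<bar> \<le> L" using L[OF KT] by blast
    have "f t - f s = (t - s) * partial_deriv i (pol v K) (x + r *\<^sub>R ?e)" using fpol[OF K] st r(3) by simp
    then have "\<bar>f t - f s\<bar> = (t - s) * \<bar>partial_deriv i (pol v K) (x + r *\<^sub>R ?e)\<bar>"
      using st(2) by (simp add: abs_mult)
    also have "\<dots> \<le> (t - s) * L" using b st(2) by (intro mult_left_mono) auto
    finally show ?thesis by (simp add: mult.commute)
  qed simp
  have fin: "finite H" "- x $ i \<le> 1 - x $ i" using finT H by auto
  \<comment> \<open>The line stays in the cube for parameters between \<open>- x $ i\<close> and \<open>1 - x $ i\<close>.\<close>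
  have LC: "\<bar>f d - f c\<bar> \<le> L * (d - c)" if "- x $ i \<le> c" "c \<le> d" "d \<le> 1 - x $ i" for c d
  proof (rule lipschitz_cover[OF fin lh cov dis _ that])
    fix K s t assume "K \<in> H" "lo K \<le> s" "s \<le> t" "t \<le> hi K"
    then show "\<bar>f t - f s\<bar> \<le> L * (t - s)" by (rule lip)
  qed
  have x01: "0 \<le> x $ i" "x $ i \<le> 1" using x by (auto simp: mem_box_cart)
  have per: "f t = f (t - 1)" for t
  proof -
    have "x + t *\<^sub>R ?e = x + (t - 1) *\<^sub>R ?e + ?e" by (simp add: algebra_simps)
    then show ?thesis unfolding f_def by (simp only: tr_periodic[OF v])
  qed
  have "\<bar>f s - f 0\<bar> \<le> L * s"
  proof (cases "s \<le> 1 - x $ i")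
    case True
    then show ?thesis using LC[where c = 0 and d = s] s x01 by simp
  next
    case False
    have "\<bar>f (1 - x $ i) - f 0\<bar> \<le> L * (1 - x $ i)" using LC[where c = 0 and d = "1 - x $ i"] x01 by simp
    moreover have "\<bar>f (s - 1) - f (- x $ i)\<bar> \<le> L * (s - 1 + x $ i)" using LC[where c = "- x $ i" and d = "s - 1"] False s x01 by simp
    moreover have "f (1 - x $ i) = f (- x $ i)" using per[of "1 - x $ i"] by simp
    moreover have "f s = f (s - 1)" by (rule per)
    ultimately have "\<bar>f s - f 0\<bar> \<le> L * (1 - x $ i) + L * (s - 1 + x $ i)" by linarith
    then show ?thesis by (simp add: algebra_simps)
  qed
  then show ?thesis by (simp add: f_def)
qed

lemma zero_jumps_lipschitz_AE:
  assumes v: "v \<in> PW" and J: "jump_form i v v = 0"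
    and L: "\<And>K y. K \<in> T \<Longrightarrow> y \<in> K \<Longrightarrow> \<bar>partial_deriv i (pol v K) y\<bar> \<le> L" and h: "\<bar>h\<bar> \<le> 1"
  shows "negligible {x. x \<in> \<Omega> \<and> x + h *\<^sub>R axis i 1 \<in> \<Omega> \<and> \<not> \<bar>v (x + h *\<^sub>R axis i 1) - v x\<bar> \<le> L * \<bar>h\<bar>}"
proof -
  let ?e = "axis i 1 :: real^3"
  let ?B = "\<lambda>h. {x. x \<in> \<Omega> \<and> x + h *\<^sub>R ?e \<in> \<Omega> \<and> \<not> \<bar>v (x + h *\<^sub>R ?e) - v x\<bar> \<le> L * \<bar>h\<bar>}"
  have e0: "?e \<noteq> 0" by (metis axis_eq_0_iff zero_neq_one)
  have pos: "negligible (?B h)" if h: "0 \<le> h" "h \<le> 1" for h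
  proof (rule negligible_periodic)
    fix x assume x: "x \<in> ?B h"
    have z: "\<forall>j. (frac3 x - x) $ j \<in> \<int>" by (simp add: frac3_def frac_def)
    have eq: "frac3 x + h *\<^sub>R ?e = (x + h *\<^sub>R ?e) + (frac3 x - x)" by simp
    have "v (frac3 x + h *\<^sub>R ?e) = v (x + h *\<^sub>R ?e)"
      unfolding eq by (rule torus_periodic_integer[OF PW_periodic[OF v] z])
    moreover have "frac3 x + h *\<^sub>R ?e \<in> \<Omega> \<longleftrightarrow> x + h *\<^sub>R ?e \<in> \<Omega>"
    proof -
      have "torus_periodic (\<lambda>x. x \<in> \<Omega>)" by (simp add: torus_periodic_def \<Omega>_periodic)
      then show ?thesis unfolding eq by (rule torus_periodic_integer[OF _ z])
    qed
    ultimately show "frac3 x \<in> ?B h" using x by (simp add: \<Omega>_frac3 frac3_periodic[OF PW_periodic[OF v]])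
  next
    have "AE x in lborel. \<not> (x \<in> ?B h \<inter> cbox 0 1)"
      using AE_goodline[of i] zero_jumps_AE[OF v J]
    proof eventually_elim
      case (elim x)
      show ?case
      proof
        assume x: "x \<in> ?B h \<inter> cbox 0 1"
        then have "\<bar>tr ?e v (x + h *\<^sub>R ?e) - tr ?e v x\<bar> \<le> L * h"
          using h by (intro zero_jumps_lipschitz_on_line[OF v elim(1) _ elim(2) L]) auto
        then show False using x h tr_\<Omega>[OF _ v e0] by auto
      qed
    qed
    then have "AE x in lebesgue. \<not> (x \<in> ?B h \<inter> cbox 0 1)" by (rule AE_completion)
    then obtain N where N: "N \<in> null_sets lebesgue" "{x \<in> space lebesgue. \<not> \<not> (x \<in> ?B h \<inter> cbox 0 1)} \<subseteq> N"
      unfolding eventually_ae_filter by blast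
    have "?B h \<inter> cbox 0 1 \<subseteq> N" using N(2) by simp blast
    then show "negligible (?B h \<inter> cbox 0 1)"
      using N(1) negligible_subset unfolding negligible_iff_null_sets[symmetric] by blast
  qed
  show ?thesis
  proof (cases "h \<ge> 0")
    case True
    then show ?thesis using pos[of h] h by simp
  next
    case False
    have "?B h \<subseteq> (+) (- h *\<^sub>R ?e) ` ?B (- h)"
    proof
      fix x assume x: "x \<in> ?B h"
      have "x = - h *\<^sub>R ?e + (x + h *\<^sub>R ?e)" by simp
      moreover have "x + h *\<^sub>R ?e \<in> ?B (- h)" using x by (auto simp: abs_minus_commute)
      ultimately show "x \<in> (+) (- h *\<^sub>R ?e) ` ?B (- h)" by blast
    qed
    moreover have "negligible ((+) (- h *\<^sub>R ?e) ` ?B (- h))"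
      using pos[of "- h"] False h by (intro negligible_translation) auto
    ultimately show ?thesis by (rule negligible_subset[rotated])
  qed
qed

text \<open>From \<open>x\<close> to \<open>y\<close> one can go along the three coordinate directions. The estimates for the three
  steps hold for almost every starting point, so for starting points \<open>z\<close> arbitrarily close to \<open>x\<close>, and
  \<open>v\<close> is continuous at \<open>x\<close> and \<open>y\<close>.\<close>

lemma zero_jumps_lipschitz:
  assumes v: "v \<in> PW" and J: "\<And>i. jump_form i v v = 0"
    and L: "\<And>K x i. K \<in> T \<Longrightarrow> x \<in> K \<Longrightarrow> \<bar>partial_deriv i (pol v K) x\<bar> \<le> L"
    and xy: "x \<in> \<Omega>" "y \<in> \<Omega>" "dist x y \<le> 1"
  shows "\<bar>v y - v x\<bar> \<le> L * (\<bar>(y - x) $ 1\<bar> + \<bar>(y - x) $ 2\<bar> + \<bar>(y - x) $ 3\<bar>)"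
proof (rule field_le_epsilon)
  fix \<epsilon> :: real assume eps: "\<epsilon> > 0"
  define h where "h = y - x"
  let ?e = "\<lambda>i. axis i 1 :: real^3"
  have hb: "\<bar>h $ j\<bar> \<le> 1" for j
    using component_le_norm_cart[of h j] xy(3) by (simp add: h_def dist_norm norm_minus_commute)
  have hsum: "h = h $ 1 *\<^sub>R ?e 1 + h $ 2 *\<^sub>R ?e 2 + h $ 3 *\<^sub>R ?e 3"
    by (simp add: vec_eq_iff forall_3 axis_def)
  let ?B = "\<lambda>i. {x. x \<in> \<Omega> \<and> x + h $ i *\<^sub>R ?e i \<in> \<Omega> \<and> \<not> \<bar>v (x + h $ i *\<^sub>R ?e i) - v x\<bar> \<le> L * \<bar>h $ i\<bar>}"
  have B: "negligible (?B i)" for i by (rule zero_jumps_lipschitz_AE[OF v J L hb])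
  let ?p1 = "h $ 1 *\<^sub>R ?e 1" and ?p2 = "h $ 1 *\<^sub>R ?e 1 + h $ 2 *\<^sub>R ?e 2"
  \<comment> \<open>The starting points to be avoided: those for which a corner of the path falls on an element
    boundary or one of the three estimates fails.\<close>
  define N where "N = - \<Omega> \<union> (+) (- ?p1) ` (- \<Omega>) \<union> (+) (- ?p2) ` (- \<Omega>) \<union> (+) (- h) ` (- \<Omega>)
     \<union> ?B 1 \<union> (+) (- ?p1) ` ?B 2 \<union> (+) (- ?p2) ` ?B 3"
  have N: "negligible N" unfolding N_def
    by (intro negligible_Un negligible_translation B negligible_compl_\<Omega>)
  obtain d1 where d1: "d1 > 0" "\<And>w. dist w x < d1 \<Longrightarrow> dist (v w) (v x) < \<epsilon> / 2"
    using continuous_on_\<Omega>[OF v xy(1)] eps unfolding continuous_at_eps_delta by (metis half_gt_zero dist_norm)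
  obtain d2 where d2: "d2 > 0" "\<And>w. dist w y < d2 \<Longrightarrow> dist (v w) (v y) < \<epsilon> / 2"
    using continuous_on_\<Omega>[OF v xy(2)] eps unfolding continuous_at_eps_delta by (metis half_gt_zero dist_norm)
  obtain z where z: "dist x z < min d1 d2" "z \<notin> N" using negligible_avoid[OF N, of "min d1 d2" x] d1(1) d2(1) by auto
  have notin: "z + p \<notin> S" if "z \<notin> (+) (- p) ` S" for p S
    using that by (metis add.commute add_diff_cancel_right' image_eqI uminus_add_conv_diff)
  have zN: "z \<in> \<Omega>" "z \<notin> ?B 1" "z + ?p1 \<in> \<Omega>" "z + ?p2 \<in> \<Omega>" "z + h \<in> \<Omega>" "z + ?p1 \<notin> ?B 2" "z + ?p2 \<notin> ?B 3"
    using z(2) notin[of ?p1 "- \<Omega>"] notin[of ?p2 "- \<Omega>"] notin[of h "- \<Omega>"] notin[of ?p1 "?B 2"] notin[of ?p2 "?B 3"]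
    unfolding N_def by blast+
  have a2: "z + ?p1 + h $ 2 *\<^sub>R ?e 2 = z + ?p2" and a3: "z + ?p2 + h $ 3 *\<^sub>R ?e 3 = z + h"
    by (simp_all add: add.assoc) (metis hsum add.assoc)
  have "\<bar>v (z + ?p1) - v z\<bar> \<le> L * \<bar>h $ 1\<bar>" using zN by blast
  moreover have "\<bar>v (z + ?p2) - v (z + ?p1)\<bar> \<le> L * \<bar>h $ 2\<bar>" using zN(3,4,6) unfolding mem_Collect_eq a2 by blast
  moreover have "\<bar>v (z + h) - v (z + ?p2)\<bar> \<le> L * \<bar>h $ 3\<bar>" using zN(4,5,7) unfolding mem_Collect_eq a3 by blast
  moreover have "dist (v z) (v x) < \<epsilon> / 2" using d1(2)[of z] z(1) by (simp add: dist_commute)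
  moreover have "dist (v (z + h)) (v y) < \<epsilon> / 2"
  proof -
    have "dist (z + h) y = dist x z" by (simp add: h_def dist_norm norm_minus_commute)
    then show ?thesis using d2(2)[of "z + h"] z(1) by simp
  qed
  ultimately have "\<bar>v y - v x\<bar> \<le> L * \<bar>h $ 1\<bar> + L * \<bar>h $ 2\<bar> + L * \<bar>h $ 3\<bar> + \<epsilon>"
    unfolding dist_real_def by linarith
  then show "\<bar>v y - v x\<bar> \<le> L * (\<bar>(y - x) $ 1\<bar> + \<bar>(y - x) $ 2\<bar> + \<bar>(y - x) $ 3\<bar>) + \<epsilon>"
    by (simp add: h_def distrib_left)
qed

text \<open>Being uniformly continuous on the dense set \<open>\<Omega>\<close>, the function extends to its closure.\<close>

lemma zero_jumps_continuous:
  assumes v: "v \<in> PW" and J: "\<And>i. jump_form i v v = 0"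
  obtains g where "g \<in> torus_C0" "\<And>x. x \<in> \<Omega> \<Longrightarrow> g x = v x"
proof -
  obtain L where L: "L \<ge> 0" "\<And>K x i. K \<in> T \<Longrightarrow> x \<in> K \<Longrightarrow> \<bar>partial_deriv i (pol v K) x\<bar> \<le> L"
    using partial_deriv_bound[OF v] by metis
  have lip: "dist (v y) (v x) \<le> (3 * L) * dist x y" if "x \<in> \<Omega>" "y \<in> \<Omega>" "dist x y \<le> 1" for x y
  proof -
    have "\<bar>(y - x) $ j\<bar> \<le> dist x y" for j
      using component_le_norm_cart[of "y - x" j] by (simp add: dist_norm norm_minus_commute)
    then have "\<bar>(y - x) $ 1\<bar> + \<bar>(y - x) $ 2\<bar> + \<bar>(y - x) $ 3\<bar> \<le> 3 * dist x y"
      by (smt (verit, ccfv_threshold))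
    then have "L * (\<bar>(y - x) $ 1\<bar> + \<bar>(y - x) $ 2\<bar> + \<bar>(y - x) $ 3\<bar>) \<le> L * (3 * dist x y)"
      using L(1) by (rule mult_left_mono)
    then show ?thesis using zero_jumps_lipschitz[OF v J L(2) that] by (simp add: dist_real_def)
  qed
  have uc: "uniformly_continuous_on \<Omega> v"
    unfolding uniformly_continuous_on_def
  proof (intro allI impI)
    fix e :: real assume e: "e > 0"
    \<comment> \<open>The bound 1 is the range of the local Lipschitz estimate.\<close>
    define d where "d = min 1 (e / (3 * L + 1))"
    have d: "d > 0" using e L(1) by (simp add: d_def)
    have "dist (v y) (v x) < e" if "x \<in> \<Omega>" "y \<in> \<Omega>" "dist y x < d" for x y
    proof -
      have "dist (v y) (v x) \<le> 3 * L * dist x y" using that lip by (simp add: d_def dist_commute)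
      also have "\<dots> \<le> 3 * L * (e / (3 * L + 1))"
        using that L(1) by (intro mult_left_mono) (auto simp: d_def dist_commute)
      also have "\<dots> < e" using e L(1) by (simp add: field_simps)
      finally show ?thesis .
    qed
    then show "\<exists>d>0. \<forall>x\<in>\<Omega>. \<forall>x'\<in>\<Omega>. dist x' x < d \<longrightarrow> dist (v x') (v x) < e" using d by blast
  qed
  obtain g where g: "uniformly_continuous_on (closure \<Omega>) g" "\<And>x. x \<in> \<Omega> \<Longrightarrow> v x = g x"
    using uniformly_continuous_on_extension_on_closure[OF uc] by metis
  have dense: "closure \<Omega> = UNIV"
  proof (intro set_eqI iffI UNIV_I)
    fix x :: "real^3"
    have "\<exists>y\<in>\<Omega>. dist y x < e" if "e > 0" for e
      using negligible_avoid[OF negligible_compl_\<Omega> that, of x] by (metis ComplI dist_commute)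
    then show "x \<in> closure \<Omega>" by (simp add: closure_approachable)
  qed
  have cg: "continuous_on UNIV g" using g(1) dense uniformly_continuous_imp_continuous by metis
  have "g (x + axis i 1) = g x" for x i
  proof -
    have "continuous_on UNIV (\<lambda>x. g (x + axis i 1) - g x)"
      by (intro continuous_intros continuous_on_compose2[OF cg] cg) auto
    then have "closed {x. g (x + axis i 1) - g x = 0}"
      by (intro closed_Collect_eq) (auto intro: continuous_intros)
    moreover have "\<Omega> \<subseteq> {x. g (x + axis i 1) - g x = 0}"
      using g(2) PW_periodic[OF v] \<Omega>_periodic by (auto simp: torus_periodic_def) (metis)
    ultimately have "closure \<Omega> \<subseteq> {x. g (x + axis i 1) - g x = 0}" by (rule closure_minimal[rotated])
    then show ?thesis unfolding dense by auto
  qed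
  then show ?thesis using g(2) cg by (intro that[of g]) (auto simp: torus_C0_def torus_periodic_def)
qed

lemma core_cong: "(\<And>x. x \<in> \<Omega> \<Longrightarrow> v x = w x) \<Longrightarrow> core v = core w"
  by (auto simp: core_def)

lemma tr_cong: assumes "\<And>x. x \<in> \<Omega> \<Longrightarrow> v x = w x" shows "tr d v = tr d w"
proof -
  have "core v = core w" using assms by (rule core_cong)
  then show ?thesis by (intro ext) (simp add: tr_def)
qed

text \<open>The continuous function itself is the limit from all sides.\<close>

lemma continuous_no_jump:
  assumes g: "g \<in> torus_C0" "g \<in> PW" and w: "w \<in> PW"
  shows "avg_form i w g = 0" "jump_form i w g = 0"
proof -
  have j: "jmp i g y = 0" if y: "y \<in> cbox 0 1" "regpt n y" "n $ i \<noteq> 0" for n y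
  proof -
    have "tr d g y = g y" if d: "n \<bullet> d \<noteq> 0" for d
    proof -
      have "((\<lambda>s. y + s *\<^sub>R d) \<longlongrightarrow> y + 0 *\<^sub>R d) (at_right 0)" by (intro tendsto_intros)
      then have "((\<lambda>s. g (y + s *\<^sub>R d)) \<longlongrightarrow> g y) (at_right 0)"
        using g(1) continuous_on_tendsto_compose[of UNIV g] by (fastforce simp: torus_C0_def)
      with regular_trace_tendsto[OF y(1,2) g(2) d] show ?thesis
        using tendsto_unique trivial_limit_at_right_real by blast
    qed
    then show ?thesis using y(3) by (simp add: jmp_def inner_axis)
  qed
  have "exit_integral i (\<lambda>y. q y * jmp i g y) = 0" if "q \<in> trace_fun i" for q
  proof -
    have "exit_integral i (\<lambda>y. q y * jmp i g y) = exit_integral i (\<lambda>y. 0 * q y)"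
      using j that trace_fun_avg_jmp(2)[OF g(2)] by (intro exit_integral_cong trace_fun_mult trace_fun_cmult) auto
    then show ?thesis unfolding exit_integral_cmult by simp
  qed
  then show "avg_form i w g = 0" "jump_form i w g = 0" using trace_fun_avg_jmp[OF w] by (auto simp: avg_form_def jump_form_def)
qed

end

section \<open>The scheme as a sum of scalar bilinear forms\<close>

lemma torus_cell_measurable: "torus_cell \<in> sets borel"
proof -
  have "torus_cell = (\<Inter>i. {x. 0 \<le> x $ i} \<inter> {x. x $ i < 1})" by (auto simp: torus_cell_def)
  also have "\<dots> \<in> sets borel"
    by (intro sets.finite_INT sets.Int borel_closed borel_open closed_Collect_le open_Collect_less continuous_intros) auto
  finally show ?thesis .
qed

lemma negligible_cube_minus_cell: "negligible (cbox 0 1 - torus_cell)"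
proof (rule negligible_subset)
  show "negligible (\<Union>i. {x::real^3. x $ i = 1})"
    using negligible_hyperplane[of "axis _ 1 :: real^3" 1]
    by (intro negligible_Union) (auto simp: inner_axis' axis_eq_0_iff)
  show "cbox 0 1 - torus_cell \<subseteq> (\<Union>i. {x::real^3. x $ i = 1})"
  proof
    fix x :: "real^3" assume x: "x \<in> cbox 0 1 - torus_cell"
    then obtain i where "\<not> (0 \<le> x $ i \<and> x $ i < 1)" by (auto simp: torus_cell_def)
    moreover have "0 \<le> x $ i \<and> x $ i \<le> 1" using x by (simp add: mem_box_cart)
    ultimately show "x \<in> (\<Union>i. {x::real^3. x $ i = 1})" by auto
  qed
qed

lemma AE_of_negligible: "negligible N \<Longrightarrow> AE x in lebesgue. x \<notin> N"
  unfolding negligible_iff_null_sets by (rule AE_not_in)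

text \<open>Bilinearity on a set of functions that is meant to be closed under linear combinations. Outside
  the set the forms of the scheme are integrals of arbitrary functions, over which nothing is known.\<close>

definition bilin :: "('x \<Rightarrow> real) set \<Rightarrow> (('x \<Rightarrow> real) \<Rightarrow> ('x \<Rightarrow> real) \<Rightarrow> real) \<Rightarrow> bool" where
  "bilin W B \<longleftrightarrow> (\<forall>v\<in>W. \<forall>w\<in>W. \<forall>z\<in>W. \<forall>a b.
     B (\<lambda>x. a * v x + b * w x) z = a * B v z + b * B w z \<and>
     B z (\<lambda>x. a * v x + b * w x) = a * B z v + b * B z w)"

lemma bilinD:
  assumes "bilin W B" "v \<in> W" "w \<in> W" "z \<in> W"
  shows "B (\<lambda>x. a * v x + b * w x) z = a * B v z + b * B w z"
    "B z (\<lambda>x. a * v x + b * w x) = a * B z v + b * B z w"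
  using assms by (simp_all add: bilin_def)

lemma bilin_sum_left:
  assumes B: "bilin W B" and W: "\<And>S f. finite S \<Longrightarrow> (\<And>j. j \<in> S \<Longrightarrow> f j \<in> W) \<Longrightarrow> (\<lambda>x. \<Sum>j\<in>S. c j * f j x) \<in> W"
    and f: "\<And>j. j \<in> S \<Longrightarrow> f j \<in> W" and z: "z \<in> W" and S: "finite S"
  shows "B (\<lambda>x. \<Sum>j\<in>S. c j * f j x) z = (\<Sum>j\<in>S. c j * B (f j) z)"
  using S f
proof (induction S)
  case empty
  have "B (\<lambda>x. 0 * z x + 0 * z x) z = 0 * B z z + 0 * B z z"
    using B z unfolding bilin_def by blast
  then show ?case by simp
next
  case (insert j S)
  have 1: "(\<lambda>x. \<Sum>j\<in>S. c j * f j x) \<in> W" using insert by (intro W) auto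
  have "f j \<in> W" using insert by auto
  from bilinD(1)[OF B this 1 z, of "c j" 1] show ?case using insert by simp
qed

lemma sum_rotate: "(\<Sum>k\<in>T. \<Sum>l\<in>f k. \<Sum>p\<in>S. g k l p) = (\<Sum>p\<in>S. \<Sum>k\<in>T. \<Sum>l\<in>f k. g k l p)"
proof -
  have "(\<Sum>k\<in>T. \<Sum>l\<in>f k. \<Sum>p\<in>S. g k l p) = (\<Sum>k\<in>T. \<Sum>p\<in>S. \<Sum>l\<in>f k. g k l p)"
    by (intro sum.cong refl sum.swap)
  also have "\<dots> = (\<Sum>p\<in>S. \<Sum>k\<in>T. \<Sum>l\<in>f k. g k l p)" by (rule sum.swap)
  finally show ?thesis .
qed

lemma bilin_swap: "bilin W B \<Longrightarrow> bilin W (\<lambda>v w. B w v)"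
  unfolding bilin_def by blast

context unit_cube_mesh
begin

lemma PW_lincomb: "v \<in> PW \<Longrightarrow> w \<in> PW \<Longrightarrow> (\<lambda>x. a * v x + b * w x) \<in> PW"
  by (intro PW_add PW_cmult)

lemma avg_jmp_lincomb:
  assumes "y \<in> cbox 0 1" "regpt n y" "n $ i \<noteq> 0" "v \<in> PW" "w \<in> PW"
  shows "avg i (\<lambda>x. a * v x + b * w x) y = a * avg i v y + b * avg i w y"
    "jmp i (\<lambda>x. a * v x + b * w x) y = a * jmp i v y + b * jmp i w y"
proof -
  have t: "tr d (\<lambda>x. a * v x + b * w x) y = a * tr d v y + b * tr d w y" if "d = axis i 1 \<or> d = - axis i 1" for d
    by (rule regular_trace_lincomb[OF assms(1,2,4,5)]) (use that assms(3) in \<open>auto simp: inner_axis\<close>)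
  show "avg i (\<lambda>x. a * v x + b * w x) y = a * avg i v y + b * avg i w y"
    unfolding avg_def using t by (simp add: field_simps)
  show "jmp i (\<lambda>x. a * v x + b * w x) y = a * jmp i v y + b * jmp i w y"
    unfolding jmp_def using t by (simp add: algebra_simps)
qed

lemma bilin_avg_form: "bilin PW (avg_form i)"
  unfolding bilin_def
proof (intro ballI allI conjI)
  fix v w z a b assume *: "v \<in> PW" "w \<in> PW" "z \<in> PW"
  note tv = trace_fun_avg_jmp[OF *(1), of i] and tw = trace_fun_avg_jmp[OF *(2), of i] and tz = trace_fun_avg_jmp[OF *(3), of i]
  note tl = trace_fun_avg_jmp[OF PW_lincomb[OF *(1,2)], of i]
  have "avg_form i (\<lambda>x. a * v x + b * w x) z = exit_integral i (\<lambda>y. a * (avg i v y * jmp i z y) + b * (avg i w y * jmp i z y))"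
    unfolding avg_form_def by (rule exit_integral_cong) (use avg_jmp_lincomb * tv tw tz tl in \<open>auto intro!: trace_fun_mult trace_fun_add trace_fun_cmult simp: algebra_simps\<close>)
  also have "\<dots> = exit_integral i (\<lambda>y. a * (avg i v y * jmp i z y)) + exit_integral i (\<lambda>y. b * (avg i w y * jmp i z y))"
    using tv tw tz by (intro exit_integral_add trace_fun_mult trace_fun_cmult)
  finally show "avg_form i (\<lambda>x. a * v x + b * w x) z = a * avg_form i v z + b * avg_form i w z"
    by (simp only: exit_integral_cmult avg_form_def)
  have "avg_form i z (\<lambda>x. a * v x + b * w x) = exit_integral i (\<lambda>y. a * (avg i z y * jmp i v y) + b * (avg i z y * jmp i w y))"
    unfolding avg_form_def by (rule exit_integral_cong) (use avg_jmp_lincomb * tv tw tz tl in \<open>auto intro!: trace_fun_mult trace_fun_add trace_fun_cmult simp: algebra_simps\<close>)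
  also have "\<dots> = exit_integral i (\<lambda>y. a * (avg i z y * jmp i v y)) + exit_integral i (\<lambda>y. b * (avg i z y * jmp i w y))"
    using tv tw tz by (intro exit_integral_add trace_fun_mult trace_fun_cmult)
  finally show "avg_form i z (\<lambda>x. a * v x + b * w x) = a * avg_form i z v + b * avg_form i z w"
    by (simp only: exit_integral_cmult avg_form_def)
qed

lemma jump_form_sym: "jump_form i v w = jump_form i w v"
  by (simp add: jump_form_def mult.commute)

lemma jump_form_nonneg: "jump_form i v v \<ge> 0"
  unfolding jump_form_def by (rule exit_integral_nonneg) simp

lemma bilin_jump_form: "bilin PW (jump_form i)"
proof -
  have 1: "jump_form i z (\<lambda>x. a * v x + b * w x) = a * jump_form i z v + b * jump_form i z w"
    if *: "v \<in> PW" "w \<in> PW" "z \<in> PW" for v w z a b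
  proof -
    note tv = trace_fun_avg_jmp[OF *(1), of i] and tw = trace_fun_avg_jmp[OF *(2), of i] and tz = trace_fun_avg_jmp[OF *(3), of i]
    note tl = trace_fun_avg_jmp[OF PW_lincomb[OF *(1,2)], of i]
    have "jump_form i z (\<lambda>x. a * v x + b * w x) = exit_integral i (\<lambda>y. a * (jmp i z y * jmp i v y) + b * (jmp i z y * jmp i w y))"
      unfolding jump_form_def by (rule exit_integral_cong) (use avg_jmp_lincomb * tv tw tz tl in \<open>auto intro!: trace_fun_mult trace_fun_add trace_fun_cmult simp: algebra_simps\<close>)
    also have "\<dots> = exit_integral i (\<lambda>y. a * (jmp i z y * jmp i v y)) + exit_integral i (\<lambda>y. b * (jmp i z y * jmp i w y))"
      using tv tw tz by (intro exit_integral_add trace_fun_mult trace_fun_cmult)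
    finally show ?thesis by (simp only: exit_integral_cmult jump_form_def)
  qed
  then show ?thesis unfolding bilin_def by (metis jump_form_sym)
qed

lemma partial_deriv_lincomb:
  assumes "v \<in> PW" "w \<in> PW" "K \<in> T" "x \<in> interior K"
  shows "partial_deriv i (\<lambda>x. a * v x + b * w x) x = a * partial_deriv i v x + b * partial_deriv i w x"
proof -
  let ?p = "\<lambda>x. a * pol v K x + b * pol w K x"
  note pp = pol_props(1)[OF assms(1,3)] pol_props(1)[OF assms(2,3)]
  have "partial_deriv i (\<lambda>x. a * v x + b * w x) x = partial_deriv i ?p x"
    using assms pol_props(2) by (intro partial_deriv_local[of "interior K"]) auto
  also have "\<dots> = a * partial_deriv i (pol v K) x + b * partial_deriv i (pol w K) x"
    unfolding partial_deriv_def[of i ?p]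
    by (rule DERIV_imp_deriv)
      (use partial_deriv_polynomial(2)[OF pp(1), of x i 0] partial_deriv_polynomial(2)[OF pp(2), of x i 0]
        in \<open>auto intro!: derivative_eq_intros\<close>)
  finally show ?thesis using partial_deriv_pol assms by simp
qed

lemma bilin_vol_form: "bilin PW (vol_form i)"
  unfolding bilin_def
proof (intro ballI allI conjI)
  fix v w z a b assume *: "v \<in> PW" "w \<in> PW" "z \<in> PW"
  show "vol_form i (\<lambda>x. a * v x + b * w x) z = a * vol_form i v z + b * vol_form i w z"
    unfolding vol_form_def sum_distrib_left sum.distrib[symmetric]
  proof (intro sum.cong refl)
    fix K assume K: "K \<in> T"
    have "integral\<^sup>L (lebesgue_on K) (\<lambda>x. (a * v x + b * w x) * partial_deriv i z x)
      = integral\<^sup>L (lebesgue_on K) (\<lambda>x. a * (v x * partial_deriv i z x) + b * (w x * partial_deriv i z x))"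
      by (simp add: algebra_simps)
    also have "\<dots> = a * integral\<^sup>L (lebesgue_on K) (\<lambda>x. v x * partial_deriv i z x) + b * integral\<^sup>L (lebesgue_on K) (\<lambda>x. w x * partial_deriv i z x)"
      using vol_form_pol(2)[OF *(1,3) K] vol_form_pol(2)[OF *(2,3) K] by simp
    finally show "integral\<^sup>L (lebesgue_on K) (\<lambda>x. (a * v x + b * w x) * partial_deriv i z x)
      = a * integral\<^sup>L (lebesgue_on K) (\<lambda>x. v x * partial_deriv i z x) + b * integral\<^sup>L (lebesgue_on K) (\<lambda>x. w x * partial_deriv i z x)" .
  qed
  show "vol_form i z (\<lambda>x. a * v x + b * w x) = a * vol_form i z v + b * vol_form i z w"
    unfolding vol_form_def sum_distrib_left sum.distrib[symmetric]
  proof (intro sum.cong refl)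
    fix K assume K: "K \<in> T"
    have "integral\<^sup>L (lebesgue_on K) (\<lambda>x. z x * partial_deriv i (\<lambda>x. a * v x + b * w x) x)
      = integral\<^sup>L (lebesgue_on K) (\<lambda>x. a * (z x * partial_deriv i v x) + b * (z x * partial_deriv i w x))"
      using partial_deriv_lincomb[OF *(1,2) K] by (intro elt_spike(1)[OF K]) (simp add: algebra_simps)
    also have "\<dots> = a * integral\<^sup>L (lebesgue_on K) (\<lambda>x. z x * partial_deriv i v x) + b * integral\<^sup>L (lebesgue_on K) (\<lambda>x. z x * partial_deriv i w x)"
      using vol_form_pol(2)[OF *(3,1) K] vol_form_pol(2)[OF *(3,2) K] by simp
    finally show "integral\<^sup>L (lebesgue_on K) (\<lambda>x. z x * partial_deriv i (\<lambda>x. a * v x + b * w x) x)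
      = a * integral\<^sup>L (lebesgue_on K) (\<lambda>x. z x * partial_deriv i v x) + b * integral\<^sup>L (lebesgue_on K) (\<lambda>x. z x * partial_deriv i w x)" .
  qed
qed

text \<open>Coefficients and source moments enter in the same way, as factors of products of piecewise
  polynomials; for this integrability is enough.\<close>

definition weight :: "(real^3 \<Rightarrow> real) \<Rightarrow> bool" where
  "weight \<rho> \<longleftrightarrow> integrable (lebesgue_on torus_cell) \<rho>"

definition mass :: "(real^3 \<Rightarrow> real) \<Rightarrow> (real^3 \<Rightarrow> real) \<Rightarrow> (real^3 \<Rightarrow> real) \<Rightarrow> real" where
  "mass \<rho> v w = (\<Sum>K\<in>T. integral\<^sup>L (lebesgue_on K) (\<lambda>x. \<rho> x * (v x * w x)))"

lemma elt_lebesgue: "K \<in> T \<Longrightarrow> K \<in> sets lebesgue"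
  using closed_elt by (simp add: borel_closed)

lemma negligible_elt_minus_cell: "K \<in> T \<Longrightarrow> negligible (K - torus_cell)"
  using subset_cube by (intro negligible_subset[OF negligible_cube_minus_cell]) auto

lemma integrable_cell_elt:
  fixes g :: "real^3 \<Rightarrow> real"
  assumes g: "integrable (lebesgue_on torus_cell) g" and K: "K \<in> T"
  shows "integrable (lebesgue_on K) g"
proof -
  have cell: "torus_cell \<in> sets lebesgue" using torus_cell_measurable by simp
  have "integrable lebesgue (\<lambda>x. indicator torus_cell x *\<^sub>R g x)"
    using g cell by (simp add: integrable_restrict_space)
  then have "integrable lebesgue (\<lambda>x. indicator K x *\<^sub>R (indicator torus_cell x *\<^sub>R g x))"
    by (rule integrable_mult_indicator[OF elt_lebesgue[OF K]])
  then have "integrable (lebesgue_on K) (\<lambda>x. indicator torus_cell x *\<^sub>R g x)"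
    using elt_lebesgue[OF K] by (simp add: integrable_restrict_space)
  then show ?thesis
    by (subst (asm) lebesgue_on_integral_spike(1)[OF elt_lebesgue[OF K] negligible_elt_minus_cell[OF K], of _ g]) auto
qed

lemma AE_cell_elt:
  assumes P: "AE x in lebesgue_on torus_cell. P x" and K: "K \<in> T"
  shows "AE x in lebesgue_on K. P x"
proof -
  have cell: "torus_cell \<in> sets lebesgue" using torus_cell_measurable by simp
  have 1: "AE x in lebesgue. x \<in> torus_cell \<longrightarrow> P x"
    using P cell by (simp add: AE_restrict_space_iff)
  have "AE x in lebesgue. x \<in> K \<longrightarrow> P x"
    using 1 AE_of_negligible[OF negligible_elt_minus_cell[OF K]] by eventually_elim auto
  then show ?thesis using elt_lebesgue[OF K] by (simp add: AE_restrict_space_iff)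
qed

lemma integral_cell:
  fixes g :: "real^3 \<Rightarrow> real"
  assumes g: "\<And>K. K \<in> T \<Longrightarrow> integrable (lebesgue_on K) g"
  shows "integral\<^sup>L (lebesgue_on torus_cell) g = (\<Sum>K\<in>T. integral\<^sup>L (lebesgue_on K) g)"
proof -
  have cell: "torus_cell \<in> sets lebesgue" using torus_cell_measurable by simp
  have i: "integrable lebesgue (\<lambda>x. indicator K x * g x)" if "K \<in> T" for K
    using g[OF that] elt_lebesgue[OF that] by (simp add: integrable_restrict_space)
  have "integral\<^sup>L (lebesgue_on torus_cell) g = integral\<^sup>L (lebesgue_on torus_cell) (\<lambda>x. \<Sum>K\<in>T. indicator K x * g x)"
  proof (rule lebesgue_on_integral_spike(2)[OF cell negligible_compl_\<Omega>])
    fix x assume x: "x \<in> torus_cell - - \<Omega>"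
    then have "frac3 x = x" by (simp add: frac3_def vec_eq_iff torus_cell_def frac_eq)
    then obtain K where K: "K \<in> T" "x \<in> interior K" using x by (auto simp: \<Omega>_def)
    have "x \<notin> L" if "L \<in> T" "L \<noteq> K" for L
    proof
      assume "x \<in> L"
      then have "x \<in> closure (interior L)"
        using convex_closure_interior[OF convex_elt intT] that(1) closure_subset by blast
      moreover have "interior K \<inter> closure (interior L) = {}"
        using disT[OF K(1) that(1)] that(2) open_Int_closure_eq_empty[of "interior K" "interior L"] by auto
      ultimately show False using K(2) by blast
    qed
    then have "(\<Sum>L\<in>T. indicator L x * g x) = (\<Sum>L\<in>T. if L = K then g x else 0)"
      using K interior_subset by (intro sum.cong refl) (auto simp: indicator_def)
    then show "g x = (\<Sum>L\<in>T. indicator L x * g x)" using K(1) finT by simp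
  qed
  also have "\<dots> = (LINT x|lebesgue. indicator torus_cell x * (\<Sum>K\<in>T. indicator K x * g x))"
    using cell by (simp add: integral_restrict_space)
  also have "\<dots> = (LINT x|lebesgue. (\<Sum>K\<in>T. indicator K x * g x))"
  proof -
    have "indicator UNIV x * (indicator torus_cell x * (\<Sum>K\<in>T. indicator K x * g x)) = indicator UNIV x * (\<Sum>K\<in>T. indicator K x * g x)"
      if "x \<in> UNIV - (cbox 0 1 - torus_cell)" for x
    proof (cases "x \<in> torus_cell")
      case False
      then have "\<forall>K\<in>T. x \<notin> K" using that subset_cube by auto
      then show ?thesis by (simp add: sum.neutral)
    qed simp
    then show ?thesis
      using lebesgue_on_integral_spike(2)[OF _ negligible_cube_minus_cell, of UNIV
          "\<lambda>x. indicator torus_cell x * (\<Sum>K\<in>T. indicator K x * g x)" "\<lambda>x. (\<Sum>K\<in>T. indicator K x * g x)"]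
      by (simp add: lebesgue_on_UNIV_eq)
  qed
  also have "\<dots> = (\<Sum>K\<in>T. LINT x|lebesgue. indicator K x * g x)"
    by (rule Bochner_Integration.integral_sum) (rule i)
  also have "\<dots> = (\<Sum>K\<in>T. integral\<^sup>L (lebesgue_on K) g)"
    by (intro sum.cong refl) (simp add: integral_restrict_space elt_lebesgue)
  finally show ?thesis .
qed

lemma weight_times_PW:
  assumes \<rho>: "weight \<rho>" and v: "v \<in> PW" and K: "K \<in> T"
  shows "integrable (lebesgue_on K) (\<lambda>x. \<rho> x * v x)"
proof -
  have \<rho>K: "integrable (lebesgue_on K) \<rho>" using \<rho> K unfolding weight_def by (rule integrable_cell_elt)
  have "integrable (lebesgue_on K) (\<lambda>x. \<rho> x * pol v K x)"
  proof (rule Bochner_Integration.integrable_bound)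
    show "integrable (lebesgue_on K) (\<lambda>x. vbound v * \<rho> x)" using \<rho>K by simp
    have "pol v K \<in> borel_measurable (lebesgue_on K)"
      using lebesgue_on_elt(1)[OF K pol_continuous[OF v K]] by (rule borel_measurable_integrable)
    then show "(\<lambda>x. \<rho> x * pol v K x) \<in> borel_measurable (lebesgue_on K)"
      using \<rho>K by (intro borel_measurable_times) auto
    show "AE x in lebesgue_on K. norm (\<rho> x * pol v K x) \<le> norm (vbound v * \<rho> x)"
      using vbound[OF v] K by (intro AE_I2) (auto simp: abs_mult mult.commute intro!: mult_mono)
  qed
  then show ?thesis
    by (subst elt_spike(2)[OF K, of _ "\<lambda>x. \<rho> x * pol v K x"]) (auto simp: pol_props(2)[OF v K])
qed

lemma weight_1: "weight (\<lambda>_. 1)"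
proof -
  have "torus_cell \<in> lmeasurable"
    using torus_cell_measurable by (intro bounded_set_imp_lmeasurable bounded_subset[OF bounded_cbox[of 0 "1::real^3"]])
      (auto simp: torus_cell_def mem_box_cart less_imp_le)
  then have "finite_measure (lebesgue_on torus_cell)" by (rule finite_measure_lebesgue_on)
  then show ?thesis unfolding weight_def by (rule finite_measure.integrable_const)
qed

lemma Linf_weight:
  assumes "Linf_fun (lebesgue_on torus_cell) \<rho>" shows "weight \<rho>"
proof -
  obtain C where C: "AE x in lebesgue_on torus_cell. \<bar>\<rho> x\<bar> \<le> C" using assms by (auto simp: Linf_fun_def)
  have "integrable (lebesgue_on torus_cell) (\<lambda>x. \<bar>C\<bar> * 1)"
    using weight_1 unfolding weight_def by (rule integrable_mult_right)
  then show ?thesis unfolding weight_def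
    by (rule Bochner_Integration.integrable_bound) (use assms C in \<open>auto simp: Linf_fun_def elim!: eventually_mono\<close>)
qed

lemma mass_sym: "mass \<rho> v w = mass \<rho> w v"
  by (simp add: mass_def mult.commute)

lemma bilin_mass:
  assumes \<rho>: "weight \<rho>" shows "bilin PW (mass \<rho>)"
proof -
  have 1: "mass \<rho> (\<lambda>x. a * v x + b * w x) z = a * mass \<rho> v z + b * mass \<rho> w z"
    if *: "v \<in> PW" "w \<in> PW" "z \<in> PW" for v w z a b
    unfolding mass_def sum_distrib_left sum.distrib[symmetric]
  proof (intro sum.cong refl)
    fix K assume K: "K \<in> T"
    have "integral\<^sup>L (lebesgue_on K) (\<lambda>x. \<rho> x * ((a * v x + b * w x) * z x))
      = integral\<^sup>L (lebesgue_on K) (\<lambda>x. a * (\<rho> x * (v x * z x)) + b * (\<rho> x * (w x * z x)))"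
      by (simp add: algebra_simps)
    also have "\<dots> = a * integral\<^sup>L (lebesgue_on K) (\<lambda>x. \<rho> x * (v x * z x)) + b * integral\<^sup>L (lebesgue_on K) (\<lambda>x. \<rho> x * (w x * z x))"
      using weight_times_PW[OF \<rho> PW_mult K] * by simp
    finally show "integral\<^sup>L (lebesgue_on K) (\<lambda>x. \<rho> x * ((a * v x + b * w x) * z x))
      = a * integral\<^sup>L (lebesgue_on K) (\<lambda>x. \<rho> x * (v x * z x)) + b * integral\<^sup>L (lebesgue_on K) (\<lambda>x. \<rho> x * (w x * z x))" .
  qed
  have 2: "mass \<rho> z (\<lambda>x. a * v x + b * w x) = a * mass \<rho> z v + b * mass \<rho> z w"
    if "v \<in> PW" "w \<in> PW" "z \<in> PW" for v w z a b
    using 1[OF that] by (simp only: mass_sym[of \<rho> z])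
  show ?thesis unfolding bilin_def by (intro ballI allI conjI; rule 1 2; assumption)
qed

lemma mass_lower:
  assumes \<rho>: "weight \<rho>" and low: "AE x in lebesgue_on torus_cell. \<rho> x \<ge> c" and v: "v \<in> PW"
  shows "mass \<rho> v v \<ge> c * mass (\<lambda>_. 1) v v"
  unfolding mass_def sum_distrib_left
proof (intro sum_mono)
  fix K assume K: "K \<in> T"
  have "integral\<^sup>L (lebesgue_on K) (\<lambda>x. c * (1 * (v x * v x))) \<le> integral\<^sup>L (lebesgue_on K) (\<lambda>x. \<rho> x * (v x * v x))"
  proof (rule integral_mono_AE)
    show "integrable (lebesgue_on K) (\<lambda>x. c * (1 * (v x * v x)))"
      using weight_times_PW[OF weight_1 PW_mult[OF v v] K] by (rule integrable_mult_right)
    show "integrable (lebesgue_on K) (\<lambda>x. \<rho> x * (v x * v x))" by (rule weight_times_PW[OF \<rho> PW_mult[OF v v] K])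
    show "AE x in lebesgue_on K. c * (1 * (v x * v x)) \<le> \<rho> x * (v x * v x)"
      using AE_cell_elt[OF low K] by eventually_elim (simp add: mult_right_mono)
  qed
  then show "c * integral\<^sup>L (lebesgue_on K) (\<lambda>x. 1 * (v x * v x)) \<le> integral\<^sup>L (lebesgue_on K) (\<lambda>x. \<rho> x * (v x * v x))"
    by simp
qed

lemma mass_nonneg: "mass (\<lambda>_. 1) v v \<ge> 0"
  unfolding mass_def by (intro sum_nonneg integral_nonneg_AE) auto

lemma form_cong:
  assumes "\<And>x. x \<in> \<Omega> \<Longrightarrow> v x = v' x" "\<And>x. x \<in> \<Omega> \<Longrightarrow> w x = w' x"
  shows "mass \<rho> v w = mass \<rho> v' w'" "avg_form i v w = avg_form i v' w'" "jump_form i v w = jump_form i v' w'" "vol_form i v w = vol_form i v' w'"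
proof -
  have i: "v x = v' x" "w x = w' x" if "K \<in> T" "x \<in> interior K" for K x using assms interior_in_\<Omega>[OF that] by auto
  show "mass \<rho> v w = mass \<rho> v' w'" unfolding mass_def by (intro sum.cong refl elt_spike(1)) (auto simp: i)
  have t: "tr d v = tr d v'" "tr d w = tr d w'" for d using assms by (auto intro: tr_cong)
  show "avg_form i v w = avg_form i v' w'" "jump_form i v w = jump_form i v' w'" by (simp_all add: avg_form_def jump_form_def avg_def jmp_def t)
  have "partial_deriv i w x = partial_deriv i w' x" if "K \<in> T" "x \<in> interior K" for K x
    using that i(2)[OF that(1)] by (intro partial_deriv_local[of "interior K"]) auto
  then show "vol_form i v w = vol_form i v' w'" unfolding vol_form_def by (intro sum.cong refl elt_spike(1)) (auto simp: i)
qed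

text \<open>Being almost everywhere zero and continuous on the open elements, \<open>v\<close> is zero there.\<close>

lemma mass_zero_imp:
  assumes v: "v \<in> PW" and z: "mass (\<lambda>_. 1) v v = 0" and x: "x \<in> \<Omega>"
  shows "v x = 0"
proof -
  obtain K where K: "K \<in> T" "frac3 x \<in> interior K" using x by (auto simp: \<Omega>_def)
  have "integral\<^sup>L (lebesgue_on K) (\<lambda>x. 1 * (v x * v x)) = 0"
    using z K(1) finT unfolding mass_def
    by (subst (asm) sum_nonneg_eq_0_iff) (auto intro!: integral_nonneg_AE)
  moreover have int: "integrable (lebesgue_on K) (\<lambda>x. 1 * (v x * v x))" by (rule weight_times_PW[OF weight_1 PW_mult[OF v v] K(1)])
  ultimately have "AE x in lebesgue_on K. v x = 0"
    by (subst (asm) integral_nonneg_eq_0_iff_AE) auto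
  then have "AE x in lebesgue. x \<in> K \<longrightarrow> v x = 0" using elt_lebesgue[OF K(1)] by (simp add: AE_restrict_space_iff)
  then obtain N where N: "negligible N" "\<And>y. y \<in> K \<Longrightarrow> v y \<noteq> 0 \<Longrightarrow> y \<in> N"
    unfolding eventually_ae_filter negligible_iff_null_sets by auto
  have "v (frac3 x) = 0"
  proof (rule ccontr)
    assume nz: "v (frac3 x) \<noteq> 0"
    have fo: "frac3 x \<in> \<Omega>" by (rule interior_in_\<Omega>[OF K])
    obtain d1 where d1: "d1 > 0" "\<And>w. dist w (frac3 x) < d1 \<Longrightarrow> dist (v w) (v (frac3 x)) < \<bar>v (frac3 x)\<bar>"
      using continuous_on_\<Omega>[OF v fo] nz unfolding continuous_at_eps_delta dist_norm real_norm_def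
      by (metis zero_less_abs_iff)
    obtain d2 where d2: "d2 > 0" "ball (frac3 x) d2 \<subseteq> K" using K(2) mem_interior by blast
    obtain y where y: "dist (frac3 x) y < min d1 d2" "y \<notin> N"
      using negligible_avoid[OF N(1), of "min d1 d2" "frac3 x"] d1(1) d2(1) by auto
    have "y \<in> ball (frac3 x) d2" using y(1) by simp
    then have "v y = 0" using N(2)[of y] d2(2) y(2) by blast
    then show False using d1(2)[of y] y(1) by (simp add: dist_commute dist_real_def)
  qed
  then show ?thesis by (simp add: frac3_periodic[OF PW_periodic[OF v]])
qed

lemma facet_integral_sum:
  assumes "finite S" "\<And>j. j \<in> S \<Longrightarrow> facet_integrable F n (g j)"
  shows "facet_integral F n (\<lambda>y. \<Sum>j\<in>S. c j * g j y) = (\<Sum>j\<in>S. c j * facet_integral F n (g j))"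
  using assms unfolding facet_integral_def facet_integrable_def
  by (subst Bochner_Integration.integral_sum) (auto intro: integrable_mult_right)

text \<open>Expanding the matrix products, each pair of components contributes the terms of \<open>face_terms\<close>.\<close>

lemma boundary_term:
  assumes U: "\<And>a. a \<in> sh_index N \<Longrightarrow> (\<lambda>x. u x a) \<in> PW" and V: "\<And>a. a \<in> sh_index N \<Longrightarrow> (\<lambda>x. v x a) \<in> PW"
  shows "(\<Sum>K\<in>T. boundary_integral K (\<lambda>n x. mdot N (numerical_flux N D n u x) (inner_trace n v x)))
    = (\<Sum>i\<in>UNIV. \<Sum>a\<in>sh_index N. \<Sum>b\<in>sh_index N.
        - flux_matrix i a b * avg_form i (\<lambda>x. u x b) (\<lambda>x. v x a) + 1/2 * D i a b * jump_form i (\<lambda>x. u x b) (\<lambda>x. v x a))"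
proof -
  let ?S = "(UNIV :: 3 set) \<times> sh_index N \<times> sh_index N"
  let ?A = "\<lambda>n a b y. trace_avg n u y b * inner_trace n v y a" and ?J = "\<lambda>n a b y. trace_jump n u y b * inner_trace n v y a"
  have expand: "mdot N (numerical_flux N D n u y) (inner_trace n v y) =
      (\<Sum>(i, a, b)\<in>?S. (n $ i * flux_matrix i a b) * ?A n a b y) + (\<Sum>(i, a, b)\<in>?S. (- 1/2 * \<bar>n $ i\<bar> * D i a b) * ?J n a b y)" for n y
  proof -
    have "mdot N (numerical_flux N D n u y) (inner_trace n v y) = (\<Sum>a\<in>sh_index N. \<Sum>i\<in>UNIV. \<Sum>b\<in>sh_index N.
       (n $ i * flux_matrix i a b) * ?A n a b y + (- 1/2 * \<bar>n $ i\<bar> * D i a b) * ?J n a b y)"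
      unfolding mdot_def numerical_flux_def mapply_def
      by (intro sum.cong refl) (simp add: sum_distrib_right sum_distrib_left left_diff_distrib right_diff_distrib
          sum_subtractf sum.distrib sum_negf sum_divide_distrib mult_ac)
    also have "\<dots> = (\<Sum>i\<in>UNIV. \<Sum>a\<in>sh_index N. \<Sum>b\<in>sh_index N.
       (n $ i * flux_matrix i a b) * ?A n a b y + (- 1/2 * \<bar>n $ i\<bar> * D i a b) * ?J n a b y)" by (rule sum.swap)
    also have "\<dots> = (\<Sum>(i, a, b)\<in>?S. (n $ i * flux_matrix i a b) * ?A n a b y + (- 1/2 * \<bar>n $ i\<bar> * D i a b) * ?J n a b y)"
      by (simp add: sum.cartesian_product)
    finally show ?thesis unfolding case_prod_beta sum.distrib .
  qed
  have facet: "facet_integral F n (\<lambda>y. mdot N (numerical_flux N D n u y) (inner_trace n v y))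
    = (\<Sum>(i, a, b)\<in>?S. flux_matrix i a b * (n $ i * facet_integral F n (?A n a b)))
      + (\<Sum>(i, a, b)\<in>?S. (- 1/2 * D i a b) * (\<bar>n $ i\<bar> * facet_integral F n (?J n a b)))"
    if K: "K \<in> T" "F facet_of K" and n: "n = facet_normal K F" for K F n
  proof -
    have fi: "facet_integrable F n (?A n a b)" "facet_integrable F n (?J n a b)" if "a \<in> sh_index N" "b \<in> sh_index N" for a b
      using facet_trace_terms(1,2)[where U = u and a = b and W = v and b = a, OF K U V n] that by auto
    have ii: "integrable (lebesgue_on {x + t *\<^sub>R n |x t. x \<in> F \<and> 0 \<le> t \<and> t \<le> 1}) (\<lambda>y. \<Sum>j\<in>?S. c j * g j (closest_point F y))"
      if "\<And>j. j \<in> ?S \<Longrightarrow> facet_integrable F n (g j)" for c and g :: "_ \<Rightarrow> real^3 \<Rightarrow> real"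
      using that unfolding facet_integrable_def by (intro Bochner_Integration.integrable_sum integrable_mult_right) auto
    have "facet_integral F n (\<lambda>y. mdot N (numerical_flux N D n u y) (inner_trace n v y))
      = facet_integral F n (\<lambda>y. \<Sum>(i, a, b)\<in>?S. (n $ i * flux_matrix i a b) * ?A n a b y)
       + facet_integral F n (\<lambda>y. \<Sum>(i, a, b)\<in>?S. (- 1/2 * \<bar>n $ i\<bar> * D i a b) * ?J n a b y)"
    proof -
      have 1: "facet_integrable F n ((\<lambda>(i, a, b). ?A n a b) j)" "facet_integrable F n ((\<lambda>(i, a, b). ?J n a b) j)" if "j \<in> ?S" for j
        using fi that by auto
      note i1 = ii[where g = "\<lambda>(i, a, b). ?A n a b" and c = "\<lambda>(i, a, b). n $ i * flux_matrix i a b", OF 1(1), unfolded case_prod_beta]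
      note i2 = ii[where g = "\<lambda>(i, a, b). ?J n a b" and c = "\<lambda>(i, a, b). - 1/2 * \<bar>n $ i\<bar> * D i a b", OF 1(2), unfolded case_prod_beta]
      show ?thesis
        unfolding expand facet_integral_def case_prod_beta by (rule Bochner_Integration.integral_add[OF i1 i2])
    qed
    also have "facet_integral F n (\<lambda>y. \<Sum>(i, a, b)\<in>?S. (n $ i * flux_matrix i a b) * ?A n a b y)
      = (\<Sum>(i, a, b)\<in>?S. (n $ i * flux_matrix i a b) * facet_integral F n (?A n a b))"
      unfolding case_prod_beta by (rule facet_integral_sum) (use fi in auto)
    also have "facet_integral F n (\<lambda>y. \<Sum>(i, a, b)\<in>?S. (- 1/2 * \<bar>n $ i\<bar> * D i a b) * ?J n a b y)
      = (\<Sum>(i, a, b)\<in>?S. (- 1/2 * \<bar>n $ i\<bar> * D i a b) * facet_integral F n (?J n a b))"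
      unfolding case_prod_beta by (rule facet_integral_sum) (use fi in auto)
    finally show ?thesis unfolding case_prod_beta by (simp only: mult_ac)
  qed
  let ?nf = "\<lambda>K F. facet_normal K F"
  have "(\<Sum>K\<in>T. boundary_integral K (\<lambda>n x. mdot N (numerical_flux N D n u x) (inner_trace n v x)))
    = (\<Sum>K\<in>T. \<Sum>F | F facet_of K. (\<Sum>(i, a, b)\<in>?S. flux_matrix i a b * (?nf K F $ i * facet_integral F (?nf K F) (?A (?nf K F) a b)))
      + (\<Sum>(i, a, b)\<in>?S. (- 1/2 * D i a b) * (\<bar>?nf K F $ i\<bar> * facet_integral F (?nf K F) (?J (?nf K F) a b))))"
    unfolding boundary_integral_def Let_def by (intro sum.cong refl facet) auto
  also have "\<dots> = (\<Sum>(i, a, b)\<in>?S. flux_matrix i a b * (\<Sum>K\<in>T. \<Sum>F | F facet_of K. ?nf K F $ i * facet_integral F (?nf K F) (?A (?nf K F) a b)))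
      + (\<Sum>(i, a, b)\<in>?S. (- 1/2 * D i a b) * (\<Sum>K\<in>T. \<Sum>F | F facet_of K. \<bar>?nf K F $ i\<bar> * facet_integral F (?nf K F) (?J (?nf K F) a b)))"
    unfolding sum.distrib case_prod_beta sum_distrib_left
    by (intro arg_cong2[of _ _ _ _ "(+)"] sum_rotate)
  also have "\<dots> = (\<Sum>(i, a, b)\<in>?S. flux_matrix i a b * - avg_form i (\<lambda>x. u x b) (\<lambda>x. v x a))
      + (\<Sum>(i, a, b)\<in>?S. (- 1/2 * D i a b) * - jump_form i (\<lambda>x. u x b) (\<lambda>x. v x a))"
    by (intro arg_cong2[of _ _ _ _ "(+)"] sum.cong refl)
      (clarsimp simp: face_terms[where U = u and W = v, OF U V])+
  also have "\<dots> = (\<Sum>(i, a, b)\<in>?S. - flux_matrix i a b * avg_form i (\<lambda>x. u x b) (\<lambda>x. v x a) + 1/2 * D i a b * jump_form i (\<lambda>x. u x b) (\<lambda>x. v x a))"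
    by (simp add: sum.distrib[symmetric] case_prod_beta)
  finally show ?thesis by (simp add: sum.cartesian_product)
qed

text \<open>Reduces the form of the scheme to scalar forms of pairs of components, with the average form and
  the volume form paired as in \<open>integration_by_parts\<close>.\<close>

lemma dg_form_eq:
  assumes U: "\<And>a. a \<in> sh_index N \<Longrightarrow> (\<lambda>x. u x a) \<in> PW" and V: "\<And>a. a \<in> sh_index N \<Longrightarrow> (\<lambda>x. v x a) \<in> PW"
    and \<sigma>: "weight \<sigma>t" "weight \<sigma>a"
  shows "dg_form T N D \<sigma>t \<sigma>a \<epsilon> u v = (\<Sum>i\<in>UNIV. \<Sum>a\<in>sh_index N. \<Sum>b\<in>sh_index N.
        - flux_matrix i a b * (avg_form i (\<lambda>x. u x b) (\<lambda>x. v x a) + vol_form i (\<lambda>x. u x b) (\<lambda>x. v x a))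
        + 1/2 * D i a b * jump_form i (\<lambda>x. u x b) (\<lambda>x. v x a))
      + (\<Sum>a\<in>sh_index N. if fst a = 0 then \<epsilon> * mass \<sigma>a (\<lambda>x. u x a) (\<lambda>x. v x a) else mass \<sigma>t (\<lambda>x. u x a) (\<lambda>x. v x a) / \<epsilon>)"
proof -
  let ?A = "sh_index N"
  have vol: "(\<Sum>K\<in>T. \<Sum>i\<in>UNIV. (LINT x|lebesgue_on K. mdot N (mapply N (flux_matrix i) (u x)) (\<lambda>a. partial_deriv i (\<lambda>y. v y a) x)))
    = (\<Sum>i\<in>UNIV. \<Sum>a\<in>?A. \<Sum>b\<in>?A. flux_matrix i a b * vol_form i (\<lambda>x. u x b) (\<lambda>x. v x a))"
  proof -
    have "(LINT x|lebesgue_on K. mdot N (mapply N (flux_matrix i) (u x)) (\<lambda>a. partial_deriv i (\<lambda>y. v y a) x))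
      = (\<Sum>a\<in>?A. \<Sum>b\<in>?A. flux_matrix i a b * (LINT x|lebesgue_on K. u x b * partial_deriv i (\<lambda>y. v y a) x))" if K: "K \<in> T" for K i
    proof -
      have int: "integrable (lebesgue_on K) (\<lambda>x. flux_matrix i a b * (u x b * partial_deriv i (\<lambda>y. v y a) x))" if "a \<in> ?A" "b \<in> ?A" for a b
        using vol_form_pol(2)[OF U[OF that(2)] V[OF that(1)] K] by (rule integrable_mult_right)
      have "(LINT x|lebesgue_on K. mdot N (mapply N (flux_matrix i) (u x)) (\<lambda>a. partial_deriv i (\<lambda>y. v y a) x))
        = (LINT x|lebesgue_on K. (\<Sum>a\<in>?A. \<Sum>b\<in>?A. flux_matrix i a b * (u x b * partial_deriv i (\<lambda>y. v y a) x)))"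
        by (simp add: mdot_def mapply_def sum_distrib_right mult.assoc)
      also have "\<dots> = (\<Sum>a\<in>?A. \<Sum>b\<in>?A. (LINT x|lebesgue_on K. flux_matrix i a b * (u x b * partial_deriv i (\<lambda>y. v y a) x)))"
        using int by (subst Bochner_Integration.integral_sum)
          (auto intro!: sum.cong Bochner_Integration.integral_sum Bochner_Integration.integrable_sum)
      finally show ?thesis by simp
    qed
    then have "(\<Sum>K\<in>T. \<Sum>i\<in>UNIV. (LINT x|lebesgue_on K. mdot N (mapply N (flux_matrix i) (u x)) (\<lambda>a. partial_deriv i (\<lambda>y. v y a) x)))
      = (\<Sum>K\<in>T. \<Sum>i\<in>UNIV. \<Sum>a\<in>?A. \<Sum>b\<in>?A. flux_matrix i a b * (LINT x|lebesgue_on K. u x b * partial_deriv i (\<lambda>y. v y a) x))"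
      by simp
    also have "\<dots> = (\<Sum>i\<in>UNIV. \<Sum>K\<in>T. \<Sum>a\<in>?A. \<Sum>b\<in>?A. flux_matrix i a b * (LINT x|lebesgue_on K. u x b * partial_deriv i (\<lambda>y. v y a) x))"
      by (rule sum.swap)
    also have "\<dots> = (\<Sum>i\<in>UNIV. \<Sum>a\<in>?A. \<Sum>b\<in>?A. \<Sum>K\<in>T. flux_matrix i a b * (LINT x|lebesgue_on K. u x b * partial_deriv i (\<lambda>y. v y a) x))"
      by (intro sum.cong refl, subst sum.swap, intro sum.cong refl, rule sum.swap)
    finally show ?thesis by (simp add: vol_form_def sum_distrib_left)
  qed
  have Qm: "(LINT x|lebesgue_on K. mdot N (mapply N (Q_matrix \<epsilon> \<sigma>t \<sigma>a x) (u x)) (v x))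
    = (\<Sum>a\<in>?A. if fst a = 0 then \<epsilon> * (LINT x|lebesgue_on K. \<sigma>a x * (u x a * v x a)) else (LINT x|lebesgue_on K. \<sigma>t x * (u x a * v x a)) / \<epsilon>)" if K: "K \<in> T" for K
  proof -
    let ?g = "\<lambda>a x. if fst a = (0::nat) then \<epsilon> * (\<sigma>a x * (u x a * v x a)) else (\<sigma>t x * (u x a * v x a)) / \<epsilon>"
    have "mdot N (mapply N (Q_matrix \<epsilon> \<sigma>t \<sigma>a x) (u x)) (v x) = (\<Sum>a\<in>?A. ?g a x)" for x
      unfolding mdot_def mapply_def Q_matrix_def mdiag_def
      by (intro sum.cong refl) (auto simp: case_prod_beta if_distrib[of "\<lambda>z. z * _"] cong: if_cong)
    moreover have "integrable (lebesgue_on K) (?g a)" if "a \<in> ?A" for a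
      using weight_times_PW[OF \<sigma>(1) PW_mult[OF U[OF that] V[OF that]] K] weight_times_PW[OF \<sigma>(2) PW_mult[OF U[OF that] V[OF that]] K]
      by (cases "fst a = 0") auto
    ultimately have "(LINT x|lebesgue_on K. mdot N (mapply N (Q_matrix \<epsilon> \<sigma>t \<sigma>a x) (u x)) (v x)) = (\<Sum>a\<in>?A. (LINT x|lebesgue_on K. ?g a x))"
      by (simp add: Bochner_Integration.integral_sum)
    also have "\<dots> = (\<Sum>a\<in>?A. if fst a = 0 then \<epsilon> * (LINT x|lebesgue_on K. \<sigma>a x * (u x a * v x a)) else (LINT x|lebesgue_on K. \<sigma>t x * (u x a * v x a)) / \<epsilon>)"
      by (intro sum.cong refl) auto
    finally show ?thesis .
  qed
  have Q: "(\<Sum>K\<in>T. (LINT x|lebesgue_on K. mdot N (mapply N (Q_matrix \<epsilon> \<sigma>t \<sigma>a x) (u x)) (v x)))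
    = (\<Sum>a\<in>?A. if fst a = 0 then \<epsilon> * mass \<sigma>a (\<lambda>x. u x a) (\<lambda>x. v x a) else mass \<sigma>t (\<lambda>x. u x a) (\<lambda>x. v x a) / \<epsilon>)"
    by (simp add: Qm, subst sum.swap, intro sum.cong refl) (auto simp: mass_def sum_distrib_left sum_divide_distrib)
  have "dg_form T N D \<sigma>t \<sigma>a \<epsilon> u v =
     (\<Sum>K\<in>T. boundary_integral K (\<lambda>n x. mdot N (numerical_flux N D n u x) (inner_trace n v x)))
     - (\<Sum>K\<in>T. \<Sum>i\<in>UNIV. (LINT x|lebesgue_on K. mdot N (mapply N (flux_matrix i) (u x)) (\<lambda>a. partial_deriv i (\<lambda>y. v y a) x)))
     + (\<Sum>K\<in>T. (LINT x|lebesgue_on K. mdot N (mapply N (Q_matrix \<epsilon> \<sigma>t \<sigma>a x) (u x)) (v x)))"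
    unfolding dg_form_def by (simp only: sum.distrib sum_subtractf)
  also have "\<dots> = (\<Sum>i\<in>UNIV. \<Sum>a\<in>?A. \<Sum>b\<in>?A.
        - flux_matrix i a b * avg_form i (\<lambda>x. u x b) (\<lambda>x. v x a) + 1/2 * D i a b * jump_form i (\<lambda>x. u x b) (\<lambda>x. v x a))
     - (\<Sum>i\<in>UNIV. \<Sum>a\<in>?A. \<Sum>b\<in>?A. flux_matrix i a b * vol_form i (\<lambda>x. u x b) (\<lambda>x. v x a))
     + (\<Sum>a\<in>?A. if fst a = 0 then \<epsilon> * mass \<sigma>a (\<lambda>x. u x a) (\<lambda>x. v x a) else mass \<sigma>t (\<lambda>x. u x a) (\<lambda>x. v x a) / \<epsilon>)"
    unfolding vol Q by (subst boundary_term, erule U, erule V, rule refl)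
  finally show ?thesis by (simp add: sum.distrib sum_subtractf sum_negf algebra_simps)
qed

end

section \<open>The discrete spaces as Euclidean spaces\<close>

lemma bilin_zero: assumes "bilin W B" "w \<in> W" shows "B (\<lambda>x. 0) w = 0" "B w (\<lambda>x. 0) = 0"
  using bilinD[OF assms(1) assms(2) assms(2) assms(2), of 0 0] by simp_all

lemma bilin_cmult:
  assumes "bilin W B" "v \<in> W" "w \<in> W"
  shows "B (\<lambda>x. c * v x) w = c * B v w" "B w (\<lambda>x. c * v x) = c * B w v"
  using bilinD[OF assms(1) assms(2) assms(2) assms(3), of c 0] by simp_all

lemma bilin_diff:
  assumes "bilin W B" "v \<in> W" "w \<in> W" "z \<in> W"
  shows "B (\<lambda>x. v x - w x) z = B v z - B w z" "B z (\<lambda>x. v x - w x) = B z v - B z w"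
  using bilinD[OF assms, of 1 "-1"] by simp_all

lemma bilin_square_diff:
  assumes "bilin W B" "v \<in> W" "w \<in> W" "(\<lambda>x. v x - w x) \<in> W"
  shows "B (\<lambda>x. v x - w x) (\<lambda>x. v x - w x) = B v v - B v w - B w v + B w w"
  using bilin_diff(1)[OF assms(1-3) assms(4)] bilin_diff(2)[OF assms(1-3), of v] bilin_diff(2)[OF assms(1-3), of w] assms
  by simp

text \<open>Otherwise the form would become negative on \<open>w + t r\<close> for suitable \<open>t\<close>.\<close>

lemma psd_null_orthogonal:
  assumes q: "bilin W q" and sym: "\<And>v w. q v w = q w v" and nn: "\<And>v. v \<in> W \<Longrightarrow> q v v \<ge> 0"
    and lin: "\<And>v w a b. v \<in> W \<Longrightarrow> w \<in> W \<Longrightarrow> (\<lambda>x. a * v x + b * w x) \<in> W"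
    and r: "r \<in> W" "q r r = 0" and w: "w \<in> W"
  shows "q r w = 0"
proof (rule ccontr)
  assume nz: "q r w \<noteq> 0"
  define t where "t = - (q w w + 1) / (2 * q r w)"
  let ?z = "\<lambda>x. 1 * w x + t * r x"
  have z: "?z \<in> W" using w r by (intro lin)
  have "q ?z ?z = q w ?z + t * q r ?z" using bilinD(1)[OF q w r(1) z, of 1 t] by simp
  moreover have "q w ?z = q w w + t * q w r" "q r ?z = q r w + t * q r r"
    using bilinD(2)[OF q w r(1) w, of 1 t] bilinD(2)[OF q w r(1) r(1), of 1 t] by simp_all
  ultimately have "q ?z ?z = q w w + 2 * t * q r w" using r sym[of w r] by (simp add: algebra_simps)
  also have "\<dots> = -1" using nz by (simp add: t_def field_simps)
  finally show False using nn[OF z] by simp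
qed

text \<open>Stated for a form that is only semidefinite, since functions that differ on element boundaries are not
  distinguished; a generator whose residual has norm zero adds no basis vector.\<close>

lemma gram_schmidt:
  fixes f :: "'i \<Rightarrow> 'x \<Rightarrow> real"
  assumes q: "bilin W q" and sym: "\<And>v w. q v w = q w v" and nn: "\<And>v. v \<in> W \<Longrightarrow> q v v \<ge> 0"
    and lin: "\<And>v w a b. v \<in> W \<Longrightarrow> w \<in> W \<Longrightarrow> (\<lambda>x. a * v x + b * w x) \<in> W" and zero: "(\<lambda>x. 0) \<in> W"
    and I: "finite I" "\<And>i. i \<in> I \<Longrightarrow> f i \<in> W"
  shows "\<exists>(n::nat) e. (\<forall>j<n. e j \<in> W) \<and> (\<forall>j<n. \<forall>k<n. q (e j) (e k) = (if j = k then 1 else 0)) \<and>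
    (\<forall>i\<in>I. q (\<lambda>x. f i x - (\<Sum>j<n. q (f i) (e j) * e j x)) (\<lambda>x. f i x - (\<Sum>j<n. q (f i) (e j) * e j x)) = 0)"
  using I
proof (induction I)
  case empty
  show ?case by (intro exI[of _ 0]) simp
next
  case (insert i I)
  then obtain n :: nat and e where e: "\<forall>j<n. e j \<in> W" "\<forall>j<n. \<forall>k<n. q (e j) (e k) = (if j = k then 1 else 0)"
    "\<forall>i\<in>I. q (\<lambda>x. f i x - (\<Sum>j<n. q (f i) (e j) * e j x)) (\<lambda>x. f i x - (\<Sum>j<n. q (f i) (e j) * e j x)) = 0"
    by auto
  have sumW: "(\<lambda>x. \<Sum>j\<in>S. c j * h j x) \<in> W" if "finite S" "\<And>j. j \<in> S \<Longrightarrow> h j \<in> W" for S :: "nat set" and c h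
    using that
  proof (induction S)
    case (insert a S)
    have "(\<lambda>x. c a * h a x + 1 * (\<Sum>j\<in>S. c j * h j x)) \<in> W" using insert by (intro lin) auto
    then show ?case using insert by simp
  qed (use zero in simp)
  let ?res = "\<lambda>g x. g x - (\<Sum>j<n. q g (e j) * e j x)"
  have resW: "?res g \<in> W" if "g \<in> W" for g
    using lin[OF that sumW[of "{..<n}" e "\<lambda>j. q g (e j)"], of 1 "-1"] e(1) by simp
  have res_e: "q (?res g) (e k) = 0" if g: "g \<in> W" and k: "k < n" for g k
  proof -
    have "q (?res g) (e k) = q g (e k) - q (\<lambda>x. \<Sum>j<n. q g (e j) * e j x) (e k)"
      using e(1) k by (intro bilin_diff(1)[OF q g] sumW) auto
    also have "q (\<lambda>x. \<Sum>j<n. q g (e j) * e j x) (e k) = (\<Sum>j<n. q g (e j) * q (e j) (e k))"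
      using e(1) k by (intro bilin_sum_left[OF q]) (auto intro: sumW)
    also have "\<dots> = (\<Sum>j<n. if j = k then q g (e k) else 0)"
      using e(2) k by (intro sum.cong refl) auto
    also have "\<dots> = q g (e k)" using k by simp
    finally show ?thesis by simp
  qed
  let ?r = "?res (f i)"
  have fi: "f i \<in> W" using insert by simp
  show ?case
  proof (cases "q ?r ?r = 0")
    case True
    then show ?thesis using e by (intro exI[of _ n] exI[of _ e]) auto
  next
    case False
    then have pos: "q ?r ?r > 0" using nn[OF resW[OF fi]] by simp
    define en where "en = (\<lambda>x. (1 / sqrt (q ?r ?r)) * ?r x)"
    have enW: "en \<in> W" unfolding en_def using lin[OF resW[OF fi] zero, of "1 / sqrt (q ?r ?r)" 0] by simp
    have en_en: "q en en = 1"
    proof -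
      have "q en en = (1 / sqrt (q ?r ?r)) * q ?r en"
        unfolding en_def by (rule bilin_cmult(1)[OF q resW[OF fi] enW[unfolded en_def]])
      also have "q ?r en = (1 / sqrt (q ?r ?r)) * q ?r ?r"
        unfolding en_def by (rule bilin_cmult(2)[OF q resW[OF fi] resW[OF fi]])
      finally show ?thesis using pos by (simp flip: power2_eq_square add: power2_eq_square[symmetric] field_simps)
    qed
    have en_e: "q en (e k) = 0" if "k < n" for k
    proof -
      have "q en (e k) = (1 / sqrt (q ?r ?r)) * q ?r (e k)"
        unfolding en_def by (rule bilin_cmult(1)[OF q resW[OF fi]]) (use e(1) that in auto)
      then show ?thesis using res_e[OF fi that] by simp
    qed
    define e' where "e' = e(n := en)"
    have new: "(\<lambda>x. g x - (\<Sum>j<Suc n. q g (e' j) * e' j x)) = (\<lambda>x. ?res g x - q g en * en x)" for g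
      by (auto simp: e'_def algebra_simps)
    have g_en: "q g en = q (?res g) en" if g: "g \<in> W" for g
    proof -
      have "q (?res g) en = q g en - q (\<lambda>x. \<Sum>j<n. q g (e j) * e j x) en"
        using e(1) enW by (intro bilin_diff(1)[OF q g] sumW) auto
      also have "q (\<lambda>x. \<Sum>j<n. q g (e j) * e j x) en = (\<Sum>j<n. q g (e j) * q (e j) en)"
        using e(1) enW by (intro bilin_sum_left[OF q]) (auto intro: sumW)
      also have "\<dots> = 0" using en_e sym by (intro sum.neutral) auto
      finally show ?thesis by simp
    qed
    show ?thesis
    proof (intro exI[of _ "Suc n"] exI[of _ e'] conjI ballI)
      show "\<forall>j<Suc n. e' j \<in> W" using e(1) enW by (auto simp: e'_def less_Suc_eq)
      show "\<forall>j<Suc n. \<forall>k<Suc n. q (e' j) (e' k) = (if j = k then 1 else 0)"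
        using e(2) en_en en_e sym by (auto simp: e'_def less_Suc_eq)
      fix i' assume i': "i' \<in> insert i I"
      show "q (\<lambda>x. f i' x - (\<Sum>j<Suc n. q (f i') (e' j) * e' j x)) (\<lambda>x. f i' x - (\<Sum>j<Suc n. q (f i') (e' j) * e' j x)) = 0"
      proof (cases "i' = i")
        case True
        have "q (f i) en = sqrt (q ?r ?r)"
        proof -
          have "q (f i) en = (1 / sqrt (q ?r ?r)) * q ?r ?r"
            unfolding g_en[OF fi] unfolding en_def by (rule bilin_cmult(2)[OF q resW[OF fi] resW[OF fi]])
          then show ?thesis using pos by (simp add: real_div_sqrt)
        qed
        then have "(\<lambda>x. ?r x - q (f i) en * en x) = (\<lambda>x. 0)" using pos by (simp add: en_def)
        then show ?thesis unfolding True new using bilin_zero(1)[OF q zero] by simp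
      next
        case False
        then have iI: "i' \<in> I" using i' by simp
        then have g: "f i' \<in> W" using insert by simp
        have z: "q (?res (f i')) (?res (f i')) = 0" using e(3) iI by blast
        then have "q (f i') en = 0"
          unfolding g_en[OF g] using psd_null_orthogonal[OF q sym nn lin resW[OF g] z enW] by blast
        then show ?thesis unfolding new using z by simp
      qed
    qed
  qed
qed

lemma finite_poly_exponents: "finite (poly_exponents kind k)"
proof -
  have "{\<alpha> :: 3 \<Rightarrow> nat. \<forall>i. \<alpha> i \<le> k} = PiE UNIV (\<lambda>_. {..k})" by auto
  then have fin: "finite {\<alpha> :: 3 \<Rightarrow> nat. \<forall>i. \<alpha> i \<le> k}" by (simp add: finite_PiE)
  show ?thesis
  proof (cases kind)
    case Triangular
    have "\<alpha> i \<le> k" if "(\<Sum>i\<in>UNIV. \<alpha> i) \<le> k" for \<alpha> :: "3 \<Rightarrow> nat" and i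
      using that member_le_sum[of i UNIV \<alpha>] by simp
    then show ?thesis using Triangular by (intro finite_subset[OF _ fin]) auto
  qed (use fin in simp)
qed

lemma monomial_polynomial: "real_polynomial_function (\<lambda>x::real^3. c * (\<Prod>i\<in>UNIV. x $ i ^ \<alpha> i))"
  by (intro real_polynomial_function.intros(4) real_polynomial_function.intros(2) real_polynomial_function_prod
      real_polynomial_function_power real_polynomial_function.intros(1) bounded_linear_vec_nth) auto

lemma poly_space_polynomial: "p \<in> poly_space kind k \<Longrightarrow> real_polynomial_function p"
proof -
  assume "p \<in> poly_space kind k"
  then obtain c where "p = (\<lambda>x. \<Sum>\<alpha>\<in>poly_exponents kind k. c \<alpha> * (\<Prod>i\<in>UNIV. x $ i ^ \<alpha> i))"
    by (auto simp: poly_space_def fun_eq_iff)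
  then show ?thesis using finite_poly_exponents monomial_polynomial by (auto intro!: real_polynomial_function_sum)
qed

lemma poly_space_lincomb:
  assumes "p \<in> poly_space kind k" "q \<in> poly_space kind k"
  shows "(\<lambda>x. a * p x + b * q x) \<in> poly_space kind k"
proof -
  obtain c d where "\<And>x. p x = (\<Sum>\<alpha>\<in>poly_exponents kind k. c \<alpha> * (\<Prod>i\<in>UNIV. x $ i ^ \<alpha> i))"
    "\<And>x. q x = (\<Sum>\<alpha>\<in>poly_exponents kind k. d \<alpha> * (\<Prod>i\<in>UNIV. x $ i ^ \<alpha> i))"
    using assms by (auto simp: poly_space_def)
  then show ?thesis unfolding poly_space_def
    by (intro CollectI exI[of _ "\<lambda>\<alpha>. a * c \<alpha> + b * d \<alpha>"]) (simp add: sum_distrib_left sum.distrib algebra_simps)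
qed

lemma poly_space_zero: "(\<lambda>x. 0) \<in> poly_space kind k"
  unfolding poly_space_def by (intro CollectI exI[of _ "\<lambda>_. 0"]) simp

lemma poly_space_monomial:
  assumes "\<alpha> \<in> poly_exponents kind k" shows "(\<lambda>x. \<Prod>i\<in>UNIV. x $ i ^ \<alpha> i) \<in> poly_space kind k"
  unfolding poly_space_def
proof (intro CollectI exI[of _ "\<lambda>\<beta>. if \<beta> = \<alpha> then 1 else 0"] allI)
  fix x :: "real^3"
  have "(\<Sum>\<beta>\<in>poly_exponents kind k. (if \<beta> = \<alpha> then 1 else 0) * (\<Prod>i\<in>UNIV. x $ i ^ \<beta> i))
    = (\<Sum>\<beta>\<in>poly_exponents kind k. if \<beta> = \<alpha> then (\<Prod>i\<in>UNIV. x $ i ^ \<alpha> i) else 0)"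
    by (intro sum.cong) auto
  then show "(\<Prod>i\<in>UNIV. x $ i ^ \<alpha> i) = (\<Sum>\<beta>\<in>poly_exponents kind k. (if \<beta> = \<alpha> then 1 else 0) * (\<Prod>i\<in>UNIV. x $ i ^ \<beta> i))"
    using assms finite_poly_exponents by simp
qed

lemma DG_space_lincomb:
  assumes "v \<in> DG_space kind T k" "w \<in> DG_space kind T k"
  shows "(\<lambda>x. a * v x + b * w x) \<in> DG_space kind T k"
proof -
  have "\<exists>p\<in>poly_space kind k. \<forall>x\<in>interior K. a * v x + b * w x = p x" if K: "K \<in> T" for K
  proof -
    obtain p q where "p \<in> poly_space kind k" "q \<in> poly_space kind k" "\<forall>x\<in>interior K. v x = p x" "\<forall>x\<in>interior K. w x = q x"
      using assms K unfolding DG_space_def by blast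
    then show ?thesis by (intro bexI[OF _ poly_space_lincomb[of p kind k q a b]]) auto
  qed
  then show ?thesis using assms by (auto simp: DG_space_def torus_periodic_def)
qed

lemma DG_space_zero: "(\<lambda>x. 0) \<in> DG_space kind T k"
  using poly_space_zero by (auto simp: DG_space_def torus_periodic_def)

lemma DG_space_cmult: "v \<in> DG_space kind T k \<Longrightarrow> (\<lambda>x. c * v x) \<in> DG_space kind T k"
  using DG_space_lincomb[of v kind T k v c 0] by simp

lemma DG_space_diff: "v \<in> DG_space kind T k \<Longrightarrow> w \<in> DG_space kind T k \<Longrightarrow> (\<lambda>x. v x - w x) \<in> DG_space kind T k"
  using DG_space_lincomb[of v kind T k w 1 "-1"] by simp

lemma DG_space_sum:
  assumes "finite S" "\<And>j. j \<in> S \<Longrightarrow> f j \<in> DG_space kind T k" shows "(\<lambda>x. \<Sum>j\<in>S. c j * f j x) \<in> DG_space kind T k"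
  using assms
proof (induction S)
  case (insert a S)
  have "(\<lambda>x. c a * f a x + 1 * (\<Sum>j\<in>S. c j * f j x)) \<in> DG_space kind T k" using insert by (intro DG_space_lincomb) auto
  then show ?case using insert by simp
qed (simp add: DG_space_zero)

context unit_cube_mesh
begin

lemma DG_space_PW: "DG_space kind T k \<subseteq> PW"
  using poly_space_polynomial by (fastforce simp: DG_space_def PW_def)

lemma DG_space_cong:
  assumes "v \<in> DG_space kind T k" "torus_periodic w" "\<And>x. x \<in> \<Omega> \<Longrightarrow> w x = v x"
  shows "w \<in> DG_space kind T k"
proof -
  have "\<exists>p\<in>poly_space kind k. \<forall>x\<in>interior K. w x = p x" if K: "K \<in> T" for K
  proof -
    obtain p where "p \<in> poly_space kind k" "\<forall>x\<in>interior K. v x = p x" using assms(1) K unfolding DG_space_def by blast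
    then show ?thesis using assms(3) interior_in_\<Omega>[OF K] by (intro bexI[of _ p]) auto
  qed
  then show ?thesis using assms(2) by (auto simp: DG_space_def)
qed

text \<open>Monomials on one element, extended by zero and periodically.\<close>

definition dg_monomial :: "(real^3) set \<times> (3 \<Rightarrow> nat) \<Rightarrow> real^3 \<Rightarrow> real" where
  "dg_monomial = (\<lambda>(K, \<alpha>) x. if frac3 x \<in> interior K then \<Prod>i\<in>UNIV. frac3 x $ i ^ \<alpha> i else 0)"

lemma frac3_interior: "K \<in> T \<Longrightarrow> x \<in> interior K \<Longrightarrow> frac3 x = x"
  using frac3_eqI[of 0 x] interior_box by auto

lemma dg_monomial_DG:
  assumes "K \<in> T" "\<alpha> \<in> poly_exponents kind k" shows "dg_monomial (K, \<alpha>) \<in> DG_space kind T k"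
proof -
  have "\<exists>p\<in>poly_space kind k. \<forall>x\<in>interior L. dg_monomial (K, \<alpha>) x = p x" if L: "L \<in> T" for L
  proof (cases "L = K")
    case True
    then show ?thesis using frac3_interior[OF assms(1)]
      by (intro bexI[OF _ poly_space_monomial[OF assms(2)]]) (auto simp: dg_monomial_def)
  next
    case False
    then show ?thesis using disT[OF L assms(1)] frac3_interior[OF L]
      by (intro bexI[OF _ poly_space_zero]) (auto simp: dg_monomial_def)
  qed
  then show ?thesis by (auto simp: DG_space_def torus_periodic_def dg_monomial_def frac3_shift)
qed

lemma dg_monomial_span:
  assumes "v \<in> DG_space kind T k"
  shows "\<exists>c. \<forall>x\<in>\<Omega>. v x = (\<Sum>j\<in>T \<times> poly_exponents kind k. c j * dg_monomial j x)"
proof -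
  have "\<forall>K\<in>T. \<exists>c. \<forall>x\<in>interior K. v x = (\<Sum>\<alpha>\<in>poly_exponents kind k. c \<alpha> * (\<Prod>i\<in>UNIV. x $ i ^ \<alpha> i))"
    using assms by (fastforce simp: DG_space_def poly_space_def)
  then obtain c where c: "\<And>K x. K \<in> T \<Longrightarrow> x \<in> interior K \<Longrightarrow> v x = (\<Sum>\<alpha>\<in>poly_exponents kind k. c K \<alpha> * (\<Prod>i\<in>UNIV. x $ i ^ \<alpha> i))"
    by metis
  have per: "torus_periodic v" using assms by (simp add: DG_space_def)
  have "v x = (\<Sum>j\<in>T \<times> poly_exponents kind k. (\<lambda>(K, \<alpha>). c K \<alpha>) j * dg_monomial j x)" if x: "x \<in> \<Omega>" for x
  proof -
    obtain K where K: "K \<in> T" "frac3 x \<in> interior K" using x by (auto simp: \<Omega>_def)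
    have out: "frac3 x \<notin> interior L" if "L \<in> T" "L \<noteq> K" for L using disT[OF K(1) that(1)] that K(2) by auto
    have "(\<Sum>j\<in>T \<times> poly_exponents kind k. (\<lambda>(K, \<alpha>). c K \<alpha>) j * dg_monomial j x)
      = (\<Sum>L\<in>T. \<Sum>\<alpha>\<in>poly_exponents kind k. c L \<alpha> * dg_monomial (L, \<alpha>) x)"
      by (simp add: sum.cartesian_product case_prod_beta)
    also have "\<dots> = (\<Sum>L\<in>T. if L = K then (\<Sum>\<alpha>\<in>poly_exponents kind k. c K \<alpha> * (\<Prod>i\<in>UNIV. frac3 x $ i ^ \<alpha> i)) else 0)"
      using out K by (intro sum.cong refl) (auto simp: dg_monomial_def)
    also have "\<dots> = v (frac3 x)" using finT K c by simp
    also have "\<dots> = v x" by (rule frac3_periodic[OF per])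
    finally show ?thesis by simp
  qed
  then show ?thesis by blast
qed

text \<open>An orthonormal basis of the discrete space, up to values outside the element interiors. It turns
  convergence in the space into convergence of finitely many real coefficients.\<close>

definition is_onb :: "mesh_kind \<Rightarrow> nat \<Rightarrow> nat \<Rightarrow> (nat \<Rightarrow> real^3 \<Rightarrow> real) \<Rightarrow> bool" where
  "is_onb kind k n e \<longleftrightarrow> (\<forall>j<n. e j \<in> DG_space kind T k) \<and>
     (\<forall>j<n. \<forall>l<n. mass (\<lambda>_. 1) (e j) (e l) = (if j = l then 1 else 0)) \<and>
     (\<forall>v\<in>DG_space kind T k. \<forall>x\<in>\<Omega>. v x = (\<Sum>j<n. mass (\<lambda>_. 1) v (e j) * e j x))"

lemma bilin_subset: "bilin W B \<Longrightarrow> W' \<subseteq> W \<Longrightarrow> bilin W' B"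
  unfolding bilin_def by blast

lemma is_onb_exists: "\<exists>n e. is_onb kind k n e"
proof -
  let ?W = "DG_space kind T k" and ?q = "mass (\<lambda>_. 1)" and ?I = "T \<times> poly_exponents kind k"
  have q: "bilin ?W ?q" by (rule bilin_subset[OF bilin_mass[OF weight_1] DG_space_PW])
  have finI: "finite ?I" using finT finite_poly_exponents by simp
  have dgI: "dg_monomial i \<in> ?W" if "i \<in> ?I" for i using that dg_monomial_DG by auto
  define G where "G n e \<longleftrightarrow> (\<forall>j<n. e j \<in> ?W) \<and> (\<forall>j<n. \<forall>k<n. ?q (e j) (e k) = (if j = k then 1 else 0)) \<and>
    (\<forall>i\<in>?I. ?q (\<lambda>x. dg_monomial i x - (\<Sum>j<n. ?q (dg_monomial i) (e j) * e j x)) (\<lambda>x. dg_monomial i x - (\<Sum>j<n. ?q (dg_monomial i) (e j) * e j x)) = 0)"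
    for n :: nat and e
  have "\<exists>n e. G n e" unfolding G_def
    by (rule gram_schmidt[OF q mass_sym mass_nonneg DG_space_lincomb DG_space_zero finI]; (assumption | rule dgI))
  then obtain n e where "G n e" by (elim exE)
  note G = this[unfolded G_def]
  note e = conjunct1[OF G] conjunct1[OF conjunct2[OF G]] and res = conjunct2[OF conjunct2[OF G]]
  have mon: "dg_monomial i x = (\<Sum>j<n. ?q (dg_monomial i) (e j) * e j x)" if i: "i \<in> ?I" and x: "x \<in> \<Omega>" for i x
  proof -
    have "(\<lambda>x. dg_monomial i x - (\<Sum>j<n. ?q (dg_monomial i) (e j) * e j x)) \<in> ?W"
      using e(1) by (intro DG_space_diff dgI[OF i] DG_space_sum) auto
    then show ?thesis using mass_zero_imp[OF _ bspec[OF res i] x] DG_space_PW by auto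
  qed
  have "v x = (\<Sum>j<n. ?q v (e j) * e j x)" if v: "v \<in> ?W" and x: "x \<in> \<Omega>" for v x
  proof -
    obtain c where c: "\<And>x. x \<in> \<Omega> \<Longrightarrow> v x = (\<Sum>i\<in>?I. c i * dg_monomial i x)" using dg_monomial_span[OF v] by blast
    have qv: "?q v (e j) = (\<Sum>i\<in>?I. c i * ?q (dg_monomial i) (e j))" if "j < n" for j
    proof -
      have "?q v (e j) = ?q (\<lambda>x. \<Sum>i\<in>?I. c i * dg_monomial i x) (e j)" by (rule form_cong(1)) (use c in auto)
      also have "\<dots> = (\<Sum>i\<in>?I. c i * ?q (dg_monomial i) (e j))"
      proof (rule bilin_sum_left[OF q])
        show "(\<lambda>x. \<Sum>j\<in>S. c j * f j x) \<in> ?W" if "finite S" "\<And>j. j \<in> S \<Longrightarrow> f j \<in> ?W" for S f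
          using that by (rule DG_space_sum)
        show "e j \<in> ?W" using e(1) that by blast
      qed (fact dgI finI)+
      finally show ?thesis .
    qed
    have "v x = (\<Sum>i\<in>?I. c i * (\<Sum>j<n. ?q (dg_monomial i) (e j) * e j x))" unfolding c[OF x] using mon[OF _ x] by simp
    also have "\<dots> = (\<Sum>j<n. \<Sum>i\<in>?I. c i * ?q (dg_monomial i) (e j) * e j x)"
      unfolding sum_distrib_left mult.assoc[symmetric] by (rule sum.swap)
    also have "\<dots> = (\<Sum>j<n. ?q v (e j) * e j x)" using qv by (simp add: sum_distrib_right)
    finally show ?thesis .
  qed
  then show ?thesis using e unfolding is_onb_def by blast
qed

definition dg_dim :: "mesh_kind \<Rightarrow> nat \<Rightarrow> nat" where "dg_dim kind k = (SOME n. \<exists>e. is_onb kind k n e)"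
definition dg_basis :: "mesh_kind \<Rightarrow> nat \<Rightarrow> nat \<Rightarrow> real^3 \<Rightarrow> real" where "dg_basis kind k = (SOME e. is_onb kind k (dg_dim kind k) e)"

lemma is_onb_dg_basis: "is_onb kind k (dg_dim kind k) (dg_basis kind k)"
proof -
  have "\<exists>e. is_onb kind k (dg_dim kind k) e" unfolding dg_dim_def by (rule someI_ex) (rule is_onb_exists)
  then show ?thesis unfolding dg_basis_def by (rule someI_ex)
qed

lemma dg_basis_DG: "j < dg_dim kind k \<Longrightarrow> dg_basis kind k j \<in> DG_space kind T k"
  and dg_basis_on: "j < dg_dim kind k \<Longrightarrow> l < dg_dim kind k \<Longrightarrow> mass (\<lambda>_. 1) (dg_basis kind k j) (dg_basis kind k l) = (if j = l then 1 else 0)"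
  and dg_basis_expand: "v \<in> DG_space kind T k \<Longrightarrow> x \<in> \<Omega> \<Longrightarrow> v x = (\<Sum>j<dg_dim kind k. mass (\<lambda>_. 1) v (dg_basis kind k j) * dg_basis kind k j x)"
  using is_onb_dg_basis[of kind k] unfolding is_onb_def by blast+

lemma DG_PW: "v \<in> DG_space kind T k \<Longrightarrow> v \<in> PW"
  using DG_space_PW[of kind k] by (rule subsetD)

lemma dg_basis_PW: "j < dg_dim kind k \<Longrightarrow> dg_basis kind k j \<in> PW"
  by (rule DG_PW[OF dg_basis_DG])

text \<open>Basis expansions are identities on \<open>\<Omega>\<close> only, so they can be inserted into forms that do not see
  the values outside.\<close>

definition omega_cong :: "((real^3 \<Rightarrow> real) \<Rightarrow> (real^3 \<Rightarrow> real) \<Rightarrow> real) \<Rightarrow> bool" where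
  "omega_cong B \<longleftrightarrow> (\<forall>v v' w w'. (\<forall>x\<in>\<Omega>. v x = v' x) \<longrightarrow> (\<forall>x\<in>\<Omega>. w x = w' x) \<longrightarrow> B v w = B v' w')"

lemma omega_cong_forms: "omega_cong (mass \<rho>)" "omega_cong (avg_form i)" "omega_cong (jump_form i)" "omega_cong (vol_form i)"
  unfolding omega_cong_def by (intro allI impI form_cong; simp)+

lemma omegacongD:
  assumes B: "omega_cong B" and v: "\<And>x. x \<in> \<Omega> \<Longrightarrow> v x = v' x" and w: "\<And>x. x \<in> \<Omega> \<Longrightarrow> w x = w' x"
  shows "B v w = B v' w'"
  by (rule B[unfolded omega_cong_def, rule_format]) (fact v w)+

lemma omega_cong_swap: "omega_cong B \<Longrightarrow> omega_cong (\<lambda>v w. B w v)"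
  unfolding omega_cong_def[of "\<lambda>v w. B w v"] by (intro allI impI, erule omegacongD) simp_all

lemma PW_lsum: "finite S \<Longrightarrow> (\<And>j. j \<in> S \<Longrightarrow> f j \<in> PW) \<Longrightarrow> (\<lambda>x. \<Sum>j\<in>S. c j * f j x) \<in> PW"
  by (intro PW_sum PW_cmult)

lemma expand_left:
  assumes B: "bilin PW B" "omega_cong B" and v: "v \<in> DG_space kind T k" and w: "w \<in> PW"
  shows "B v w = (\<Sum>j<dg_dim kind k. mass (\<lambda>_. 1) v (dg_basis kind k j) * B (dg_basis kind k j) w)"
proof -
  have "B v w = B (\<lambda>x. \<Sum>j<dg_dim kind k. mass (\<lambda>_. 1) v (dg_basis kind k j) * dg_basis kind k j x) w"
    by (rule omegacongD[OF B(2)]) (use dg_basis_expand[OF v] in auto)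
  also have "\<dots> = (\<Sum>j<dg_dim kind k. mass (\<lambda>_. 1) v (dg_basis kind k j) * B (dg_basis kind k j) w)"
    by (rule bilin_sum_left[OF B(1) PW_lsum _ w]) (use dg_basis_PW in auto)
  finally show ?thesis .
qed

lemma parseval:
  assumes v: "v \<in> DG_space kind T k"
  shows "mass (\<lambda>_. 1) v v = (\<Sum>j<dg_dim kind k. (mass (\<lambda>_. 1) v (dg_basis kind k j))\<^sup>2)"
proof -
  have "mass (\<lambda>_. 1) v v = (\<Sum>j<dg_dim kind k. mass (\<lambda>_. 1) v (dg_basis kind k j) * mass (\<lambda>_. 1) (dg_basis kind k j) v)"
    by (rule expand_left[OF bilin_mass[OF weight_1] omega_cong_forms(1) v DG_PW[OF v]])
  also have "\<dots> = (\<Sum>j<dg_dim kind k. (mass (\<lambda>_. 1) v (dg_basis kind k j))\<^sup>2)"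
    by (intro sum.cong refl) (simp only: power2_eq_square mass_sym[of _ _ v])
  finally show ?thesis .
qed

text \<open>Convergence of the coefficients; by \<open>dg_conv_mass_diff\<close> it is convergence in the mean square.\<close>

definition dg_conv :: "mesh_kind \<Rightarrow> nat \<Rightarrow> (nat \<Rightarrow> real^3 \<Rightarrow> real) \<Rightarrow> (real^3 \<Rightarrow> real) \<Rightarrow> bool" where
  "dg_conv kind k vn v \<longleftrightarrow> (\<forall>n. vn n \<in> DG_space kind T k) \<and> v \<in> DG_space kind T k \<and>
     (\<forall>j<dg_dim kind k. (\<lambda>n. mass (\<lambda>_. 1) (vn n) (dg_basis kind k j)) \<longlonglongrightarrow> mass (\<lambda>_. 1) v (dg_basis kind k j))"

lemma dg_conv_left:
  assumes B: "bilin PW B" "omega_cong B" and c: "dg_conv kind k vn v" and w: "w \<in> PW"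
  shows "(\<lambda>n. B (vn n) w) \<longlonglongrightarrow> B v w"
proof -
  have d: "vn n \<in> DG_space kind T k" "v \<in> DG_space kind T k" for n using c by (auto simp: dg_conv_def)
  show ?thesis unfolding expand_left[OF B d(1) w] expand_left[OF B d(2) w]
    using c by (intro tendsto_sum tendsto_mult tendsto_const) (auto simp: dg_conv_def)
qed

lemma dg_conv_both:
  assumes B: "bilin PW B" "omega_cong B" and c: "dg_conv kind k vn v" and c': "dg_conv kind' k' wn w"
  shows "(\<lambda>n. B (vn n) (wn n)) \<longlonglongrightarrow> B v w"
proof -
  have d: "vn n \<in> DG_space kind T k" "v \<in> DG_space kind T k" "wn n \<in> DG_space kind' T k'" "w \<in> DG_space kind' T k'" for n
    using c c' by (auto simp: dg_conv_def)
  then have p: "wn n \<in> PW" "w \<in> PW" for n by (auto intro: DG_PW)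
  have b: "(\<lambda>n. B (dg_basis kind k j) (wn n)) \<longlonglongrightarrow> B (dg_basis kind k j) w" if "j < dg_dim kind k" for j
  proof -
    have "omega_cong (\<lambda>v w. B w v)" using B(2) by (rule omega_cong_swap)
    from dg_conv_left[OF bilin_swap[OF B(1)] this c'] show ?thesis using dg_basis_PW[OF that] by blast
  qed
  show ?thesis unfolding expand_left[OF B d(1) p(1)] expand_left[OF B d(2) p(2)]
    using c b by (intro tendsto_sum tendsto_mult) (auto simp: dg_conv_def)
qed

lemma dg_conv_mass_diff:
  assumes c: "dg_conv kind k vn v"
  shows "(\<lambda>n. mass (\<lambda>_. 1) (\<lambda>x. vn n x - v x) (\<lambda>x. vn n x - v x)) \<longlonglongrightarrow> 0"
proof -
  let ?q = "mass (\<lambda>_. 1)"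
  have d: "vn n \<in> PW" "v \<in> PW" for n using c by (auto simp: dg_conv_def intro: DG_PW)
  have "?q (\<lambda>x. vn n x - v x) (\<lambda>x. vn n x - v x) = ?q (vn n) (vn n) - 2 * ?q (vn n) v + ?q v v" for n
    using bilin_square_diff[OF bilin_mass[OF weight_1] d(1) d(2) PW_diff[OF d(1) d(2)], of n] mass_sym[of _ v "vn n"] by simp
  moreover have "(\<lambda>n. ?q (vn n) (vn n) - 2 * ?q (vn n) v + ?q v v) \<longlonglongrightarrow> ?q v v - 2 * ?q v v + ?q v v"
    using c d by (intro tendsto_intros dg_conv_both[OF bilin_mass[OF weight_1] omega_cong_forms(1)]
        dg_conv_left[OF bilin_mass[OF weight_1] omega_cong_forms(1)])
  ultimately show ?thesis by simp
qed

end

text \<open>Bolzano and Weierstrass, for finitely many coordinates in turn.\<close>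

lemma bounded_finite_subseq:
  fixes c :: "nat \<Rightarrow> 'i \<Rightarrow> real"
  assumes "finite I" "\<And>i n. i \<in> I \<Longrightarrow> \<bar>c n i\<bar> \<le> B"
  shows "\<exists>r l. strict_mono (r :: nat \<Rightarrow> nat) \<and> (\<forall>i\<in>I. (\<lambda>n. c (r n) i) \<longlonglongrightarrow> l i)"
  using assms
proof (induction I)
  case empty
  show ?case by (intro exI[of _ id]) (simp add: strict_mono_def)
next
  case (insert i I)
  then obtain r l where r: "strict_mono (r :: nat \<Rightarrow> nat)" "\<forall>i\<in>I. (\<lambda>n. c (r n) i) \<longlonglongrightarrow> l i" by auto
  have "bounded (range (\<lambda>n. c (r n) i))" using insert.prems[of i] by (auto simp: bounded_iff)
  then obtain m s where s: "strict_mono s" "((\<lambda>n. c (r n) i) \<circ> s) \<longlonglongrightarrow> m"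
    using bounded_imp_convergent_subsequence by metis
  show ?case
  proof (intro exI[of _ "r \<circ> s"] exI[of _ "l(i := m)"] conjI ballI)
    show "strict_mono (r \<circ> s)" using r(1) s(1) by (rule strict_mono_o)
    fix i' assume i': "i' \<in> insert i I"
    show "(\<lambda>n. c ((r \<circ> s) n) i') \<longlonglongrightarrow> (l(i := m)) i'"
    proof (cases "i' = i")
      case True
      then show ?thesis using s(2) by (simp add: o_def)
    next
      case False
      then have "(\<lambda>n. c (r n) i') \<longlonglongrightarrow> l i'" using r(2) i' by auto
      from LIMSEQ_subseq_LIMSEQ[OF this s(1)] False show ?thesis by (simp add: o_def)
    qed
  qed
qed

lemma finite_measure_sphere: "finite_measure sphere_measure"
proof -
  have "integrable sphere_measure (\<lambda>_. 1 :: real)" by (rule sphere_integral(1)) simp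
  then have "emeasure sphere_measure (space sphere_measure) < \<infinity>" by (simp add: integrable_iff_bounded)
  then show ?thesis by (intro finite_measureI) simp
qed

lemma finite_measure_cell: "finite_measure (lebesgue_on torus_cell)"
  using torus_cell_measurable
  by (intro finite_measure_lebesgue_on bounded_set_imp_lmeasurable bounded_subset[OF bounded_cbox[of 0 "1::real^3"]])
    (auto simp: torus_cell_def mem_box_cart less_imp_le)

text \<open>The harmonics are bounded on the sphere, so the integrand is dominated by
  a multiple of \<open>1 + f\<^sup>2\<close>, which is integrable over the finite product measure; then Fubini's theorem applies.\<close>

lemma source_moments_integrable:
  assumes f: "L2_fun (lebesgue_on torus_cell \<Otimes>\<^sub>M sphere_measure) (\<lambda>(x, \<omega>). f x \<omega>)"
  shows "integrable (lebesgue_on torus_cell) (\<lambda>x. source_moments f x a)"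
proof -
  interpret C: finite_measure "lebesgue_on torus_cell" by (rule finite_measure_cell)
  interpret S: finite_measure sphere_measure by (rule finite_measure_sphere)
  interpret P: pair_sigma_finite "lebesgue_on torus_cell" sphere_measure by standard
  let ?M = "lebesgue_on torus_cell \<Otimes>\<^sub>M sphere_measure"
  have finM: "finite_measure ?M" by (rule finite_measure_pair_measure[OF finite_measure_sphere finite_measure_cell])
  have fm: "(\<lambda>(x, \<omega>). f x \<omega>) \<in> borel_measurable ?M" and f2: "integrable ?M (\<lambda>z. ((\<lambda>(x, \<omega>). f x \<omega>) z)\<^sup>2)"
    using f by (auto simp: L2_fun_def)
  have spm: "space sphere_measure = sphere 0 1" "sets sphere_measure = sets (restrict_space borel (sphere 0 1))"
    by (simp_all add: sphere_measure_def space_restrict_space)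
  have "compact (sph_harm a ` sphere 0 1)" by (intro compact_continuous_image continuous_sph_harm) simp
  then obtain B where B: "\<And>\<omega>. \<omega> \<in> sphere 0 1 \<Longrightarrow> \<bar>sph_harm a \<omega>\<bar> \<le> B"
    using compact_imp_bounded bounded_iff by (metis imageI real_norm_def)
  have ym: "sph_harm a \<in> borel_measurable sphere_measure"
    unfolding measurable_cong_sets[OF spm(2) refl]
    by (intro measurable_restrict_space1 borel_measurable_continuous_onI continuous_sph_harm)
  have "integrable ?M (\<lambda>z. sph_harm a (snd z) * (\<lambda>(x, \<omega>). f x \<omega>) z)"
  proof (rule Bochner_Integration.integrable_bound)
    show "integrable ?M (\<lambda>z. \<bar>B\<bar> * (1 + ((\<lambda>(x, \<omega>). f x \<omega>) z)\<^sup>2))"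
      by (intro integrable_mult_right Bochner_Integration.integrable_add f2 finite_measure.integrable_const[OF finM])
    show "(\<lambda>z. sph_harm a (snd z) * (\<lambda>(x, \<omega>). f x \<omega>) z) \<in> borel_measurable ?M"
      by (intro borel_measurable_times fm measurable_compose[OF measurable_snd ym])
    show "AE z in ?M. norm (sph_harm a (snd z) * (\<lambda>(x, \<omega>). f x \<omega>) z) \<le> norm (\<bar>B\<bar> * (1 + ((\<lambda>(x, \<omega>). f x \<omega>) z)\<^sup>2))"
    proof (rule AE_I2)
      fix z assume "z \<in> space ?M"
      then have 1: "\<bar>sph_harm a (snd z)\<bar> \<le> \<bar>B\<bar>" using B[of "snd z"] by (auto simp: space_pair_measure spm(1))
      have "\<bar>t\<bar> \<le> 1 + t\<^sup>2" for t :: real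
        using zero_le_power2[of "\<bar>t\<bar> - 1"] abs_ge_zero[of t] unfolding power2_diff power2_abs one_power2 by linarith
      from mult_mono[OF 1 this] show "norm (sph_harm a (snd z) * (\<lambda>(x, \<omega>). f x \<omega>) z) \<le> norm (\<bar>B\<bar> * (1 + ((\<lambda>(x, \<omega>). f x \<omega>) z)\<^sup>2))"
        by (simp add: abs_mult)
    qed
  qed
  from P.integrable_fst'[OF this] show ?thesis by (simp add: source_moments_def)
qed

section \<open>The a priori estimate\<close>

lemma sum_single:
  assumes "finite A" "a \<in> A" "\<And>b. b \<in> A \<Longrightarrow> b \<noteq> a \<Longrightarrow> g b = 0" shows "sum g A = g a"
proof -
  have "sum g A = g a + sum g (A - {a})" by (rule sum.remove[OF assms(1,2)])
  also have "sum g (A - {a}) = 0" by (rule sum.neutral) (use assms(3) in auto)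
  finally show ?thesis by simp
qed

text \<open>Otherwise a subsequence would stay away from the limit.\<close>

lemma seq_limit_by_subseq:
  fixes X :: "nat \<Rightarrow> real"
  assumes "\<And>r. strict_mono (r :: nat \<Rightarrow> nat) \<Longrightarrow> \<exists>s. strict_mono (s :: nat \<Rightarrow> nat) \<and> (\<lambda>n. X (r (s n))) \<longlonglongrightarrow> l"
  shows "X \<longlonglongrightarrow> l"
proof (rule ccontr)
  assume "\<not> X \<longlonglongrightarrow> l"
  then obtain e where e: "e > 0" "\<And>N. \<exists>n\<ge>N. \<not> dist (X n) l < e" unfolding lim_sequentially by blast
  have "infinite {n. \<not> dist (X n) l < e}" unfolding infinite_nat_iff_unbounded_le using e(2) by blast
  then obtain r where r: "strict_mono (r :: nat \<Rightarrow> nat)" "\<And>n. r n \<in> {n. \<not> dist (X n) l < e}"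
    using infinite_enumerate by blast
  obtain s where s: "strict_mono (s :: nat \<Rightarrow> nat)" "(\<lambda>n. X (r (s n))) \<longlonglongrightarrow> l" using assms[OF r(1)] by blast
  obtain N where "\<And>n. n \<ge> N \<Longrightarrow> dist (X (r (s n))) l < e" using s(2) e(1) unfolding lim_sequentially by blast
  then show False using r(2)[of "s N"] by simp
qed

lemma mabs_of_entry:
  assumes "a \<in> sh_index N" "b \<in> sh_index N"
  shows "mabs_of N U d a b = (\<Sum>c\<in>sh_index N. \<bar>d c\<bar> * (U a c * U b c))"
proof -
  have "mmult N U (mdiag (\<lambda>a. \<bar>d a\<bar>)) a c = U a c * \<bar>d c\<bar>" if "c \<in> sh_index N" for c
    unfolding mmult_def mdiag_def using that by (subst sum_single[of _ c]) auto
  then show ?thesis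
    unfolding mabs_of_def mmult_def[of N "mmult N U (mdiag (\<lambda>a. \<bar>d a\<bar>))"] mtranspose_def by (intro sum.cong refl) simp
qed

lemma diagonalization_entry:
  assumes "orth_diagonalization N B U d" "a \<in> sh_index N" "b \<in> sh_index N"
  shows "B a b = (\<Sum>c\<in>sh_index N. d c * (U a c * U b c))"
proof -
  have 1: "mmult N U (mdiag d) a c = U a c * d c" if "c \<in> sh_index N" for c
    unfolding mmult_def mdiag_def using that by (subst sum_single[of _ c]) auto
  have "B a b = mmult N (mmult N U (mdiag d)) (mtranspose U) a b"
    using assms unfolding orth_diagonalization_def meq_def by blast
  also have "\<dots> = (\<Sum>c\<in>sh_index N. d c * (U a c * U b c))"
    unfolding mmult_def[of N "mmult N U (mdiag d)"] mtranspose_def by (intro sum.cong refl) (simp add: 1)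
  finally show ?thesis .
qed

lemma (in unit_cube_mesh) bilin_sum_both:
  assumes B: "bilin PW B" and v: "\<And>a. a \<in> S \<Longrightarrow> v a \<in> PW" and S: "finite S"
  shows "B (\<lambda>x. \<Sum>a\<in>S. c a * v a x) (\<lambda>x. \<Sum>a\<in>S. c a * v a x) = (\<Sum>a\<in>S. \<Sum>b\<in>S. c a * c b * B (v b) (v a))"
proof -
  have s: "(\<lambda>x. \<Sum>a\<in>S. c a * v a x) \<in> PW" using S v by (rule PW_lsum)
  have "B (\<lambda>x. \<Sum>a\<in>S. c a * v a x) (\<lambda>x. \<Sum>a\<in>S. c a * v a x) = (\<Sum>b\<in>S. c b * B (v b) (\<lambda>x. \<Sum>a\<in>S. c a * v a x))"
    by (rule bilin_sum_left[OF B PW_lsum v s S])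
  also have "\<dots> = (\<Sum>b\<in>S. c b * (\<Sum>a\<in>S. c a * B (v b) (v a)))"
  proof (intro sum.cong refl arg_cong2[where f = times])
    fix b assume b: "b \<in> S"
    show "B (v b) (\<lambda>x. \<Sum>a\<in>S. c a * v a x) = (\<Sum>a\<in>S. c a * B (v b) (v a))"
      by (rule bilin_sum_left[OF bilin_swap[OF B] PW_lsum v v[OF b] S])
  qed
  also have "\<dots> = (\<Sum>b\<in>S. \<Sum>a\<in>S. c a * c b * B (v b) (v a))" by (simp add: sum_distrib_left mult_ac)
  also have "\<dots> = (\<Sum>a\<in>S. \<Sum>b\<in>S. c a * c b * B (v b) (v a))" by (rule sum.swap)
  finally show ?thesis .
qed

text \<open>The family of schemes for \<open>\<epsilon> \<in> (0, 1)\<close> with its solutions.\<close>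

locale pn_scheme =
  fixes \<sigma>t \<sigma>a :: "real^3 \<Rightarrow> real" and f :: "real^3 \<Rightarrow> real^3 \<Rightarrow> real" and \<sigma>s_min \<sigma>a_min :: real
    and N :: nat and kind :: mesh_kind and T :: "(real^3) set set" and k :: "nat \<Rightarrow> nat"
    and U :: "3 \<Rightarrow> mmat" and \<Lambda> :: "3 \<Rightarrow> mvec" and u :: "real \<Rightarrow> real^3 \<Rightarrow> mvec"
  assumes \<sigma>t: "Linf_fun (lebesgue_on torus_cell) \<sigma>t"
    and \<sigma>a: "Linf_fun (lebesgue_on torus_cell) \<sigma>a"
    and f: "L2_fun (lebesgue_on torus_cell \<Otimes>\<^sub>M sphere_measure) (\<lambda>(x, \<omega>). f x \<omega>)"
    and \<sigma>s_pos: "\<sigma>s_min > 0" and \<sigma>a_pos: "\<sigma>a_min > 0"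
    and scattering: "\<forall>\<epsilon>\<in>{0<..<1}. AE x in lebesgue_on torus_cell. \<sigma>t x - \<epsilon>\<^sup>2 * \<sigma>a x \<ge> \<sigma>s_min"
    and absorption: "AE x in lebesgue_on torus_cell. \<sigma>a x \<ge> \<sigma>a_min"
    and N1: "N \<ge> 1"
    and mesh: "torus_mesh kind T"
    and diag: "\<forall>i. orth_diagonalization N (flux_matrix i) (U i) (\<Lambda> i)"
    and sol: "\<forall>\<epsilon>\<in>{0<..<1}. dg_solution kind T N k (\<lambda>i. mabs_of N (U i) (\<Lambda> i)) \<sigma>t \<sigma>a f \<epsilon> (u \<epsilon>)"

sublocale pn_scheme \<subseteq> unit_cube_mesh T
  by (rule torus_mesh_unit_cube_mesh[OF mesh])

context pn_scheme
begin

abbreviation A where "A \<equiv> sh_index N"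
abbreviation DG where "DG a \<equiv> DG_space kind T (k (fst a))"
abbreviation q1 where "q1 \<equiv> mass (\<lambda>_. 1)"

definition D :: "3 \<Rightarrow> mmat" where "D i = mabs_of N (U i) (\<Lambda> i)"

text \<open>The right-hand side for a test function with the single component \<open>v\<close> at index \<open>a\<close>.\<close>

definition R :: "nat \<times> int \<Rightarrow> (real^3 \<Rightarrow> real) \<Rightarrow> real" where
  "R a v = mass (\<lambda>x. source_moments f x a) v (\<lambda>_. 1)"

text \<open>The moments of positive degree are of order \<open>\<epsilon>\<close>. After division by this scale, the solution \<open>W\<close> is
  bounded uniformly in \<open>\<epsilon>\<close>, and its first moments are the components of the scaled current.\<close>

definition sc :: "real \<Rightarrow> nat \<times> int \<Rightarrow> real" where "sc \<epsilon> a = (if fst a = 0 then 1 else \<epsilon>)"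

definition W :: "real \<Rightarrow> nat \<times> int \<Rightarrow> real^3 \<Rightarrow> real" where "W \<epsilon> a = (\<lambda>x. (1 / sc \<epsilon> a) * u \<epsilon> x a)"

lemma A0: "a \<in> A \<Longrightarrow> fst a = 0 \<longleftrightarrow> a = (0, 0)"
  by (auto simp: sh_index_def)

lemma weights: "weight \<sigma>t" "weight \<sigma>a" "weight (\<lambda>x. source_moments f x a)"
  using Linf_weight[OF \<sigma>t] Linf_weight[OF \<sigma>a] source_moments_integrable[OF f] by (auto simp: weight_def)

lemma \<sigma>t_low: "AE x in lebesgue_on torus_cell. \<sigma>t x \<ge> \<sigma>s_min"
proof -
  \<comment> \<open>Any \<open>\<epsilon>\<close> in \<open>(0, 1)\<close> would do in place of \<open>1/2\<close>.\<close>
  have "AE x in lebesgue_on torus_cell. \<sigma>t x - (1/2)\<^sup>2 * \<sigma>a x \<ge> \<sigma>s_min" using scattering by (rule bspec) simp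
  then show ?thesis using absorption
  proof eventually_elim
    case (elim x)
    have "0 \<le> (1/2)\<^sup>2 * \<sigma>a x" using elim(2) \<sigma>a_pos by simp
    then show ?case using elim(1) by linarith
  qed
qed

lemma u_DG: assumes "0 < \<epsilon>" "\<epsilon> < 1" "a \<in> A" shows "(\<lambda>x. u \<epsilon> x a) \<in> DG a"
proof -
  have "u \<epsilon> \<in> DG_moment_space kind T N k" using sol assms by (auto simp: dg_solution_def)
  then show ?thesis using assms(3) by (cases a) (auto simp: DG_moment_space_def)
qed

lemma W_DG: "0 < \<epsilon> \<Longrightarrow> \<epsilon> < 1 \<Longrightarrow> a \<in> A \<Longrightarrow> W \<epsilon> a \<in> DG a"
  unfolding W_def by (intro DG_space_cmult u_DG)

lemma u_W: "\<epsilon> \<noteq> 0 \<Longrightarrow> (\<lambda>x. u \<epsilon> x a) = (\<lambda>x. sc \<epsilon> a * W \<epsilon> a x)"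
  by (auto simp: W_def sc_def)

lemma u_PW: "0 < \<epsilon> \<Longrightarrow> \<epsilon> < 1 \<Longrightarrow> a \<in> A \<Longrightarrow> (\<lambda>x. u \<epsilon> x a) \<in> PW"
  by (rule DG_PW[OF u_DG])

lemma W_PW: "0 < \<epsilon> \<Longrightarrow> \<epsilon> < 1 \<Longrightarrow> a \<in> A \<Longrightarrow> W \<epsilon> a \<in> PW"
  by (rule DG_PW[OF W_DG])

lemma one_PW: "(\<lambda>_. 1) \<in> PW" by (rule PW_const)

lemma R_cmult: "v \<in> PW \<Longrightarrow> R a (\<lambda>x. c * v x) = c * R a v"
  unfolding R_def by (rule bilin_cmult(1)[OF bilin_mass[OF weights(3)] _ one_PW])

lemma dg_rhs_eq:
  assumes "\<And>a. a \<in> A \<Longrightarrow> (\<lambda>x. v x a) \<in> PW"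
  shows "dg_rhs T N f \<epsilon> v = \<epsilon> * (\<Sum>a\<in>A. R a (\<lambda>x. v x a))"
proof -
  have "(LINT x|lebesgue_on K. mdot N (source_moments f x) (v x)) = (\<Sum>a\<in>A. (LINT x|lebesgue_on K. source_moments f x a * (v x a * 1)))"
    if K: "K \<in> T" for K
    unfolding mdot_def using weight_times_PW[OF weights(3) assms K]
    by (subst Bochner_Integration.integral_sum) auto
  then show ?thesis unfolding dg_rhs_def R_def mass_def by (subst sum.swap) simp
qed

lemma form_u:
  assumes e: "0 < \<epsilon>" "\<epsilon> < 1" and v: "v \<in> DG_moment_space kind T N k"
  shows "(\<Sum>i\<in>UNIV. \<Sum>a\<in>A. \<Sum>b\<in>A.
        - flux_matrix i a b * (avg_form i (\<lambda>x. u \<epsilon> x b) (\<lambda>x. v x a) + vol_form i (\<lambda>x. u \<epsilon> x b) (\<lambda>x. v x a))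
        + 1/2 * D i a b * jump_form i (\<lambda>x. u \<epsilon> x b) (\<lambda>x. v x a))
      + (\<Sum>a\<in>A. if fst a = 0 then \<epsilon> * mass \<sigma>a (\<lambda>x. u \<epsilon> x a) (\<lambda>x. v x a) else mass \<sigma>t (\<lambda>x. u \<epsilon> x a) (\<lambda>x. v x a) / \<epsilon>)
      = \<epsilon> * (\<Sum>a\<in>A. R a (\<lambda>x. v x a))"
proof -
  have vPW: "(\<lambda>x. v x a) \<in> PW" if "a \<in> A" for a
    using v that by (cases a) (auto simp: DG_moment_space_def intro: DG_PW)
  have uPW: "(\<lambda>x. u \<epsilon> x a) \<in> PW" if "a \<in> A" for a using u_PW[OF e that] .
  have "dg_form T N D \<sigma>t \<sigma>a \<epsilon> (u \<epsilon>) v = dg_rhs T N f \<epsilon> v"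
    using sol e v unfolding dg_solution_def D_def[abs_def] by simp
  then have "dg_form T N D \<sigma>t \<sigma>a \<epsilon> (u \<epsilon>) v = \<epsilon> * (\<Sum>a\<in>A. R a (\<lambda>x. v x a))"
    by (rule trans) (rule dg_rhs_eq, erule vPW)
  then show ?thesis
    by (rule trans[rotated]) (rule dg_form_eq[symmetric], erule uPW, erule vPW, (rule weights)+)
qed

text \<open>Test functions with only one nonzero component single out the equation for one moment.\<close>

lemma scheme_eq:
  assumes e: "0 < \<epsilon>" "\<epsilon> < 1" and a0: "a0 \<in> A" and w: "w \<in> DG a0"
  shows "(\<Sum>i\<in>UNIV. \<Sum>b\<in>A. - flux_matrix i a0 b * (avg_form i (\<lambda>x. u \<epsilon> x b) w + vol_form i (\<lambda>x. u \<epsilon> x b) w)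
        + 1/2 * D i a0 b * jump_form i (\<lambda>x. u \<epsilon> x b) w)
      + (if fst a0 = 0 then \<epsilon> * mass \<sigma>a (\<lambda>x. u \<epsilon> x a0) w else mass \<sigma>t (\<lambda>x. u \<epsilon> x a0) w / \<epsilon>)
      = \<epsilon> * R a0 w"
proof -
  define v where "v x a = (if a = a0 then w x else 0)" for x a
  have va0: "(\<lambda>x. v x a0) = w" and va: "a \<noteq> a0 \<Longrightarrow> (\<lambda>x. v x a) = (\<lambda>x. 0)" for a by (auto simp: v_def)
  have "v \<in> DG_moment_space kind T N k"
    unfolding DG_moment_space_def
  proof (intro CollectI ballI, clarify)
    fix l m assume "(l, m) \<in> A"
    show "(\<lambda>x. v x (l, m)) \<in> DG_space kind T (k l)"
      using w va0 va[of "(l, m)"] DG_space_zero by (cases "(l, m) = a0") auto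
  qed
  note F = form_u[OF e this]
  have uPW: "(\<lambda>x. u \<epsilon> x a) \<in> PW" if "a \<in> A" for a using u_PW[OF e that] .
  note zM = bilin_zero(2)[OF bilin_avg_form uPW] and zV = bilin_zero(2)[OF bilin_vol_form uPW] and zJ = bilin_zero(2)[OF bilin_jump_form uPW]
  have 1: "(\<Sum>a\<in>A. \<Sum>b\<in>A.
        - flux_matrix i a b * (avg_form i (\<lambda>x. u \<epsilon> x b) (\<lambda>x. v x a) + vol_form i (\<lambda>x. u \<epsilon> x b) (\<lambda>x. v x a))
        + 1/2 * D i a b * jump_form i (\<lambda>x. u \<epsilon> x b) (\<lambda>x. v x a))
      = (\<Sum>b\<in>A. - flux_matrix i a0 b * (avg_form i (\<lambda>x. u \<epsilon> x b) w + vol_form i (\<lambda>x. u \<epsilon> x b) w)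
        + 1/2 * D i a0 b * jump_form i (\<lambda>x. u \<epsilon> x b) w)" for i
    by (subst sum_single[OF finite_sh_index a0]) (simp_all add: va va0 zM zV zJ)
  have 2: "(\<Sum>a\<in>A. if fst a = 0 then \<epsilon> * mass \<sigma>a (\<lambda>x. u \<epsilon> x a) (\<lambda>x. v x a) else mass \<sigma>t (\<lambda>x. u \<epsilon> x a) (\<lambda>x. v x a) / \<epsilon>)
      = (if fst a0 = 0 then \<epsilon> * mass \<sigma>a (\<lambda>x. u \<epsilon> x a0) w else mass \<sigma>t (\<lambda>x. u \<epsilon> x a0) w / \<epsilon>)"
    by (subst sum_single[OF finite_sh_index a0])
      (simp_all add: va va0 bilin_zero(2)[OF bilin_mass[OF weights(2)] uPW] bilin_zero(2)[OF bilin_mass[OF weights(1)] uPW])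
  have 3: "(\<Sum>a\<in>A. R a (\<lambda>x. v x a)) = R a0 w"
    by (subst sum_single[OF finite_sh_index a0]) (simp_all add: va va0 R_def bilin_zero(1)[OF bilin_mass[OF weights(3)] one_PW])
  show ?thesis using F unfolding 1 2 3 .
qed

text \<open>The dissipation of the numerical flux in the energy identity.\<close>

definition Jq :: "real \<Rightarrow> 3 \<Rightarrow> real" where
  "Jq \<epsilon> i = (\<Sum>a\<in>A. \<Sum>b\<in>A. D i a b * jump_form i (\<lambda>x. u \<epsilon> x b) (\<lambda>x. u \<epsilon> x a))"

text \<open>Diagonalizing \<open>|A\<^sup>(\<^sup>i\<^sup>)|\<close> writes the dissipation as a sum of squares of jumps of the characteristic
  variables with nonnegative weights.\<close>

lemma Jq_nonneg:
  assumes e: "0 < \<epsilon>" "\<epsilon> < 1" shows "Jq \<epsilon> i \<ge> 0"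
proof -
  let ?u = "\<lambda>a x. u \<epsilon> x a"
  have "Jq \<epsilon> i = (\<Sum>a\<in>A. \<Sum>b\<in>A. \<Sum>c\<in>A. \<bar>\<Lambda> i c\<bar> * (U i a c * U i b c * jump_form i (?u b) (?u a)))"
    unfolding Jq_def D_def by (intro sum.cong refl) (simp add: mabs_of_entry sum_distrib_right mult.assoc)
  also have "\<dots> = (\<Sum>c\<in>A. \<Sum>a\<in>A. \<Sum>b\<in>A. \<bar>\<Lambda> i c\<bar> * (U i a c * U i b c * jump_form i (?u b) (?u a)))"
    by (rule sum_rotate)
  also have "\<dots> = (\<Sum>c\<in>A. \<bar>\<Lambda> i c\<bar> * jump_form i (\<lambda>x. \<Sum>a\<in>A. U i a c * ?u a x) (\<lambda>x. \<Sum>a\<in>A. U i a c * ?u a x))"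
  proof (intro sum.cong refl)
    fix c
    have "jump_form i (\<lambda>x. \<Sum>a\<in>A. U i a c * ?u a x) (\<lambda>x. \<Sum>a\<in>A. U i a c * ?u a x) = (\<Sum>a\<in>A. \<Sum>b\<in>A. U i a c * U i b c * jump_form i (?u b) (?u a))"
      by (rule bilin_sum_both[OF bilin_jump_form u_PW[OF e] finite_sh_index])
    then show "(\<Sum>a\<in>A. \<Sum>b\<in>A. \<bar>\<Lambda> i c\<bar> * (U i a c * U i b c * jump_form i (?u b) (?u a)))
      = \<bar>\<Lambda> i c\<bar> * jump_form i (\<lambda>x. \<Sum>a\<in>A. U i a c * ?u a x) (\<lambda>x. \<Sum>a\<in>A. U i a c * ?u a x)"
      by (simp only: sum_distrib_left)
  qed
  also have "\<dots> \<ge> 0" by (intro sum_nonneg mult_nonneg_nonneg jump_form_nonneg) simp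
  finally show ?thesis .
qed

text \<open>The matrix is symmetric and the form is antisymmetric by \<open>integration_by_parts\<close>.\<close>

lemma transport_skew:
  assumes v: "\<And>a. a \<in> A \<Longrightarrow> v a \<in> PW"
  shows "(\<Sum>a\<in>A. \<Sum>b\<in>A. flux_matrix i a b * (avg_form i (v b) (v a) + vol_form i (v b) (v a))) = 0"
proof -
  let ?S = "\<Sum>a\<in>A. \<Sum>b\<in>A. flux_matrix i a b * (avg_form i (v b) (v a) + vol_form i (v b) (v a))"
  have "?S = (\<Sum>b\<in>A. \<Sum>a\<in>A. flux_matrix i a b * (avg_form i (v b) (v a) + vol_form i (v b) (v a)))" by (rule sum.swap)
  also have "\<dots> = (\<Sum>b\<in>A. \<Sum>a\<in>A. - (flux_matrix i b a * (avg_form i (v a) (v b) + vol_form i (v a) (v b))))"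
  proof (intro sum.cong refl)
    fix a b assume "a \<in> A" "b \<in> A"
    then have eq: "avg_form i (v b) (v a) + vol_form i (v b) (v a) = - (avg_form i (v a) (v b) + vol_form i (v a) (v b))"
      using integration_by_parts[OF v v, of a b i] by simp
    show "flux_matrix i a b * (avg_form i (v b) (v a) + vol_form i (v b) (v a)) = - (flux_matrix i b a * (avg_form i (v a) (v b) + vol_form i (v a) (v b)))"
      unfolding eq flux_matrix_sym[of i a b] by (simp only: mult_minus_right)
  qed
  also have "\<dots> = - ?S" by (simp add: sum_negf)
  finally show ?thesis by simp
qed

definition c0 :: real where "c0 = min \<sigma>s_min \<sigma>a_min"

lemma c0_pos: "c0 > 0" using \<sigma>s_pos \<sigma>a_pos by (simp add: c0_def)

definition S :: "real \<Rightarrow> real" where "S \<epsilon> = (\<Sum>a\<in>A. q1 (W \<epsilon> a) (W \<epsilon> a))"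

lemma S_nonneg: "S \<epsilon> \<ge> 0" unfolding S_def by (intro sum_nonneg mass_nonneg)

text \<open>The solution as its own test function. Both diagonal blocks scale the same way: \<open>\<epsilon> \<sigma>a\<close> on the zeroth
  moment, and \<open>(\<sigma>t / \<epsilon>) \<epsilon>\<^sup>2\<close> on the others.\<close>

lemma energy:
  assumes e: "0 < \<epsilon>" "\<epsilon> < 1"
  shows "1/2 * (\<Sum>i\<in>UNIV. Jq \<epsilon> i) + \<epsilon> * (c0 * S \<epsilon>) \<le> \<epsilon> * (\<Sum>a\<in>A. sc \<epsilon> a * R a (W \<epsilon> a))"
proof -
  have mom: "u \<epsilon> \<in> DG_moment_space kind T N k" using sol e by (auto simp: dg_solution_def)
  let ?u = "\<lambda>a x. u \<epsilon> x a"
  have uW: "?u a = (\<lambda>x. sc \<epsilon> a * W \<epsilon> a x)" for a using e by (intro u_W) simp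
  have tr: "(\<Sum>a\<in>A. \<Sum>b\<in>A. - flux_matrix i a b * (avg_form i (?u b) (?u a) + vol_form i (?u b) (?u a)) + 1/2 * D i a b * jump_form i (?u b) (?u a))
     = 1/2 * Jq \<epsilon> i" for i
  proof -
    have "(\<Sum>a\<in>A. \<Sum>b\<in>A. - flux_matrix i a b * (avg_form i (?u b) (?u a) + vol_form i (?u b) (?u a)) + 1/2 * D i a b * jump_form i (?u b) (?u a))
     = (\<Sum>a\<in>A. \<Sum>b\<in>A. 1/2 * (D i a b * jump_form i (?u b) (?u a)) - flux_matrix i a b * (avg_form i (?u b) (?u a) + vol_form i (?u b) (?u a)))"
      by (intro sum.cong refl) simp
    also have "\<dots> = 1/2 * Jq \<epsilon> i - (\<Sum>a\<in>A. \<Sum>b\<in>A. flux_matrix i a b * (avg_form i (?u b) (?u a) + vol_form i (?u b) (?u a)))"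
      unfolding Jq_def sum_subtractf sum_distrib_left ..
    also have "(\<Sum>a\<in>A. \<Sum>b\<in>A. flux_matrix i a b * (avg_form i (?u b) (?u a) + vol_form i (?u b) (?u a))) = 0"
      by (rule transport_skew) (rule u_PW[OF e])
    finally show ?thesis by simp
  qed
  have "1/2 * (\<Sum>i\<in>UNIV. Jq \<epsilon> i)
      + (\<Sum>a\<in>A. if fst a = 0 then \<epsilon> * mass \<sigma>a (?u a) (?u a) else mass \<sigma>t (?u a) (?u a) / \<epsilon>) = \<epsilon> * (\<Sum>a\<in>A. R a (?u a))"
    using form_u[OF e mom] unfolding tr by (simp only: sum_distrib_left)
  moreover have "\<epsilon> * (c0 * S \<epsilon>) \<le> (\<Sum>a\<in>A. if fst a = 0 then \<epsilon> * mass \<sigma>a (?u a) (?u a) else mass \<sigma>t (?u a) (?u a) / \<epsilon>)"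
    unfolding S_def sum_distrib_left
  proof (intro sum_mono)
    fix a assume a: "a \<in> A"
    note w = W_PW[OF e a]
    show "\<epsilon> * (c0 * q1 (W \<epsilon> a) (W \<epsilon> a)) \<le> (if fst a = 0 then \<epsilon> * mass \<sigma>a (?u a) (?u a) else mass \<sigma>t (?u a) (?u a) / \<epsilon>)"
    proof (cases "fst a = 0")
      case True
      have "c0 * q1 (W \<epsilon> a) (W \<epsilon> a) \<le> \<sigma>a_min * q1 (W \<epsilon> a) (W \<epsilon> a)"
        by (intro mult_right_mono mass_nonneg) (simp add: c0_def)
      also have "\<dots> \<le> mass \<sigma>a (W \<epsilon> a) (W \<epsilon> a)" by (rule mass_lower[OF weights(2) absorption w])
      finally show ?thesis using True e by (simp add: uW sc_def)
    next
      case False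
      have "c0 * q1 (W \<epsilon> a) (W \<epsilon> a) \<le> \<sigma>s_min * q1 (W \<epsilon> a) (W \<epsilon> a)"
        by (intro mult_right_mono mass_nonneg) (simp add: c0_def)
      also have "\<dots> \<le> mass \<sigma>t (W \<epsilon> a) (W \<epsilon> a)" by (rule mass_lower[OF weights(1) \<sigma>t_low w])
      finally have "\<epsilon> * (c0 * q1 (W \<epsilon> a) (W \<epsilon> a)) \<le> \<epsilon> * mass \<sigma>t (W \<epsilon> a) (W \<epsilon> a)" using e by simp
      also have "\<dots> = mass \<sigma>t (?u a) (?u a) / \<epsilon>"
      proof -
        have p: "(\<lambda>x. sc \<epsilon> a * W \<epsilon> a x) \<in> PW" using w by (rule PW_cmult)
        have "mass \<sigma>t (?u a) (?u a) = sc \<epsilon> a * (sc \<epsilon> a * mass \<sigma>t (W \<epsilon> a) (W \<epsilon> a))"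
          unfolding uW bilin_cmult(1)[OF bilin_mass[OF weights(1)] w p] bilin_cmult(2)[OF bilin_mass[OF weights(1)] w w] ..
        then show ?thesis using False e by (simp add: sc_def)
      qed
      finally show ?thesis using False by simp
    qed
  qed
  moreover have "R a (?u a) = sc \<epsilon> a * R a (W \<epsilon> a)" if "a \<in> A" for a
    unfolding uW by (rule R_cmult[OF W_PW[OF e that]])
  ultimately show ?thesis by simp
qed

text \<open>A bound for the norm of the right-hand side as a linear form on the discrete space.\<close>

definition \<rho> :: real where "\<rho> = (\<Sum>a\<in>A. \<Sum>j<dg_dim kind (k (fst a)). \<bar>R a (dg_basis kind (k (fst a)) j)\<bar>)"

lemma rho_nonneg: "\<rho> \<ge> 0" unfolding \<rho>_def by (intro sum_nonneg) simp

lemma coef_bound: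
  assumes e: "0 < \<epsilon>" "\<epsilon> < 1" and a: "a \<in> A" and j: "j < dg_dim kind (k (fst a))"
  shows "\<bar>q1 (W \<epsilon> a) (dg_basis kind (k (fst a)) j)\<bar> \<le> sqrt (S \<epsilon>)"
proof -
  have "(q1 (W \<epsilon> a) (dg_basis kind (k (fst a)) j))\<^sup>2 \<le> (\<Sum>j<dg_dim kind (k (fst a)). (q1 (W \<epsilon> a) (dg_basis kind (k (fst a)) j))\<^sup>2)"
    using j by (intro member_le_sum) auto
  also have "\<dots> = q1 (W \<epsilon> a) (W \<epsilon> a)" by (rule parseval[OF W_DG[OF e a], symmetric])
  also have "\<dots> \<le> S \<epsilon>" unfolding S_def using a by (rule member_le_sum[of a A "\<lambda>a. q1 (W \<epsilon> a) (W \<epsilon> a)"]) (rule mass_nonneg finite_sh_index)+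
  finally have "\<bar>q1 (W \<epsilon> a) (dg_basis kind (k (fst a)) j)\<bar>\<^sup>2 \<le> S \<epsilon>" unfolding power2_abs .
  then show ?thesis by (rule real_le_rsqrt)
qed

lemma rhs_bound:
  assumes e: "0 < \<epsilon>" "\<epsilon> < 1"
  shows "(\<Sum>a\<in>A. sc \<epsilon> a * R a (W \<epsilon> a)) \<le> sqrt (S \<epsilon>) * \<rho>"
  unfolding \<rho>_def sum_distrib_left
proof (intro sum_mono)
  fix a assume a: "a \<in> A"
  have sc1: "\<bar>sc \<epsilon> a\<bar> \<le> 1" using e by (simp add: sc_def)
  have "R a (W \<epsilon> a) = (\<Sum>j<dg_dim kind (k (fst a)). q1 (W \<epsilon> a) (dg_basis kind (k (fst a)) j) * R a (dg_basis kind (k (fst a)) j))"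
    unfolding R_def by (rule expand_left[OF bilin_mass[OF weights(3)] omega_cong_forms(1) W_DG[OF e a] one_PW])
  then have "\<bar>R a (W \<epsilon> a)\<bar> \<le> (\<Sum>j<dg_dim kind (k (fst a)). \<bar>q1 (W \<epsilon> a) (dg_basis kind (k (fst a)) j)\<bar> * \<bar>R a (dg_basis kind (k (fst a)) j)\<bar>)"
    by (simp add: order_trans[OF sum_abs] abs_mult)
  also have "\<dots> \<le> (\<Sum>j<dg_dim kind (k (fst a)). sqrt (S \<epsilon>) * \<bar>R a (dg_basis kind (k (fst a)) j)\<bar>)"
    by (intro sum_mono mult_right_mono coef_bound[OF e a]) auto
  finally have 1: "\<bar>R a (W \<epsilon> a)\<bar> \<le> (\<Sum>j<dg_dim kind (k (fst a)). sqrt (S \<epsilon>) * \<bar>R a (dg_basis kind (k (fst a)) j)\<bar>)" .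
  have "sc \<epsilon> a * R a (W \<epsilon> a) \<le> \<bar>sc \<epsilon> a\<bar> * \<bar>R a (W \<epsilon> a)\<bar>" by (simp flip: abs_mult)
  also have "\<dots> \<le> 1 * \<bar>R a (W \<epsilon> a)\<bar>" using sc1 by (intro mult_right_mono) auto
  finally show "sc \<epsilon> a * R a (W \<epsilon> a) \<le> (\<Sum>j<dg_dim kind (k (fst a)). sqrt (S \<epsilon>) * \<bar>R a (dg_basis kind (k (fst a)) j)\<bar>)" using 1 by simp
qed

text \<open>From \<open>energy\<close> and \<open>rhs_bound\<close>, \<open>c0 S \<le> sqrt S * \<rho>\<close> after division by \<open>\<epsilon>\<close>. The jump terms inherit
  the factor \<open>\<epsilon>\<close> of the right-hand side.\<close>

lemma a_priori:
  assumes e: "0 < \<epsilon>" "\<epsilon> < 1"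
  shows "sqrt (S \<epsilon>) \<le> \<rho> / c0" "(\<Sum>i\<in>UNIV. Jq \<epsilon> i) \<le> \<epsilon> * (2 * \<rho>\<^sup>2 / c0)"
proof -
  have J0: "(\<Sum>i\<in>UNIV. Jq \<epsilon> i) \<ge> 0" by (intro sum_nonneg Jq_nonneg e)
  have en: "1/2 * (\<Sum>i\<in>UNIV. Jq \<epsilon> i) + \<epsilon> * (c0 * S \<epsilon>) \<le> \<epsilon> * (sqrt (S \<epsilon>) * \<rho>)"
    by (rule order_trans[OF energy[OF e]]) (use rhs_bound[OF e] e in \<open>simp add: mult_left_mono\<close>)
  then have "\<epsilon> * (c0 * S \<epsilon>) \<le> \<epsilon> * (sqrt (S \<epsilon>) * \<rho>)" using J0 by linarith
  then have le: "c0 * S \<epsilon> \<le> sqrt (S \<epsilon>) * \<rho>" using e by simp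
  show s: "sqrt (S \<epsilon>) \<le> \<rho> / c0"
  proof (cases "S \<epsilon> = 0")
    case True
    then show ?thesis using rho_nonneg c0_pos by simp
  next
    case False
    then have pos: "sqrt (S \<epsilon>) > 0" using S_nonneg[of \<epsilon>] by simp
    have "sqrt (S \<epsilon>) * (c0 * sqrt (S \<epsilon>)) \<le> sqrt (S \<epsilon>) * \<rho>" using le S_nonneg[of \<epsilon>] by (simp add: mult_ac flip: mult.assoc)
    then have "c0 * sqrt (S \<epsilon>) \<le> \<rho>" using pos by simp
    then show ?thesis using c0_pos by (simp add: field_simps)
  qed
  have "\<epsilon> * (c0 * S \<epsilon>) \<ge> 0" using e c0_pos S_nonneg[of \<epsilon>] by simp
  then have "1/2 * (\<Sum>i\<in>UNIV. Jq \<epsilon> i) \<le> \<epsilon> * (sqrt (S \<epsilon>) * \<rho>)" using en by linarith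
  also have "\<dots> \<le> \<epsilon> * (\<rho> / c0 * \<rho>)" using e s rho_nonneg by (intro mult_left_mono mult_right_mono) auto
  finally show "(\<Sum>i\<in>UNIV. Jq \<epsilon> i) \<le> \<epsilon> * (2 * \<rho>\<^sup>2 / c0)" by (simp add: power2_eq_square mult_ac)
qed

text \<open>The entry is the sum of \<open>|\<Lambda>\<^sub>c| (U\<^sub>0\<^sub>c)\<^sup>2\<close> over \<open>c\<close>. If it vanished, so would \<open>\<Lambda>\<^sub>c U\<^sub>0\<^sub>c\<close> for all \<open>c\<close>, and
  with them the whole first row of the flux matrix, which has an entry \<open>1 / sqrt 3\<close>.\<close>

lemma D00_pos: "D i (0, 0) (0, 0) > 0"
proof -
  have D00: "D i (0, 0) (0, 0) = (\<Sum>c\<in>A. \<bar>\<Lambda> i c\<bar> * (U i (0, 0) c * U i (0, 0) c))"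
    unfolding D_def by (rule mabs_of_entry) auto
  have nn: "\<bar>\<Lambda> i c\<bar> * (U i (0, 0) c * U i (0, 0) c) \<ge> 0" for c by simp
  have "D i (0, 0) (0, 0) \<noteq> 0"
  proof
    assume "D i (0, 0) (0, 0) = 0"
    then have "\<forall>c\<in>A. \<bar>\<Lambda> i c\<bar> * (U i (0, 0) c * U i (0, 0) c) = 0"
      unfolding D00 by (subst (asm) sum_nonneg_eq_0_iff[OF finite_sh_index nn])
    then have z: "\<Lambda> i c * (U i (0, 0) c * U i b c) = 0" if "c \<in> A" for b c using that by fastforce
    have dd: "orth_diagonalization N (flux_matrix i) (U i) (\<Lambda> i)" using diag by simp
    have mem: "sph_idx i \<in> A" by (rule sph_idx_in_sh_index[OF N1])
    have "flux_matrix i (0, 0) (sph_idx i) = 0"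
      unfolding diagonalization_entry[OF dd zero_in_sh_index mem] using z by (intro sum.neutral) blast
    moreover have "flux_matrix i (0, 0) (sph_idx i) = 1 / sqrt 3"
      using flux_matrix_row0[of "fst (sph_idx i)" "snd (sph_idx i)" N i] mem by simp
    ultimately show False by simp
  qed
  moreover have "D i (0, 0) (0, 0) \<ge> 0" unfolding D00 by (intro sum_nonneg nn)
  ultimately show ?thesis by simp
qed

end

section \<open>Compactness, the limit system and its uniqueness\<close>

lemma torus_C0_diff: "g \<in> torus_C0 \<Longrightarrow> h \<in> torus_C0 \<Longrightarrow> (\<lambda>x. g x - h x) \<in> torus_C0"
  unfolding torus_C0_def torus_periodic_def by (auto intro: continuous_on_diff)

lemma torus_C0_cmult: "g \<in> torus_C0 \<Longrightarrow> (\<lambda>x. c * g x) \<in> torus_C0"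
  unfolding torus_C0_def torus_periodic_def by (auto intro: continuous_on_mult_left)

lemma fst_sph_idx: "fst (sph_idx i) = 1"
  by (simp add: sph_idx_def)

lemma flux_matrix_row_zero:
  "b \<in> sh_index N \<Longrightarrow> flux_matrix i (0, 0) b = (if b = sph_idx i then 1 / sqrt 3 else 0)"
  using flux_matrix_row0[of "fst b" "snd b" N i] by simp

context pn_scheme
begin

text \<open>The limit system for the coefficients \<open>g\<close> of the zeroth and \<open>J\<close> of the rescaled first moments, in the
  normalization of the spherical harmonics.\<close>

definition limit_system :: "(real^3 \<Rightarrow> real) \<Rightarrow> (3 \<Rightarrow> real^3 \<Rightarrow> real) \<Rightarrow> bool" where
  "limit_system g J \<longleftrightarrow> g \<in> torus_C0 \<inter> DG_space kind T (k 0) \<and> (\<forall>i. J i \<in> DG_space kind T (k 1)) \<and>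
     (\<forall>v\<in>torus_C0 \<inter> DG_space kind T (k 0). - (\<Sum>i\<in>UNIV. 1 / sqrt 3 * vol_form i (J i) v) + mass \<sigma>a g v = R (0, 0) v) \<and>
     (\<forall>i. \<forall>w\<in>DG_space kind T (k 1). 1 / sqrt 3 * vol_form i w g + mass \<sigma>t (J i) w = 0)"

lemma idx_in: "sph_idx i \<in> A"
  by (rule sph_idx_in_sh_index[OF N1])

text \<open>A continuous test function makes both the average form and the jump form vanish, so that the numerical flux
  drops out and only the first moments are coupled to the zeroth, through the first row of the flux
  matrix. All terms carry a factor \<open>\<epsilon>\<close>, which cancels.\<close>

lemma zeroth_moment_equation:
  assumes e: "0 < \<epsilon>" "\<epsilon> < 1" and v: "v \<in> torus_C0" "v \<in> DG_space kind T (k 0)"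
  shows "- (\<Sum>i\<in>UNIV. 1 / sqrt 3 * vol_form i (W \<epsilon> (sph_idx i)) v) + mass \<sigma>a (W \<epsilon> (0, 0)) v = R (0, 0) v"
proof -
  have vD: "v \<in> DG (0, 0)" using v(2) by simp
  have vP: "v \<in> PW" by (rule DG_PW[OF v(2)])
  have e0: "\<epsilon> \<noteq> 0" using e by simp
  have row: "(\<Sum>b\<in>A. - flux_matrix i (0, 0) b * (avg_form i (\<lambda>x. u \<epsilon> x b) v + vol_form i (\<lambda>x. u \<epsilon> x b) v)
        + 1/2 * D i (0, 0) b * jump_form i (\<lambda>x. u \<epsilon> x b) v) = - (\<epsilon> * (1 / sqrt 3 * vol_form i (W \<epsilon> (sph_idx i)) v))" for i
  proof -
    have "(\<Sum>b\<in>A. - flux_matrix i (0, 0) b * (avg_form i (\<lambda>x. u \<epsilon> x b) v + vol_form i (\<lambda>x. u \<epsilon> x b) v)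
        + 1/2 * D i (0, 0) b * jump_form i (\<lambda>x. u \<epsilon> x b) v)
      = (\<Sum>b\<in>A. - flux_matrix i (0, 0) b * vol_form i (\<lambda>x. u \<epsilon> x b) v)"
      by (intro sum.cong refl) (simp add: continuous_no_jump[OF v(1) vP u_PW[OF e]])
    also have "\<dots> = - flux_matrix i (0, 0) (sph_idx i) * vol_form i (\<lambda>x. u \<epsilon> x (sph_idx i)) v"
      by (rule sum_single[OF finite_sh_index idx_in]) (simp add: flux_matrix_row_zero)
    also have "vol_form i (\<lambda>x. u \<epsilon> x (sph_idx i)) v = \<epsilon> * vol_form i (W \<epsilon> (sph_idx i)) v"
      unfolding u_W[OF e0] bilin_cmult(1)[OF bilin_vol_form W_PW[OF e idx_in] vP] by (simp add: sc_def fst_sph_idx del: One_nat_def)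
    finally show ?thesis by (simp add: flux_matrix_row_zero[OF idx_in])
  qed
  have 0: "(\<lambda>x. u \<epsilon> x (0, 0)) = W \<epsilon> (0, 0)" unfolding u_W[OF e0] by (simp add: sc_def)
  have "\<epsilon> * (- (\<Sum>i\<in>UNIV. 1 / sqrt 3 * vol_form i (W \<epsilon> (sph_idx i)) v) + mass \<sigma>a (W \<epsilon> (0, 0)) v) = \<epsilon> * R (0, 0) v"
    using scheme_eq[OF e zero_in_sh_index vD] unfolding row 0 sum_negf sum_distrib_left[symmetric]
    by (simp only: fst_conv if_True refl distrib_left mult_minus_right)
  then show ?thesis using e by simp
qed

text \<open>Each moment in the transport part comes with its scale, so in the limit only the zeroth one
  remains.\<close>

lemma first_moment_equation:
  assumes e: "0 < \<epsilon>" "\<epsilon> < 1" and w: "w \<in> DG_space kind T (k 1)"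
  shows "(\<Sum>i\<in>UNIV. \<Sum>b\<in>A. sc \<epsilon> b * (- flux_matrix i (sph_idx j) b * (avg_form i (W \<epsilon> b) w + vol_form i (W \<epsilon> b) w)
        + 1/2 * D i (sph_idx j) b * jump_form i (W \<epsilon> b) w)) + mass \<sigma>t (W \<epsilon> (sph_idx j)) w = \<epsilon> * R (sph_idx j) w"
proof -
  have wP: "w \<in> PW" by (rule DG_PW[OF w])
  have wD: "w \<in> DG (sph_idx j)" using w unfolding fst_sph_idx .
  have e0: "\<epsilon> \<noteq> 0" using e by simp
  have 1: "- flux_matrix i (sph_idx j) b * (avg_form i (\<lambda>x. u \<epsilon> x b) w + vol_form i (\<lambda>x. u \<epsilon> x b) w)
        + 1/2 * D i (sph_idx j) b * jump_form i (\<lambda>x. u \<epsilon> x b) w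
      = sc \<epsilon> b * (- flux_matrix i (sph_idx j) b * (avg_form i (W \<epsilon> b) w + vol_form i (W \<epsilon> b) w)
        + 1/2 * D i (sph_idx j) b * jump_form i (W \<epsilon> b) w)" if b: "b \<in> A" for i b
    unfolding u_W[OF e0] bilin_cmult(1)[OF bilin_avg_form W_PW[OF e b] wP] bilin_cmult(1)[OF bilin_vol_form W_PW[OF e b] wP]
      bilin_cmult(1)[OF bilin_jump_form W_PW[OF e b] wP] by (simp add: algebra_simps)
  have 2: "mass \<sigma>t (\<lambda>x. u \<epsilon> x (sph_idx j)) w / \<epsilon> = mass \<sigma>t (W \<epsilon> (sph_idx j)) w"
    unfolding u_W[OF e0] bilin_cmult(1)[OF bilin_mass[OF weights(1)] W_PW[OF e idx_in] wP] using e0 by (simp add: sc_def fst_sph_idx del: One_nat_def)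
  have f: "(fst (sph_idx j) = 0) = False" by (simp add: fst_sph_idx)
  have "(\<Sum>i\<in>UNIV. \<Sum>b\<in>A. - flux_matrix i (sph_idx j) b * (avg_form i (\<lambda>x. u \<epsilon> x b) w + vol_form i (\<lambda>x. u \<epsilon> x b) w)
        + 1/2 * D i (sph_idx j) b * jump_form i (\<lambda>x. u \<epsilon> x b) w) + mass \<sigma>t (W \<epsilon> (sph_idx j)) w = \<epsilon> * R (sph_idx j) w"
    using scheme_eq[OF e idx_in wD] unfolding f if_False 2 .
  moreover have "(\<Sum>i\<in>UNIV. \<Sum>b\<in>A. - flux_matrix i (sph_idx j) b * (avg_form i (\<lambda>x. u \<epsilon> x b) w + vol_form i (\<lambda>x. u \<epsilon> x b) w)
        + 1/2 * D i (sph_idx j) b * jump_form i (\<lambda>x. u \<epsilon> x b) w) =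
      (\<Sum>i\<in>UNIV. \<Sum>b\<in>A. sc \<epsilon> b * (- flux_matrix i (sph_idx j) b * (avg_form i (W \<epsilon> b) w + vol_form i (W \<epsilon> b) w)
        + 1/2 * D i (sph_idx j) b * jump_form i (W \<epsilon> b) w))"
    by (intro sum.cong refl 1)
  ultimately show ?thesis by (simp only:)
qed

text \<open>The difference of two solutions solves the system without source. Tested with itself, the coupling
  terms of the two equations cancel, and a sum of positive definite forms remains.\<close>

lemma limit_system_unique:
  assumes 1: "limit_system g J" and 2: "limit_system g' J'" and x: "x \<in> \<Omega>"
  shows "g x = g' x" "J i x = J' i x"
proof -
  note d1 = 1[unfolded limit_system_def] and d2 = 2[unfolded limit_system_def]
  have g: "g \<in> torus_C0" "g \<in> DG_space kind T (k 0)" and g': "g' \<in> torus_C0" "g' \<in> DG_space kind T (k 0)" using d1 d2 by simp_all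
  have J: "J i \<in> DG_space kind T (k 1)" "J' i \<in> DG_space kind T (k 1)" for i using d1 d2 by simp_all
  define d where "d = (\<lambda>x. g x - g' x)"
  define e where "e i = (\<lambda>x. J i x - J' i x)" for i
  have d: "d \<in> torus_C0 \<inter> DG_space kind T (k 0)" unfolding d_def using g g' by (simp add: torus_C0_diff DG_space_diff)
  have e: "e i \<in> DG_space kind T (k 1)" for i unfolding e_def using J by (simp add: DG_space_diff)
  have P: "g \<in> PW" "g' \<in> PW" "J i \<in> PW" "J' i \<in> PW" "d \<in> PW" "e i \<in> PW" for i
    using g g' J d e by (auto intro: DG_PW)
  have q1: "vol_form i (e i) d = vol_form i (J i) d - vol_form i (J' i) d" for i
    unfolding e_def by (rule bilin_diff(1)[OF bilin_vol_form P(3,4,5)])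
  have q2: "mass \<sigma>a d d = mass \<sigma>a g d - mass \<sigma>a g' d"
    by (subst (2) d_def, subst bilin_diff(1)[OF bilin_mass[OF weights(2)] P(1,2,5), symmetric]) (simp add: d_def)
  have q3: "vol_form i (e i) d = vol_form i (e i) g - vol_form i (e i) g'" for i
    unfolding d_def by (rule bilin_diff(2)[OF bilin_vol_form P(1,2,6)])
  have q4: "mass \<sigma>t (e i) (e i) = mass \<sigma>t (J i) (e i) - mass \<sigma>t (J' i) (e i)" for i
    by (subst bilin_diff(1)[OF bilin_mass[OF weights(1)] P(3,4,6), symmetric]) (simp add: e_def)
  have E1: "- (\<Sum>i\<in>UNIV. 1 / sqrt 3 * vol_form i (J i) d) + mass \<sigma>a g d = R (0, 0) d"
    "- (\<Sum>i\<in>UNIV. 1 / sqrt 3 * vol_form i (J' i) d) + mass \<sigma>a g' d = R (0, 0) d"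
    using d1 d2 d by blast+
  have E2: "1 / sqrt 3 * vol_form i (e i) g + mass \<sigma>t (J i) (e i) = 0" "1 / sqrt 3 * vol_form i (e i) g' + mass \<sigma>t (J' i) (e i) = 0" for i
    using d1 d2 e by blast+
  have "(\<Sum>i\<in>UNIV. 1 / sqrt 3 * vol_form i (e i) d) = mass \<sigma>a d d"
    unfolding q1 q2 right_diff_distrib sum_subtractf using E1 by linarith
  moreover have "1 / sqrt 3 * vol_form i (e i) d = - mass \<sigma>t (e i) (e i)" for i
    unfolding q3 q4 right_diff_distrib using E2[of i] by linarith
  ultimately have s: "mass \<sigma>a d d + (\<Sum>i\<in>UNIV. mass \<sigma>t (e i) (e i)) = 0" by (simp add: sum_negf)
  have nn: "0 \<le> mass \<sigma>a d d" "0 \<le> mass \<sigma>t (e i) (e i)" for i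
    using order_trans[OF mult_nonneg_nonneg mass_lower[OF weights(2) absorption P(5)]] \<sigma>a_pos mass_nonneg[of d]
      order_trans[OF mult_nonneg_nonneg mass_lower[OF weights(1) \<sigma>t_low P(6)]] \<sigma>s_pos mass_nonneg[of "e i"] by simp_all
  have sn: "0 \<le> (\<Sum>i\<in>UNIV. mass \<sigma>t (e i) (e i))" using nn(2) by (rule sum_nonneg)
  have z1: "mass \<sigma>a d d = 0" using s nn(1) sn by linarith
  have "(\<Sum>i\<in>UNIV. mass \<sigma>t (e i) (e i)) = 0" using s nn(1) sn by linarith
  then have z2: "mass \<sigma>t (e i) (e i) = 0" for i using sum_nonneg_eq_0_iff[of UNIV "\<lambda>i. mass \<sigma>t (e i) (e i)"] nn(2) by simp
  have "\<sigma>a_min * mass (\<lambda>_. 1) d d \<le> 0" using mass_lower[OF weights(2) absorption P(5)] z1 by simp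
  then have "mass (\<lambda>_. 1) d d = 0" using \<sigma>a_pos mass_nonneg[of d] by (simp add: mult_le_0_iff)
  from mass_zero_imp[OF P(5) this x] show "g x = g' x" by (simp add: d_def)
  have "\<sigma>s_min * mass (\<lambda>_. 1) (e i) (e i) \<le> 0" using mass_lower[OF weights(1) \<sigma>t_low P(6)] z2 by simp
  then have "mass (\<lambda>_. 1) (e i) (e i) = 0" using \<sigma>s_pos mass_nonneg[of "e i"] by (simp add: mult_le_0_iff)
  from mass_zero_imp[OF P(6) this x] show "J i x = J' i x" by (simp add: e_def)
qed

text \<open>The dissipation is of order \<open>\<epsilon>\<close> and its limit only involves the zeroth moment, whose jumps
  therefore vanish. Passing to the limit in the moment equations is then a matter of bilinear forms
  on finite-dimensional spaces.\<close>

lemma limit_point_system: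
  assumes en: "\<And>n. 0 < en n" "\<And>n. en n < 1" "en \<longlonglongrightarrow> (0 :: real)"
    and c: "\<And>a. a \<in> A \<Longrightarrow> dg_conv kind (k (fst a)) (\<lambda>n. W (en n) a) (Wl a)"
  shows "\<exists>g. limit_system g (\<lambda>i. Wl (sph_idx i)) \<and> (\<forall>x\<in>\<Omega>. g x = Wl (0, 0) x)"
proof -
  let ?z = "(0 :: nat, 0 :: int)"
  let ?s = "\<lambda>b :: nat \<times> int. if b = ?z then 1 else 0 :: real"
  have sc: "(\<lambda>n. sc (en n) b) \<longlonglongrightarrow> ?s b" if "b \<in> A" for b
    using en(3) A0[OF that] by (cases "b = ?z") (simp_all add: sc_def)
  have WlD: "Wl a \<in> DG a" if "a \<in> A" for a using c[OF that] unfolding dg_conv_def by blast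
  have WlP: "Wl a \<in> PW" if "a \<in> A" for a by (rule DG_PW[OF WlD[OF that]])
  note z = zero_in_sh_index[of N]
  have J0: "jump_form i (Wl ?z) (Wl ?z) = 0" for i
  proof -
    have Jq: "Jq (en n) i = (\<Sum>a\<in>A. \<Sum>b\<in>A. D i a b * (sc (en n) b * (sc (en n) a * jump_form i (W (en n) b) (W (en n) a))))" for n i
    proof -
      have e: "0 < en n" "en n < 1" and e0: "en n \<noteq> 0" using en(1,2)[of n] by simp_all
      have "jump_form i (\<lambda>x. u (en n) x b) (\<lambda>x. u (en n) x a) = sc (en n) b * (sc (en n) a * jump_form i (W (en n) b) (W (en n) a))"
        if "a \<in> A" "b \<in> A" for a b
        unfolding u_W[OF e0] bilin_cmult(1)[OF bilin_jump_form W_PW[OF e that(2)] PW_cmult[OF W_PW[OF e that(1)]]]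
          bilin_cmult(2)[OF bilin_jump_form W_PW[OF e that(1)] W_PW[OF e that(2)]] ..
      then show ?thesis unfolding Jq_def by (intro sum.cong refl) simp
    qed
    have lim: "(\<lambda>n. Jq (en n) i) \<longlonglongrightarrow> D i ?z ?z * jump_form i (Wl ?z) (Wl ?z)" for i
    proof -
      have "(\<lambda>n. Jq (en n) i) \<longlonglongrightarrow> (\<Sum>a\<in>A. \<Sum>b\<in>A. D i a b * (?s b * (?s a * jump_form i (Wl b) (Wl a))))"
        unfolding Jq
        by (intro tendsto_sum tendsto_mult tendsto_const sc dg_conv_both[OF bilin_jump_form omega_cong_forms(3) c c])
      also have "(\<Sum>a\<in>A. \<Sum>b\<in>A. D i a b * (?s b * (?s a * jump_form i (Wl b) (Wl a)))) = (\<Sum>b\<in>A. D i ?z b * (?s b * (?s ?z * jump_form i (Wl b) (Wl ?z))))"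
        by (rule sum_single[OF finite_sh_index z]) simp
      also have "\<dots> = D i ?z ?z * (?s ?z * (?s ?z * jump_form i (Wl ?z) (Wl ?z)))"
        by (rule sum_single[OF finite_sh_index z]) simp
      finally show ?thesis by simp
    qed
    have nn: "0 \<le> D i ?z ?z * jump_form i (Wl ?z) (Wl ?z)" for i
      by (rule mult_nonneg_nonneg[OF less_imp_le[OF D00_pos] jump_form_nonneg])
    have "(\<lambda>n. en n * (2 * \<rho>\<^sup>2 / c0)) \<longlonglongrightarrow> 0 * (2 * \<rho>\<^sup>2 / c0)" by (intro tendsto_mult en(3) tendsto_const)
    then have "(\<Sum>i\<in>UNIV. D i ?z ?z * jump_form i (Wl ?z) (Wl ?z)) \<le> 0 * (2 * \<rho>\<^sup>2 / c0)"
      using a_priori(2)[OF en(1,2)] by (intro LIMSEQ_le[OF tendsto_sum[OF lim]]) auto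
    moreover have "D i ?z ?z * jump_form i (Wl ?z) (Wl ?z) \<le> (\<Sum>i\<in>UNIV. D i ?z ?z * jump_form i (Wl ?z) (Wl ?z))"
      by (rule member_le_sum[of i UNIV "\<lambda>i. D i ?z ?z * jump_form i (Wl ?z) (Wl ?z)"]) (simp_all add: nn)
    ultimately have "D i ?z ?z * jump_form i (Wl ?z) (Wl ?z) = 0" using nn[of i] by linarith
    then show ?thesis using D00_pos[of i] by simp
  qed
  obtain g where g: "g \<in> torus_C0" and gW: "\<And>x. x \<in> \<Omega> \<Longrightarrow> g x = Wl ?z x"
    using zero_jumps_continuous[OF WlP[OF z] J0] by metis
  have per: "torus_periodic g" using g by (simp add: torus_C0_def)
  have gD: "g \<in> DG_space kind T (k 0)" using DG_space_cong[OF _ per gW] WlD[OF z] by simp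
  have gP: "g \<in> PW" by (rule DG_PW[OF gD])
  have E1: "- (\<Sum>i\<in>UNIV. 1 / sqrt 3 * vol_form i (Wl (sph_idx i)) v) + mass \<sigma>a g v = R (0, 0) v"
    if v: "v \<in> torus_C0 \<inter> DG_space kind T (k 0)" for v
  proof -
    have v': "v \<in> torus_C0" "v \<in> DG_space kind T (k 0)" "v \<in> PW" using v DG_PW by auto
    have "(\<lambda>n. - (\<Sum>i\<in>UNIV. 1 / sqrt 3 * vol_form i (W (en n) (sph_idx i)) v) + mass \<sigma>a (W (en n) ?z) v)
        \<longlonglongrightarrow> - (\<Sum>i\<in>UNIV. 1 / sqrt 3 * vol_form i (Wl (sph_idx i)) v) + mass \<sigma>a (Wl ?z) v"
      by (intro tendsto_add tendsto_minus tendsto_sum tendsto_mult tendsto_const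
          dg_conv_left[OF bilin_vol_form omega_cong_forms(4) c[OF idx_in] v'(3)]
          dg_conv_left[OF bilin_mass[OF weights(2)] omega_cong_forms(1) c[OF z] v'(3)])
    then have "(\<lambda>n. R ?z v) \<longlonglongrightarrow> - (\<Sum>i\<in>UNIV. 1 / sqrt 3 * vol_form i (Wl (sph_idx i)) v) + mass \<sigma>a (Wl ?z) v"
      unfolding zeroth_moment_equation[OF en(1,2) v'(1,2)] .
    then have "R ?z v = - (\<Sum>i\<in>UNIV. 1 / sqrt 3 * vol_form i (Wl (sph_idx i)) v) + mass \<sigma>a (Wl ?z) v"
      by (rule LIMSEQ_unique[OF tendsto_const])
    also have "mass \<sigma>a (Wl ?z) v = mass \<sigma>a g v" by (rule form_cong(1)) (simp_all add: gW)
    finally show ?thesis by (rule sym)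
  qed
  have E2: "1 / sqrt 3 * vol_form j w g + mass \<sigma>t (Wl (sph_idx j)) w = 0" if w: "w \<in> DG_space kind T (k 1)" for j w
  proof -
    have wP: "w \<in> PW" by (rule DG_PW[OF w])
    let ?F = "\<lambda>i b v. - flux_matrix i (sph_idx j) b * (avg_form i v w + vol_form i v w) + 1/2 * D i (sph_idx j) b * jump_form i v w"
    have lim: "(\<lambda>n. (\<Sum>i\<in>UNIV. \<Sum>b\<in>A. sc (en n) b * ?F i b (W (en n) b)) + mass \<sigma>t (W (en n) (sph_idx j)) w)
        \<longlonglongrightarrow> (\<Sum>i\<in>UNIV. \<Sum>b\<in>A. ?s b * ?F i b (Wl b)) + mass \<sigma>t (Wl (sph_idx j)) w"
      by (intro tendsto_add tendsto_sum tendsto_mult tendsto_const sc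
          dg_conv_left[OF bilin_vol_form omega_cong_forms(4) c wP] dg_conv_left[OF bilin_avg_form omega_cong_forms(2) c wP]
          dg_conv_left[OF bilin_jump_form omega_cong_forms(3) c wP]
          dg_conv_left[OF bilin_mass[OF weights(1)] omega_cong_forms(1) c[OF idx_in] wP])
    have "(\<lambda>n. en n * R (sph_idx j) w) \<longlonglongrightarrow> 0 * R (sph_idx j) w" by (intro tendsto_mult en(3) tendsto_const)
    then have "(\<Sum>i\<in>UNIV. \<Sum>b\<in>A. ?s b * ?F i b (Wl b)) + mass \<sigma>t (Wl (sph_idx j)) w = 0 * R (sph_idx j) w"
      using lim unfolding first_moment_equation[OF en(1,2) w] by (rule LIMSEQ_unique[rotated])
    moreover have "(\<Sum>b\<in>A. ?s b * ?F i b (Wl b)) = (if i = j then 1 / sqrt 3 * vol_form j w g else 0)" for i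
    proof -
      have "(\<Sum>b\<in>A. ?s b * ?F i b (Wl b)) = ?s ?z * ?F i ?z (Wl ?z)"
        by (rule sum_single[OF finite_sh_index z]) simp
      also have "\<dots> = ?F i ?z (Wl ?z)" by simp
      also have "\<dots> = ?F i ?z g"
        using form_cong(2,3,4)[of "Wl ?z" g w w i] gW by simp
      also have "jump_form i g w = 0" using jump_form_sym[of i g w] continuous_no_jump(2)[OF g gP wP] by simp
      also have "avg_form i g w + vol_form i g w = - vol_form i w g"
        using integration_by_parts[OF gP wP, of i] continuous_no_jump(1)[OF g gP wP, of i] by simp
      also have "flux_matrix i (sph_idx j) ?z = (if i = j then 1 / sqrt 3 else 0)"
        unfolding flux_matrix_sym[of i "sph_idx j"] flux_matrix_row_zero[OF idx_in] by (simp add: inj_sph_idx eq_commute)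
      finally show ?thesis by simp
    qed
    ultimately show ?thesis by simp
  qed
  have "limit_system g (\<lambda>i. Wl (sph_idx i))"
    unfolding limit_system_def
  proof (intro conjI allI ballI IntI)
    show "Wl (sph_idx i) \<in> DG_space kind T (k 1)" for i using WlD[OF idx_in[of i]] unfolding fst_sph_idx .
  qed (fact g gD E1 E2)+
  then show ?thesis using gW by blast
qed

text \<open>By \<open>a_priori\<close> all coefficients of \<open>W\<close> are bounded, hence converge along a common subsequence.\<close>

lemma limit_point:
  assumes en: "\<And>n. 0 < en n" "\<And>n. en n < 1" "en \<longlonglongrightarrow> (0 :: real)"
  shows "\<exists>r g J. strict_mono (r :: nat \<Rightarrow> nat) \<and> limit_system g J \<and>
    (\<lambda>n. q1 (\<lambda>x. W (en (r n)) (0, 0) x - g x) (\<lambda>x. W (en (r n)) (0, 0) x - g x)) \<longlonglongrightarrow> 0 \<and>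
    (\<forall>i. (\<lambda>n. q1 (\<lambda>x. W (en (r n)) (sph_idx i) x - J i x) (\<lambda>x. W (en (r n)) (sph_idx i) x - J i x)) \<longlonglongrightarrow> 0)"
proof -
  let ?I = "Sigma A (\<lambda>a. {..<dg_dim kind (k (fst a))})"
  let ?e = "\<lambda>a. dg_basis kind (k (fst a))"
  have fin: "finite ?I" using finite_sh_index by (rule finite_SigmaI) simp
  define cf where "cf n = (\<lambda>(a, j). q1 (W (en n) a) (?e a j))" for n
  have bd: "\<bar>cf n i\<bar> \<le> \<rho> / c0" if i0: "i \<in> ?I" for i n
  proof -
    obtain a j where i: "i = (a, j)" "a \<in> A" "j \<in> {..<dg_dim kind (k (fst a))}" using i0 by (rule SigmaE)
    then have i3: "j < dg_dim kind (k (fst a))" by simp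
    have "\<bar>q1 (W (en n) a) (?e a j)\<bar> \<le> \<rho> / c0"
      by (rule order_trans[OF coef_bound[OF en(1,2) i(2) i3] a_priori(1)[OF en(1,2)]])
    then show ?thesis unfolding i(1) cf_def by simp
  qed
  have "\<exists>r l. strict_mono (r :: nat \<Rightarrow> nat) \<and> (\<forall>i\<in>?I. (\<lambda>n. cf (r n) i) \<longlonglongrightarrow> l i)"
    by (rule bounded_finite_subseq[OF fin]) (rule bd)
  then obtain r l where r: "strict_mono (r :: nat \<Rightarrow> nat)"
    and l0: "\<forall>i\<in>?I. (\<lambda>n. cf (r n) i) \<longlonglongrightarrow> l i"
    by (elim exE conjE)
  have l: "(\<lambda>n. q1 (W (en (r n)) a) (?e a j)) \<longlonglongrightarrow> l (a, j)" if "a \<in> A" "j < dg_dim kind (k (fst a))" for a j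
    using bspec[OF l0, of "(a, j)"] that by (simp add: cf_def)
  define Wl where "Wl a = (\<lambda>x. \<Sum>j<dg_dim kind (k (fst a)). l (a, j) * ?e a j x)" for a
  have WlD: "Wl a \<in> DG a" for a unfolding Wl_def by (rule DG_space_sum) (simp_all add: dg_basis_DG)
  have co: "q1 (Wl a) (?e a j) = l (a, j)" if j: "j < dg_dim kind (k (fst a))" for a j
  proof -
    have "q1 (Wl a) (?e a j) = (\<Sum>j'<dg_dim kind (k (fst a)). l (a, j') * q1 (?e a j') (?e a j))"
      unfolding Wl_def by (rule bilin_sum_left[OF bilin_mass[OF weight_1] PW_lsum]) (use j in \<open>simp_all add: dg_basis_PW\<close>)
    also have "\<dots> = l (a, j) * q1 (?e a j) (?e a j)"
      by (rule sum_single) (use j in \<open>simp_all add: dg_basis_on\<close>)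
    finally show ?thesis using j by (simp add: dg_basis_on)
  qed
  have c: "dg_conv kind (k (fst a)) (\<lambda>n. W ((en \<circ> r) n) a) (Wl a)" if a: "a \<in> A" for a
    unfolding dg_conv_def o_def
    using l[OF a] by (intro conjI allI impI W_DG en a WlD) (simp_all add: co)
  have er: "0 < (en \<circ> r) n" "(en \<circ> r) n < 1" for n using en by simp_all
  have er0: "(en \<circ> r) \<longlonglongrightarrow> 0" by (rule LIMSEQ_subseq_LIMSEQ[OF en(3) r])
  have "\<exists>g. limit_system g (\<lambda>i. Wl (sph_idx i)) \<and> (\<forall>x\<in>\<Omega>. g x = Wl (0, 0) x)"
    by (rule limit_point_system[OF er er0]) (rule c)
  then obtain g where g: "limit_system g (\<lambda>i. Wl (sph_idx i))" and gW: "\<forall>x\<in>\<Omega>. g x = Wl (0, 0) x"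
    by (elim exE conjE)
  have "(\<lambda>n. q1 (\<lambda>x. W (en (r n)) (0, 0) x - g x) (\<lambda>x. W (en (r n)) (0, 0) x - g x)) \<longlonglongrightarrow> 0"
  proof -
    have "q1 (\<lambda>x. W (en (r n)) (0, 0) x - g x) (\<lambda>x. W (en (r n)) (0, 0) x - g x)
      = q1 (\<lambda>x. W ((en \<circ> r) n) (0, 0) x - Wl (0, 0) x) (\<lambda>x. W ((en \<circ> r) n) (0, 0) x - Wl (0, 0) x)" for n
      by (rule form_cong(1)) (simp_all add: gW)
    then show ?thesis using dg_conv_mass_diff[OF c[OF zero_in_sh_index]] by simp
  qed
  moreover have "(\<lambda>n. q1 (\<lambda>x. W (en (r n)) (sph_idx i) x - Wl (sph_idx i) x) (\<lambda>x. W (en (r n)) (sph_idx i) x - Wl (sph_idx i) x)) \<longlonglongrightarrow> 0" for i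
    using dg_conv_mass_diff[OF c[OF idx_in]] by simp
  ultimately show ?thesis using r g by (intro exI[of _ r] exI[of _ g] exI[of _ "\<lambda>i. Wl (sph_idx i)"]) simp
qed

text \<open>Every sequence has a subsequence that converges to a solution of the limit system; by uniqueness it is
  always the same one.\<close>

lemma convergence:
  "\<exists>g J. limit_system g J \<and>
    ((\<lambda>\<epsilon>. q1 (\<lambda>x. W \<epsilon> (0, 0) x - g x) (\<lambda>x. W \<epsilon> (0, 0) x - g x)) \<longlongrightarrow> 0) (at_right 0) \<and>
    (\<forall>i. ((\<lambda>\<epsilon>. q1 (\<lambda>x. W \<epsilon> (sph_idx i) x - J i x) (\<lambda>x. W \<epsilon> (sph_idx i) x - J i x)) \<longlongrightarrow> 0) (at_right 0))"
proof -
  \<comment> \<open>The limit is found along one particular sequence in \<open>(0, 1)\<close>.\<close>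
  have half: "(\<lambda>n. 1 / 2 * inverse (real (Suc n))) \<longlonglongrightarrow> 1 / 2 * 0"
    by (intro tendsto_mult tendsto_const LIMSEQ_inverse_real_of_nat)
  have b: "0 < 1 / 2 * inverse (real (Suc n))" "1 / 2 * inverse (real (Suc n)) < 1" for n
    by (simp_all add: field_simps)
  obtain g J where s: "limit_system g J" using limit_point[OF b half[unfolded mult_zero_right]] by (elim exE conjE)
  have sub: "\<exists>t. strict_mono (t :: nat \<Rightarrow> nat) \<and>
    (\<lambda>n. q1 (\<lambda>x. W (en (r (t n))) (0, 0) x - g x) (\<lambda>x. W (en (r (t n))) (0, 0) x - g x)) \<longlonglongrightarrow> 0 \<and>
    (\<forall>i. (\<lambda>n. q1 (\<lambda>x. W (en (r (t n))) (sph_idx i) x - J i x) (\<lambda>x. W (en (r (t n))) (sph_idx i) x - J i x)) \<longlonglongrightarrow> 0)"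
    if en: "\<And>n. 0 < en n" "\<And>n. en n < 1" "en \<longlonglongrightarrow> 0" and r: "strict_mono (r :: nat \<Rightarrow> nat)" for en r
  proof -
    have er: "0 < (en \<circ> r) n" "(en \<circ> r) n < 1" for n using en by simp_all
    have er0: "(en \<circ> r) \<longlonglongrightarrow> 0" by (rule LIMSEQ_subseq_LIMSEQ[OF en(3) r])
    obtain t g' J' where t: "strict_mono (t :: nat \<Rightarrow> nat)" and s': "limit_system g' J'"
      and lg: "(\<lambda>n. q1 (\<lambda>x. W ((en \<circ> r) (t n)) (0, 0) x - g' x) (\<lambda>x. W ((en \<circ> r) (t n)) (0, 0) x - g' x)) \<longlonglongrightarrow> 0"
      and lJ: "\<forall>i. (\<lambda>n. q1 (\<lambda>x. W ((en \<circ> r) (t n)) (sph_idx i) x - J' i x) (\<lambda>x. W ((en \<circ> r) (t n)) (sph_idx i) x - J' i x)) \<longlonglongrightarrow> 0"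
      using limit_point[OF er er0] by (elim exE conjE)
    note un = limit_system_unique[OF s s']
    have eg: "q1 (\<lambda>x. v x - g x) (\<lambda>x. v x - g x) = q1 (\<lambda>x. v x - g' x) (\<lambda>x. v x - g' x)" for v
      by (rule form_cong(1)) (simp_all add: un)
    have eJ: "q1 (\<lambda>x. v x - J i x) (\<lambda>x. v x - J i x) = q1 (\<lambda>x. v x - J' i x) (\<lambda>x. v x - J' i x)" for v i
      by (rule form_cong(1)) (simp_all add: un)
    show ?thesis unfolding eg eJ using t lg lJ unfolding o_def by (intro exI[of _ t] conjI)
  qed
  have "((\<lambda>\<epsilon>. q1 (\<lambda>x. W \<epsilon> (0, 0) x - g x) (\<lambda>x. W \<epsilon> (0, 0) x - g x)) \<longlongrightarrow> 0) (at_right 0)"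
  proof (rule tendsto_at_right_sequentially[of 0 "1 :: real"])
    fix en :: "nat \<Rightarrow> real"
    assume en: "\<And>n. 0 < en n" "\<And>n. en n < 1" "en \<longlonglongrightarrow> 0"
    show "(\<lambda>n. q1 (\<lambda>x. W (en n) (0, 0) x - g x) (\<lambda>x. W (en n) (0, 0) x - g x)) \<longlonglongrightarrow> 0"
    proof (rule seq_limit_by_subseq)
      fix r assume r: "strict_mono (r :: nat \<Rightarrow> nat)"
      show "\<exists>t. strict_mono (t :: nat \<Rightarrow> nat) \<and> (\<lambda>n. q1 (\<lambda>x. W (en (r (t n))) (0, 0) x - g x) (\<lambda>x. W (en (r (t n))) (0, 0) x - g x)) \<longlonglongrightarrow> 0"
        using sub[OF en r] by (elim exE conjE) (intro exI conjI)
    qed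
  qed simp
  moreover have "((\<lambda>\<epsilon>. q1 (\<lambda>x. W \<epsilon> (sph_idx i) x - J i x) (\<lambda>x. W \<epsilon> (sph_idx i) x - J i x)) \<longlongrightarrow> 0) (at_right 0)" for i
  proof (rule tendsto_at_right_sequentially[of 0 "1 :: real"])
    fix en :: "nat \<Rightarrow> real"
    assume en: "\<And>n. 0 < en n" "\<And>n. en n < 1" "en \<longlonglongrightarrow> 0"
    show "(\<lambda>n. q1 (\<lambda>x. W (en n) (sph_idx i) x - J i x) (\<lambda>x. W (en n) (sph_idx i) x - J i x)) \<longlonglongrightarrow> 0"
    proof (rule seq_limit_by_subseq)
      fix r assume r: "strict_mono (r :: nat \<Rightarrow> nat)"
      show "\<exists>t. strict_mono (t :: nat \<Rightarrow> nat) \<and> (\<lambda>n. q1 (\<lambda>x. W (en (r (t n))) (sph_idx i) x - J i x) (\<lambda>x. W (en (r (t n))) (sph_idx i) x - J i x)) \<longlonglongrightarrow> 0"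
        using sub[OF en r] by (elim exE conjE) (intro exI conjI, assumption, erule spec)
    qed
  qed simp
  ultimately show ?thesis using s by (intro exI conjI allI)
qed

end

section \<open>The limit in physical variables\<close>

context unit_cube_mesh
begin

lemma vol_form_sum:
  assumes p: "\<And>i. p i \<in> PW" and q: "\<And>i. q i \<in> PW"
  shows "(\<Sum>K\<in>T. LINT x|lebesgue_on K. (\<Sum>i\<in>UNIV. p i x * partial_deriv i (q i) x)) = (\<Sum>i\<in>UNIV. vol_form i (p i) (q i))"
proof -
  have "(LINT x|lebesgue_on K. (\<Sum>i\<in>UNIV. p i x * partial_deriv i (q i) x)) = (\<Sum>i\<in>UNIV. LINT x|lebesgue_on K. p i x * partial_deriv i (q i) x)"
    if "K \<in> T" for K
    by (rule Bochner_Integration.integral_sum) (rule vol_form_pol(2)[OF p q that])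
  then show ?thesis unfolding vol_form_def by (subst sum.swap) simp
qed

lemma mass_integrable: "weight \<rho> \<Longrightarrow> v \<in> PW \<Longrightarrow> w \<in> PW \<Longrightarrow> K \<in> T \<Longrightarrow> integrable (lebesgue_on K) (\<lambda>x. \<rho> x * (v x * w x))"
  by (rule weight_times_PW[OF _ PW_mult])

lemma mass_sum:
  assumes \<rho>: "weight \<rho>" and p: "\<And>i. i \<in> S \<Longrightarrow> p i \<in> PW" and q: "\<And>i. i \<in> S \<Longrightarrow> q i \<in> PW"
  shows "(\<Sum>K\<in>T. LINT x|lebesgue_on K. (\<Sum>i\<in>S. \<rho> x * (p i x * q i x))) = (\<Sum>i\<in>S. mass \<rho> (p i) (q i))"
proof -
  have "(LINT x|lebesgue_on K. (\<Sum>i\<in>S. \<rho> x * (p i x * q i x))) = (\<Sum>i\<in>S. LINT x|lebesgue_on K. \<rho> x * (p i x * q i x))"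
    if "K \<in> T" for K
    by (rule Bochner_Integration.integral_sum) (rule mass_integrable[OF \<rho> p q that])
  then show ?thesis unfolding mass_def by (subst sum.swap) simp
qed

lemma cell_square_sum:
  assumes v: "\<And>i. i \<in> S \<Longrightarrow> v i \<in> PW"
  shows "(LINT x|lebesgue_on torus_cell. (\<Sum>i\<in>S. (v i x)\<^sup>2)) = (\<Sum>i\<in>S. mass (\<lambda>_. 1) (v i) (v i))"
proof -
  have eq: "(\<Sum>i\<in>S. (v i x)\<^sup>2) = (\<Sum>i\<in>S. 1 * (v i x * v i x))" for x by (simp add: power2_eq_square)
  have "(LINT x|lebesgue_on torus_cell. (\<Sum>i\<in>S. 1 * (v i x * v i x))) = (\<Sum>K\<in>T. LINT x|lebesgue_on K. (\<Sum>i\<in>S. 1 * (v i x * v i x)))"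
    by (rule integral_cell) (intro Bochner_Integration.integrable_sum mass_integrable[OF weight_1] v)
  also have "\<dots> = (\<Sum>i\<in>S. mass (\<lambda>_. 1) (v i) (v i))" by (rule mass_sum[OF weight_1 v v])
  finally show ?thesis unfolding eq .
qed

end

lemma four_pi_sphere_avg: "4 * pi * sphere_avg (f x) = sqrt (4 * pi) * source_moments f x (0, 0)"
proof -
  have "source_moments f x (0, 0) = 1 / sqrt (4 * pi) * (LINT \<omega>|sphere_measure. f x \<omega>)"
    unfolding source_moments_def sph_harm_degree_0 by (rule integral_mult_right_zero)
  then show ?thesis by (simp add: sphere_avg_def)
qed

lemma sqrt_four_pi_third: "sqrt (4 * pi / 3) = sqrt (4 * pi) * (1 / sqrt 3)"
  by (simp add: real_sqrt_divide)

context pn_scheme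
begin

lemma current_component:
  assumes "0 < \<epsilon>"
  shows "scaled_current N \<epsilon> (u \<epsilon>) x $ i = sqrt (4 * pi / 3) * W \<epsilon> (sph_idx i) x"
  using assms unfolding scaled_current_eq[OF N1] W_def by (simp add: sc_def fst_sph_idx)

lemma flux_W: "scalar_flux N (u \<epsilon>) x = sqrt (4 * pi) * W \<epsilon> (0, 0) x"
  unfolding scalar_flux_eq W_def by (simp add: sc_def)

text \<open>Convergence in \<open>mass\<close> of the coefficients is convergence of the flux in the mean square.\<close>

lemma flux_L2:
  assumes e: "0 < \<epsilon>" "\<epsilon> < 1" and g: "g \<in> PW"
  shows "torus_L2_norm (\<lambda>x. scalar_flux N (u \<epsilon>) x - sqrt (4 * pi) * g x)
    = sqrt (4 * pi * q1 (\<lambda>x. W \<epsilon> (0, 0) x - g x) (\<lambda>x. W \<epsilon> (0, 0) x - g x))"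
proof -
  let ?d = "\<lambda>x. W \<epsilon> (0, 0) x - g x"
  have d: "?d \<in> PW" by (rule PW_diff[OF W_PW[OF e zero_in_sh_index] g])
  have "(norm (scalar_flux N (u \<epsilon>) x - sqrt (4 * pi) * g x))\<^sup>2 = 4 * pi * (\<Sum>i\<in>{()}. (?d x)\<^sup>2)" for x
    unfolding flux_W right_diff_distrib[symmetric] by (simp add: power_mult_distrib)
  then have "torus_L2_norm (\<lambda>x. scalar_flux N (u \<epsilon>) x - sqrt (4 * pi) * g x) = sqrt (LINT x|lebesgue_on torus_cell. 4 * pi * (\<Sum>i\<in>{()}. (?d x)\<^sup>2))"
    unfolding torus_L2_norm_def by (simp only:)
  also have "(LINT x|lebesgue_on torus_cell. 4 * pi * (\<Sum>i\<in>{()}. (?d x)\<^sup>2)) = 4 * pi * (LINT x|lebesgue_on torus_cell. (\<Sum>i\<in>{()}. (?d x)\<^sup>2))"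
    by (rule integral_mult_right_zero)
  also have "(LINT x|lebesgue_on torus_cell. (\<Sum>i\<in>{()}. (?d x)\<^sup>2)) = (\<Sum>i\<in>{()}. q1 ?d ?d)"
    by (rule cell_square_sum) (rule d)
  finally show ?thesis by simp
qed

lemma current_L2:
  assumes e: "0 < \<epsilon>" "\<epsilon> < 1" and J: "\<And>i. J i \<in> PW"
  shows "torus_L2_norm (\<lambda>x. scaled_current N \<epsilon> (u \<epsilon>) x - (\<chi> i. sqrt (4 * pi / 3) * J i x))
    = sqrt (4 * pi / 3 * (\<Sum>i\<in>UNIV. q1 (\<lambda>x. W \<epsilon> (sph_idx i) x - J i x) (\<lambda>x. W \<epsilon> (sph_idx i) x - J i x)))"
proof -
  let ?d = "\<lambda>i x. W \<epsilon> (sph_idx i) x - J i x"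
  have d: "?d i \<in> PW" for i by (rule PW_diff[OF W_PW[OF e idx_in] J])
  have "(norm (scaled_current N \<epsilon> (u \<epsilon>) x - (\<chi> i. sqrt (4 * pi / 3) * J i x)))\<^sup>2 = 4 * pi / 3 * (\<Sum>i\<in>UNIV. (?d i x)\<^sup>2)" for x
  proof -
    have "(scaled_current N \<epsilon> (u \<epsilon>) x - (\<chi> i. sqrt (4 * pi / 3) * J i x)) $ i = sqrt (4 * pi / 3) * ?d i x" for i
      by (simp only: vector_minus_component vec_lambda_beta current_component[OF e(1)] right_diff_distrib)
    then have "(norm (scaled_current N \<epsilon> (u \<epsilon>) x - (\<chi> i. sqrt (4 * pi / 3) * J i x)))\<^sup>2 = (\<Sum>i\<in>UNIV. (sqrt (4 * pi / 3) * ?d i x) * (sqrt (4 * pi / 3) * ?d i x))"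
      unfolding power2_norm_eq_inner inner_vec_def inner_real_def by (simp only:)
    also have "\<dots> = (\<Sum>i\<in>UNIV. 4 * pi / 3 * (?d i x)\<^sup>2)"
    proof (intro sum.cong refl)
      fix i
      have "(sqrt (4 * pi / 3) * ?d i x) * (sqrt (4 * pi / 3) * ?d i x) = (sqrt (4 * pi / 3) * sqrt (4 * pi / 3)) * (?d i x)\<^sup>2"
        by (simp only: power2_eq_square mult_ac)
      then show "(sqrt (4 * pi / 3) * ?d i x) * (sqrt (4 * pi / 3) * ?d i x) = 4 * pi / 3 * (?d i x)\<^sup>2"
        by (subst (asm) real_sqrt_mult_self) simp
    qed
    finally show ?thesis unfolding sum_distrib_left .
  qed
  then have "torus_L2_norm (\<lambda>x. scaled_current N \<epsilon> (u \<epsilon>) x - (\<chi> i. sqrt (4 * pi / 3) * J i x))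
      = sqrt (LINT x|lebesgue_on torus_cell. 4 * pi / 3 * (\<Sum>i\<in>UNIV. (?d i x)\<^sup>2))"
    unfolding torus_L2_norm_def by (simp only:)
  also have "(LINT x|lebesgue_on torus_cell. 4 * pi / 3 * (\<Sum>i\<in>UNIV. (?d i x)\<^sup>2)) = 4 * pi / 3 * (LINT x|lebesgue_on torus_cell. (\<Sum>i\<in>UNIV. (?d i x)\<^sup>2))"
    by (rule integral_mult_right_zero)
  also have "(LINT x|lebesgue_on torus_cell. (\<Sum>i\<in>UNIV. (?d i x)\<^sup>2)) = (\<Sum>i\<in>UNIV. q1 (?d i) (?d i))"
    by (rule cell_square_sum) (rule d)
  finally show ?thesis .
qed

text \<open>Multiplying by \<open>sqrt (4 * pi)\<close> passes from coefficients to moments: it turns the factor \<open>1 / sqrt 3\<close>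
  into the normalization \<open>sqrt (4 * pi / 3)\<close> of the current, and the source moment into \<open>4\<pi>\<langle>f\<rangle>\<close>.\<close>

lemma limit_balance:
  assumes s: "limit_system g J" and v: "v \<in> torus_C0 \<inter> DG_space kind T (k 0)"
  shows "(\<Sum>K\<in>T. - (LINT x|lebesgue_on K. (\<chi> i. sqrt (4 * pi / 3) * J i x) \<bullet> grad v x)
                + (LINT x|lebesgue_on K. \<sigma>a x * (sqrt (4 * pi) * g x) * v x))
        = 4 * pi * (\<Sum>K\<in>T. LINT x|lebesgue_on K. sphere_avg (f x) * v x)"
proof -
  let ?c = "sqrt (4 * pi)" and ?c1 = "sqrt (4 * pi / 3)"
  have J: "J i \<in> DG_space kind T (k 1)" and g: "g \<in> DG_space kind T (k 0)" for i using s unfolding limit_system_def by simp_all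
  have P: "J i \<in> PW" "v \<in> PW" "g \<in> PW" for i using J g v by (auto intro: DG_PW)
  have e: "- (\<Sum>i\<in>UNIV. 1 / sqrt 3 * vol_form i (J i) v) + mass \<sigma>a g v = R (0, 0) v"
    using s v unfolding limit_system_def by blast
  have 1: "(\<Sum>K\<in>T. LINT x|lebesgue_on K. (\<chi> i. ?c1 * J i x) \<bullet> grad v x) = ?c1 * (\<Sum>i\<in>UNIV. vol_form i (J i) v)"
  proof -
    have "(\<chi> i. ?c1 * J i x) \<bullet> grad v x = (\<Sum>i\<in>UNIV. ?c1 * J i x * partial_deriv i v x)" for x
      unfolding inner_vec_def grad_def inner_real_def vec_lambda_beta ..
    then have "(\<Sum>K\<in>T. LINT x|lebesgue_on K. (\<chi> i. ?c1 * J i x) \<bullet> grad v x) = (\<Sum>i\<in>UNIV. vol_form i (\<lambda>x. ?c1 * J i x) v)"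
      using vol_form_sum[of "\<lambda>i x. ?c1 * J i x" "\<lambda>_. v", OF PW_cmult[OF P(1)] P(2)] by (simp only:)
    also have "\<dots> = (\<Sum>i\<in>UNIV. ?c1 * vol_form i (J i) v)"
      unfolding bilin_cmult(1)[OF bilin_vol_form P(1,2)] ..
    finally show ?thesis unfolding sum_distrib_left .
  qed
  have 2: "(\<Sum>K\<in>T. LINT x|lebesgue_on K. \<sigma>a x * (?c * g x) * v x) = ?c * mass \<sigma>a g v"
    unfolding bilin_cmult(1)[OF bilin_mass[OF weights(2)] P(3,2), symmetric] unfolding mass_def by (simp only: mult.assoc)
  have 3: "4 * pi * (\<Sum>K\<in>T. LINT x|lebesgue_on K. sphere_avg (f x) * v x) = ?c * R (0, 0) v"
  proof -
    have "4 * pi * (LINT x|lebesgue_on K. sphere_avg (f x) * v x) = ?c * (LINT x|lebesgue_on K. source_moments f x (0, 0) * (v x * 1))" for K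
    proof -
      have "4 * pi * (LINT x|lebesgue_on K. sphere_avg (f x) * v x) = (LINT x|lebesgue_on K. 4 * pi * sphere_avg (f x) * v x)"
        unfolding mult.assoc[of "4 * pi"] by (rule integral_mult_right_zero[symmetric])
      also have "\<dots> = (LINT x|lebesgue_on K. ?c * (source_moments f x (0, 0) * (v x * 1)))"
        unfolding four_pi_sphere_avg by (simp only: mult.assoc mult_1_right)
      also have "\<dots> = ?c * (LINT x|lebesgue_on K. source_moments f x (0, 0) * (v x * 1))"
        by (rule integral_mult_right_zero)
      finally show ?thesis .
    qed
    then show ?thesis unfolding R_def mass_def sum_distrib_left by (simp only:)
  qed
  have "- (?c1 * (\<Sum>i\<in>UNIV. vol_form i (J i) v)) + ?c * mass \<sigma>a g v = ?c * (- (\<Sum>i\<in>UNIV. 1 / sqrt 3 * vol_form i (J i) v) + mass \<sigma>a g v)"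
    unfolding sqrt_four_pi_third sum_distrib_left[symmetric] by (simp add: algebra_simps)
  then show ?thesis unfolding sum.distrib sum_negf 1 2 3 e .
qed

text \<open>The normalizations of the flux and the current differ by \<open>sqrt 3\<close>, so the factor \<open>1 / sqrt 3\<close> from the
  flux matrix becomes \<open>1/3\<close>.\<close>

lemma limit_fick:
  assumes s: "limit_system g J" and w: "w \<in> DG_vec_space kind T (k 1)"
  shows "(\<Sum>K\<in>T. 1/3 * (LINT x|lebesgue_on K. grad (\<lambda>x. sqrt (4 * pi) * g x) x \<bullet> w x)
                + (LINT x|lebesgue_on K. \<sigma>t x * ((\<chi> i. sqrt (4 * pi / 3) * J i x) \<bullet> w x))) = 0"
proof -
  let ?c = "sqrt (4 * pi)" and ?c1 = "sqrt (4 * pi / 3)"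
  let ?w = "\<lambda>i x. w x $ i"
  have J: "J i \<in> DG_space kind T (k 1)" and g: "g \<in> DG_space kind T (k 0)" and wD: "?w i \<in> DG_space kind T (k 1)" for i
    using s w unfolding limit_system_def DG_vec_space_def by simp_all
  have P: "J i \<in> PW" "g \<in> PW" "?w i \<in> PW" for i using J g wD by (auto intro: DG_PW)
  have e: "1 / sqrt 3 * vol_form i (?w i) g + mass \<sigma>t (J i) (?w i) = 0" for i
    using s wD[of i] unfolding limit_system_def by blast
  have 1: "(\<Sum>K\<in>T. LINT x|lebesgue_on K. grad (\<lambda>x. ?c * g x) x \<bullet> w x) = (\<Sum>i\<in>UNIV. ?c * vol_form i (?w i) g)"
  proof -
    have "grad (\<lambda>x. ?c * g x) x \<bullet> w x = (\<Sum>i\<in>UNIV. ?w i x * partial_deriv i (\<lambda>x. ?c * g x) x)" for x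
      unfolding inner_vec_def grad_def inner_real_def vec_lambda_beta by (simp only: mult.commute)
    then have "(\<Sum>K\<in>T. LINT x|lebesgue_on K. grad (\<lambda>x. ?c * g x) x \<bullet> w x) = (\<Sum>i\<in>UNIV. vol_form i (?w i) (\<lambda>x. ?c * g x))"
      using vol_form_sum[of ?w "\<lambda>_ x. ?c * g x", OF P(3) PW_cmult[OF P(2)]] by (simp only:)
    then show ?thesis unfolding bilin_cmult(2)[OF bilin_vol_form P(2,3)] .
  qed
  have 2: "(\<Sum>K\<in>T. LINT x|lebesgue_on K. \<sigma>t x * ((\<chi> i. ?c1 * J i x) \<bullet> w x)) = (\<Sum>i\<in>UNIV. ?c1 * mass \<sigma>t (J i) (?w i))"
  proof -
    have "\<sigma>t x * ((\<chi> i. ?c1 * J i x) \<bullet> w x) = (\<Sum>i\<in>UNIV. \<sigma>t x * (?c1 * J i x * ?w i x))" for x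
      unfolding inner_vec_def inner_real_def vec_lambda_beta sum_distrib_left ..
    then have "(\<Sum>K\<in>T. LINT x|lebesgue_on K. \<sigma>t x * ((\<chi> i. ?c1 * J i x) \<bullet> w x)) = (\<Sum>i\<in>UNIV. mass \<sigma>t (\<lambda>x. ?c1 * J i x) (?w i))"
      using mass_sum[OF weights(1), of UNIV "\<lambda>i x. ?c1 * J i x" ?w, OF PW_cmult[OF P(1)] P(3)] by (simp only:)
    then show ?thesis unfolding bilin_cmult(1)[OF bilin_mass[OF weights(1)] P(1,3)] .
  qed
  have third: "1/3 * ?c = ?c1 * (1 / sqrt 3)"
    unfolding sqrt_four_pi_third by (simp add: field_simps)
  have "1/3 * (\<Sum>i\<in>UNIV. ?c * vol_form i (?w i) g) + (\<Sum>i\<in>UNIV. ?c1 * mass \<sigma>t (J i) (?w i))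
      = (\<Sum>i\<in>UNIV. ?c1 * (1 / sqrt 3 * vol_form i (?w i) g + mass \<sigma>t (J i) (?w i)))"
    unfolding sum_distrib_left sum.distrib[symmetric] mult.assoc[of "1/3" ?c, symmetric] third distrib_left
    by (simp only: mult.assoc)
  also have "\<dots> = 0" unfolding e by simp
  finally have z: "1/3 * (\<Sum>i\<in>UNIV. ?c * vol_form i (?w i) g) + (\<Sum>i\<in>UNIV. ?c1 * mass \<sigma>t (J i) (?w i)) = 0" .
  have "(\<Sum>K\<in>T. 1/3 * (LINT x|lebesgue_on K. grad (\<lambda>x. ?c * g x) x \<bullet> w x) + (LINT x|lebesgue_on K. \<sigma>t x * ((\<chi> i. ?c1 * J i x) \<bullet> w x)))
      = 1/3 * (\<Sum>K\<in>T. LINT x|lebesgue_on K. grad (\<lambda>x. ?c * g x) x \<bullet> w x) + (\<Sum>K\<in>T. LINT x|lebesgue_on K. \<sigma>t x * ((\<chi> i. ?c1 * J i x) \<bullet> w x))"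
    by (simp only: sum.distrib sum_distrib_left)
  then show ?thesis unfolding 1 2 z .
qed

theorem diffusion_limit:
  "\<exists>\<phi>0 J0.
     \<phi>0 \<in> torus_C0 \<inter> DG_space kind T (k 0) \<and>
     J0 \<in> DG_vec_space kind T (k 1) \<and>
     ((\<lambda>\<epsilon>. torus_L2_norm (\<lambda>x. scalar_flux N (u \<epsilon>) x - \<phi>0 x)) \<longlongrightarrow> 0) (at_right 0) \<and>
     ((\<lambda>\<epsilon>. torus_L2_norm (\<lambda>x. scaled_current N \<epsilon> (u \<epsilon>) x - J0 x)) \<longlongrightarrow> 0) (at_right 0) \<and>
     (\<forall>v0 \<in> torus_C0 \<inter> DG_space kind T (k 0).
        (\<Sum>K\<in>T. - (LINT x|lebesgue_on K. J0 x \<bullet> grad v0 x)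
                + (LINT x|lebesgue_on K. \<sigma>a x * \<phi>0 x * v0 x))
        = 4 * pi * (\<Sum>K\<in>T. LINT x|lebesgue_on K. sphere_avg (f x) * v0 x)) \<and>
     (\<forall>v1 \<in> DG_vec_space kind T (k 1).
        (\<Sum>K\<in>T. 1/3 * (LINT x|lebesgue_on K. grad \<phi>0 x \<bullet> v1 x)
                + (LINT x|lebesgue_on K. \<sigma>t x * (J0 x \<bullet> v1 x))) = 0)"
proof -
  obtain g J where s: "limit_system g J"
    and lg: "((\<lambda>\<epsilon>. q1 (\<lambda>x. W \<epsilon> (0, 0) x - g x) (\<lambda>x. W \<epsilon> (0, 0) x - g x)) \<longlongrightarrow> 0) (at_right 0)"
    and lJ: "\<forall>i. ((\<lambda>\<epsilon>. q1 (\<lambda>x. W \<epsilon> (sph_idx i) x - J i x) (\<lambda>x. W \<epsilon> (sph_idx i) x - J i x)) \<longlongrightarrow> 0) (at_right 0)"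
    using convergence by (elim exE conjE)
  have g: "g \<in> torus_C0" "g \<in> DG_space kind T (k 0)" and J: "J i \<in> DG_space kind T (k 1)" for i
    using s unfolding limit_system_def by simp_all
  let ?\<phi> = "\<lambda>x. sqrt (4 * pi) * g x" and ?J = "\<lambda>x. \<chi> i. sqrt (4 * pi / 3) * J i x"
  have small: "eventually (\<lambda>\<epsilon>. 0 < \<epsilon> \<and> \<epsilon> < (1 :: real)) (at_right 0)"
    unfolding eventually_at_right_field by (intro exI[of _ 1]) simp
  show ?thesis
  proof (intro exI[of _ ?\<phi>] exI[of _ ?J] conjI ballI IntI)
    show "?\<phi> \<in> torus_C0" by (rule torus_C0_cmult[OF g(1)])
    show "?\<phi> \<in> DG_space kind T (k 0)" by (rule DG_space_cmult[OF g(2)])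
    show "?J \<in> DG_vec_space kind T (k 1)" unfolding DG_vec_space_def using DG_space_cmult[OF J] by simp
    have "((\<lambda>\<epsilon>. sqrt (4 * pi * q1 (\<lambda>x. W \<epsilon> (0, 0) x - g x) (\<lambda>x. W \<epsilon> (0, 0) x - g x))) \<longlongrightarrow> sqrt (4 * pi * 0)) (at_right 0)"
      by (intro tendsto_real_sqrt tendsto_mult tendsto_const lg)
    moreover have "eventually (\<lambda>\<epsilon>. sqrt (4 * pi * q1 (\<lambda>x. W \<epsilon> (0, 0) x - g x) (\<lambda>x. W \<epsilon> (0, 0) x - g x))
        = torus_L2_norm (\<lambda>x. scalar_flux N (u \<epsilon>) x - ?\<phi> x)) (at_right 0)"
      using small by (rule eventually_mono) (rule flux_L2[symmetric], auto intro: DG_PW[OF g(2)])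
    ultimately show "((\<lambda>\<epsilon>. torus_L2_norm (\<lambda>x. scalar_flux N (u \<epsilon>) x - ?\<phi> x)) \<longlongrightarrow> 0) (at_right 0)"
      by (simp add: Lim_transform_eventually)
    have "((\<lambda>\<epsilon>. sqrt (4 * pi / 3 * (\<Sum>i\<in>UNIV. q1 (\<lambda>x. W \<epsilon> (sph_idx i) x - J i x) (\<lambda>x. W \<epsilon> (sph_idx i) x - J i x))))
        \<longlongrightarrow> sqrt (4 * pi / 3 * (\<Sum>i\<in>(UNIV :: 3 set). 0))) (at_right 0)"
      by (intro tendsto_real_sqrt tendsto_mult tendsto_const tendsto_sum lJ[rule_format])
    moreover have "eventually (\<lambda>\<epsilon>. sqrt (4 * pi / 3 * (\<Sum>i\<in>UNIV. q1 (\<lambda>x. W \<epsilon> (sph_idx i) x - J i x) (\<lambda>x. W \<epsilon> (sph_idx i) x - J i x)))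
        = torus_L2_norm (\<lambda>x. scaled_current N \<epsilon> (u \<epsilon>) x - ?J x)) (at_right 0)"
      using small by (rule eventually_mono) (rule current_L2[symmetric], auto intro: DG_PW[OF J])
    ultimately show "((\<lambda>\<epsilon>. torus_L2_norm (\<lambda>x. scaled_current N \<epsilon> (u \<epsilon>) x - ?J x)) \<longlongrightarrow> 0) (at_right 0)"
      by (simp add: Lim_transform_eventually)
  next
    fix v assume v: "v \<in> torus_C0 \<inter> DG_space kind T (k 0)"
    show "(\<Sum>K\<in>T. - (LINT x|lebesgue_on K. ?J x \<bullet> grad v x) + (LINT x|lebesgue_on K. \<sigma>a x * ?\<phi> x * v x))
        = 4 * pi * (\<Sum>K\<in>T. LINT x|lebesgue_on K. sphere_avg (f x) * v x)"
      by (rule limit_balance[OF s v])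
  next
    fix w assume w: "w \<in> DG_vec_space kind T (k 1)"
    show "(\<Sum>K\<in>T. 1/3 * (LINT x|lebesgue_on K. grad ?\<phi> x \<bullet> w x) + (LINT x|lebesgue_on K. \<sigma>t x * (?J x \<bullet> w x))) = 0"
      by (rule limit_fick[OF s w])
  qed
qed

end

theorem theorem3p1:
  fixes \<sigma>t \<sigma>a :: "real^3 \<Rightarrow> real"
    and f :: "real^3 \<Rightarrow> real^3 \<Rightarrow> real"
    and \<sigma>s_min \<sigma>a_min :: real
    and N :: nat
    and kind :: mesh_kind
    and T :: "(real^3) set set"
    and k :: "nat \<Rightarrow> nat"
    and U :: "3 \<Rightarrow> mmat"
    and \<Lambda> :: "3 \<Rightarrow> mvec"
    and u :: "real \<Rightarrow> real^3 \<Rightarrow> mvec"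
  assumes "torus_periodic \<sigma>t" and "torus_periodic \<sigma>a"
    and "\<forall>\<omega>\<in>sphere 0 1. torus_periodic (\<lambda>x. f x \<omega>)"
    and "Linf_fun (lebesgue_on torus_cell) \<sigma>t"
    and "Linf_fun (lebesgue_on torus_cell) \<sigma>a"
    and "L2_fun (lebesgue_on torus_cell \<Otimes>\<^sub>M sphere_measure) (\<lambda>(x, \<omega>). f x \<omega>)"
    and "\<sigma>s_min > 0" and "\<sigma>a_min > 0"
    and "\<forall>\<epsilon>\<in>{0<..<1}. AE x in lebesgue_on torus_cell. \<sigma>t x - \<epsilon>\<^sup>2 * \<sigma>a x \<ge> \<sigma>s_min"
    and "AE x in lebesgue_on torus_cell. \<sigma>a x \<ge> \<sigma>a_min"
    and "N \<ge> 1"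
    and "torus_mesh kind T"
    and "\<forall>i. orth_diagonalization N (flux_matrix i) (U i) (\<Lambda> i)"
    and "\<forall>\<epsilon>\<in>{0<..<1}.
           dg_solution kind T N k (\<lambda>i. mabs_of N (U i) (\<Lambda> i)) \<sigma>t \<sigma>a f \<epsilon> (u \<epsilon>)"
  shows "\<exists>\<phi>0 J0.
     \<phi>0 \<in> torus_C0 \<inter> DG_space kind T (k 0) \<and>
     J0 \<in> DG_vec_space kind T (k 1) \<and>
     ((\<lambda>\<epsilon>. torus_L2_norm (\<lambda>x. scalar_flux N (u \<epsilon>) x - \<phi>0 x)) \<longlongrightarrow> 0) (at_right 0) \<and>
     ((\<lambda>\<epsilon>. torus_L2_norm (\<lambda>x. scaled_current N \<epsilon> (u \<epsilon>) x - J0 x)) \<longlongrightarrow> 0) (at_right 0) \<and>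
     (\<forall>v0 \<in> torus_C0 \<inter> DG_space kind T (k 0).
        (\<Sum>K\<in>T. - (LINT x|lebesgue_on K. J0 x \<bullet> grad v0 x)
                + (LINT x|lebesgue_on K. \<sigma>a x * \<phi>0 x * v0 x))
        = 4 * pi * (\<Sum>K\<in>T. LINT x|lebesgue_on K. sphere_avg (f x) * v0 x)) \<and>
     (\<forall>v1 \<in> DG_vec_space kind T (k 1).
        (\<Sum>K\<in>T. 1/3 * (LINT x|lebesgue_on K. grad \<phi>0 x \<bullet> v1 x)
                + (LINT x|lebesgue_on K. \<sigma>t x * (J0 x \<bullet> v1 x))) = 0)"
proof -
  interpret pn_scheme \<sigma>t \<sigma>a f \<sigma>s_min \<sigma>a_min N kind T k U \<Lambda> u
    by standard (fact assms)+
  show ?thesis by (rule diffusion_limit)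
qed

end
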